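(* Let $x(0)\in\mathcal D$ be any initial point, let $\Delta_0\ge f(x(0))$, and let $\mu=\mu_{24\Delta_0}$, $G=G_{24\Delta_0}$. Then for any $\delta\in\left(0,\min\{1/5,1/\ln d\}\right)$ and all sufficiently large $N$, by choosing the parameters of the Zeroth-Order Proximal Point Algorithm (described in the context) to satisfy \[ m=\max\!\left\{\mu,\frac{G^2}{2\Delta_0}\right\},\quad t_0(n)=\Theta\!\left(d\ln\frac n\delta\right),\quad \nu(n)\le\frac{G/m}{6n(n+1)},\quad T(n)=\Theta\!\left(n^2d\ln\frac n\delta\right), \] we have \[ f(x(N))-f^\ast\le O\!\left(\frac1N\right) \] with probability at least $1-\delta$. Consequently, for any sufficiently small $\epsilon>0$, the number of zeroth-order queries (evaluations of $f$) needed by the algorithm to achieve $f(x(N))-f^\ast\le\epsilon$ with probability at least $1-\delta$ is bounded by \[ O\!\left(\frac{d}{\epsilon^3}\ln\frac1{\epsilon\delta}\right). \]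
   Context: Setting. $d\ge 3$; $\mathcal D\subseteq\mathbb R^d$ is a nonempty open (possibly nonconvex) set; $f:\mathcal D\to\mathbb R$ is continuous with $f^\ast:=\inf_{x\in\mathcal D}f(x)>0$; $\operatorname{epi}(f)=\{(x,\lambda):x\in\mathcal D,\ \lambda\ge f(x)\}$. $\|\cdot\|$ is the Euclidean norm, $[N]=\{1,\dots,N\}$, $\mathbb S_{d-1}$ is the unit sphere in $\mathbb R^d$, $\mathcal U(\cdot)$ denotes the uniform distribution. Assumption 1 (convex lifting). There are a set $\mathfrak L_{\mathrm{lft}}\subseteq\mathbb R^d\times\mathbb R\times\mathbb R^{d_\xi}$, a convex set $\mathfrak F_{\mathrm{cvx}}\subseteq\mathbb R\times\mathbb R^{d+d_\xi}$ and a bijection $\Phi:\mathfrak L_{\mathrm{lft}}\to\mathfrak F_{\mathrm{cvx}}$ such that: (i) for all $x\in\mathbb R^d,\lambda\in\mathbb R$: $(x,\lambda)\in\operatorname{epi}(f)$ iff there is $\xi\in\mathbb R^{d_\xi}$ with $(x,\lambda,\xi)\in\mathfrak L_{\mathrm{lft}}$; (ii) for every $(x,\lambda,\xi)\in\mathfrak L_{\mathrm{lft}}$, $\Phi(x,\lambda,\xi)=(\lambda,\zeta)$ for some $\zeta\in\mathbb R^{d+d_\xi}$; (iii) $\Phi$ and $\Phi^{-1}$ are locally Lipschitz continuous. Assumption 2. For each $\Delta>0$: (i) $\{(x,\lambda,\xi)\in\mathfrak L_{\mathrm{lft}}:\lambda\le\Delta\}$ is compact (hence $\mathcal S(\Delta):=\{x\in\mathcal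 D:f(x)\le\Delta\}$ is compact); (ii) there is $G_\Delta>0$ such that $|f(x)-f(y)|\le G_\Delta\|x-y\|$ for all $x,y\in\mathcal S(\Delta)$; (iii) there is $\mu_\Delta>0$ such that for every convex $C\subseteq\mathcal S(\Delta)$ the function $x\mapsto f(x)+\frac{\mu_\Delta}{2}\|x\|^2$ is convex on $C$. Such constants $G_\Delta,\mu_\Delta$ are fixed for each $\Delta$. Gradient estimator. For $x\in\mathcal D$, $z\in\mathbb S_{d-1}$, $\nu>0$ with $x\pm\nu z\in\mathcal D$: $\mathsf G(x;z,\nu)=d\cdot\frac{f(x+\nu z)-f(x-\nu z)}{2\nu}\cdot z$ (two queries of $f$). Zeroth-Order Proximal Point Algorithm. Parameters: $x(0)\in\mathcal D$, $m>0$, offsets $(t_0(n))_{n=1}^N$, smoothing radii $(\nu(n))_{n=1}^N$ (positive), epoch lengths $(T(n))_{n=1}^N$. For $n=1,\dots,N$ set $x(n)=\mathtt{ZOGD}(x(n-1),m,\nu(n),T(n),t_0(n))$; output $x(N)$. The subroutine $\mathtt{ZOGD}(x_0,m,\nu,T,t_0)$: with step sizes $\eta_t=\frac{3}{m(t+t_0)}$, for $t=1,\dots,T$ sample $z_t\sim\mathcal U(\mathbb S_{d-1})$ independently of everything before, set $g_t=\mathsf G(x_{t-1};z_t,\nu)$ and $x_t=x_{t-1}-\eta_t(g_t+2m(x_{t-1}-x_0))$; return $\overline x_T=\frac{2}{T(T+2t_0-1)}\sum_{t=1}^T(t+t_0-1)x_{t-1}$. If some $\mathsf G(x_{t-1};z_t,\nu)$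 is undefined the algorithm fails; the probability statements include the assertion that the algorithm does not fail. The constants hidden in $O(\cdot)$, $\Theta(\cdot)$ and the thresholds "sufficiently large/small" may depend on the problem data ($\Delta_0$, $m$, $G$, and the diameter and Lipschitz constants associated with the convex lifting on sublevel sets), but the hidden constants do not depend on $n,N,\epsilon,\delta$ nor otherwise explicitly on $d$. "By choosing ... to satisfy ... $\Theta(\cdot)$" means there exist choices of $t_0(n),T(n)$ of these orders. *)

theory Defs
  imports "HOL-Probability.Probability"
begin

section \<open>Euclidean spaces of varying dimension\<close>

text \<open>
  The constants in the convergence theorem have to be uniform in the dimension, so the dimension
  must be an ordinary quantified variable and cannot be a type. All spaces \<open>\<real>\<^sup>n\<close> are therefore
  realised as nested subspaces \<open>Rn n\<close> of one inner product space: the finitely supported real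
  sequences with the \<open>\<ell>\<^sup>2\<close> inner product. (The norm that the library puts on
  \<open>nat \<Rightarrow>\<^sub>0 real\<close> is the \<open>\<ell>\<^sup>1\<close> norm.) On \<open>Rn n\<close> the library notions of norm,
  distance, convexity, compactness, continuity and Lipschitz continuity are the usual Euclidean ones.
\<close>

typedef fseq = "{x :: nat \<Rightarrow> real. finite {i. x i \<noteq> 0}}"
  morphisms coord Abs_fseq
  by (rule exI[of _ "\<lambda>_. 0"]) simp

setup_lifting type_definition_fseq

lemma finite_support [simp]: "finite {i. coord x i \<noteq> 0}"
  using coord[of x] by simp

lemma fseq_eqI: "(\<And>i. coord x i = coord y i) \<Longrightarrow> x = y"
  by (simp add: coord_inject[symmetric] fun_eq_iff)

instantiation fseq :: real_vector
begin

lift_definition zero_fseq :: fseq is "\<lambda>_. 0" by simp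

lift_definition plus_fseq :: "fseq \<Rightarrow> fseq \<Rightarrow> fseq" is "\<lambda>x y i. x i + y i"
proof -
  fix x y :: "nat \<Rightarrow> real"
  assume "finite {i. x i \<noteq> 0}" "finite {i. y i \<noteq> 0}"
  then have "finite ({i. x i \<noteq> 0} \<union> {i. y i \<noteq> 0})" by simp
  then show "finite {i. x i + y i \<noteq> 0}" by (rule rev_finite_subset) auto
qed

lift_definition minus_fseq :: "fseq \<Rightarrow> fseq \<Rightarrow> fseq" is "\<lambda>x y i. x i - y i"
proof -
  fix x y :: "nat \<Rightarrow> real"
  assume "finite {i. x i \<noteq> 0}" "finite {i. y i \<noteq> 0}"
  then have "finite ({i. x i \<noteq> 0} \<union> {i. y i \<noteq> 0})" by simp
  then show "finite {i. x i - y i \<noteq> 0}" by (rule rev_finite_subset) auto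
qed

lift_definition uminus_fseq :: "fseq \<Rightarrow> fseq" is "\<lambda>x i. - x i" by simp

lift_definition scaleR_fseq :: "real \<Rightarrow> fseq \<Rightarrow> fseq" is "\<lambda>r x i. r * x i"
  by (erule rev_finite_subset) auto

instance
  by standard (transfer, simp add: algebra_simps)+

end

lemma coord_simps [simp]:
  "coord 0 i = 0"
  "coord (x + y) i = coord x i + coord y i"
  "coord (x - y) i = coord x i - coord y i"
  "coord (- x) i = - coord x i"
  "coord (r *\<^sub>R x) i = r * coord x i"
  by (simp_all add: zero_fseq.rep_eq plus_fseq.rep_eq minus_fseq.rep_eq uminus_fseq.rep_eq
      scaleR_fseq.rep_eq)

instantiation fseq :: real_inner
begin

definition inner_fseq :: "fseq \<Rightarrow> fseq \<Rightarrow> real"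
  where "inner_fseq x y = (\<Sum>i | coord x i \<noteq> 0. coord x i * coord y i)"

definition norm_fseq :: "fseq \<Rightarrow> real"
  where "norm_fseq x = sqrt (inner x x)"

definition sgn_fseq :: "fseq \<Rightarrow> fseq"
  where "sgn_fseq x = x /\<^sub>R norm x"

definition dist_fseq :: "fseq \<Rightarrow> fseq \<Rightarrow> real"
  where "dist_fseq x y = norm (x - y)"

definition uniformity_fseq :: "(fseq \<times> fseq) filter"
  where "uniformity_fseq = (INF e\<in>{0<..}. principal {(x, y). dist x y < e})"

definition open_fseq :: "fseq set \<Rightarrow> bool"
  where "open_fseq U \<longleftrightarrow> (\<forall>x\<in>U. \<forall>\<^sub>F (x', y) in uniformity. x' = x \<longrightarrow> y \<in> U)"

instance
proof
  have inner_superset: "inner x y = (\<Sum>i\<in>A. coord x i * coord y i)"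
    if "finite A" "{i. coord x i \<noteq> 0} \<subseteq> A" for x y :: fseq and A
    unfolding inner_fseq_def using that by (intro sum.mono_neutral_left) auto
  fix x y z :: fseq and r :: real
  define A where "A = {i. coord x i \<noteq> 0} \<union> {i. coord y i \<noteq> 0} \<union> {i. coord (x + y) i \<noteq> 0}
    \<union> {i. coord (r *\<^sub>R x) i \<noteq> 0}"
  have fin: "finite A" unfolding A_def by (intro finite_UnI finite_support)
  have I: "inner u v = (\<Sum>i\<in>A. coord u i * coord v i)" if "u \<in> {x, y, x + y, r *\<^sub>R x}" for u v
    using that by (intro inner_superset fin) (auto simp: A_def)
  show "inner x y = inner y x"
    by (simp add: I mult.commute)
  show "inner (x + y) z = inner x z + inner y z"
    by (simp add: I algebra_simps sum.distrib)
  show "inner (r *\<^sub>R x) y = r * inner x y"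
    by (simp add: I algebra_simps sum_distrib_left)
  show "0 \<le> inner x x"
    by (simp add: I sum_nonneg)
  show "(inner x x = 0) = (x = 0)"
  proof
    assume "inner x x = 0"
    then have "(\<Sum>i | coord x i \<noteq> 0. coord x i * coord x i) = 0"
      by (simp add: inner_fseq_def)
    then have "\<forall>i\<in>{i. coord x i \<noteq> 0}. coord x i * coord x i = 0"
      by (subst (asm) sum_nonneg_eq_0_iff) auto
    then show "x = 0" by (intro fseq_eqI) auto
  qed (simp add: inner_fseq_def)
qed (simp_all add: norm_fseq_def sgn_fseq_def dist_fseq_def uniformity_fseq_def open_fseq_def)

end

definition Rn :: "nat \<Rightarrow> fseq set"
  where "Rn n = {x. \<forall>i\<ge>n. coord x i = 0}"

lift_definition fseq_of :: "nat \<Rightarrow> (nat \<Rightarrow> real) \<Rightarrow> fseq" is "\<lambda>n y i. if i < n then y i else 0"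
  by simp

text \<open>
  The uniform distribution on the unit sphere of \<open>Rn d\<close>, i.e. normalised surface measure, obtained
  as the law of the direction of a point that is uniformly distributed in the unit ball.
\<close>

definition uniform_sphere :: "nat \<Rightarrow> fseq measure"
  where "uniform_sphere d =
    distr (uniform_measure (\<Pi>\<^sub>M i\<in>{..<d}. lborel)
             {y \<in> space (\<Pi>\<^sub>M i\<in>{..<d}. lborel). norm (fseq_of d y) \<le> 1})
      borel (\<lambda>y. sgn (fseq_of d y))"


section \<open>The problem class\<close>

definition locally_lipschitz_on :: "'a::metric_space set \<Rightarrow> ('a \<Rightarrow> 'b::metric_space) \<Rightarrow> bool"
  where "locally_lipschitz_on S g \<longleftrightarrow>
    (\<forall>x\<in>S. \<exists>u>0. \<exists>K. K-lipschitz_on (cball x u \<inter> S) g)"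

definition lipschitz_const :: "'a::metric_space set \<Rightarrow> ('a \<Rightarrow> 'b::metric_space) \<Rightarrow> real"
  where "lipschitz_const S g = Inf {K. K-lipschitz_on S g}"

definition sublevel :: "fseq set \<Rightarrow> (fseq \<Rightarrow> real) \<Rightarrow> real \<Rightarrow> fseq set"
  where "sublevel X f \<Delta> = {x \<in> X. f x \<le> \<Delta>}"

definition epigraph_on :: "fseq set \<Rightarrow> (fseq \<Rightarrow> real) \<Rightarrow> (fseq \<times> real) set"
  where "epigraph_on X f = {(x, l). x \<in> X \<and> f x \<le> l}"

definition lift_sublevel :: "(fseq \<times> real \<times> fseq) set \<Rightarrow> real \<Rightarrow> (fseq \<times> real \<times> fseq) set"
  where "lift_sublevel L \<Delta> = {(x, l, \<xi>) \<in> L. l \<le> \<Delta>}"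

definition cvx_sublevel :: "(real \<times> fseq) set \<Rightarrow> real \<Rightarrow> (real \<times> fseq) set"
  where "cvx_sublevel F \<Delta> = {(l, \<zeta>) \<in> F. l \<le> \<Delta>}"

locale objective =
  fixes d :: nat and X :: "fseq set" and f :: "fseq \<Rightarrow> real"
  assumes dim: "3 \<le> d"
    and domain_nonempty: "X \<noteq> {}"
    and domain_open: "openin (top_of_set (Rn d)) X"
    and f_continuous: "continuous_on X f"
    and f_bdd_below: "bdd_below (f ` X)"
    and f_Inf_pos: "0 < Inf (f ` X)"

locale convex_lifting = objective +
  fixes d\<xi> :: nat
    and L :: "(fseq \<times> real \<times> fseq) set" and F :: "(real \<times> fseq) set"
    and \<Phi> :: "fseq \<times> real \<times> fseq \<Rightarrow> real \<times> fseq"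
  assumes L_subset: "L \<subseteq> Rn d \<times> UNIV \<times> Rn d\<xi>"
    and F_subset: "F \<subseteq> UNIV \<times> Rn (d + d\<xi>)"
    and F_convex: "convex F"
    and \<Phi>_bij: "bij_betw \<Phi> L F"
    and lift_epigraph:
      "\<And>x l. x \<in> Rn d \<Longrightarrow> (x, l) \<in> epigraph_on X f \<longleftrightarrow> (\<exists>\<xi>\<in>Rn d\<xi>. (x, l, \<xi>) \<in> L)"
    and \<Phi>_level:
      "\<And>x l \<xi>. (x, l, \<xi>) \<in> L \<Longrightarrow> \<exists>\<zeta>\<in>Rn (d + d\<xi>). \<Phi> (x, l, \<xi>) = (l, \<zeta>)"
    and \<Phi>_lipschitz: "locally_lipschitz_on L \<Phi>"
    and \<Phi>_inv_lipschitz: "locally_lipschitz_on F (inv_into L \<Phi>)"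

locale lifted_problem = convex_lifting +
  fixes G :: "real \<Rightarrow> real" and \<mu> :: "real \<Rightarrow> real"
  assumes lift_compact: "\<And>\<Delta>. 0 < \<Delta> \<Longrightarrow> compact (lift_sublevel L \<Delta>)"
    and G_pos: "\<And>\<Delta>. 0 < \<Delta> \<Longrightarrow> 0 < G \<Delta>"
    and f_lipschitz: "\<And>\<Delta> x y. 0 < \<Delta> \<Longrightarrow> x \<in> sublevel X f \<Delta> \<Longrightarrow> y \<in> sublevel X f \<Delta> \<Longrightarrow>
      \<bar>f x - f y\<bar> \<le> G \<Delta> * norm (x - y)"
    and \<mu>_pos: "\<And>\<Delta>. 0 < \<Delta> \<Longrightarrow> 0 < \<mu> \<Delta>"
    and f_weakly_convex: "\<And>\<Delta> C. 0 < \<Delta> \<Longrightarrow> convex C \<Longrightarrow> C \<subseteq> sublevel X f \<Delta> \<Longrightarrow>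
      convex_on C (\<lambda>x. f x + \<mu> \<Delta> / 2 * (norm x)\<^sup>2)"


section \<open>The zeroth-order proximal point algorithm\<close>

text \<open>The value \<open>None\<close> stands for failure: the estimator queried \<open>f\<close> outside its domain.\<close>

definition grad_est ::
    "nat \<Rightarrow> fseq set \<Rightarrow> (fseq \<Rightarrow> real) \<Rightarrow> real \<Rightarrow> fseq \<Rightarrow> fseq \<Rightarrow> fseq option"
  where "grad_est d X f \<nu> x z =
    (if x \<in> X \<and> x + \<nu> *\<^sub>R z \<in> X \<and> x - \<nu> *\<^sub>R z \<in> X
     then Some ((real d * ((f (x + \<nu> *\<^sub>R z) - f (x - \<nu> *\<^sub>R z)) / (2 * \<nu>))) *\<^sub>R z)
     else None)"

primrec zogd_iter ::
    "nat \<Rightarrow> fseq set \<Rightarrow> (fseq \<Rightarrow> real) \<Rightarrow> real \<Rightarrow> real \<Rightarrow> real \<Rightarrow> fseq \<Rightarrow> (nat \<Rightarrow> fseq) \<Rightarrow> nat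
      \<Rightarrow> fseq option"
  where
    "zogd_iter d X f m \<nu> t0 x0 z 0 = Some x0"
  | "zogd_iter d X f m \<nu> t0 x0 z (Suc t) =
      Option.bind (zogd_iter d X f m \<nu> t0 x0 z t) (\<lambda>x.
      Option.bind (grad_est d X f \<nu> x (z (Suc t))) (\<lambda>g.
        Some (x - (3 / (m * (real (Suc t) + t0))) *\<^sub>R (g + (2 * m) *\<^sub>R (x - x0)))))"

text \<open>If iteration \<open>T\<close> has not failed, no earlier one has, so \<open>the\<close> is applied to defined values.\<close>

definition zogd ::
    "nat \<Rightarrow> fseq set \<Rightarrow> (fseq \<Rightarrow> real) \<Rightarrow> real \<Rightarrow> real \<Rightarrow> nat \<Rightarrow> real \<Rightarrow> (nat \<Rightarrow> fseq) \<Rightarrow> fseq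
      \<Rightarrow> fseq option"
  where "zogd d X f m \<nu> T t0 z x0 =
    (if zogd_iter d X f m \<nu> t0 x0 z T = None then None
     else Some ((2 / (real T * (real T + 2 * t0 - 1))) *\<^sub>R
       (\<Sum>t=1..T. (real t + t0 - 1) *\<^sub>R the (zogd_iter d X f m \<nu> t0 x0 z (t - 1)))))"

text \<open>\<open>z (n, t)\<close> is the direction sampled in iteration \<open>t\<close> of epoch \<open>n\<close>.\<close>

primrec zoppa ::
    "nat \<Rightarrow> fseq set \<Rightarrow> (fseq \<Rightarrow> real) \<Rightarrow> real \<Rightarrow> (nat \<Rightarrow> real) \<Rightarrow> (nat \<Rightarrow> nat) \<Rightarrow> (nat \<Rightarrow> real)
      \<Rightarrow> fseq \<Rightarrow> (nat \<times> nat \<Rightarrow> fseq) \<Rightarrow> nat \<Rightarrow> fseq option"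
  where
    "zoppa d X f m \<nu> T t0 x0 z 0 = Some x0"
  | "zoppa d X f m \<nu> T t0 x0 z (Suc n) =
      Option.bind (zoppa d X f m \<nu> T t0 x0 z n)
        (zogd d X f m (\<nu> (Suc n)) (T (Suc n)) (t0 (Suc n)) (\<lambda>t. z (Suc n, t)))"

definition directions :: "nat \<Rightarrow> (nat \<times> nat \<Rightarrow> fseq) measure"
  where "directions d = (\<Pi>\<^sub>M i\<in>UNIV. uniform_sphere d)"

text \<open>The probability that the algorithm does not fail and its output is \<open>r\<close>-optimal.\<close>

definition success_prob ::
    "nat \<Rightarrow> fseq set \<Rightarrow> (fseq \<Rightarrow> real) \<Rightarrow> real \<Rightarrow> (nat \<Rightarrow> real) \<Rightarrow> (nat \<Rightarrow> nat) \<Rightarrow> (nat \<Rightarrow> real)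
      \<Rightarrow> fseq \<Rightarrow> nat \<Rightarrow> real \<Rightarrow> real"
  where "success_prob d X f m \<nu> T t0 x0 N r =
    measure (directions d) {z \<in> space (directions d).
      \<exists>x. zoppa d X f m \<nu> T t0 x0 z N = Some x \<and> x \<in> X \<and> f x - Inf (f ` X) \<le> r}"

text \<open>Each of the \<open>T n\<close> gradient estimates in epoch \<open>n\<close> takes two evaluations of \<open>f\<close>.\<close>

definition num_queries :: "(nat \<Rightarrow> nat) \<Rightarrow> nat \<Rightarrow> nat"
  where "num_queries T N = (\<Sum>n=1..N. 2 * T n)"

text \<open>\<open>t0 n = \<Theta>(d ln (n/\<delta>))\<close> and \<open>T n = \<Theta>(n\<^sup>2 d ln (n/\<delta>))\<close> for \<open>1 \<le> n \<le> N\<close>, with explicit constants.\<close>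

definition schedule ::
    "real \<Rightarrow> real \<Rightarrow> nat \<Rightarrow> real \<Rightarrow> nat \<Rightarrow> (nat \<Rightarrow> real) \<Rightarrow> (nat \<Rightarrow> nat) \<Rightarrow> bool"
  where "schedule a b d \<delta> N t0 T \<longleftrightarrow> (\<forall>n\<in>{1..N}.
    a * (real d * ln (real n / \<delta>)) \<le> t0 n \<and>
    t0 n \<le> b * (real d * ln (real n / \<delta>)) \<and>
    a * ((real n)\<^sup>2 * real d * ln (real n / \<delta>)) \<le> real (T n) \<and>
    real (T n) \<le> b * ((real n)\<^sup>2 * real d * ln (real n / \<delta>)))"

definition smoothing_ok :: "real \<Rightarrow> real \<Rightarrow> nat \<Rightarrow> (nat \<Rightarrow> real) \<Rightarrow> bool"
  where "smoothing_ok G m N \<nu> \<longleftrightarrow> (\<forall>n\<in>{1..N}.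
    0 < \<nu> n \<and> \<nu> n \<le> (G / m) / (6 * real n * (real n + 1)))"

text \<open>
  The numbers on which hidden constants and thresholds may depend: \<open>\<Delta>0\<close>, the proximal parameter
  \<open>m\<close>, the Lipschitz constant \<open>g\<close> of \<open>f\<close>, and the diameter \<open>D\<close> and Lipschitz constants \<open>K1\<close>, \<open>K2\<close>
  of the lifting. The lifting data are taken at the level \<open>24 \<Delta>0\<close> that also defines \<open>m\<close> and \<open>g\<close>,
  and dominate those at lower levels. Local Lipschitz continuity and compactness of the sublevel
  sets make the sets in \<open>lipschitz_const\<close> nonempty.
\<close>

definition problem_data ::
    "(fseq \<times> real \<times> fseq) set \<Rightarrow> (real \<times> fseq) set \<Rightarrow> (fseq \<times> real \<times> fseq \<Rightarrow> real \<times> fseq)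
      \<Rightarrow> (real \<Rightarrow> real) \<Rightarrow> (real \<Rightarrow> real) \<Rightarrow> real \<Rightarrow> real \<Rightarrow> real \<Rightarrow> real \<Rightarrow> real \<Rightarrow> real \<Rightarrow> bool"
  where "problem_data L F \<Phi> G \<mu> \<Delta>0 m g D K1 K2 \<longleftrightarrow>
    g = G (24 * \<Delta>0) \<and>
    m = max (\<mu> (24 * \<Delta>0)) (g\<^sup>2 / (2 * \<Delta>0)) \<and>
    D = diameter (lift_sublevel L (24 * \<Delta>0)) \<and>
    K1 = lipschitz_const (lift_sublevel L (24 * \<Delta>0)) \<Phi> \<and>
    K2 = lipschitz_const (cvx_sublevel F (24 * \<Delta>0)) (inv_into L \<Phi>)"

end

theory Submission
  imports Defs
begin

text \<open>
  Write \<open>R = G / m\<close>. While \<open>f (x n) \<le> 3 \<Delta>0\<close>, the ball of radius \<open>10 R\<close> around \<open>x n\<close> lies in the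
  sublevel set of level \<open>24 \<Delta>0\<close>, and there \<open>y \<mapsto> f y + m * \<bar>y - x n\<bar>\<^sup>2\<close> is strongly convex with
  minimiser within distance \<open>R\<close> of \<open>x n\<close>. Minimising it inexactly suffices: mapping back a point of the
  segment that joins the images of the current iterate and of a global minimiser in the convex
  set \<open>F\<close> gives some \<open>y\<close> with \<open>f y - f\<^sup>* \<le> (1 - \<alpha>) (f (x n) - f\<^sup>*)\<close> and
  \<open>\<bar>y - x n\<bar> \<le> \<alpha> K2 K1 D\<close>, and \<open>\<alpha> = 2 / (n + 2)\<close> in epoch \<open>n + 1\<close> turns this into a gap of order \<open>1 / n\<close>.

  For the inner loop, the divergence theorem shows that the estimator is, on average, a subgradient of the
  weakly convex \<open>f\<close> up to an error of order \<open>G \<nu>\<close>, and a Poincare inequality on the sphere gives the second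
  moment \<open>O(d G\<^sup>2)\<close>. The latter is obtained by moving one random direction to an independent
  one along a path of rotations of the pair, each of which preserves its law.
  The distance to the minimiser and the weighted sum of the gaps then yield two exponential
  supermartingales: with probability at least \<open>1 - \<delta> / (n (n + 1))\<close>, the iterates of epoch \<open>n\<close> stay in the
  ball and their average is accurate. A union bound over the epochs concludes.
\<close>

text \<open>\<open>f\<close> is only Lipschitz and weakly convex, so the estimates work with
  difference quotients and approximate subgradients instead of gradients. The obstacle is a rate
  linear in \<open>d\<close>: the estimator can be as long as \<open>real d * g\<close>, and only
  its second moment is of order \<open>real d * g\<^sup>2\<close>. This requires a Poincare constant
  of order \<open>1 / real d\<close> for a nonsmooth function whose subgradients bound its drops
  from one side only. Level 24: \<open>m\<close> is so large that
  \<open>g * R \<le> 2 * \<Delta>0\<close>. All epochs together raise \<open>f\<close> by at most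
  \<open>g * R\<close>, hence to at most \<open>3 * \<Delta>0\<close>, and a ball of radius
  \<open>10 * R\<close> adds at most \<open>20 * \<Delta>0\<close>. Radius 10: inner iterates stay
  within \<open>3 * R\<close> of the centre, the smoothing takes \<open>R / 12\<close>, and the mean
  of the estimator is tested with a translation of length up to \<open>2 * R\<close>. Step size 3:
  the proximal objective has strong convexity modulus at least \<open>m\<close>, so step
  \<open>3 / (m * s)\<close> contracts the squared distance by a relative \<open>3 / s\<close>. One
  third of this pays for the variance in the exponential moment; the rest turns the weight
  \<open>s * (s - 1)\<close> into \<open>(s - 1) * (s - 2)\<close>.\<close>

subsection \<open>Coordinates and separability\<close>

definition axis_fseq :: "nat \<Rightarrow> fseq" where
  "axis_fseq i = fseq_of (Suc i) (\<lambda>j. if j = i then 1 else 0)"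

lemma coord_fseq_of [simp]: "coord (fseq_of n y) i = (if i < n then y i else 0)"
  by (simp add: fseq_of.rep_eq)

lemma coord_axis_fseq [simp]: "coord (axis_fseq i) j = (if j = i then 1 else 0)"
  by (auto simp: axis_fseq_def)

lemma coord_sum [simp]: "coord (\<Sum>a\<in>A. h a) i = (\<Sum>a\<in>A. coord (h a) i)"
  by (induction A rule: infinite_finite_induct) auto

lemma fseq_expansion:
  assumes "x \<in> Rn n"
  shows "x = (\<Sum>i<n. coord x i *\<^sub>R axis_fseq i)"
proof (rule fseq_eqI)
  fix j
  show "coord x j = coord (\<Sum>i<n. coord x i *\<^sub>R axis_fseq i) j"
    using assms by (auto simp: Rn_def if_distrib cong: if_cong)
qed

lemma inner_fseq_eq:
  assumes "x \<in> Rn n"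
  shows "inner x y = (\<Sum>i<n. coord x i * coord y i)"
  unfolding inner_fseq_def using assms
  by (intro sum.mono_neutral_left) (auto simp: Rn_def not_less[symmetric])

lemma inner_axis_fseq [simp]: "inner (axis_fseq i) y = coord y i"
proof -
  have "axis_fseq i \<in> Rn (Suc i)" by (auto simp: Rn_def)
  then show ?thesis by (simp add: inner_fseq_eq if_distrib cong: if_cong)
qed

lemma inner_axis_fseq_right [simp]: "inner y (axis_fseq i) = coord y i"
  by (metis inner_axis_fseq inner_commute)

lemma norm_axis_fseq [simp]: "norm (axis_fseq i) = 1"
  by (simp add: norm_eq_sqrt_inner)

lemma abs_coord_le_norm: "\<bar>coord x i\<bar> \<le> norm x"
  using Cauchy_Schwarz_ineq2[of "axis_fseq i" x] by simp

lemma norm_le_sum_abs_coord: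
  assumes "x \<in> Rn n"
  shows "norm x \<le> (\<Sum>i<n. \<bar>coord x i\<bar>)"
proof -
  have "norm (\<Sum>i<n. coord x i *\<^sub>R axis_fseq i) \<le> (\<Sum>i<n. norm (coord x i *\<^sub>R axis_fseq i))"
    by (rule norm_sum)
  then show ?thesis unfolding fseq_expansion[OF assms, symmetric] by simp
qed

lemma subspace_Rn: "subspace (Rn n)"
  by (auto simp: subspace_def Rn_def)

lemma Rn_intros [intro]:
  "0 \<in> Rn n" "x \<in> Rn n \<Longrightarrow> y \<in> Rn n \<Longrightarrow> x + y \<in> Rn n" "x \<in> Rn n \<Longrightarrow> y \<in> Rn n \<Longrightarrow> x - y \<in> Rn n"
  "x \<in> Rn n \<Longrightarrow> r *\<^sub>R x \<in> Rn n" "x \<in> Rn n \<Longrightarrow> - x \<in> Rn n" "fseq_of n c \<in> Rn n"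
  "x \<in> Rn n \<Longrightarrow> sgn x \<in> Rn n" "i < n \<Longrightarrow> axis_fseq i \<in> Rn n"
  by (auto simp: Rn_def sgn_fseq_def)

lemma continuous_on_coord [continuous_intros]:
  "continuous_on S h \<Longrightarrow> continuous_on S (\<lambda>x. coord (h x) i)"
  using continuous_on_inner[OF continuous_on_const, of S h "axis_fseq i"] by simp

lemma closed_Rn: "closed (Rn n)"
proof -
  have "Rn n = (\<Inter>i\<in>{n..}. {x. coord x i = 0})" by (auto simp: Rn_def)
  moreover have "closed {x. coord x i = 0}" for i
    by (intro closed_Collect_eq continuous_intros)
  ultimately show ?thesis by auto
qed

lemma convex_Rn: "convex (Rn n)"
  using subspace_Rn by (rule subspace_imp_convex)

definition rational_fseqs :: "fseq set" where
  "rational_fseqs = range (\<lambda>l :: rat list. fseq_of (length l) (\<lambda>i. of_rat (l ! i)))"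

lemma countable_rational_fseqs: "countable rational_fseqs"
  unfolding rational_fseqs_def by (rule countable_image) simp

lemma rational_fseqs_dense:
  assumes "0 < e"
  shows "\<exists>q\<in>rational_fseqs. dist x q < e"
proof -
  obtain n where n: "\<And>i. n \<le> i \<Longrightarrow> coord x i = 0"
  proof -
    obtain N where "\<forall>i\<in>{i. coord x i \<noteq> 0}. i < N"
      using finite_support[of x] finite_nat_set_iff_bounded by blast
    then show thesis using that[of N] by (meson mem_Collect_eq not_less)
  qed
  \<comment> \<open>The denominator \<open>real n + 1\<close> covers \<open>n = 0\<close> and leaves
    strict room after summing over the \<open>n\<close> coordinates.\<close>
  have "\<exists>q. \<bar>coord x i - of_rat q\<bar> < e / (real n + 1)" for i
  proof -
    have "coord x i < coord x i + e / (real n + 1)" using assms by simp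
    from of_rat_dense[OF this] obtain q where "coord x i < of_rat q" "of_rat q < coord x i + e / (real n + 1)"
      by blast
    then show ?thesis by (intro exI[of _ q]) auto
  qed
  then have "\<exists>q. \<forall>i. \<bar>coord x i - of_rat (q i)\<bar> < e / (real n + 1)" by (intro choice allI)
  then obtain q where q: "\<And>i. \<bar>coord x i - of_rat (q i)\<bar> < e / (real n + 1)" by blast
  define l where "l = map q [0..<n]"
  define v where "v = fseq_of (length l) (\<lambda>i. of_rat (l ! i))"
  have l: "length l = n" "\<And>i. i < n \<Longrightarrow> l ! i = q i" by (simp_all add: l_def)
  have "x - v \<in> Rn n" using n by (auto simp: Rn_def v_def l)
  then have "norm (x - v) \<le> (\<Sum>i<n. \<bar>coord (x - v) i\<bar>)" by (rule norm_le_sum_abs_coord)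
  also have "\<dots> \<le> (\<Sum>i<n. e / (real n + 1))"
    by (intro sum_mono) (simp add: v_def l less_imp_le[OF q])
  also have "\<dots> = real n / (real n + 1) * e" by simp
  also have "\<dots> < 1 * e" using assms by (intro mult_strict_right_mono) simp_all
  finally have "dist x v < e" by (simp add: dist_norm)
  moreover have "v \<in> rational_fseqs"
    unfolding rational_fseqs_def v_def by (rule rangeI)
  ultimately show ?thesis by blast
qed

text \<open>Second countability makes the Borel sets of a product the product of the Borel sets,
  which is what sums, norms and inner products of measurable vector-valued functions rely
  on.\<close>

instance fseq :: second_countable_topology
proof
  define B :: "fseq set set" where "B = (\<lambda>(q, r). ball q (of_rat r)) ` (rational_fseqs \<times> UNIV)"
  have "countable B"
    unfolding B_def by (simp add: countable_rational_fseqs)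
  moreover have "open S = generate_topology B S" for S
  proof (rule iffI)
    assume "open S"
    have "\<exists>b\<in>B. x \<in> b \<and> b \<subseteq> S" if xS: "x \<in> S" for x
    proof -
      obtain e where e: "e > 0" "ball x e \<subseteq> S" by (rule openE[OF \<open>open S\<close> xS])
      obtain r :: rat where r: "0 < real_of_rat r" "real_of_rat r < e / 2"
        using of_rat_dense[of 0 "e / 2"] e by auto
      obtain q where q: "q \<in> rational_fseqs" "dist x q < real_of_rat r"
        using rational_fseqs_dense[OF r(1)] by blast
      have "ball q (of_rat r) \<subseteq> ball x e"
      proof
        fix y assume "y \<in> ball q (real_of_rat r)"
        then show "y \<in> ball x e" using q r dist_triangle[of x y q] by auto
      qed
      moreover have "ball q (of_rat r) \<in> B"
        unfolding B_def using q(1) by (intro image_eqI[of _ _ "(q, r)"]) auto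
      moreover have "x \<in> ball q (of_rat r)" using q(2) by (simp add: dist_commute)
      ultimately show ?thesis using e(2) by blast
    qed
    then have *: "\<Union>{b\<in>B. b \<subseteq> S} = S" by blast
    have "generate_topology B (\<Union>{b\<in>B. b \<subseteq> S})"
      by (rule generate_topology.UN) (auto intro: generate_topology.Basis)
    then show "generate_topology B S" unfolding * .
  next
    assume "generate_topology B S"
    then show "open S" by induction (auto simp: B_def)
  qed
  ultimately show "\<exists>B :: fseq set set. countable B \<and> open = generate_topology B" by blast
qed

lemma measurable_coord [measurable]: "(\<lambda>x. coord x i) \<in> borel_measurable borel"
  by (intro borel_measurable_continuous_onI continuous_intros)

lemma Rn_borel [measurable]: "Rn n \<in> sets borel"
  using closed_Rn by auto

subsection \<open>Lebesgue measure\<close>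

abbreviation lborel_fun :: "nat \<Rightarrow> (nat \<Rightarrow> real) measure" where
  "lborel_fun d \<equiv> (\<Pi>\<^sub>M i\<in>{..<d}. lborel)"

lemma measurable_fseq_of [measurable]: "fseq_of d \<in> borel_measurable (lborel_fun d)"
proof -
  have "fseq_of d y = (\<Sum>i<d. y i *\<^sub>R axis_fseq i)" for y
    by (rule fseq_eqI) (simp add: if_distrib cong: if_cong)
  then have "fseq_of d = (\<lambda>y. \<Sum>i<d. y i *\<^sub>R axis_fseq i)" by (simp add: fun_eq_iff)
  then show ?thesis by simp
qed

text \<open>Lebesgue measure of dimension \<open>d\<close>, carried by the subspace
  \<open>Rn d\<close> but defined on the whole sequence space, so that all dimensions share one
  type.\<close>

definition leb :: "nat \<Rightarrow> fseq measure" where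
  "leb d = distr (lborel_fun d) borel (fseq_of d)"

lemma sets_leb [measurable_cong, simp]: "sets (leb d) = sets borel"
  by (simp add: leb_def)

lemma space_leb [simp]: "space (leb d) = UNIV"
  by (simp add: leb_def)

lemma nn_integral_leb:
  assumes [measurable]: "H \<in> borel_measurable borel"
  shows "(\<integral>\<^sup>+u. H u \<partial>leb d) = (\<integral>\<^sup>+y. H (fseq_of d y) \<partial>lborel_fun d)"
  by (simp add: leb_def nn_integral_distr)

lemma AE_leb_Rn: "AE u in leb d. u \<in> Rn d"
  unfolding leb_def by (subst AE_distr_iff) auto

interpretation lborel_fun: product_sigma_finite "\<lambda>_ :: nat. lborel :: real measure"
  by standard

text \<open>A product measure is determined by its values on boxes, and a coordinatewise affine map
  sends boxes to boxes, so the one-dimensional rule applies in each factor. Translations, scalings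
  and reflections of \<open>leb\<close> are all instances.\<close>

lemma nn_integral_lborel_fun_affine:
  assumes [measurable]: "H \<in> borel_measurable (lborel_fun d)" and c: "\<And>i. c i \<noteq> 0"
  shows "(\<integral>\<^sup>+y. H y \<partial>lborel_fun d)
    = ennreal (\<Prod>i<d. \<bar>c i\<bar>) * (\<integral>\<^sup>+y. H (\<lambda>i\<in>{..<d}. t i + c i * y i) \<partial>lborel_fun d)"
proof -
  let ?T = "\<lambda>y. \<lambda>i\<in>{..<d}. t i + c i * y i"
  let ?k = "ennreal (\<Prod>i<d. \<bar>c i\<bar>)"
  have T [measurable]: "?T \<in> measurable (lborel_fun d) (lborel_fun d)" by measurable
  have "scale_measure ?k (distr (lborel_fun d) (lborel_fun d) ?T) = lborel_fun d"
  proof (rule lborel_fun.PiM_eqI)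
    fix A :: "nat \<Rightarrow> real set" assume A: "\<And>i. i \<in> {..<d} \<Longrightarrow> A i \<in> sets lborel"
    let ?B = "\<lambda>i. {y. t i + c i * y \<in> A i}"
    have B: "?B i \<in> sets lborel" if "i \<in> {..<d}" for i
    proof -
      have [measurable]: "A i \<in> sets borel" using A[OF that] by simp
      show ?thesis by simp
    qed
    have E: "emeasure lborel (A i) = ennreal \<bar>c i\<bar> * emeasure lborel (?B i)" if "i \<in> {..<d}" for i
    proof -
      have [measurable]: "A i \<in> sets borel" using A[OF that] by simp
      have "emeasure lborel (A i) = (\<integral>\<^sup>+y. indicator (A i) y \<partial>lborel)" by simp
      also have "\<dots> = ennreal \<bar>c i\<bar> * (\<integral>\<^sup>+y. indicator (A i) (t i + c i * y) \<partial>lborel)"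
        by (subst nn_integral_real_affine[OF _ c[of i], where t = "t i"]) auto
      also have "(\<integral>\<^sup>+y. indicator (A i) (t i + c i * y) \<partial>lborel) = (\<integral>\<^sup>+y. indicator (?B i) y \<partial>lborel)"
        by (intro nn_integral_cong) (auto simp: indicator_def)
      finally show ?thesis by simp
    qed
    have vimage: "?T -` (Pi\<^sub>E {..<d} A) \<inter> space (lborel_fun d) = Pi\<^sub>E {..<d} ?B"
    proof (intro set_eqI)
      fix y :: "nat \<Rightarrow> real"
      show "y \<in> ?T -` (Pi\<^sub>E {..<d} A) \<inter> space (lborel_fun d) \<longleftrightarrow> y \<in> Pi\<^sub>E {..<d} ?B"
        by (simp add: space_PiM PiE_iff conj_commute)
    qed
    have "emeasure (distr (lborel_fun d) (lborel_fun d) ?T) (Pi\<^sub>E {..<d} A)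
        = emeasure (lborel_fun d) (Pi\<^sub>E {..<d} ?B)"
      using A by (subst emeasure_distr) (auto simp only: vimage intro!: T sets_PiM_I_finite)
    also have "\<dots> = (\<Prod>i<d. emeasure lborel (?B i))"
      by (rule lborel_fun.emeasure_PiM) (use B in auto)
    finally have "emeasure (distr (lborel_fun d) (lborel_fun d) ?T) (Pi\<^sub>E {..<d} A)
        = (\<Prod>i<d. emeasure lborel (?B i))" .
    then show "emeasure (scale_measure ?k (distr (lborel_fun d) (lborel_fun d) ?T)) (Pi\<^sub>E {..<d} A)
        = (\<Prod>i<d. emeasure lborel (A i))"
      by (simp add: E prod.distrib prod_ennreal[symmetric])
  qed auto
  then have "(\<integral>\<^sup>+y. H y \<partial>lborel_fun d)
      = (\<integral>\<^sup>+y. H y \<partial>scale_measure ?k (distr (lborel_fun d) (lborel_fun d) ?T))" by simp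
  also have "\<dots> = ?k * (\<integral>\<^sup>+y. H (?T y) \<partial>lborel_fun d)"
    by (simp add: nn_integral_scale_measure nn_integral_distr)
  finally show ?thesis .
qed

lemma nn_integral_leb_translate:
  assumes [measurable]: "H \<in> borel_measurable borel" and v: "v \<in> Rn d"
  shows "(\<integral>\<^sup>+u. H (u + v) \<partial>leb d) = (\<integral>\<^sup>+u. H u \<partial>leb d)"
proof -
  have *: "fseq_of d (\<lambda>i\<in>{..<d}. coord v i + 1 * y i) = fseq_of d y + v" for y
    using v by (intro fseq_eqI) (auto simp: Rn_def)
  have "(\<integral>\<^sup>+y. H (fseq_of d y) \<partial>lborel_fun d)
      = ennreal (\<Prod>i<d. \<bar>1\<bar>) * (\<integral>\<^sup>+y. H (fseq_of d (\<lambda>i\<in>{..<d}. coord v i + 1 * y i)) \<partial>lborel_fun d)"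
    by (rule nn_integral_lborel_fun_affine) auto
  then show ?thesis unfolding * by (simp add: nn_integral_leb)
qed

lemma nn_integral_leb_scale:
  assumes [measurable]: "H \<in> borel_measurable borel" and r: "r \<noteq> 0"
  shows "(\<integral>\<^sup>+u. H u \<partial>leb d) = ennreal (\<bar>r\<bar> ^ d) * (\<integral>\<^sup>+u. H (r *\<^sub>R u) \<partial>leb d)"
proof -
  have *: "fseq_of d (\<lambda>i\<in>{..<d}. 0 + r * y i) = r *\<^sub>R fseq_of d y" for y
    by (intro fseq_eqI) (auto simp: Rn_def)
  have "(\<integral>\<^sup>+y. H (fseq_of d y) \<partial>lborel_fun d)
      = ennreal (\<Prod>i<d. \<bar>r\<bar>) * (\<integral>\<^sup>+y. H (fseq_of d (\<lambda>i\<in>{..<d}. 0 + r * y i)) \<partial>lborel_fun d)"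
    by (rule nn_integral_lborel_fun_affine) (use r in auto)
  then show ?thesis unfolding * by (simp add: nn_integral_leb)
qed

text \<open>Reflections and the coordinate swaps below are enough symmetry for isotropy. Both are
  written as vector expressions, so that norms can be computed through inner products.\<close>

definition flip_fseq :: "nat \<Rightarrow> fseq \<Rightarrow> fseq" where
  "flip_fseq k u = u - (2 * coord u k) *\<^sub>R axis_fseq k"

lemma nn_integral_leb_flip:
  assumes [measurable]: "H \<in> borel_measurable borel"
  shows "(\<integral>\<^sup>+u. H (flip_fseq k u) \<partial>leb d) = (\<integral>\<^sup>+u. H u \<partial>leb d)"
proof -
  have [measurable]: "flip_fseq k \<in> borel_measurable borel"
    unfolding flip_fseq_def by measurable
  define c :: "nat \<Rightarrow> real" where "c = (\<lambda>i. if i = k then -1 else 1)"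
  have *: "fseq_of d (\<lambda>i\<in>{..<d}. 0 + c i * y i) = flip_fseq k (fseq_of d y)" for y
    by (intro fseq_eqI) (auto simp: flip_fseq_def c_def)
  have "(\<Prod>i<d. \<bar>c i\<bar>) = 1" by (intro prod.neutral) (auto simp: c_def)
  moreover have "(\<integral>\<^sup>+y. H (fseq_of d y) \<partial>lborel_fun d)
      = ennreal (\<Prod>i<d. \<bar>c i\<bar>) * (\<integral>\<^sup>+y. H (fseq_of d (\<lambda>i\<in>{..<d}. 0 + c i * y i)) \<partial>lborel_fun d)"
    by (rule nn_integral_lborel_fun_affine) (auto simp: c_def)
  ultimately show ?thesis unfolding * by (simp add: nn_integral_leb)
qed

definition swap_fseq :: "nat \<Rightarrow> nat \<Rightarrow> fseq \<Rightarrow> fseq" where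
  "swap_fseq j k u = u + (coord u k - coord u j) *\<^sub>R (axis_fseq j - axis_fseq k)"

lemma coord_swap_fseq: "coord (swap_fseq j k u) i = coord u (Transposition.transpose j k i)"
  by (auto simp: swap_fseq_def Transposition.transpose_def)

lemma nn_integral_leb_swap:
  assumes [measurable]: "H \<in> borel_measurable borel" and jk: "j < d" "k < d"
  shows "(\<integral>\<^sup>+u. H (swap_fseq j k u) \<partial>leb d) = (\<integral>\<^sup>+u. H u \<partial>leb d)"
proof -
  have [measurable]: "swap_fseq j k \<in> borel_measurable borel"
    unfolding swap_fseq_def by measurable
  let ?p = "Transposition.transpose j k"
  have p: "?p i \<in> {..<d} \<longleftrightarrow> i \<in> {..<d}" for i using jk by (auto simp: Transposition.transpose_def)
  let ?T = "\<lambda>y. \<lambda>i\<in>{..<d}. y (?p i)"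
  have T [measurable]: "?T \<in> measurable (lborel_fun d) (lborel_fun d)"
    using p by (intro measurable_restrict measurable_component_singleton) auto
  have "distr (lborel_fun d) (lborel_fun d) ?T = lborel_fun d"
  proof (rule lborel_fun.PiM_eqI)
    fix A :: "nat \<Rightarrow> real set" assume A: "\<And>i. i \<in> {..<d} \<Longrightarrow> A i \<in> sets lborel"
    have *: "(\<forall>i\<in>{..<d}. y (?p i) \<in> A i) \<longleftrightarrow> (\<forall>i\<in>{..<d}. y i \<in> A (?p i))" for y :: "nat \<Rightarrow> real"
      using p by (metis transpose_involutory)
    have vimage: "?T -` (Pi\<^sub>E {..<d} A) \<inter> space (lborel_fun d) = Pi\<^sub>E {..<d} (\<lambda>i. A (?p i))"
    proof (intro set_eqI)
      fix y :: "nat \<Rightarrow> real"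
      show "y \<in> ?T -` (Pi\<^sub>E {..<d} A) \<inter> space (lborel_fun d) \<longleftrightarrow> y \<in> Pi\<^sub>E {..<d} (\<lambda>i. A (?p i))"
        using *[of y] by (simp add: space_PiM PiE_iff conj_commute Ball_def)
    qed
    have "emeasure (distr (lborel_fun d) (lborel_fun d) ?T) (Pi\<^sub>E {..<d} A)
        = emeasure (lborel_fun d) (Pi\<^sub>E {..<d} (\<lambda>i. A (?p i)))"
      using A by (subst emeasure_distr) (auto simp only: vimage intro!: T sets_PiM_I_finite)
    also have "\<dots> = (\<Prod>i<d. emeasure lborel (A (?p i)))"
      by (rule lborel_fun.emeasure_PiM) (use A p in auto)
    also have "\<dots> = (\<Prod>i<d. emeasure lborel (A i))"
      using p by (intro prod.reindex_bij_witness[where i = ?p and j = ?p]) auto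
    finally show "emeasure (distr (lborel_fun d) (lborel_fun d) ?T) (Pi\<^sub>E {..<d} A)
        = (\<Prod>i<d. emeasure lborel (A i))" .
  qed auto
  then have "(\<integral>\<^sup>+y. H (fseq_of d y) \<partial>lborel_fun d)
      = (\<integral>\<^sup>+y. H (fseq_of d y) \<partial>distr (lborel_fun d) (lborel_fun d) ?T)" by simp
  also have "\<dots> = (\<integral>\<^sup>+y. H (fseq_of d (?T y)) \<partial>lborel_fun d)"
    by (simp add: nn_integral_distr)
  finally have "(\<integral>\<^sup>+y. H (fseq_of d y) \<partial>lborel_fun d) = (\<integral>\<^sup>+y. H (fseq_of d (?T y)) \<partial>lborel_fun d)" .
  moreover have "fseq_of d (?T y) = swap_fseq j k (fseq_of d y)" for y
    using jk by (intro fseq_eqI) (auto simp: swap_fseq_def Transposition.transpose_def)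
  ultimately show ?thesis by (simp add: nn_integral_leb)
qed

section \<open>Isotropy of radially weighted Lebesgue measure\<close>

lemma norm_fseq_sq:
  assumes "u \<in> Rn d"
  shows "(norm u)\<^sup>2 = (\<Sum>i<d. (coord u i)\<^sup>2)"
proof -
  have "(norm u)\<^sup>2 = inner u u" by (rule power2_norm_eq_inner)
  also have "\<dots> = (\<Sum>i<d. (coord u i)\<^sup>2)"
    unfolding inner_fseq_eq[OF assms] power2_eq_square ..
  finally show ?thesis .
qed

lemma norm_flip_fseq [simp]: "norm (flip_fseq k u) = norm u"
proof -
  have "(norm (flip_fseq k u))\<^sup>2 = (norm u)\<^sup>2"
    unfolding power2_norm_eq_inner flip_fseq_def
    by (simp add: inner_diff_left inner_diff_right algebra_simps)
  then show ?thesis by simp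
qed

lemma norm_swap_fseq [simp]: "norm (swap_fseq j k u) = norm u"
proof (cases "j = k")
  case False
  have "(norm (swap_fseq j k u))\<^sup>2 = (norm u)\<^sup>2"
    unfolding power2_norm_eq_inner swap_fseq_def using False
    by (simp add: inner_add_left inner_add_right inner_diff_left inner_diff_right algebra_simps)
  then show ?thesis by simp
qed (simp add: swap_fseq_def)

text \<open>Mixed terms vanish because flipping one coordinate changes their sign. In extended
  nonnegative reals they cannot be split off, so the two integrals of \<open>(S + b)\<^sup>2\<close>
  and \<open>(S - b)\<^sup>2\<close>, equal by the flip, are added by the parallelogram
  identity.\<close>

lemma nn_integral_leb_coord_square_sum:
  assumes [measurable]: "w \<in> borel_measurable borel"
  shows "(\<integral>\<^sup>+u. ennreal ((\<Sum>i<n. a i * coord u i)\<^sup>2) * w (norm u) \<partial>leb d)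
    = (\<Sum>i<n. ennreal ((a i)\<^sup>2) * (\<integral>\<^sup>+u. ennreal ((coord u i)\<^sup>2) * w (norm u) \<partial>leb d))"
proof (induction n)
  case (Suc n)
  define S where "S = (\<lambda>u. \<Sum>i<n. a i * coord u i)"
  define b where "b = (\<lambda>u. a n * coord u n)"
  have [measurable]: "S \<in> borel_measurable borel" "b \<in> borel_measurable borel"
    unfolding S_def b_def by measurable
  let ?I = "\<lambda>h. \<integral>\<^sup>+u. ennreal (h u) * w (norm u) \<partial>leb d"
  have "S (flip_fseq n u) = S u" "b (flip_fseq n u) = - b u" for u
    by (auto simp: S_def b_def flip_fseq_def intro!: sum.cong)
  then have "?I (\<lambda>u. (S u - b u)\<^sup>2) = ?I (\<lambda>u. (S u + b u)\<^sup>2)"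
    using nn_integral_leb_flip[of "\<lambda>u. ennreal ((S u + b u)\<^sup>2) * w (norm u)" d n] by simp
  then have "2 * ?I (\<lambda>u. (S u + b u)\<^sup>2) = ?I (\<lambda>u. (S u + b u)\<^sup>2) + ?I (\<lambda>u. (S u - b u)\<^sup>2)"
    by (simp add: mult_2)
  also have "\<dots> = (\<integral>\<^sup>+u. (ennreal ((S u + b u)\<^sup>2) + ennreal ((S u - b u)\<^sup>2)) * w (norm u) \<partial>leb d)"
    by (subst nn_integral_add[symmetric]) (auto simp: distrib_right)
  also have "\<dots> = (\<integral>\<^sup>+u. 2 * (ennreal ((S u)\<^sup>2) * w (norm u)) + 2 * (ennreal ((b u)\<^sup>2) * w (norm u)) \<partial>leb d)"
  proof (intro nn_integral_cong)
    fix u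
    have "ennreal ((S u + b u)\<^sup>2) + ennreal ((S u - b u)\<^sup>2) = ennreal (2 * (S u)\<^sup>2 + 2 * (b u)\<^sup>2)"
      unfolding ennreal_plus[OF zero_le_power2 zero_le_power2, symmetric]
      by (simp add: power2_eq_square algebra_simps)
    also have "\<dots> = 2 * ennreal ((S u)\<^sup>2) + 2 * ennreal ((b u)\<^sup>2)"
      by (simp add: ennreal_mult)
    finally show "(ennreal ((S u + b u)\<^sup>2) + ennreal ((S u - b u)\<^sup>2)) * w (norm u)
        = 2 * (ennreal ((S u)\<^sup>2) * w (norm u)) + 2 * (ennreal ((b u)\<^sup>2) * w (norm u))"
      by (simp add: distrib_right mult.assoc)
  qed
  also have "\<dots> = 2 * (?I (\<lambda>u. (S u)\<^sup>2) + ?I (\<lambda>u. (b u)\<^sup>2))"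
    by (subst nn_integral_add) (auto simp: nn_integral_cmult distrib_left)
  finally have "?I (\<lambda>u. (S u + b u)\<^sup>2) = ?I (\<lambda>u. (S u)\<^sup>2) + ?I (\<lambda>u. (b u)\<^sup>2)"
    by (subst (asm) ennreal_mult_cancel_left) auto
  moreover have "?I (\<lambda>u. (b u)\<^sup>2) = ennreal ((a n)\<^sup>2) * ?I (\<lambda>u. (coord u n)\<^sup>2)"
    by (subst nn_integral_cmult[symmetric]) (auto simp: b_def power_mult_distrib ennreal_mult mult.assoc)
  ultimately show ?case
    using Suc.IH by (simp add: S_def b_def)
qed simp

text \<open>Flips remove the mixed products of coordinates, swaps make the remaining squares equal,
  and the sum of the \<open>d\<close> equal squares is \<open>(norm u)\<^sup>2\<close>.\<close>

lemma nn_integral_leb_isotropic: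
  assumes [measurable]: "w \<in> borel_measurable borel" and p: "p \<in> Rn d"
  shows "ennreal (real d) * (\<integral>\<^sup>+u. ennreal ((inner p u)\<^sup>2) * w (norm u) \<partial>leb d)
    = ennreal ((norm p)\<^sup>2) * (\<integral>\<^sup>+u. ennreal ((norm u)\<^sup>2) * w (norm u) \<partial>leb d)"
proof -
  define J where "J i = (\<integral>\<^sup>+u. ennreal ((coord u i)\<^sup>2) * w (norm u) \<partial>leb d)" for i
  have J: "J i = J 0" if "i < d" for i
    using nn_integral_leb_swap[of "\<lambda>u. ennreal ((coord u 0)\<^sup>2) * w (norm u)" 0 d i] that
    by (simp add: coord_swap_fseq J_def)
  have "(\<integral>\<^sup>+u. ennreal ((inner p u)\<^sup>2) * w (norm u) \<partial>leb d) = (\<Sum>i<d. ennreal ((coord p i)\<^sup>2) * J i)"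
    unfolding inner_fseq_eq[OF p] J_def by (rule nn_integral_leb_coord_square_sum) fact
  also have "\<dots> = (\<Sum>i<d. ennreal ((coord p i)\<^sup>2)) * J 0"
    unfolding sum_distrib_right by (intro sum.cong refl arg_cong2[where f = "(*)"] J) simp
  also have "(\<Sum>i<d. ennreal ((coord p i)\<^sup>2)) = ennreal ((norm p)\<^sup>2)"
    by (subst sum_ennreal) (auto simp: norm_fseq_sq[OF p])
  finally have 1: "(\<integral>\<^sup>+u. ennreal ((inner p u)\<^sup>2) * w (norm u) \<partial>leb d) = ennreal ((norm p)\<^sup>2) * J 0" .
  have "(\<integral>\<^sup>+u. ennreal ((norm u)\<^sup>2) * w (norm u) \<partial>leb d)
      = (\<integral>\<^sup>+u. (\<Sum>i<d. ennreal ((coord u i)\<^sup>2) * w (norm u)) \<partial>leb d)"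
  proof (intro nn_integral_cong_AE, use AE_leb_Rn[of d] in eventually_elim)
    fix u assume "u \<in> Rn d"
    then show "ennreal ((norm u)\<^sup>2) * w (norm u) = (\<Sum>i<d. ennreal ((coord u i)\<^sup>2) * w (norm u))"
      by (simp add: norm_fseq_sq sum_distrib_right[symmetric])
  qed
  also have "\<dots> = (\<Sum>i<d. J i)"
    unfolding J_def by (rule nn_integral_sum) auto
  also have "\<dots> = ennreal (real d) * J 0"
  proof -
    have "(\<Sum>i<d. J i) = (\<Sum>i<d. J 0)" by (intro sum.cong refl J) simp
    then show ?thesis by (simp add: ennreal_of_nat_eq_real_of_nat)
  qed
  finally show ?thesis unfolding 1 by (simp add: mult_ac)
qed

section \<open>Volume of balls, sigma-finiteness, the origin as a null set\<close>

lemma emeasure_leb_cball_finite: "emeasure (leb d) (cball 0 r) < \<infinity>"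
proof -
  have "emeasure (leb d) (cball 0 r) = emeasure (lborel_fun d) (fseq_of d -` cball 0 r \<inter> space (lborel_fun d))"
    unfolding leb_def by (subst emeasure_distr) auto
  also have "\<dots> \<le> emeasure (lborel_fun d) (Pi\<^sub>E {..<d} (\<lambda>_. {-r..r}))"
  proof (intro emeasure_mono subsetI)
    fix y assume y: "y \<in> fseq_of d -` cball 0 r \<inter> space (lborel_fun d)"
    show "y \<in> Pi\<^sub>E {..<d} (\<lambda>_. {-r..r})"
    proof (intro PiE_I)
      fix i assume i: "i \<in> {..<d}"
      have "\<bar>coord (fseq_of d y) i\<bar> \<le> norm (fseq_of d y)" by (rule abs_coord_le_norm)
      with y i show "y i \<in> {-r..r}" by auto
    qed (use y in \<open>auto simp: space_PiM PiE_iff extensional_def\<close>)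
  qed (auto intro!: sets_PiM_I_finite)
  also have "\<dots> = (\<Prod>i<d. emeasure lborel {-r..r})"
    by (rule lborel_fun.emeasure_PiM) auto
  also have "\<dots> < \<infinity>"
    by (simp add: emeasure_lborel_Icc_eq power_less_top_ennreal)
  finally show ?thesis .
qed

text \<open>A cube of side \<open>r / (d + 1)\<close> at the origin fits into the ball, because the
  norm is at most the sum of the absolute coordinates.\<close>

lemma emeasure_leb_cball_pos:
  assumes r: "0 < r"
  shows "0 < emeasure (leb d) (cball 0 r)"
proof -
  define e where "e = r / (real d + 1)"
  have e: "0 < e" using r by (simp add: e_def)
  have "0 < (\<Prod>i<d. emeasure lborel {0..e})"
    using e by (auto simp: prod_pos ennreal_zero_less_mult_iff ennreal_power)
  also have "\<dots> = emeasure (lborel_fun d) (Pi\<^sub>E {..<d} (\<lambda>_. {0..e}))"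
    by (rule lborel_fun.emeasure_PiM[symmetric]) auto
  also have "\<dots> \<le> emeasure (lborel_fun d) (fseq_of d -` cball 0 r \<inter> space (lborel_fun d))"
  proof (intro emeasure_mono subsetI)
    fix y assume y: "y \<in> Pi\<^sub>E {..<d} (\<lambda>_. {0..e})"
    have "norm (fseq_of d y) \<le> (\<Sum>i<d. \<bar>coord (fseq_of d y) i\<bar>)"
      by (intro norm_le_sum_abs_coord) auto
    also have "\<dots> \<le> (\<Sum>i<d. e)"
      by (intro sum_mono) (use y in \<open>auto dest!: PiE_mem\<close>)
    also have "\<dots> \<le> r" using r by (simp add: e_def field_simps)
    finally show "y \<in> fseq_of d -` cball 0 r \<inter> space (lborel_fun d)"
      using y by (auto simp: space_PiM PiE_iff)
  qed (auto intro!: measurable_sets[OF measurable_fseq_of])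
  also have "\<dots> = emeasure (leb d) (cball 0 r)"
    unfolding leb_def by (subst emeasure_distr) auto
  finally show ?thesis .
qed

lemma cball_fseq_borel [measurable]: "cball (a :: fseq) r \<in> sets borel"
  by (rule borel_closed) simp

definition ball_vol :: "nat \<Rightarrow> ennreal" where
  "ball_vol d = emeasure (leb d) (cball 0 1)"

lemma ball_vol [simp]: "ball_vol d \<noteq> 0" "ball_vol d \<noteq> \<infinity>" "ball_vol d \<noteq> top" "0 < ball_vol d" "ball_vol d < top"
  using emeasure_leb_cball_finite[of d 1] emeasure_leb_cball_pos[of 1 d] by (auto simp: ball_vol_def)

interpretation leb: sigma_finite_measure "leb d"
proof
  show "\<exists>A. countable A \<and> A \<subseteq> sets (leb d) \<and> \<Union>A = space (leb d) \<and> (\<forall>a\<in>A. emeasure (leb d) a \<noteq> \<infinity>)"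
  proof (intro exI[of _ "range (\<lambda>n :: nat. cball 0 (real n))"] conjI ballI)
    show "\<Union>(range (\<lambda>n. cball 0 (real n))) = space (leb d)"
      using real_arch_simple by (auto simp: dist_norm)
  qed (auto intro!: less_imp_neq[OF emeasure_leb_cball_finite, simplified])
qed

interpretation leb_pair: pair_sigma_finite "leb d" "leb d"
  by standard

text \<open>The set \<open>{0}\<close> is invariant under scaling by 2, which multiplies
  \<open>leb d\<close> by \<open>2 ^ d\<close>. A finite mass equal to a proper multiple of itself
  is zero.\<close>

lemma AE_leb_nonzero:
  assumes d: "0 < d"
  shows "AE u in leb d. u \<noteq> 0"
proof -
  have "(\<integral>\<^sup>+u. indicator {0} u \<partial>leb d) = ennreal (2 ^ d) * (\<integral>\<^sup>+u. indicator {0} u \<partial>leb d)"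
    using nn_integral_leb_scale[of "indicator {0}" 2 d] by (simp add: indicator_def)
  then have *: "emeasure (leb d) {0} = ennreal (2 ^ d) * emeasure (leb d) {0}" by simp
  have fin: "emeasure (leb d) {0} < \<infinity>"
    by (rule le_less_trans[OF emeasure_mono emeasure_leb_cball_finite[of d 1]]) auto
  have "emeasure (leb d) {0} = 0"
  proof -
    obtain c where c: "emeasure (leb d) {0} = ennreal c" "0 \<le> c"
      using fin by (cases "emeasure (leb d) {0}") auto
    have "ennreal c = ennreal (2 ^ d * c)"
      using * c by (simp add: ennreal_mult)
    then have "c = 2 ^ d * c" using c(2) by (subst (asm) ennreal_inj) auto
    moreover have "(1 :: real) < 2 ^ d" using d by simp
    ultimately show ?thesis using c by auto
  qed
  then show ?thesis by (subst AE_iff_null) (auto simp: null_sets_def)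
qed

subsection \<open>The uniform distribution on the sphere\<close>

lemma nn_integral_uniform_sphere:
  assumes [measurable]: "H \<in> borel_measurable borel"
  shows "(\<integral>\<^sup>+z. H z \<partial>uniform_sphere d) = (\<integral>\<^sup>+u. H (sgn u) * indicator (cball 0 1) u \<partial>leb d) / ball_vol d"
proof -
  let ?S = "{y \<in> space (lborel_fun d). norm (fseq_of d y) \<le> 1}"
  have S [measurable]: "?S \<in> sets (lborel_fun d)" by measurable
  have "emeasure (lborel_fun d) ?S = ball_vol d"
    unfolding ball_vol_def leb_def by (subst emeasure_distr) (auto intro!: arg_cong2[where f = emeasure])
  moreover have "(\<integral>\<^sup>+y. H (sgn (fseq_of d y)) * indicator ?S y \<partial>lborel_fun d)
      = (\<integral>\<^sup>+y. H (sgn (fseq_of d y)) * indicator (cball 0 1) (fseq_of d y) \<partial>lborel_fun d)"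
    by (intro nn_integral_cong) (auto simp: indicator_def)
  moreover have "(\<integral>\<^sup>+z. H z \<partial>uniform_sphere d)
      = (\<integral>\<^sup>+y. H (sgn (fseq_of d y)) \<partial>uniform_measure (lborel_fun d) ?S)"
    unfolding uniform_sphere_def by (rule nn_integral_distr) measurable
  moreover have "(\<integral>\<^sup>+y. H (sgn (fseq_of d y)) \<partial>uniform_measure (lborel_fun d) ?S)
      = (\<integral>\<^sup>+y. H (sgn (fseq_of d y)) * indicator ?S y \<partial>lborel_fun d) / emeasure (lborel_fun d) ?S"
    by (rule nn_integral_uniform_measure) measurable
  moreover have "(\<integral>\<^sup>+u. H (sgn u) * indicator (cball 0 1) u \<partial>leb d)
      = (\<integral>\<^sup>+y. H (sgn (fseq_of d y)) * indicator (cball 0 1) (fseq_of d y) \<partial>lborel_fun d)"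
    by (rule nn_integral_leb) measurable
  ultimately show ?thesis by argo
qed

lemma sets_uniform_sphere [measurable_cong, simp]: "sets (uniform_sphere d) = sets borel"
  by (simp add: uniform_sphere_def)

lemma space_uniform_sphere [simp]: "space (uniform_sphere d) = UNIV"
  by (simp add: uniform_sphere_def)

lemma prob_space_uniform_sphere: "prob_space (uniform_sphere d)"
proof
  have "emeasure (uniform_sphere d) UNIV = (\<integral>\<^sup>+z. 1 \<partial>uniform_sphere d)" by simp
  also have "\<dots> = 1"
    by (subst nn_integral_uniform_sphere) (auto simp: ball_vol_def[symmetric] ennreal_divide_self)
  finally show "emeasure (uniform_sphere d) (space (uniform_sphere d)) = 1" by simp
qed

interpretation sph: prob_space "uniform_sphere d"
  by (rule prob_space_uniform_sphere)

lemma AE_uniform_sphere: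
  assumes d: "0 < d"
  shows "AE z in uniform_sphere d. z \<in> Rn d \<and> norm z = 1"
proof -
  let ?A = "{z. \<not> (z \<in> Rn d \<and> norm z = 1)}"
  have [measurable]: "?A \<in> sets borel" by measurable
  have "emeasure (uniform_sphere d) ?A = (\<integral>\<^sup>+z. indicator ?A z \<partial>uniform_sphere d)" by simp
  also have "\<dots> = (\<integral>\<^sup>+u. indicator ?A (sgn u) * indicator (cball 0 1) u \<partial>leb d) / ball_vol d"
    by (rule nn_integral_uniform_sphere) measurable
  also have "(\<integral>\<^sup>+u. indicator ?A (sgn u) * indicator (cball 0 1) u \<partial>leb d) = (\<integral>\<^sup>+u. 0 \<partial>leb d)"
  proof (intro nn_integral_cong_AE, use AE_leb_Rn[of d] AE_leb_nonzero[OF d] in eventually_elim)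
    fix u assume "u \<in> Rn d" "u \<noteq> 0"
    then have "sgn u \<in> Rn d" "norm (sgn u) = 1" by (auto simp: norm_sgn)
    then show "indicator ?A (sgn u) * indicator (cball 0 1) u = (0 :: ennreal)" by simp
  qed
  finally show ?thesis by (subst AE_iff_null) (auto simp: null_sets_def)
qed

subsection \<open>Polar coordinates\<close>

lemma nn_integral_power_tail:
  fixes a :: real
  assumes a: "0 < a" and d: "0 < d"
  shows "(\<integral>\<^sup>+t. ennreal (real d / t ^ (d + 1)) * indicator {a..} t \<partial>lborel) = ennreal (1 / a ^ d)"
proof -
  have "(\<integral>\<^sup>+t. ennreal (real d / t ^ (d + 1)) * indicator {a..} t \<partial>lborel) = ennreal (0 - (- (1 / a ^ d)))"
  proof (rule nn_integral_FTC_atLeast)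
    fix t assume t: "a \<le> t"
    then have "0 < t" using a by simp
    have "d - Suc 0 + Suc 0 = d" using d by simp
    then have "t ^ d = t ^ (d - Suc 0) * t" by (metis power_Suc2 Suc_pred' d One_nat_def)
    with \<open>0 < t\<close> show "((\<lambda>t. - (1 / t ^ d)) has_real_derivative real d / t ^ (d + 1)) (at t)"
      by (auto intro!: derivative_eq_intros simp: field_simps)
  next
    show "((\<lambda>t :: real. - (1 / t ^ d)) \<longlongrightarrow> 0) at_top"
    proof -
      have "((\<lambda>t :: real. 1 / t ^ d) \<longlongrightarrow> 0) at_top"
        by (rule real_tendsto_divide_at_top[OF tendsto_const filterlim_pow_at_top[OF d filterlim_ident]])
      from tendsto_minus[OF this] show ?thesis by simp
    qed
  qed (use a in auto)
  then show ?thesis by simp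
qed

text \<open>Scaling and Fubini suffice. The spherical mean is by definition an average over
  \<open>u\<close> in the unit ball. Substituting \<open>r = t * norm u\<close> and then
  \<open>v = t *\<^sub>R u\<close> turns the condition \<open>norm u \<le> 1\<close> into
  \<open>norm v \<le> t\<close>, and integrating \<open>d / t ^ (d + 1)\<close> over these
  \<open>t\<close> cancels the factor \<open>norm v ^ d\<close>.\<close>

lemma nn_integral_leb_polar:
  assumes H [measurable]: "H \<in> borel_measurable borel" and d: "0 < d"
  shows "(\<integral>\<^sup>+u. H u \<partial>leb d) = ball_vol d *
    (\<integral>\<^sup>+r. ennreal (real d * r ^ (d - 1)) * indicator {0<..} r * (\<integral>\<^sup>+z. H (r *\<^sub>R z) \<partial>uniform_sphere d) \<partial>lborel)"
proof -
  define D where "D r = ennreal (real d * r ^ (d - 1)) * indicator {0<..} r" for r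
  have [measurable]: "D \<in> borel_measurable borel" unfolding D_def by measurable
  have "ball_vol d * (\<integral>\<^sup>+r. D r * (\<integral>\<^sup>+z. H (r *\<^sub>R z) \<partial>uniform_sphere d) \<partial>lborel)
      = (\<integral>\<^sup>+r. ball_vol d * (D r * (\<integral>\<^sup>+z. H (r *\<^sub>R z) \<partial>uniform_sphere d)) \<partial>lborel)"
    by (rule nn_integral_cmult[symmetric]) measurable
  also have "\<dots> = (\<integral>\<^sup>+r. (\<integral>\<^sup>+u. D r * (H (r *\<^sub>R sgn u) * indicator (cball 0 1) u) \<partial>leb d) \<partial>lborel)"
  proof (intro nn_integral_cong)
    fix r
    have "ball_vol d * (\<integral>\<^sup>+z. H (r *\<^sub>R z) \<partial>uniform_sphere d)
        = (\<integral>\<^sup>+u. H (r *\<^sub>R sgn u) * indicator (cball 0 1) u \<partial>leb d)"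
      by (subst nn_integral_uniform_sphere) (auto simp: ennreal_times_divide mult_divide_eq_ennreal mult.commute[of "ball_vol d"])
    then have "ball_vol d * (D r * (\<integral>\<^sup>+z. H (r *\<^sub>R z) \<partial>uniform_sphere d))
        = D r * (\<integral>\<^sup>+u. H (r *\<^sub>R sgn u) * indicator (cball 0 1) u \<partial>leb d)"
      by (subst mult.left_commute) (rule arg_cong)
    also have "\<dots> = (\<integral>\<^sup>+u. D r * (H (r *\<^sub>R sgn u) * indicator (cball 0 1) u) \<partial>leb d)"
      by (rule nn_integral_cmult[symmetric]) measurable
    finally show "ball_vol d * (D r * (\<integral>\<^sup>+z. H (r *\<^sub>R z) \<partial>uniform_sphere d))
        = (\<integral>\<^sup>+u. D r * (H (r *\<^sub>R sgn u) * indicator (cball 0 1) u) \<partial>leb d)" .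
  qed
  also have "\<dots> = (\<integral>\<^sup>+u. (\<integral>\<^sup>+r. D r * (H (r *\<^sub>R sgn u) * indicator (cball 0 1) u) \<partial>lborel) \<partial>leb d)"
  proof -
    interpret pair_sigma_finite "leb d" lborel by standard
    show ?thesis by (rule Fubini') measurable
  qed
  \<comment> \<open>Substitution \<open>r = norm u * t\<close> for fixed \<open>u\<close>; it
    removes \<open>sgn\<close> from the argument of \<open>H\<close>.\<close>
  also have "\<dots> = (\<integral>\<^sup>+u. (\<integral>\<^sup>+t. D t * (ennreal (norm u ^ d) * indicator (cball 0 1) u * H (t *\<^sub>R u)) \<partial>lborel) \<partial>leb d)"
  proof (intro nn_integral_cong_AE, use AE_leb_nonzero[OF d] in eventually_elim)
    fix u :: fseq assume u: "u \<noteq> 0"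
    have "(\<integral>\<^sup>+r. D r * (H (r *\<^sub>R sgn u) * indicator (cball 0 1) u) \<partial>lborel)
        = ennreal \<bar>norm u\<bar> * (\<integral>\<^sup>+t. D (0 + norm u * t) * (H ((0 + norm u * t) *\<^sub>R sgn u) * indicator (cball 0 1) u) \<partial>lborel)"
      by (rule nn_integral_real_affine) (use u in auto)
    also have "\<dots> = (\<integral>\<^sup>+t. ennreal \<bar>norm u\<bar> * (D (0 + norm u * t) * (H ((0 + norm u * t) *\<^sub>R sgn u) * indicator (cball 0 1) u)) \<partial>lborel)"
      by (rule nn_integral_cmult[symmetric]) measurable
    also have "\<dots> = (\<integral>\<^sup>+t. D t * (ennreal (norm u ^ d) * indicator (cball 0 1) u * H (t *\<^sub>R u)) \<partial>lborel)"
    proof (intro nn_integral_cong)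
      fix t
      have "norm u ^ d = norm u * norm u ^ (d - 1)" using d by (metis power_eq_if not_gr_zero)
      then have "ennreal \<bar>norm u\<bar> * D (norm u * t) = D t * ennreal (norm u ^ d)"
        using u by (auto simp: D_def indicator_def zero_less_mult_iff power_mult_distrib ennreal_mult[symmetric] mult_ac)
      moreover have "(norm u * t) *\<^sub>R sgn u = t *\<^sub>R u" using u by (simp add: sgn_fseq_def)
      ultimately show "ennreal \<bar>norm u\<bar> * (D (0 + norm u * t) * (H ((0 + norm u * t) *\<^sub>R sgn u) * indicator (cball 0 1) u))
          = D t * (ennreal (norm u ^ d) * indicator (cball 0 1) u * H (t *\<^sub>R u))"
        by (simp add: mult.assoc[symmetric]) (simp add: mult_ac)
    qed
    finally show "(\<integral>\<^sup>+r. D r * (H (r *\<^sub>R sgn u) * indicator (cball 0 1) u) \<partial>lborel)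
        = (\<integral>\<^sup>+t. D t * (ennreal (norm u ^ d) * indicator (cball 0 1) u * H (t *\<^sub>R u)) \<partial>lborel)" .
  qed
  also have "\<dots> = (\<integral>\<^sup>+t. (\<integral>\<^sup>+u. D t * (ennreal (norm u ^ d) * indicator (cball 0 1) u * H (t *\<^sub>R u)) \<partial>leb d) \<partial>lborel)"
  proof -
    interpret pair_sigma_finite lborel "leb d" by standard
    show ?thesis by (rule Fubini') measurable
  qed
  \<comment> \<open>Substitution \<open>v = t *\<^sub>R u\<close> for fixed
    \<open>t\<close>.\<close>
  also have "\<dots> = (\<integral>\<^sup>+t. (\<integral>\<^sup>+v. ennreal (real d / t ^ (d + 1)) * indicator {norm v..} t * indicator {0<..} t
      * (ennreal (norm v ^ d) * H v) \<partial>leb d) \<partial>lborel)"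
  proof (rule nn_integral_cong)
    fix t :: real
    show "(\<integral>\<^sup>+u. D t * (ennreal (norm u ^ d) * indicator (cball 0 1) u * H (t *\<^sub>R u)) \<partial>leb d)
      = (\<integral>\<^sup>+v. ennreal (real d / t ^ (d + 1)) * indicator {norm v..} t * indicator {0<..} t
      * (ennreal (norm v ^ d) * H v) \<partial>leb d)"
    proof (cases "0 < t")
      case t: True
      define K where "K v = ennreal (real d / t ^ (d + 1)) * indicator {norm v..} t * (ennreal (norm v ^ d) * H v)" for v
      have [measurable]: "(\<lambda>v :: fseq. indicator {norm v..} t :: ennreal) \<in> borel_measurable borel"
        unfolding indicator_def atLeast_iff by measurable
      have [measurable]: "K \<in> borel_measurable borel" unfolding K_def by measurable
      have K: "ennreal (t ^ d) * K (t *\<^sub>R u) = D t * (ennreal (norm u ^ d) * indicator (cball 0 1) u * H (t *\<^sub>R u))" for u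
      proof -
        have td: "t ^ d = t * t ^ (d - 1)" using d by (metis power_eq_if not_gr_zero)
        have E: "ennreal (t ^ d) * (ennreal (real d / t ^ (d + 1)) * ennreal ((t * norm u) ^ d))
            = ennreal (real d * t ^ (d - 1)) * ennreal (norm u ^ d)"
          using t by (simp add: ennreal_mult[symmetric] power_mult_distrib td field_simps)
        have "ennreal (t ^ d) * K (t *\<^sub>R u)
            = (ennreal (t ^ d) * (ennreal (real d / t ^ (d + 1)) * ennreal ((t * norm u) ^ d)))
              * (indicator (cball 0 1) u * H (t *\<^sub>R u))"
          using t by (auto simp: K_def indicator_def mult_ac)
        also have "\<dots> = ennreal (real d * t ^ (d - 1)) * ennreal (norm u ^ d) * (indicator (cball 0 1) u * H (t *\<^sub>R u))"
          by (simp only: E)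
        also have "\<dots> = D t * (ennreal (norm u ^ d) * indicator (cball 0 1) u * H (t *\<^sub>R u))"
          using t by (auto simp: D_def indicator_def mult_ac)
        finally show ?thesis .
      qed
      have "(\<integral>\<^sup>+u. D t * (ennreal (norm u ^ d) * indicator (cball 0 1) u * H (t *\<^sub>R u)) \<partial>leb d)
          = (\<integral>\<^sup>+u. ennreal (t ^ d) * K (t *\<^sub>R u) \<partial>leb d)" by (simp add: K)
      also have "\<dots> = ennreal (\<bar>t\<bar> ^ d) * (\<integral>\<^sup>+u. K (t *\<^sub>R u) \<partial>leb d)"
        using t by (simp add: nn_integral_cmult)
      also have "\<dots> = (\<integral>\<^sup>+u. K u \<partial>leb d)"
        by (rule nn_integral_leb_scale[symmetric]) (use t in auto)
      finally show ?thesis using t by (simp add: K_def)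
    next
      case False
      then have "D t = 0" "indicator {0<..} t = (0 :: ennreal)" by (auto simp: D_def)
      then show ?thesis by simp
    qed
  qed
  also have "\<dots> = (\<integral>\<^sup>+v. (\<integral>\<^sup>+t. ennreal (real d / t ^ (d + 1)) * indicator {norm v..} t * indicator {0<..} t
      * (ennreal (norm v ^ d) * H v) \<partial>lborel) \<partial>leb d)"
  proof -
    interpret pair_sigma_finite "leb d" lborel by standard
    have [measurable]: "(\<lambda>x :: fseq \<times> real. indicator {norm (fst x)..} (snd x) :: ennreal) \<in> borel_measurable (leb d \<Otimes>\<^sub>M lborel)"
      unfolding indicator_def atLeast_iff by measurable
    show ?thesis by (rule Fubini') (auto simp: split_beta')
  qed
  also have "\<dots> = (\<integral>\<^sup>+v. H v \<partial>leb d)"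
  proof (intro nn_integral_cong_AE, use AE_leb_nonzero[OF d] in eventually_elim)
    fix v :: fseq assume v: "v \<noteq> 0"
    have "(\<integral>\<^sup>+t. ennreal (real d / t ^ (d + 1)) * indicator {norm v..} t * indicator {0<..} t * (ennreal (norm v ^ d) * H v) \<partial>lborel)
        = (\<integral>\<^sup>+t. ennreal (real d / t ^ (d + 1)) * indicator {norm v..} t * (ennreal (norm v ^ d) * H v) \<partial>lborel)"
    proof (intro nn_integral_cong)
      fix t
      have "0 < t" if "norm v \<le> t"
        by (rule less_le_trans[OF _ that]) (use v in simp)
      then have "indicator {norm v..} t * indicator {0<..} t = (indicator {norm v..} t :: ennreal)"
        by (cases "norm v \<le> t") simp_all
      then show "ennreal (real d / t ^ (d + 1)) * indicator {norm v..} t * indicator {0<..} t * (ennreal (norm v ^ d) * H v)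
          = ennreal (real d / t ^ (d + 1)) * indicator {norm v..} t * (ennreal (norm v ^ d) * H v)"
        by (simp only: mult.assoc)
    qed
    also have "\<dots> = (\<integral>\<^sup>+t. ennreal (real d / t ^ (d + 1)) * indicator {norm v..} t \<partial>lborel) * (ennreal (norm v ^ d) * H v)"
      by (rule nn_integral_multc) measurable
    also have "(\<integral>\<^sup>+t. ennreal (real d / t ^ (d + 1)) * indicator {norm v..} t \<partial>lborel) = ennreal (1 / norm v ^ d)"
      by (rule nn_integral_power_tail) (use v d in auto)
    also have "ennreal (1 / norm v ^ d) * (ennreal (norm v ^ d) * H v) = H v"
      using v by (simp add: mult.assoc[symmetric] ennreal_mult[symmetric])
    finally show "(\<integral>\<^sup>+t. ennreal (real d / t ^ (d + 1)) * indicator {norm v..} t * indicator {0<..} t * (ennreal (norm v ^ d) * H v) \<partial>lborel) = H v" .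
  qed
  finally show ?thesis by (simp add: D_def)
qed

text \<open>Under Lebesgue measure the radius and the direction are independent. The radial factor
  is the same for every \<open>Q\<close>, so the case of constant 1 identifies it.\<close>

lemma nn_integral_leb_radial_times_direction:
  assumes [measurable]: "b \<in> borel_measurable borel" "Q \<in> borel_measurable borel" and d: "0 < d"
  shows "(\<integral>\<^sup>+u. b (norm u) * Q (sgn u) \<partial>leb d)
    = (\<integral>\<^sup>+u. b (norm u) \<partial>leb d) * (\<integral>\<^sup>+z. Q z \<partial>uniform_sphere d)"
proof -
  let ?D = "\<lambda>r. ennreal (real d * r ^ (d - 1)) * indicator {0<..} r"
  have *: "?D r * (\<integral>\<^sup>+z. b (norm (r *\<^sub>R z)) * q (sgn (r *\<^sub>R z)) \<partial>uniform_sphere d)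
      = ?D r * b r * (\<integral>\<^sup>+z. q z \<partial>uniform_sphere d)"
    if [measurable]: "q \<in> borel_measurable borel" for r and q :: "fseq \<Rightarrow> ennreal"
  proof (cases "0 < r")
    case True
    have "(\<integral>\<^sup>+z. b (norm (r *\<^sub>R z)) * q (sgn (r *\<^sub>R z)) \<partial>uniform_sphere d)
        = (\<integral>\<^sup>+z. b r * q z \<partial>uniform_sphere d)"
      by (intro nn_integral_cong_AE, use AE_uniform_sphere[OF d] in eventually_elim)
        (use True in \<open>auto simp: sgn_scaleR sgn_fseq_def\<close>)
    also have "\<dots> = b r * (\<integral>\<^sup>+z. q z \<partial>uniform_sphere d)" by (rule nn_integral_cmult) simp
    finally show ?thesis by (simp add: mult_ac)
  qed simp
  have "(\<integral>\<^sup>+u. b (norm u) * q (sgn u) \<partial>leb d)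
      = ball_vol d * (\<integral>\<^sup>+r. ?D r * b r \<partial>lborel) * (\<integral>\<^sup>+z. q z \<partial>uniform_sphere d)"
    if [measurable]: "q \<in> borel_measurable borel" for q :: "fseq \<Rightarrow> ennreal"
    by (subst nn_integral_leb_polar[OF _ d], measurable, simp only: *[OF that], subst nn_integral_multc)
      (auto simp: mult_ac)
  from this[of Q] this[of "\<lambda>_. 1"] show ?thesis
    by (simp add: sph.emeasure_space_1[simplified])
qed

text \<open>On the unit ball the weight \<open>1 / r\<^sup>2\<close> turns the square of
  \<open>inner p u\<close> into that of \<open>inner p (sgn u)\<close>; isotropy then gives the
  factor \<open>1 / d\<close>. At the origin both sides vanish, as division by zero yields
  zero.\<close>

lemma nn_integral_uniform_sphere_inner_square:
  assumes p: "p \<in> Rn d" and d: "0 < d"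
  shows "(\<integral>\<^sup>+z. ennreal ((inner p z)\<^sup>2) \<partial>uniform_sphere d) = ennreal ((norm p)\<^sup>2 / real d)"
proof -
  define w :: "real \<Rightarrow> ennreal" where "w r = ennreal (1 / r\<^sup>2) * indicator {..1} r" for r
  have [measurable]: "w \<in> borel_measurable borel" unfolding w_def by measurable
  have 1: "(\<integral>\<^sup>+u. ennreal ((inner p (sgn u))\<^sup>2) * indicator (cball 0 1) u \<partial>leb d)
      = (\<integral>\<^sup>+u. ennreal ((inner p u)\<^sup>2) * w (norm u) \<partial>leb d)"
    by (intro nn_integral_cong)
      (auto simp: w_def indicator_def sgn_fseq_def ennreal_mult[symmetric] power_mult_distrib field_simps)
  have 2: "(\<integral>\<^sup>+u. ennreal ((norm u)\<^sup>2) * w (norm u) \<partial>leb d) = ball_vol d"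
  proof -
    have "(\<integral>\<^sup>+u. ennreal ((norm u)\<^sup>2) * w (norm u) \<partial>leb d) = (\<integral>\<^sup>+u. indicator (cball 0 1) u \<partial>leb d)"
      by (intro nn_integral_cong_AE, use AE_leb_nonzero[OF d] in eventually_elim)
        (auto simp: w_def indicator_def ennreal_mult[symmetric])
    then show ?thesis by (simp add: ball_vol_def)
  qed
  define I where "I = (\<integral>\<^sup>+u. ennreal ((inner p u)\<^sup>2) * w (norm u) \<partial>leb d)"
  have "ennreal (real d) * I = ennreal ((norm p)\<^sup>2) * ball_vol d"
    unfolding I_def using nn_integral_leb_isotropic[OF _ p, of w] by (simp add: 2)
  then have "I / ball_vol d = ennreal ((norm p)\<^sup>2) / ennreal (real d)"
    using d by (metis (no_types, lifting) I_def ball_vol(1,3) ennreal_divide_times ennreal_neq_top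
        ennreal_times_divide mult.commute mult_divide_eq_ennreal ennreal_eq_0_iff of_nat_le_0_iff not_gr_zero)
  then show ?thesis
    using d by (subst nn_integral_uniform_sphere) (auto simp: 1 I_def[symmetric] divide_ennreal)
qed

subsection \<open>Rotations of pairs\<close>

text \<open>After exchanging the integrals, a shear is a translation by a vector depending on the
  other variable, which lies in \<open>Rn d\<close> almost everywhere.\<close>

lemma nn_integral_leb_pair_shear1:
  assumes [measurable]: "H \<in> borel_measurable (borel \<Otimes>\<^sub>M borel)"
  shows "(\<integral>\<^sup>+X. \<integral>\<^sup>+Y. H (X + a *\<^sub>R Y, Y) \<partial>leb d \<partial>leb d) = (\<integral>\<^sup>+X. \<integral>\<^sup>+Y. H (X, Y) \<partial>leb d \<partial>leb d)"
proof -
  have "(\<integral>\<^sup>+X. \<integral>\<^sup>+Y. H (X + a *\<^sub>R Y, Y) \<partial>leb d \<partial>leb d) = (\<integral>\<^sup>+Y. \<integral>\<^sup>+X. H (X + a *\<^sub>R Y, Y) \<partial>leb d \<partial>leb d)"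
    by (rule leb_pair.Fubini') measurable
  also have "\<dots> = (\<integral>\<^sup>+Y. \<integral>\<^sup>+X. H (X, Y) \<partial>leb d \<partial>leb d)"
  proof (intro nn_integral_cong_AE, use AE_leb_Rn[of d] in eventually_elim)
    fix Y assume "Y \<in> Rn d"
    then show "(\<integral>\<^sup>+X. H (X + a *\<^sub>R Y, Y) \<partial>leb d) = (\<integral>\<^sup>+X. H (X, Y) \<partial>leb d)"
      by (intro nn_integral_leb_translate[where H = "\<lambda>X. H (X, Y)"]) auto
  qed
  also have "\<dots> = (\<integral>\<^sup>+X. \<integral>\<^sup>+Y. H (X, Y) \<partial>leb d \<partial>leb d)"
    by (rule leb_pair.Fubini'[symmetric]) measurable
  finally show ?thesis .
qed

lemma nn_integral_leb_pair_shear2: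
  assumes [measurable]: "H \<in> borel_measurable (borel \<Otimes>\<^sub>M borel)"
  shows "(\<integral>\<^sup>+X. \<integral>\<^sup>+Y. H (X, Y + b *\<^sub>R X) \<partial>leb d \<partial>leb d) = (\<integral>\<^sup>+X. \<integral>\<^sup>+Y. H (X, Y) \<partial>leb d \<partial>leb d)"
proof (intro nn_integral_cong_AE, use AE_leb_Rn[of d] in eventually_elim)
  fix X assume "X \<in> Rn d"
  then have "b *\<^sub>R X \<in> Rn d" by auto
  then show "(\<integral>\<^sup>+Y. H (X, Y + b *\<^sub>R X) \<partial>leb d) = (\<integral>\<^sup>+Y. H (X, Y) \<partial>leb d)"
    by (rule nn_integral_leb_translate[where H = "\<lambda>Y. H (X, Y)", rotated]) measurable
qed

text \<open>A rotation by an angle other than \<open>\<pi>\<close> is a product of three shears.\<close>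

lemma nn_integral_leb_pair_rotate:
  assumes [measurable]: "H \<in> borel_measurable (borel \<Otimes>\<^sub>M borel)"
    and cs: "c\<^sup>2 + s\<^sup>2 = 1" "s \<noteq> 0 \<or> c = 1"
  shows "(\<integral>\<^sup>+X. \<integral>\<^sup>+Y. H (c *\<^sub>R X + s *\<^sub>R Y, c *\<^sub>R Y - s *\<^sub>R X) \<partial>leb d \<partial>leb d)
    = (\<integral>\<^sup>+X. \<integral>\<^sup>+Y. H (X, Y) \<partial>leb d \<partial>leb d)"
proof (cases "s = 0")
  case False
  \<comment> \<open>For angle \<theta> this is tan(\<theta>/2): shear the first vector by
    \<open>a\<close>, the second by \<open>- s\<close>, and the first by \<open>a\<close>
    again.\<close>
  define a where "a = (1 - c) / s"
  have a1: "1 + a * - s = c" using False by (simp add: a_def)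
  have "a * (1 + c) = (1 - c\<^sup>2) / s" by (simp add: a_def power2_eq_square algebra_simps)
  also have "1 - c\<^sup>2 = s * s" using cs(1) by (simp add: power2_eq_square)
  finally have a2: "a * (1 + c) = s" using False by simp
  have eq1: "c *\<^sub>R X + s *\<^sub>R Y = (X + a *\<^sub>R Y) + a *\<^sub>R (Y + (- s) *\<^sub>R (X + a *\<^sub>R Y))" for X Y :: fseq
  proof -
    have "(X + a *\<^sub>R Y) + a *\<^sub>R (Y + (- s) *\<^sub>R (X + a *\<^sub>R Y)) = (1 + a * - s) *\<^sub>R X + (a * (1 + (1 + a * - s))) *\<^sub>R Y"
      by (intro fseq_eqI) (simp add: algebra_simps)
    then show ?thesis unfolding a1 a2 by simp
  qed
  have eq2: "c *\<^sub>R Y - s *\<^sub>R X = Y + (- s) *\<^sub>R (X + a *\<^sub>R Y)" for X Y :: fseq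
  proof -
    have "Y + (- s) *\<^sub>R (X + a *\<^sub>R Y) = (1 + a * - s) *\<^sub>R Y - s *\<^sub>R X"
      by (simp add: algebra_simps)
    then show ?thesis unfolding a1 by simp
  qed
  let ?H1 = "\<lambda>Z. H (fst Z + a *\<^sub>R snd Z, snd Z)"
  let ?H2 = "\<lambda>Z. ?H1 (fst Z, snd Z + (- s) *\<^sub>R fst Z)"
  have "(\<integral>\<^sup>+X. \<integral>\<^sup>+Y. H (c *\<^sub>R X + s *\<^sub>R Y, c *\<^sub>R Y - s *\<^sub>R X) \<partial>leb d \<partial>leb d)
      = (\<integral>\<^sup>+X. \<integral>\<^sup>+Y. ?H2 (X + a *\<^sub>R Y, Y) \<partial>leb d \<partial>leb d)"
    unfolding eq1 eq2 by simp
  also have "\<dots> = (\<integral>\<^sup>+X. \<integral>\<^sup>+Y. ?H2 (X, Y) \<partial>leb d \<partial>leb d)"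
    by (rule nn_integral_leb_pair_shear1) measurable
  also have "\<dots> = (\<integral>\<^sup>+X. \<integral>\<^sup>+Y. ?H1 (X, Y + (- s) *\<^sub>R X) \<partial>leb d \<partial>leb d)" by simp
  also have "\<dots> = (\<integral>\<^sup>+X. \<integral>\<^sup>+Y. ?H1 (X, Y) \<partial>leb d \<partial>leb d)"
    by (rule nn_integral_leb_pair_shear2) measurable
  also have "\<dots> = (\<integral>\<^sup>+X. \<integral>\<^sup>+Y. H (X + a *\<^sub>R Y, Y) \<partial>leb d \<partial>leb d)" by simp
  also have "\<dots> = (\<integral>\<^sup>+X. \<integral>\<^sup>+Y. H (X, Y) \<partial>leb d \<partial>leb d)"
    by (rule nn_integral_leb_pair_shear1) measurable
  finally show ?thesis .
qed (use cs in auto)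

subsection \<open>A Poincare inequality on the sphere\<close>

text \<open>The weight \<open>gram\<close> is invariant under rotations of the pair and tames the singularity of \<open>sgn\<close> at 0.\<close>

definition gram :: "fseq \<times> fseq \<Rightarrow> real" where
  "gram Z = (norm (fst Z))\<^sup>2 * (norm (snd Z))\<^sup>2 - (inner (fst Z) (snd Z))\<^sup>2"

text \<open>The shell of squared radius between 1/2 and 1 in dimension \<open>2 * d\<close>. It is
  invariant under \<open>rot\<close>; the upper bound makes all masses finite, and the lower bound
  keeps \<open>norm X\<close> and \<open>norm Y\<close> from being small simultaneously.\<close>

definition annulus :: "fseq \<times> fseq \<Rightarrow> ennreal" where
  "annulus Z = indicator {1/2..1} ((norm (fst Z))\<^sup>2 + (norm (snd Z))\<^sup>2)"

text \<open>The rotation mixes the two vectors with each other; it does not rotate either one inside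
  the space.\<close>

definition rot :: "real \<Rightarrow> real \<Rightarrow> fseq \<times> fseq \<Rightarrow> fseq \<times> fseq" where
  "rot c s Z = (c *\<^sub>R fst Z + s *\<^sub>R snd Z, c *\<^sub>R snd Z - s *\<^sub>R fst Z)"

lemma measurable_gram [measurable]: "gram \<in> borel_measurable (borel \<Otimes>\<^sub>M borel)"
  unfolding gram_def by measurable

lemma measurable_annulus [measurable]: "annulus \<in> borel_measurable (borel \<Otimes>\<^sub>M borel)"
  unfolding annulus_def by measurable

lemma measurable_rot [measurable]: "rot c s \<in> measurable (borel \<Otimes>\<^sub>M borel) (borel \<Otimes>\<^sub>M borel)"
  unfolding rot_def by measurable

lemma gram_nonneg: "0 \<le> gram Z"
  using Cauchy_Schwarz_ineq[of "fst Z" "snd Z"] by (simp add: gram_def power2_norm_eq_inner)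

lemma norm_rot:
  assumes "c\<^sup>2 + s\<^sup>2 = 1"
  shows "(norm (fst (rot c s Z)))\<^sup>2 + (norm (snd (rot c s Z)))\<^sup>2 = (norm (fst Z))\<^sup>2 + (norm (snd Z))\<^sup>2"
proof -
  obtain X Y where Z: "Z = (X, Y)" by (cases Z)
  have "(norm (fst (rot c s Z)))\<^sup>2 + (norm (snd (rot c s Z)))\<^sup>2 = (c\<^sup>2 + s\<^sup>2) * (inner X X + inner Y Y)"
    unfolding power2_norm_eq_inner
    by (simp add: Z rot_def inner_add_left inner_add_right inner_diff_left inner_diff_right
        power2_eq_square algebra_simps inner_commute[of Y X])
  then show ?thesis using assms by (simp add: Z power2_norm_eq_inner)
qed

text \<open>\<open>gram\<close> is the Gram determinant, the squared area of the parallelogram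
  spanned by the pair. A linear substitution multiplies it by the squared determinant, here
  1.\<close>

lemma gram_rot:
  assumes "c\<^sup>2 + s\<^sup>2 = 1"
  shows "gram (rot c s Z) = gram Z"
proof -
  obtain X Y where Z: "Z = (X, Y)" by (cases Z)
  define a b p where "a = inner X X" and "b = inner Y Y" and "p = inner X Y"
  have "gram (rot c s Z) = (c\<^sup>2 * a + 2 * c * s * p + s\<^sup>2 * b) * (c\<^sup>2 * b - 2 * c * s * p + s\<^sup>2 * a)
      - (c\<^sup>2 * p - s\<^sup>2 * p + c * s * b - c * s * a)\<^sup>2"
    unfolding gram_def power2_norm_eq_inner
    by (simp add: Z rot_def inner_add_left inner_add_right inner_diff_left inner_diff_right
        power2_eq_square algebra_simps inner_commute[of Y X] a_def b_def p_def)
  also have "\<dots> = (c\<^sup>2 + s\<^sup>2)\<^sup>2 * (a * b - p\<^sup>2)"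
    by (simp add: power2_eq_square algebra_simps)
  finally show ?thesis
    using assms by (simp add: Z gram_def power2_norm_eq_inner a_def b_def p_def)
qed

lemma annulus_rot: "c\<^sup>2 + s\<^sup>2 = 1 \<Longrightarrow> annulus (rot c s Z) = annulus Z"
  unfolding annulus_def by (simp only: norm_rot)

lemma annulus_bound:
  assumes "annulus (X, Y) \<noteq> 0"
  shows "norm X \<le> 1" "norm Y \<le> 1" "(norm X)\<^sup>2 + (norm Y)\<^sup>2 \<le> 1" "1/2 \<le> (norm X)\<^sup>2 + (norm Y)\<^sup>2"
proof -
  show 1: "(norm X)\<^sup>2 + (norm Y)\<^sup>2 \<le> 1" and "1/2 \<le> (norm X)\<^sup>2 + (norm Y)\<^sup>2"
    using assms by (auto simp: annulus_def indicator_def split: if_splits)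
  have "(norm X)\<^sup>2 \<le> 1" "(norm Y)\<^sup>2 \<le> 1"
    using 1 zero_le_power2[of "norm X"] zero_le_power2[of "norm Y"] by linarith+
  then show "norm X \<le> 1" "norm Y \<le> 1" by (simp_all add: power_le_one_iff abs_square_le_1)
qed

lemma annulus_le_1: "annulus Z \<le> 1"
  by (simp add: annulus_def indicator_def)

text \<open>The measure is left unnormalised; its total mass
  \<open>pair_integral d (\<lambda>_. 1)\<close> appears on both sides of the estimates and cancels
  at the end.\<close>

definition pair_integral :: "nat \<Rightarrow> (fseq \<times> fseq \<Rightarrow> ennreal) \<Rightarrow> ennreal" where
  "pair_integral d H = (\<integral>\<^sup>+X. \<integral>\<^sup>+Y. annulus (X, Y) * H (X, Y) \<partial>leb d \<partial>leb d)"

lemma pair_integral_rot: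
  assumes [measurable]: "H \<in> borel_measurable (borel \<Otimes>\<^sub>M borel)"
    and cs: "c\<^sup>2 + s\<^sup>2 = 1" "s \<noteq> 0 \<or> c = 1"
  shows "pair_integral d (\<lambda>Z. H (rot c s Z)) = pair_integral d H"
proof -
  have "pair_integral d (\<lambda>Z. H (rot c s Z))
      = (\<integral>\<^sup>+X. \<integral>\<^sup>+Y. annulus (rot c s (X, Y)) * H (rot c s (X, Y)) \<partial>leb d \<partial>leb d)"
    unfolding pair_integral_def by (simp only: annulus_rot[OF cs(1)])
  also have "\<dots> = pair_integral d H"
    unfolding pair_integral_def
    using nn_integral_leb_pair_rotate[OF _ cs, of "\<lambda>Z. annulus Z * H Z" d] by (simp add: rot_def)
  finally show ?thesis .
qed

lemma pair_integral_add:
  assumes [measurable]: "H \<in> borel_measurable (borel \<Otimes>\<^sub>M borel)" "H' \<in> borel_measurable (borel \<Otimes>\<^sub>M borel)"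
  shows "pair_integral d (\<lambda>Z. H Z + H' Z) = pair_integral d H + pair_integral d H'"
proof -
  have "pair_integral d (\<lambda>Z. H Z + H' Z)
      = (\<integral>\<^sup>+X. (\<integral>\<^sup>+Y. annulus (X, Y) * H (X, Y) \<partial>leb d) + (\<integral>\<^sup>+Y. annulus (X, Y) * H' (X, Y) \<partial>leb d) \<partial>leb d)"
    unfolding pair_integral_def distrib_left
    by (intro nn_integral_cong nn_integral_add) measurable
  also have "\<dots> = pair_integral d H + pair_integral d H'"
    unfolding pair_integral_def by (intro nn_integral_add) measurable
  finally show ?thesis .
qed

lemma pair_integral_cmult:
  assumes [measurable]: "H \<in> borel_measurable (borel \<Otimes>\<^sub>M borel)"
  shows "pair_integral d (\<lambda>Z. a * H Z) = a * pair_integral d H"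
proof -
  have "pair_integral d (\<lambda>Z. a * H Z) = (\<integral>\<^sup>+X. a * (\<integral>\<^sup>+Y. annulus (X, Y) * H (X, Y) \<partial>leb d) \<partial>leb d)"
    unfolding pair_integral_def mult.left_commute[of _ a]
    by (rule nn_integral_cong, rule nn_integral_cmult) measurable
  also have "\<dots> = a * pair_integral d H"
    unfolding pair_integral_def by (rule nn_integral_cmult) measurable
  finally show ?thesis .
qed

lemma pair_integral_sum:
  assumes [measurable]: "\<And>j. H j \<in> borel_measurable (borel \<Otimes>\<^sub>M borel)"
  shows "pair_integral d (\<lambda>Z. \<Sum>j<(n::nat). H j Z) = (\<Sum>j<n. pair_integral d (H j))"
proof (induction n)
  case (Suc n)
  then show ?case by (simp add: pair_integral_add)
qed (simp add: pair_integral_def)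

lemma pair_integral_mono:
  assumes "\<And>X Y. annulus (X, Y) \<noteq> 0 \<Longrightarrow> X \<in> Rn d \<Longrightarrow> Y \<in> Rn d \<Longrightarrow> X \<noteq> 0 \<Longrightarrow> H (X, Y) \<le> H' (X, Y)" and d: "0 < d"
  shows "pair_integral d H \<le> pair_integral d H'"
  unfolding pair_integral_def
proof (rule nn_integral_mono_AE, use AE_leb_Rn[of d] AE_leb_nonzero[OF d] in eventually_elim)
  fix X assume X: "X \<in> Rn d" "X \<noteq> 0"
  show "(\<integral>\<^sup>+Y. annulus (X, Y) * H (X, Y) \<partial>leb d) \<le> (\<integral>\<^sup>+Y. annulus (X, Y) * H' (X, Y) \<partial>leb d)"
  proof (rule nn_integral_mono_AE, use AE_leb_Rn[of d] in eventually_elim)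
    fix Y assume "Y \<in> Rn d"
    then show "annulus (X, Y) * H (X, Y) \<le> annulus (X, Y) * H' (X, Y)"
      using assms(1)[of X Y] X by (cases "annulus (X, Y) = 0") (auto intro: mult_left_mono)
  qed
qed

lemma emeasure_leb_cball: "0 < r \<Longrightarrow> emeasure (leb d) (cball 0 r) = ennreal (r ^ d) * ball_vol d"
proof -
  assume r: "0 < r"
  have "(\<integral>\<^sup>+u. indicator (cball 0 r) u \<partial>leb d) = ennreal (\<bar>r\<bar> ^ d) * (\<integral>\<^sup>+u. indicator (cball 0 r) (r *\<^sub>R u) \<partial>leb d)"
    by (rule nn_integral_leb_scale) (use r in auto)
  moreover have "indicator (cball 0 r) (r *\<^sub>R u) = (indicator (cball 0 1) u :: ennreal)" for u :: fseq
    using r by (auto simp: indicator_def)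
  ultimately show ?thesis using r by (simp add: ball_vol_def)
qed

lemma pair_integral_1_pos: "0 < d \<Longrightarrow> 0 < pair_integral d (\<lambda>_. 1)"
proof -
  assume d: "0 < d"
  \<comment> \<open>The product of this shell with the ball of radius 1/2 lies in the annulus, as
    \<open>9/16 \<ge> 1/2\<close> and \<open>16/25 + 1/4 \<le> 1\<close>.\<close>
  define A where "A = {u :: fseq. 3/4 < norm u \<and> norm u \<le> 4/5}"
  have [measurable]: "A \<in> sets borel" unfolding A_def by measurable
  have A: "0 < emeasure (leb d) A"
  proof (rule ccontr)
    assume "\<not> 0 < emeasure (leb d) A"
    then have 0: "emeasure (leb d) A = 0" by simp
    have "emeasure (leb d) (cball 0 (4/5)) \<le> emeasure (leb d) (cball 0 (3/4) \<union> A)"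
      by (rule emeasure_mono) (auto simp: A_def)
    also have "\<dots> \<le> emeasure (leb d) (cball 0 (3/4)) + emeasure (leb d) A"
      by (rule emeasure_subadditive) auto
    finally have "ennreal ((4/5) ^ d) * ball_vol d \<le> ennreal ((3/4) ^ d) * ball_vol d"
      by (simp add: emeasure_leb_cball 0)
    then have "ennreal ((4/5) ^ d) \<le> ennreal ((3/4) ^ d)"
      by (metis ball_vol(1,3) ennreal_mult_le_mult_iff mult.commute)
    moreover have "(3/4 :: real) ^ d < (4/5) ^ d" using d by (intro power_strict_mono) auto
    ultimately show False by simp
  qed
  have "0 < emeasure (leb d) (cball 0 (1/2)) * emeasure (leb d) A"
    using A emeasure_leb_cball_pos[of "1/2" d] by (simp add: ennreal_zero_less_mult_iff)
  also have "\<dots> = (\<integral>\<^sup>+X. \<integral>\<^sup>+Y. indicator A X * indicator (cball 0 (1/2)) Y \<partial>leb d \<partial>leb d)"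
    by (simp add: nn_integral_cmult nn_integral_multc mult.commute)
  also have "\<dots> \<le> pair_integral d (\<lambda>_. 1)"
    unfolding pair_integral_def
  proof (rule nn_integral_mono, rule nn_integral_mono)
    fix X Y :: fseq
    have "(norm X)\<^sup>2 + (norm Y)\<^sup>2 \<in> {1/2..1}" if "X \<in> A" "Y \<in> cball 0 (1/2)"
    proof -
      have *: "(3/4)\<^sup>2 \<le> (norm X)\<^sup>2" "(norm X)\<^sup>2 \<le> (4/5)\<^sup>2" "(norm Y)\<^sup>2 \<le> (1/2)\<^sup>2"
        using that by (auto simp: A_def intro!: power_mono)
      have sq: "(3/4 :: real)\<^sup>2 = 9/16" "(4/5 :: real)\<^sup>2 = 16/25" "(1/2 :: real)\<^sup>2 = 1/4"
        by (simp_all add: power_divide)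
      show ?thesis
        using * zero_le_power2[of "norm Y"] unfolding sq atLeastAtMost_iff by linarith
    qed
    then show "indicator A X * indicator (cball 0 (1/2)) Y \<le> annulus (X, Y) * (1 :: ennreal)"
      by (auto simp: annulus_def indicator_def)
  qed
  finally show ?thesis .
qed

lemma pair_integral_le:
  assumes "\<And>X Y. annulus (X, Y) \<noteq> 0 \<Longrightarrow> H (X, Y) \<le> ennreal c * indicator A X" and [measurable]: "A \<in> sets borel"
  shows "pair_integral d H \<le> ennreal c * emeasure (leb d) A * ball_vol d"
proof -
  have "pair_integral d H \<le> (\<integral>\<^sup>+X. \<integral>\<^sup>+Y. (ennreal c * indicator A X) * indicator (cball 0 1) Y \<partial>leb d \<partial>leb d)"
    unfolding pair_integral_def
  proof (rule nn_integral_mono, rule nn_integral_mono)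
    fix X Y :: fseq
    show "annulus (X, Y) * H (X, Y) \<le> ennreal c * indicator A X * indicator (cball 0 1) Y"
    proof (cases "annulus (X, Y) = 0")
      case False
      then have "Y \<in> cball 0 1" using annulus_bound(2) by auto
      moreover have "annulus (X, Y) * H (X, Y) \<le> 1 * (ennreal c * indicator A X)"
        using assms(1)[OF False] annulus_le_1 by (intro mult_mono) auto
      ultimately show ?thesis by simp
    qed simp
  qed
  also have "\<dots> = ennreal c * emeasure (leb d) A * ball_vol d"
    by (simp add: nn_integral_cmult nn_integral_multc ball_vol_def)
  finally show ?thesis .
qed

lemma pair_integral_1_finite: "pair_integral d (\<lambda>_. 1) < \<infinity>"
proof -
  have "pair_integral d (\<lambda>_. 1) \<le> ennreal 1 * emeasure (leb d) (cball 0 1) * ball_vol d"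
    by (rule pair_integral_le) (use annulus_bound(1) in auto)
  also have "\<dots> < \<infinity>" by (simp add: ball_vol_def[symmetric] ennreal_mult_less_top)
  finally show ?thesis .
qed

text \<open>The weight is a function of \<open>\<bar>Y\<bar>\<close> for fixed \<open>X\<close>, so \<open>Y\<close> is isotropic.\<close>

lemma annulus_isotropic:
  assumes p: "p \<in> Rn d"
  shows "ennreal (real d) * (\<integral>\<^sup>+Y. annulus (X, Y) * ennreal ((inner p Y)\<^sup>2) \<partial>leb d)
    = ennreal ((norm p)\<^sup>2) * (\<integral>\<^sup>+Y. annulus (X, Y) * ennreal ((norm Y)\<^sup>2) \<partial>leb d)"
  using nn_integral_leb_isotropic[OF _ p, of "\<lambda>\<rho>. indicator {1/2..1} ((norm X)\<^sup>2 + \<rho>\<^sup>2)"]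
  by (simp add: annulus_def mult.commute)

lemma ennreal_mult_3_le: "3 \<le> d \<Longrightarrow> 3 * x \<le> ennreal (real d) * x"
  by (intro mult_right_mono) (auto simp: ennreal_le_iff[symmetric] simp del: ennreal_le_iff ennreal_numeral
      intro: order_trans[of _ "ennreal 3"])

text \<open>Rotating by 45 degrees turns the product of the squared norms into
  \<open>t\<^sup>2 - (inner X Y)\<^sup>2\<close>, where \<open>t\<close> is half the squared radius
  and at least 1/4. With \<open>A\<close> and \<open>Q\<close> the integrals of the two products,
  this gives \<open>A + Q\<close> at least 1/16 of the mass. Isotropy gives
  \<open>Q = A / d\<close>, at most \<open>A / 3\<close>.\<close>

lemma pair_integral_norms:
  assumes d: "3 \<le> d"
  shows "3 * pair_integral d (\<lambda>_. 1) \<le> 64 * pair_integral d (\<lambda>Z. ennreal ((norm (fst Z))\<^sup>2 * (norm (snd Z))\<^sup>2))"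
proof -
  define A where "A = pair_integral d (\<lambda>Z. ennreal ((norm (fst Z))\<^sup>2 * (norm (snd Z))\<^sup>2))"
  define Q where "Q = pair_integral d (\<lambda>Z. ennreal ((inner (fst Z) (snd Z))\<^sup>2))"
  have "ennreal (real d) * Q = (\<integral>\<^sup>+X. ennreal (real d) * (\<integral>\<^sup>+Y. annulus (X, Y) * ennreal ((inner X Y)\<^sup>2) \<partial>leb d) \<partial>leb d)"
    unfolding Q_def pair_integral_def by (simp add: nn_integral_cmult)
  also have "\<dots> = (\<integral>\<^sup>+X. ennreal ((norm X)\<^sup>2) * (\<integral>\<^sup>+Y. annulus (X, Y) * ennreal ((norm Y)\<^sup>2) \<partial>leb d) \<partial>leb d)"
    by (rule nn_integral_cong_AE, use AE_leb_Rn[of d] in eventually_elim) (rule annulus_isotropic)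
  also have "\<dots> = A"
    unfolding A_def pair_integral_def
    by (simp add: nn_integral_cmult[symmetric] ennreal_mult mult_ac)
  finally have Q: "ennreal (real d) * Q = A" .
  have Q3: "3 * Q \<le> A" using ennreal_mult_3_le[OF d, of Q] Q by simp
  define c :: real where "c = 1 / sqrt 2"
  have c: "c\<^sup>2 + c\<^sup>2 = 1" "c * c = 1 / 2" "c \<noteq> 0" by (simp_all add: c_def power_divide)
  have "A = pair_integral d (\<lambda>Z. ennreal ((norm (fst (rot c c Z)))\<^sup>2 * (norm (snd (rot c c Z)))\<^sup>2))"
    unfolding A_def
    by (rule pair_integral_rot[symmetric, where H = "\<lambda>Z. ennreal ((norm (fst Z))\<^sup>2 * (norm (snd Z))\<^sup>2)"])
      (use c in auto)
  then have "A + Q = pair_integral d (\<lambda>Z. ennreal ((norm (fst (rot c c Z)))\<^sup>2 * (norm (snd (rot c c Z)))\<^sup>2)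
      + ennreal ((inner (fst Z) (snd Z))\<^sup>2))"
    unfolding Q_def by (subst pair_integral_add) auto
  also have "\<dots> \<ge> pair_integral d (\<lambda>Z. ennreal (1/16) * 1)"
  proof (rule pair_integral_mono)
    fix X Y assume "annulus (X, Y) \<noteq> 0"
    from annulus_bound(4)[OF this] have r: "1/2 \<le> (norm X)\<^sup>2 + (norm Y)\<^sup>2" .
    have e1: "(norm (c *\<^sub>R X + c *\<^sub>R Y))\<^sup>2 = ((norm X)\<^sup>2 + (norm Y)\<^sup>2) / 2 + inner X Y"
    proof -
      have "(norm (c *\<^sub>R X + c *\<^sub>R Y))\<^sup>2 = (c * c) * (inner X X + inner Y Y + 2 * inner X Y)"
        unfolding power2_norm_eq_inner
        by (simp add: inner_add_left inner_add_right algebra_simps inner_commute[of Y X])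
      then show ?thesis unfolding c(2) power2_norm_eq_inner by argo
    qed
    have e2: "(norm (c *\<^sub>R Y - c *\<^sub>R X))\<^sup>2 = ((norm X)\<^sup>2 + (norm Y)\<^sup>2) / 2 - inner X Y"
    proof -
      have "(norm (c *\<^sub>R Y - c *\<^sub>R X))\<^sup>2 = (c * c) * (inner X X + inner Y Y - 2 * inner X Y)"
        unfolding power2_norm_eq_inner
        by (simp add: inner_diff_left inner_diff_right algebra_simps inner_commute[of Y X])
      then show ?thesis unfolding c(2) power2_norm_eq_inner by argo
    qed
    define t where "t = ((norm X)\<^sup>2 + (norm Y)\<^sup>2) / 2"
    have "(1/4) * (1/4) \<le> t * t" using r by (intro mult_mono) (auto simp: t_def)
    then have "1/16 \<le> (norm (c *\<^sub>R X + c *\<^sub>R Y))\<^sup>2 * (norm (c *\<^sub>R Y - c *\<^sub>R X))\<^sup>2 + (inner X Y)\<^sup>2"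
      unfolding e1 e2 t_def[symmetric] by (simp add: power2_eq_square algebra_simps)
    then have "ennreal (1/16) \<le> ennreal ((norm (c *\<^sub>R X + c *\<^sub>R Y))\<^sup>2 * (norm (c *\<^sub>R Y - c *\<^sub>R X))\<^sup>2 + (inner X Y)\<^sup>2)"
      by (rule ennreal_leI)
    also have "\<dots> = ennreal ((norm (c *\<^sub>R X + c *\<^sub>R Y))\<^sup>2 * (norm (c *\<^sub>R Y - c *\<^sub>R X))\<^sup>2) + ennreal ((inner X Y)\<^sup>2)"
      by (rule ennreal_plus) auto
    finally show "ennreal (1/16) * 1 \<le> ennreal ((norm (fst (rot c c (X, Y))))\<^sup>2 * (norm (snd (rot c c (X, Y))))\<^sup>2)
        + ennreal ((inner (fst (X, Y)) (snd (X, Y)))\<^sup>2)"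
      by (simp add: rot_def)
  qed (use d in auto)
  also have "pair_integral d (\<lambda>Z. ennreal (1/16) * 1) = ennreal (1/16) * pair_integral d (\<lambda>_. 1)"
    by (rule pair_integral_cmult) simp
  finally have *: "ennreal (1/16) * pair_integral d (\<lambda>_. 1) \<le> A + Q" .
  have "3 * pair_integral d (\<lambda>_. 1) = 48 * (ennreal (1/16) * pair_integral d (\<lambda>_. 1))"
    by (simp add: mult.assoc[symmetric] ennreal_mult[symmetric] flip: ennreal_numeral)
  also have "\<dots> \<le> 48 * (A + Q)" by (intro mult_left_mono *) simp
  also have "\<dots> = 48 * A + 16 * (3 * Q)" by (simp add: distrib_left mult.assoc[symmetric])
  also have "\<dots> \<le> 48 * A + 16 * A" by (intro add_mono mult_left_mono Q3) auto
  also have "\<dots> = 64 * A" by (simp add: distrib_right[symmetric])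
  finally show ?thesis unfolding A_def .
qed

text \<open>For fixed \<open>X\<close> the Gram determinant is \<open>(norm X)\<^sup>2\<close> times
  the squared norm of the part of \<open>Y\<close> orthogonal to \<open>X\<close>. By isotropy this
  part carries at least 2/3 of the integral of \<open>(norm Y)\<^sup>2\<close>. What remains depends
  on \<open>norm X\<close> alone, so the direction of \<open>X\<close> splits off as uniform. The
  constant 32 is \<open>64/3 * 3/2\<close>.\<close>

lemma pair_integral_direction_lower:
  assumes d: "3 \<le> d" and Q [measurable]: "Q \<in> borel_measurable borel"
  shows "pair_integral d (\<lambda>_. 1) * (\<integral>\<^sup>+z. Q z \<partial>uniform_sphere d)
    \<le> 32 * pair_integral d (\<lambda>Z. ennreal (gram Z) * Q (sgn (fst Z)))"
proof -
  have d0: "0 < d" using d by simp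
  define B where "B X = (\<integral>\<^sup>+Y. annulus (X, Y) * ennreal ((norm Y)\<^sup>2) \<partial>leb d)" for X
  define P where "P X = (\<integral>\<^sup>+Y. annulus (X, Y) * ennreal (gram (sgn X, Y)) \<partial>leb d)" for X
  define E where "E = (\<integral>\<^sup>+z. Q z \<partial>uniform_sphere d)"
  define b where "b r = ennreal (r\<^sup>2) * (\<integral>\<^sup>+Y. indicator {1/2..1} (r\<^sup>2 + (norm Y)\<^sup>2) * ennreal ((norm Y)\<^sup>2) \<partial>leb d)" for r :: real
  have b [measurable]: "b \<in> borel_measurable borel" unfolding b_def by measurable
  have bB: "b (norm X) = ennreal ((norm X)\<^sup>2) * B X" for X by (simp add: b_def B_def annulus_def)
  have finB: "B X < \<infinity>" for X
  proof -
    have "B X \<le> (\<integral>\<^sup>+Y. indicator (cball 0 1) Y \<partial>leb d)"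
      unfolding B_def
    proof (rule nn_integral_mono)
      fix Y
      show "annulus (X, Y) * ennreal ((norm Y)\<^sup>2) \<le> indicator (cball 0 1) Y"
      proof (cases "annulus (X, Y) = 0")
        case False
        then have Y: "norm Y \<le> 1" using annulus_bound(2) by auto
        then have "(norm Y)\<^sup>2 \<le> 1" by (simp add: power_le_one)
        then have "annulus (X, Y) * ennreal ((norm Y)\<^sup>2) \<le> 1 * ennreal 1"
          by (intro mult_mono annulus_le_1 ennreal_leI) auto
        then show ?thesis using Y by simp
      qed simp
    qed
    also have "\<dots> < \<infinity>" using emeasure_leb_cball_finite[of d 1] by simp
    finally show ?thesis .
  qed
  have PB: "2 * B X \<le> 3 * P X" if X: "X \<in> Rn d" "X \<noteq> 0" for X
  proof -
    define R where "R = (\<integral>\<^sup>+Y. annulus (X, Y) * ennreal ((inner (sgn X) Y)\<^sup>2) \<partial>leb d)"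
    have "sgn X \<in> Rn d" using X by auto
    from annulus_isotropic[OF this, of X] have "ennreal (real d) * R = B X"
      using X by (simp add: norm_sgn B_def R_def)
    with ennreal_mult_3_le[OF d, of R] have R: "3 * R \<le> B X" by simp
    have "P X + R = (\<integral>\<^sup>+Y. annulus (X, Y) * (ennreal (gram (sgn X, Y)) + ennreal ((inner (sgn X) Y)\<^sup>2)) \<partial>leb d)"
      unfolding P_def R_def distrib_left by (rule nn_integral_add[symmetric]) measurable
    also have "\<dots> = B X"
      unfolding B_def
    proof (intro nn_integral_cong arg_cong2[where f = "(*)"] refl)
      fix Y
      have g: "gram (sgn X, Y) = (norm Y)\<^sup>2 - (inner (sgn X) Y)\<^sup>2"
        using X by (simp add: gram_def norm_sgn)
      have "ennreal (gram (sgn X, Y)) + ennreal ((inner (sgn X) Y)\<^sup>2) = ennreal (gram (sgn X, Y) + (inner (sgn X) Y)\<^sup>2)"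
        by (rule ennreal_plus[symmetric]) (auto simp: gram_nonneg)
      then show "ennreal (gram (sgn X, Y)) + ennreal ((inner (sgn X) Y)\<^sup>2) = ennreal ((norm Y)\<^sup>2)"
        by (simp add: g)
    qed
    finally have PR: "P X + R = B X" .
    \<comment> \<open>Finiteness allows \<open>P X + R = B X\<close> to be read in the reals, where
      \<open>R\<close> can be subtracted.\<close>
    have fin: "B X \<noteq> top" using finB[of X] by simp
    then have "P X \<noteq> top" "R \<noteq> top" using PR by auto
    then obtain p r where pr: "P X = ennreal p" "0 \<le> p" "R = ennreal r" "0 \<le> r"
      by (metis ennreal_cases)
    have B: "B X = ennreal (p + r)" using PR pr by simp
    have "ennreal (3 * r) \<le> ennreal (p + r)"
      using R pr B by (simp add: ennreal_mult)
    then have "3 * r \<le> p + r" using pr by (subst (asm) ennreal_le_iff) auto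
    then have "ennreal (2 * (p + r)) \<le> ennreal (3 * p)" by (intro ennreal_leI) argo
    then show ?thesis using pr B by (simp add: ennreal_mult)
  qed
  have "(\<integral>\<^sup>+X. b (norm X) \<partial>leb d) * E = (\<integral>\<^sup>+X. b (norm X) * Q (sgn X) \<partial>leb d)"
    unfolding E_def by (rule nn_integral_leb_radial_times_direction[symmetric]) (use d in auto)
  then have "2 * ((\<integral>\<^sup>+X. b (norm X) \<partial>leb d) * E) = (\<integral>\<^sup>+X. 2 * (b (norm X) * Q (sgn X)) \<partial>leb d)"
    by (simp add: nn_integral_cmult)
  also have "\<dots> \<le> (\<integral>\<^sup>+X. 3 * (ennreal ((norm X)\<^sup>2) * P X * Q (sgn X)) \<partial>leb d)"
  proof (rule nn_integral_mono_AE, use AE_leb_Rn[of d] AE_leb_nonzero[OF d0] in eventually_elim)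
    fix X assume "X \<in> Rn d" "X \<noteq> 0"
    then have "2 * B X \<le> 3 * P X" by (rule PB)
    then have "(2 * B X) * (ennreal ((norm X)\<^sup>2) * Q (sgn X)) \<le> (3 * P X) * (ennreal ((norm X)\<^sup>2) * Q (sgn X))"
      by (rule mult_right_mono) simp
    then show "2 * (b (norm X) * Q (sgn X)) \<le> 3 * (ennreal ((norm X)\<^sup>2) * P X * Q (sgn X))"
      unfolding bB by (simp add: mult_ac)
  qed
  also have "\<dots> = 3 * pair_integral d (\<lambda>Z. ennreal (gram Z) * Q (sgn (fst Z)))"
  proof -
    have [measurable]: "P \<in> borel_measurable borel" unfolding P_def by measurable
    have "ennreal ((norm X)\<^sup>2) * P X * Q (sgn X) = (\<integral>\<^sup>+Y. annulus (X, Y) * (ennreal (gram (X, Y)) * Q (sgn X)) \<partial>leb d)" for X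
    proof -
      have "gram (X, Y) = (norm X)\<^sup>2 * gram (sgn X, Y)" for Y
        by (cases "X = 0") (auto simp: gram_def sgn_fseq_def power_mult_distrib algebra_simps power_divide field_simps)
      then have "annulus (X, Y) * (ennreal (gram (X, Y)) * Q (sgn X))
          = ennreal ((norm X)\<^sup>2) * (annulus (X, Y) * ennreal (gram (sgn X, Y))) * Q (sgn X)" for Y
        by (simp add: ennreal_mult gram_nonneg mult_ac)
      then show ?thesis
        unfolding P_def by (simp add: nn_integral_cmult nn_integral_multc)
    qed
    then show ?thesis
      unfolding pair_integral_def by (subst nn_integral_cmult) (auto)
  qed
  finally have 1: "2 * ((\<integral>\<^sup>+X. b (norm X) \<partial>leb d) * E) \<le> 3 * pair_integral d (\<lambda>Z. ennreal (gram Z) * Q (sgn (fst Z)))" .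
  have "(\<integral>\<^sup>+X. b (norm X) \<partial>leb d) = pair_integral d (\<lambda>Z. ennreal ((norm (fst Z))\<^sup>2 * (norm (snd Z))\<^sup>2))"
    unfolding bB B_def pair_integral_def
    by (simp add: nn_integral_cmult[symmetric] ennreal_mult mult_ac)
  with pair_integral_norms[OF d] have 2: "3 * pair_integral d (\<lambda>_. 1) \<le> 64 * (\<integral>\<^sup>+X. b (norm X) \<partial>leb d)" by simp
  have "3 * (pair_integral d (\<lambda>_. 1) * E) = (3 * pair_integral d (\<lambda>_. 1)) * E" by (simp add: mult_ac)
  also have "\<dots> \<le> (64 * (\<integral>\<^sup>+X. b (norm X) \<partial>leb d)) * E" by (intro mult_right_mono 2) simp
  also have "\<dots> = 32 * (2 * ((\<integral>\<^sup>+X. b (norm X) \<partial>leb d) * E))" by (simp add: mult.assoc[symmetric])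
  also have "\<dots> \<le> 32 * (3 * pair_integral d (\<lambda>Z. ennreal (gram Z) * Q (sgn (fst Z))))"
    by (intro mult_left_mono 1) simp
  also have "\<dots> = 3 * (32 * pair_integral d (\<lambda>Z. ennreal (gram Z) * Q (sgn (fst Z))))"
    by (rule mult.left_commute)
  finally show ?thesis
    unfolding E_def[symmetric] by (subst (asm) ennreal_mult_le_mult_iff) auto
qed

text \<open>\<open>sgn\<close> is Lipschitz near \<open>X\<close> with constant
  \<open>2 / norm X\<close>; multiplied out, the estimate includes zero vectors.\<close>

lemma norm_sgn_diff_le: "norm (sgn X' - sgn X) * norm X \<le> 2 * norm (X' - X)" for X X' :: fseq
proof (cases "X' = 0")
  case False
  have "norm X *\<^sub>R (sgn X' - sgn X) = (norm X - norm X') *\<^sub>R sgn X' + (X' - X)"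
    using False by (cases "X = 0") (auto simp: sgn_fseq_def algebra_simps)
  then have "norm (sgn X' - sgn X) * norm X = norm ((norm X - norm X') *\<^sub>R sgn X' + (X' - X))"
    by (metis abs_norm_cancel mult.commute norm_scaleR)
  also have "\<dots> \<le> \<bar>norm X - norm X'\<bar> * 1 + norm (X' - X)"
    by (rule norm_triangle_le) (simp add: norm_sgn False)
  also have "\<dots> \<le> 2 * norm (X' - X)"
    using norm_triangle_ineq3[of X X'] by (simp add: norm_minus_commute)
  finally show ?thesis .
qed (simp add: norm_sgn)

text \<open>The subgradient at the start bounds the drop of \<open>k\<close> along the step. Only
  its tangential part \<open>pv\<close> has a first-order effect, and since \<open>pv\<close> is
  orthogonal to \<open>X\<close> this effect is \<open>s * inner pv Y / norm X1\<close>. The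
  singular denominator is absorbed by \<open>gram\<close>, which is at most
  \<open>(norm X1)\<^sup>2\<close> by rotation invariance. The second-order error, governed by the
  squared displacement of the direction, is of order \<open>e\<close> after weighting except in a
  small ball of \<open>X\<close>; this is the indicator term.\<close>

lemma path_step_bound:
  fixes k :: "fseq \<Rightarrow> real"
  assumes X: "X \<in> Rn d" "X \<noteq> 0" and Y: "Y \<in> Rn d" and ann: "annulus (X, Y) \<noteq> 0"
    and cs: "c\<^sup>2 + s\<^sup>2 = 1" "\<bar>1 - c\<bar> \<le> e" "\<bar>s\<bar> \<le> e" and e: "0 < e"
    and v: "norm v \<le> L" and nonneg: "0 \<le> L" "0 \<le> M" "0 \<le> \<tau>"
    and sub: "\<And>z'. z' \<in> Rn d \<Longrightarrow> norm z' = 1 \<Longrightarrow>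
      k z' \<ge> k (sgn X) + inner v (z' - sgn X) - M * (norm (z' - sgn X))\<^sup>2 - \<tau>"
  defines "pv \<equiv> v - inner v (sgn X) *\<^sub>R sgn X"
  shows "gram (X, Y) * (max 0 (k (sgn X) - k (sgn (c *\<^sub>R X + s *\<^sub>R Y))))\<^sup>2
    \<le> 2 * s\<^sup>2 * (inner pv Y)\<^sup>2 + (1024 * (L + M)\<^sup>2 * e ^ 3 + 4 * \<tau>\<^sup>2)
      + 256 * (L + M)\<^sup>2 * e\<^sup>2 * indicator (cball 0 (sqrt e)) X"
proof -
  define X1 where "X1 = c *\<^sub>R X + s *\<^sub>R Y"
  define N where "N = L + M"
  have N: "0 \<le> N" "M \<le> N" using nonneg by (auto simp: N_def)
  have R: "0 \<le> 2 * s\<^sup>2 * (inner pv Y)\<^sup>2" "0 \<le> 1024 * N\<^sup>2 * e ^ 3" "0 \<le> 4 * \<tau>\<^sup>2"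
    "0 \<le> 256 * N\<^sup>2 * e\<^sup>2 * indicator (cball 0 (sqrt e)) X"
    using e by (auto simp: indicator_def)
  have g0: "0 \<le> gram (X, Y)" by (rule gram_nonneg)
  have rX1: "fst (rot c s (X, Y)) = X1" by (simp add: rot_def X1_def)
  define Y1 where "Y1 = snd (rot c s (X, Y))"
  \<comment> \<open>Invariance lets the same weight be bounded at either end of the step: by
    \<open>(norm X1)\<^sup>2\<close> for the first-order term and by \<open>(norm X)\<^sup>2\<close>
    for the second-order one.\<close>
  have "gram (X, Y) = gram (X1, Y1)"
    using gram_rot[OF cs(1), of "(X, Y)"] rX1 Y1_def by (metis prod.collapse)
  then have gX1: "gram (X, Y) \<le> (norm X1)\<^sup>2 * (norm Y1)\<^sup>2" by (simp add: gram_def)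
  have "(norm X1)\<^sup>2 + (norm Y1)\<^sup>2 = (norm X)\<^sup>2 + (norm Y)\<^sup>2"
    using norm_rot[OF cs(1), of "(X, Y)"] by (simp add: rX1 Y1_def)
  then have "(norm Y1)\<^sup>2 \<le> 1" using annulus_bound(3)[OF ann] zero_le_power2[of "norm X1"] by linarith
  then have gX1': "gram (X, Y) \<le> (norm X1)\<^sup>2" using mult_left_mono[of "(norm Y1)\<^sup>2" 1 "(norm X1)\<^sup>2"] gX1 by simp
  have nXY: "norm X \<le> 1" "norm Y \<le> 1" using annulus_bound[OF ann] by auto
  have gX: "gram (X, Y) \<le> (norm X)\<^sup>2"
  proof -
    have "gram (X, Y) \<le> (norm X)\<^sup>2 * (norm Y)\<^sup>2" by (simp add: gram_def)
    also have "\<dots> \<le> (norm X)\<^sup>2 * 1" using nXY by (intro mult_left_mono) (auto simp: power_le_one)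
    finally show ?thesis by simp
  qed
  have g1: "gram (X, Y) \<le> 1" using gX nXY by (meson norm_ge_zero order_trans power_le_one)
  show ?thesis
  proof (cases "X1 = 0")
    case True
    then have "gram (X, Y) = 0" using gX1' g0 by simp
    then show ?thesis using R unfolding N_def by simp
  next
    case X1: False
    define z z1 where "z = sgn X" and "z1 = sgn X1"
    have z: "norm z = 1" "norm z1 = 1" "inner z z = 1" "inner z1 z1 = 1" "z1 \<in> Rn d"
      using X X1 Y by (auto simp: z_def z1_def norm_sgn X1_def dot_square_norm)
    define \<delta> where "\<delta> = norm (z1 - z)"
    have \<delta>0: "0 \<le> \<delta>" by (simp add: \<delta>_def)
    have in1: "inner z1 z = 1 - \<delta>\<^sup>2 / 2"
      unfolding \<delta>_def power2_norm_eq_inner using z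
      by (simp add: inner_diff_left inner_diff_right inner_commute[of z z1] diff_divide_distrib)
    have pvX: "inner pv X = 0"
    proof -
      have "inner v (sgn X) * inner (sgn X) X = inner v X"
        using X(2) by (simp add: sgn_fseq_def dot_square_norm power2_eq_square field_simps)
      then show ?thesis by (simp add: pv_def inner_diff_left)
    qed
    have pvz1: "inner pv z1 = s * inner pv Y / norm X1"
      by (simp add: z1_def sgn_fseq_def X1_def inner_add_right pvX divide_inverse mult_ac)
    \<comment> \<open>The radial part of \<open>v\<close> sees only \<open>inner z z1 - 1\<close>,
      which is quadratic in the displacement because both directions are unit vectors.\<close>
    have "inner v (z1 - z) = inner pv z1 + inner v z * (inner z z1 - 1)"
      by (simp add: pv_def z_def[symmetric] inner_diff_left inner_diff_right algebra_simps)
    then have iv: "inner v (z1 - z) = s * inner pv Y / norm X1 - inner v z * (\<delta>\<^sup>2 / 2)"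
      using in1 by (simp add: pvz1 inner_commute[of z z1])
    have "\<bar>inner v z\<bar> \<le> norm v * norm z" by (rule Cauchy_Schwarz_ineq2)
    then have vz: "\<bar>inner v z\<bar> \<le> L" using v z by simp
    have "inner v z * (\<delta>\<^sup>2 / 2) \<le> L * \<delta>\<^sup>2"
    proof -
      have "inner v z * (\<delta>\<^sup>2 / 2) \<le> L * (\<delta>\<^sup>2 / 2)" using vz by (intro mult_right_mono) auto
      also have "\<dots> \<le> L * \<delta>\<^sup>2" using nonneg by (intro mult_left_mono) auto
      finally show ?thesis .
    qed
    then have "k z - k z1 \<le> - (s * inner pv Y / norm X1) + (N * \<delta>\<^sup>2 + \<tau>)"
      using sub[OF z(5,2)] iv by (simp add: z_def[symmetric] \<delta>_def[symmetric] N_def algebra_simps)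
    moreover define a where "a = \<bar>s * inner pv Y / norm X1\<bar>"
    moreover define b where "b = N * \<delta>\<^sup>2 + \<tau>"
    ultimately have "k z - k z1 \<le> a + b" by linarith
    moreover have ab: "0 \<le> a" "0 \<le> b" using N nonneg by (auto simp: a_def b_def)
    ultimately have "(max 0 (k z - k z1))\<^sup>2 \<le> (a + b)\<^sup>2" by (intro power_mono) auto
    also have "\<dots> \<le> 2 * a\<^sup>2 + 2 * b\<^sup>2"
      using sum_squares_bound[of a b] by (simp add: power2_sum)
    finally have "(max 0 (k z - k z1))\<^sup>2 \<le> 2 * a\<^sup>2 + 2 * b\<^sup>2" .
    moreover have "b\<^sup>2 \<le> 2 * (N * \<delta>\<^sup>2)\<^sup>2 + 2 * \<tau>\<^sup>2"
      using sum_squares_bound[of "N * \<delta>\<^sup>2" \<tau>] by (simp add: b_def power2_sum)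
    ultimately have pos: "(max 0 (k z - k z1))\<^sup>2 \<le> 2 * a\<^sup>2 + 4 * (N * \<delta>\<^sup>2)\<^sup>2 + 4 * \<tau>\<^sup>2" by linarith
    have A: "gram (X, Y) * a\<^sup>2 \<le> s\<^sup>2 * (inner pv Y)\<^sup>2"
    proof -
      have "gram (X, Y) * a\<^sup>2 \<le> (norm X1)\<^sup>2 * a\<^sup>2" by (intro mult_right_mono gX1') auto
      also have "\<dots> = s\<^sup>2 * (inner pv Y)\<^sup>2"
        using X1 by (simp add: a_def power_divide power_mult_distrib)
      finally show ?thesis .
    qed
    have "norm (X1 - X) \<le> 2 * e"
    proof -
      have "X1 - X = (c - 1) *\<^sub>R X + s *\<^sub>R Y" by (simp add: X1_def algebra_simps)
      then have "norm (X1 - X) \<le> \<bar>c - 1\<bar> * norm X + \<bar>s\<bar> * norm Y"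
        using norm_triangle_ineq[of "(c - 1) *\<^sub>R X" "s *\<^sub>R Y"] by simp
      also have "\<dots> \<le> e * 1 + e * 1"
        using cs nXY e by (intro add_mono mult_mono) auto
      finally show ?thesis by simp
    qed
    then have "\<delta> * norm X \<le> 4 * e"
      using norm_sgn_diff_le[of X1 X] by (simp add: \<delta>_def z_def z1_def)
    then have "(\<delta> * norm X)\<^sup>2 \<le> (4 * e)\<^sup>2" by (intro power_mono) (auto simp: \<delta>_def)
    then have \<delta>X: "(norm X)\<^sup>2 * \<delta>\<^sup>2 \<le> 16 * e\<^sup>2" by (simp add: power_mult_distrib mult.commute)
    \<comment> \<open>At \<open>norm X = sqrt e\<close> the estimate changes: outside that radius
      \<open>\<delta>\<^sup>2\<close> is at most \<open>16 * e\<close>, inside only the trivial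
      bound 4 is used.\<close>
    have "\<delta> \<le> 2" using norm_triangle_ineq4[of z1 z] z by (simp add: \<delta>_def)
    then have \<delta>4: "\<delta>\<^sup>2 \<le> 4" using power_mono[of \<delta> 2 2] \<delta>0 by simp
    have \<delta>2: "\<delta>\<^sup>2 \<le> 16 * e + 4 * indicator (cball 0 (sqrt e)) X"
    proof (cases "norm X \<le> sqrt e")
      case False
      then have "e \<le> (norm X)\<^sup>2" using power_mono[of "sqrt e" "norm X" 2] e by simp
      then have "e * \<delta>\<^sup>2 \<le> (norm X)\<^sup>2 * \<delta>\<^sup>2" by (intro mult_right_mono) auto
      also note \<delta>X
      finally have "e * \<delta>\<^sup>2 \<le> e * (16 * e)" by (simp add: power2_eq_square)
      then have "\<delta>\<^sup>2 \<le> 16 * e" using e by simp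
      then show ?thesis using False by simp
    qed (use \<delta>4 e in simp)
    have B: "gram (X, Y) * (N * \<delta>\<^sup>2)\<^sup>2 \<le> 256 * N\<^sup>2 * e ^ 3 + 64 * N\<^sup>2 * e\<^sup>2 * indicator (cball 0 (sqrt e)) X"
    proof -
      have "gram (X, Y) * \<delta>\<^sup>2 \<le> (norm X)\<^sup>2 * \<delta>\<^sup>2" by (intro mult_right_mono gX) auto
      then have "gram (X, Y) * \<delta>\<^sup>2 \<le> 16 * e\<^sup>2" using \<delta>X by linarith
      then have "(gram (X, Y) * \<delta>\<^sup>2) * \<delta>\<^sup>2 \<le> 16 * e\<^sup>2 * (16 * e + 4 * indicator (cball 0 (sqrt e)) X)"
        by (rule mult_mono) (use \<delta>2 e g0 in auto)
      then have "N\<^sup>2 * ((gram (X, Y) * \<delta>\<^sup>2) * \<delta>\<^sup>2) \<le> N\<^sup>2 * (16 * e\<^sup>2 * (16 * e + 4 * indicator (cball 0 (sqrt e)) X))"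
        by (intro mult_left_mono) auto
      then show ?thesis by (simp add: power_mult_distrib power2_eq_square power3_eq_cube algebra_simps)
    qed
    have C: "gram (X, Y) * \<tau>\<^sup>2 \<le> 1 * \<tau>\<^sup>2" by (intro mult_right_mono g1) auto
    have "gram (X, Y) * (max 0 (k z - k z1))\<^sup>2 \<le> gram (X, Y) * (2 * a\<^sup>2 + 4 * (N * \<delta>\<^sup>2)\<^sup>2 + 4 * \<tau>\<^sup>2)"
      by (intro mult_left_mono pos g0)
    also have "\<dots> = 2 * (gram (X, Y) * a\<^sup>2) + 4 * (gram (X, Y) * (N * \<delta>\<^sup>2)\<^sup>2) + 4 * (gram (X, Y) * \<tau>\<^sup>2)"
      by (simp add: algebra_simps)
    also have "\<dots> \<le> 2 * (s\<^sup>2 * (inner pv Y)\<^sup>2)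
        + 4 * (256 * N\<^sup>2 * e ^ 3 + 64 * N\<^sup>2 * e\<^sup>2 * indicator (cball 0 (sqrt e)) X) + 4 * (1 * \<tau>\<^sup>2)"
      using A B C by (intro add_mono mult_left_mono) auto
    finally show ?thesis
      unfolding X1_def[symmetric] z_def[symmetric] z1_def[symmetric] N_def[symmetric] by (simp add: algebra_simps)
  qed
qed

text \<open>Averaging the first-order term over the isotropic \<open>Y\<close> produces the factor
  \<open>1 / d\<close>. All other terms must be \<open>o(e\<^sup>2)\<close>, because there will be
  of order \<open>1 / e\<close> steps and Cauchy-Schwarz costs another such factor. For the last
  term this holds since the ball of radius \<open>sqrt e\<close> has measure at most of order
  \<open>e\<close>.\<close>

lemma path_step_integral:
  fixes k :: "fseq \<Rightarrow> real"
  assumes d: "0 < d" and k [measurable]: "k \<in> borel_measurable borel"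
    and sub: "\<And>z \<tau>. z \<in> Rn d \<Longrightarrow> norm z = 1 \<Longrightarrow> 0 < \<tau> \<Longrightarrow> \<exists>v\<in>Rn d. norm v \<le> L \<and>
      (\<forall>z'\<in>Rn d. norm z' = 1 \<longrightarrow> k z' \<ge> k z + inner v (z' - z) - M * (norm (z' - z))\<^sup>2 - \<tau>)"
    and nonneg: "0 \<le> L" "0 \<le> M"
    and cs: "c\<^sup>2 + s\<^sup>2 = 1" "\<bar>1 - c\<bar> \<le> e" "\<bar>s\<bar> \<le> e" and e: "0 < e"
  shows "pair_integral d (\<lambda>Z. ennreal (gram Z * (max 0 (k (sgn (fst Z)) - k (sgn (c *\<^sub>R fst Z + s *\<^sub>R snd Z))))\<^sup>2))
    \<le> ennreal (2 * s\<^sup>2 * L\<^sup>2 / real d + 1024 * (L + M)\<^sup>2 * e ^ 3 + 4 * e ^ 4) * pair_integral d (\<lambda>_. 1)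
      + ennreal (256 * (L + M)\<^sup>2 * e\<^sup>2) * emeasure (leb d) (cball 0 (sqrt e)) * ball_vol d"
proof -
  define N where "N = L + M"
  let ?H = "\<lambda>Z. gram Z * (max 0 (k (sgn (fst Z)) - k (sgn (c *\<^sub>R fst Z + s *\<^sub>R snd Z))))\<^sup>2"
  let ?c1 = "1024 * N\<^sup>2 * e ^ 3 + 4 * e ^ 4" and ?c2 = "256 * N\<^sup>2 * e\<^sup>2"
  let ?W = "\<lambda>X. \<integral>\<^sup>+Y. annulus (X, Y) \<partial>leb d"
  let ?I = "\<lambda>X. indicator (cball 0 (sqrt e)) X :: ennreal"
  have inner_bound: "(\<integral>\<^sup>+Y. annulus (X, Y) * ennreal (?H (X, Y)) \<partial>leb d)
      \<le> ennreal (2 * s\<^sup>2 * L\<^sup>2 / real d) * ?W X + (ennreal ?c1 * ?W X + ennreal ?c2 * ?I X * ?W X)"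
    if X: "X \<in> Rn d" "X \<noteq> 0" for X
  proof -
    \<comment> \<open>The slack of the subgradient is chosen as \<open>e\<^sup>2\<close>; it enters
      squared and costs \<open>4 * e ^ 4\<close>.\<close>
    have "sgn X \<in> Rn d" "norm (sgn X) = 1" "0 < e\<^sup>2" using X e by (auto simp: norm_sgn)
    from sub[OF this] obtain v where v: "v \<in> Rn d" "norm v \<le> L"
      "\<And>z'. z' \<in> Rn d \<Longrightarrow> norm z' = 1 \<Longrightarrow> k z' \<ge> k (sgn X) + inner v (z' - sgn X) - M * (norm (z' - sgn X))\<^sup>2 - e\<^sup>2"
      by blast
    define pv where "pv = v - inner v (sgn X) *\<^sub>R sgn X"
    have pvR: "pv \<in> Rn d" using v X unfolding pv_def by (intro Rn_intros) auto
    have "(norm pv)\<^sup>2 = (norm v)\<^sup>2 - (inner v (sgn X))\<^sup>2"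
    proof -
      define w where "w = sgn X"
      have "inner w w = 1" using X by (simp add: w_def dot_square_norm norm_sgn)
      then have "inner (v - inner v w *\<^sub>R w) (v - inner v w *\<^sub>R w) = inner v v - (inner v w)\<^sup>2"
        by (simp add: inner_diff_left inner_diff_right inner_commute[of w v] power2_eq_square)
      then show ?thesis unfolding pv_def w_def power2_norm_eq_inner .
    qed
    then have "(norm pv)\<^sup>2 \<le> (norm v)\<^sup>2" by simp
    also have "\<dots> \<le> L\<^sup>2" using v nonneg by (intro power_mono) auto
    finally have pvL: "(norm pv)\<^sup>2 \<le> L\<^sup>2" .
    define J where "J = (\<integral>\<^sup>+Y. annulus (X, Y) * ennreal ((inner pv Y)\<^sup>2) \<partial>leb d)"
    have "ennreal (real d) * J = ennreal ((norm pv)\<^sup>2) * (\<integral>\<^sup>+Y. annulus (X, Y) * ennreal ((norm Y)\<^sup>2) \<partial>leb d)"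
      unfolding J_def by (rule annulus_isotropic[OF pvR])
    also have "\<dots> \<le> ennreal (L\<^sup>2) * ?W X"
    proof (intro mult_mono ennreal_leI pvL nn_integral_mono)
      fix Y
      show "annulus (X, Y) * ennreal ((norm Y)\<^sup>2) \<le> annulus (X, Y)"
      proof (cases "annulus (X, Y) = 0")
        case False
        then have "(norm Y)\<^sup>2 \<le> 1" using annulus_bound(2) by (simp add: power_le_one)
        then have "annulus (X, Y) * ennreal ((norm Y)\<^sup>2) \<le> annulus (X, Y) * ennreal 1"
          by (intro mult_left_mono ennreal_leI) auto
        then show ?thesis by simp
      qed simp
    qed auto
    finally have "ennreal (1 / real d) * (ennreal (real d) * J) \<le> ennreal (1 / real d) * (ennreal (L\<^sup>2) * ?W X)"
      by (rule mult_left_mono) simp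
    then have J: "J \<le> ennreal (L\<^sup>2 / real d) * ?W X"
      using d by (simp add: mult.assoc[symmetric] ennreal_mult[symmetric])
    have "(\<integral>\<^sup>+Y. annulus (X, Y) * ennreal (?H (X, Y)) \<partial>leb d)
        \<le> (\<integral>\<^sup>+Y. ennreal (2 * s\<^sup>2) * (annulus (X, Y) * ennreal ((inner pv Y)\<^sup>2))
          + (ennreal ?c1 * annulus (X, Y) + ennreal ?c2 * ?I X * annulus (X, Y)) \<partial>leb d)"
    proof (rule nn_integral_mono_AE, use AE_leb_Rn[of d] in eventually_elim)
      fix Y assume Y: "Y \<in> Rn d"
      show "annulus (X, Y) * ennreal (?H (X, Y)) \<le> ennreal (2 * s\<^sup>2) * (annulus (X, Y) * ennreal ((inner pv Y)\<^sup>2))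
          + (ennreal ?c1 * annulus (X, Y) + ennreal ?c2 * ?I X * annulus (X, Y))"
      proof (cases "annulus (X, Y) = 0")
        case False
        have "?H (X, Y) \<le> 2 * s\<^sup>2 * (inner pv Y)\<^sup>2 + (1024 * N\<^sup>2 * e ^ 3 + 4 * (e\<^sup>2)\<^sup>2)
            + ?c2 * indicator (cball 0 (sqrt e)) X"
          unfolding pv_def N_def fst_conv snd_conv
          by (rule path_step_bound[OF X Y False cs e v(2) nonneg _ v(3)]) (use e in auto)
        then have "ennreal (?H (X, Y)) \<le> ennreal (2 * s\<^sup>2 * (inner pv Y)\<^sup>2 + ?c1 + ?c2 * indicator (cball 0 (sqrt e)) X)"
          by (intro ennreal_leI) (simp flip: power_mult)
        also have "\<dots> = ennreal (2 * s\<^sup>2) * ennreal ((inner pv Y)\<^sup>2) + (ennreal ?c1 + ennreal ?c2 * ?I X)"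
        proof -
          have "ennreal (2 * s\<^sup>2 * (inner pv Y)\<^sup>2 + ?c1 + ?c2 * indicator (cball 0 (sqrt e)) X)
              = ennreal (2 * s\<^sup>2 * (inner pv Y)\<^sup>2 + ?c1) + ennreal (?c2 * indicator (cball 0 (sqrt e)) X)"
            by (rule ennreal_plus) (use e in auto)
          also have "ennreal (2 * s\<^sup>2 * (inner pv Y)\<^sup>2 + ?c1) = ennreal (2 * s\<^sup>2 * (inner pv Y)\<^sup>2) + ennreal ?c1"
            by (rule ennreal_plus) (use e in auto)
          also have "ennreal (2 * s\<^sup>2 * (inner pv Y)\<^sup>2) = ennreal (2 * s\<^sup>2) * ennreal ((inner pv Y)\<^sup>2)"
            by (rule ennreal_mult) auto
          also have "ennreal (?c2 * indicator (cball 0 (sqrt e)) X) = ennreal ?c2 * ?I X"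
            by (auto simp: indicator_def)
          finally show ?thesis by (simp only: add.assoc)
        qed
        finally have "annulus (X, Y) * ennreal (?H (X, Y))
            \<le> annulus (X, Y) * (ennreal (2 * s\<^sup>2) * ennreal ((inner pv Y)\<^sup>2) + (ennreal ?c1 + ennreal ?c2 * ?I X))"
          by (rule mult_left_mono) simp
        then show ?thesis by (simp only: distrib_left mult_ac)
      qed simp
    qed
    also have "\<dots> = ennreal (2 * s\<^sup>2) * J + (ennreal ?c1 * ?W X + ennreal ?c2 * ?I X * ?W X)"
      unfolding J_def by (subst nn_integral_add, measurable, subst nn_integral_add, measurable)
        (simp add: nn_integral_cmult)
    also have "ennreal (2 * s\<^sup>2) * J \<le> ennreal (2 * s\<^sup>2) * (ennreal (L\<^sup>2 / real d) * ?W X)"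
      by (intro mult_left_mono J) simp
    also have "ennreal (2 * s\<^sup>2) * (ennreal (L\<^sup>2 / real d) * ?W X) = ennreal (2 * s\<^sup>2 * L\<^sup>2 / real d) * ?W X"
      by (simp add: mult.assoc[symmetric] ennreal_mult[symmetric])
    finally show ?thesis by (simp add: add_right_mono)
  qed
  have W: "(\<integral>\<^sup>+X. ?W X \<partial>leb d) = pair_integral d (\<lambda>_. 1)" by (simp add: pair_integral_def)
  have "pair_integral d (\<lambda>Z. ennreal (?H Z))
      \<le> (\<integral>\<^sup>+X. ennreal (2 * s\<^sup>2 * L\<^sup>2 / real d) * ?W X + (ennreal ?c1 * ?W X + ennreal ?c2 * ?I X * ?W X) \<partial>leb d)"
    unfolding pair_integral_def
    by (rule nn_integral_mono_AE, use AE_leb_Rn[of d] AE_leb_nonzero[OF d] in eventually_elim) (rule inner_bound)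
  also have "\<dots> = ennreal (2 * s\<^sup>2 * L\<^sup>2 / real d) * (\<integral>\<^sup>+X. ?W X \<partial>leb d)
      + (ennreal ?c1 * (\<integral>\<^sup>+X. ?W X \<partial>leb d) + (\<integral>\<^sup>+X. ennreal ?c2 * ?I X * ?W X \<partial>leb d))"
    by (subst nn_integral_add, measurable, subst nn_integral_add, measurable)
      (simp add: nn_integral_cmult)
  also have "(\<integral>\<^sup>+X. ennreal ?c2 * ?I X * ?W X \<partial>leb d) = pair_integral d (\<lambda>Z. ennreal ?c2 * ?I (fst Z))"
  proof -
    have "(\<integral>\<^sup>+Y. annulus (X, Y) * (ennreal ?c2 * ?I X) \<partial>leb d) = ennreal ?c2 * ?I X * ?W X" for X
      by (subst nn_integral_multc, measurable) (rule mult.commute)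
    then show ?thesis unfolding pair_integral_def by simp
  qed
  also have "pair_integral d (\<lambda>Z. ennreal ?c2 * ?I (fst Z)) \<le> ennreal ?c2 * emeasure (leb d) (cball 0 (sqrt e)) * ball_vol d"
    by (rule pair_integral_le) auto
  also have "ennreal (2 * s\<^sup>2 * L\<^sup>2 / real d) * (\<integral>\<^sup>+X. ?W X \<partial>leb d) + (ennreal ?c1 * (\<integral>\<^sup>+X. ?W X \<partial>leb d)
        + ennreal ?c2 * emeasure (leb d) (cball 0 (sqrt e)) * ball_vol d)
      = ennreal (2 * s\<^sup>2 * L\<^sup>2 / real d + ?c1) * pair_integral d (\<lambda>_. 1)
        + ennreal ?c2 * emeasure (leb d) (cball 0 (sqrt e)) * ball_vol d"
  proof -
    have "ennreal (2 * s\<^sup>2 * L\<^sup>2 / real d + ?c1) = ennreal (2 * s\<^sup>2 * L\<^sup>2 / real d) + ennreal ?c1"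
      by (rule ennreal_plus) (use e in auto)
    then show ?thesis unfolding W by (simp only: distrib_right add.assoc)
  qed
  finally show ?thesis by (simp add: N_def add.assoc add_left_mono)
qed

text \<open>Divide the half circle from \<open>X\<close> through \<open>Y\<close> to
  \<open>- X\<close> into \<open>K\<close> rotations by the angle \<open>e = pi / K\<close>. All
  steps have the same law, so Cauchy-Schwarz over the path gives \<open>K\<^sup>2\<close> times the
  bound for one step. Its main part contains \<open>K\<^sup>2 * s\<^sup>2\<close>, at most 16, and
  the rest vanishes as \<open>K\<close> grows. The constant is
  \<open>2048 = 32 * 2 * 2 * 16\<close>: comparison of measures, two signs of the difference, the
  first-order term of one step, and 16.\<close>

lemma uniform_sphere_poincare:
  fixes k :: "fseq \<Rightarrow> real"
  assumes d: "3 \<le> d" and k [measurable]: "k \<in> borel_measurable borel"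
    and sub: "\<And>z \<tau>. z \<in> Rn d \<Longrightarrow> norm z = 1 \<Longrightarrow> 0 < \<tau> \<Longrightarrow> \<exists>v\<in>Rn d. norm v \<le> L \<and>
      (\<forall>z'\<in>Rn d. norm z' = 1 \<longrightarrow> k z' \<ge> k z + inner v (z' - z) - M * (norm (z' - z))\<^sup>2 - \<tau>)"
    and nonneg: "0 \<le> L" "0 \<le> M"
  shows "(\<integral>\<^sup>+z. ennreal ((k z - k (- z))\<^sup>2) \<partial>uniform_sphere d) \<le> ennreal (2048 * L\<^sup>2 / real d)"
proof -
  define E where "E = (\<integral>\<^sup>+z. ennreal ((k z - k (- z))\<^sup>2) \<partial>uniform_sphere d)"
  have d0: "0 < d" using d by simp
  obtain m where m: "pair_integral d (\<lambda>_. 1) = ennreal m" "0 < m"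
    using pair_integral_1_pos[OF d0] pair_integral_1_finite[of d]
    by (cases "pair_integral d (\<lambda>_. 1)") auto
  obtain V where V: "ball_vol d = ennreal V" "0 < V"
    using ball_vol(4,5)[of d] by (cases "ball_vol d") auto
  define N where "N = L + M"
  define Cst where "Cst = 1024 * ((1024 * N\<^sup>2 + 4) * m + 256 * N\<^sup>2 * V * V)"
  have Cst: "0 \<le> Cst" using m V by (simp add: Cst_def)
  have main: "ennreal m * E \<le> ennreal (2048 * L\<^sup>2 / real d * m + Cst * (pi / real K))" if K: "4 \<le> K" for K :: nat
  proof -
    define e where "e = pi / real K"
    have K0: "0 < real K" using K by simp
    have e: "0 < e" "e \<le> 1" using K pi_less_4 by (auto simp: e_def field_simps)
    have Ke: "real K * e = pi" using K0 by (simp add: e_def)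
    define c s where "c = cos e" and "s = sin e"
    have cs: "c\<^sup>2 + s\<^sup>2 = 1" by (simp add: c_def s_def)
    have s: "\<bar>s\<bar> \<le> e" using abs_sin_x_le_abs_x[of e] e by (simp add: s_def)
    have "\<bar>1 - c\<bar> \<le> e"
    proof -
      have "1 - c = 2 * (sin (e / 2))\<^sup>2" using cos_double_sin[of "e / 2"] by (simp add: c_def)
      moreover have "(sin (e / 2))\<^sup>2 \<le> (e / 2)\<^sup>2"
        using abs_sin_x_le_abs_x[of "e / 2"] by (simp add: abs_le_square_iff[symmetric])
      moreover have "(e / 2)\<^sup>2 \<le> e / 2" using e by (simp add: power2_eq_square field_simps)
      ultimately show ?thesis by (auto simp: abs_if)
    qed
    note c = this
    have s0: "s \<noteq> 0" using e pi_gt3 by (auto simp: s_def intro!: less_imp_neq[symmetric] sin_gt_zero)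
    \<comment> \<open>The path starts at \<open>X\<close>, passes through \<open>Y\<close> at a
      right angle and ends at the antipode; the antipode is what the two-point difference
      needs.\<close>
    define X where "X j Z = cos (real j * e) *\<^sub>R fst Z + sin (real j * e) *\<^sub>R snd Z" for j and Z :: "fseq \<times> fseq"
    have [measurable]: "X j \<in> borel_measurable (borel \<Otimes>\<^sub>M borel)" for j unfolding X_def by measurable
    have X0: "X 0 Z = fst Z" and XK: "X K Z = - fst Z" for Z by (auto simp: X_def Ke)
    have Xrot: "X j Z = fst (rot (cos (real j * e)) (sin (real j * e)) Z)"
      "X (Suc j) Z = c *\<^sub>R fst (rot (cos (real j * e)) (sin (real j * e)) Z) + s *\<^sub>R snd (rot (cos (real j * e)) (sin (real j * e)) Z)" for j Z
    proof -
      show "X j Z = fst (rot (cos (real j * e)) (sin (real j * e)) Z)" by (simp add: X_def rot_def)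
      have "real (Suc j) * e = real j * e + e" by (simp add: algebra_simps)
      then show "X (Suc j) Z = c *\<^sub>R fst (rot (cos (real j * e)) (sin (real j * e)) Z) + s *\<^sub>R snd (rot (cos (real j * e)) (sin (real j * e)) Z)"
        unfolding X_def rot_def by (simp add: cos_add sin_add c_def s_def algebra_simps)
    qed
    let ?x1 = "\<lambda>t Z. c *\<^sub>R fst Z + t *\<^sub>R snd Z"
    define D where "D Z = ennreal (gram Z * (k (sgn (fst Z)) - k (sgn (?x1 s Z)))\<^sup>2)" for Z
    define J where "J t Z = ennreal (gram Z * (max 0 (k (sgn (fst Z)) - k (sgn (?x1 t Z))))\<^sup>2)" for t Z
    define J' where "J' Z = ennreal (gram Z * (max 0 (k (sgn (?x1 s Z)) - k (sgn (fst Z))))\<^sup>2)" for Z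
    have [measurable]: "D \<in> borel_measurable (borel \<Otimes>\<^sub>M borel)" "J t \<in> borel_measurable (borel \<Otimes>\<^sub>M borel)"
      "J' \<in> borel_measurable (borel \<Otimes>\<^sub>M borel)" for t
      unfolding D_def J_def J'_def by measurable
    have Dj: "pair_integral d (\<lambda>Z. ennreal (gram Z * (k (sgn (X j Z)) - k (sgn (X (Suc j) Z)))\<^sup>2)) = pair_integral d D"
      if j: "j < K" for j
    proof -
      have j': "sin (real j * e) \<noteq> 0 \<or> cos (real j * e) = 1"
      proof (cases "j = 0")
        case False
        have "real j * e < real K * e" using j e by simp
        then have "0 < sin (real j * e)" using False e Ke by (intro sin_gt_zero) auto
        then show ?thesis by simp
      qed simp
      have "ennreal (gram Z * (k (sgn (X j Z)) - k (sgn (X (Suc j) Z)))\<^sup>2)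
          = D (rot (cos (real j * e)) (sin (real j * e)) Z)" for Z
        unfolding D_def Xrot(2) unfolding Xrot(1) by (subst gram_rot) auto
      then show ?thesis by (simp add: pair_integral_rot[OF _ _ j'])
    qed
    \<comment> \<open>Subgradients bound drops only, so the square is split into drops and
      rises.\<close>
    have "D = (\<lambda>Z. J s Z + J' Z)"
    proof (rule ext)
      fix Z
      have "(a - b)\<^sup>2 = (max 0 (a - b))\<^sup>2 + (max 0 (b - a))\<^sup>2" for a b :: real
        by (auto simp: max_def power2_eq_square algebra_simps)
      then have "gram Z * (k (sgn (fst Z)) - k (sgn (?x1 s Z)))\<^sup>2
          = gram Z * (max 0 (k (sgn (fst Z)) - k (sgn (?x1 s Z))))\<^sup>2 + gram Z * (max 0 (k (sgn (?x1 s Z)) - k (sgn (fst Z))))\<^sup>2"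
        by (simp only: distrib_left)
      then show "D Z = J s Z + J' Z"
        unfolding D_def J_def J'_def using gram_nonneg[of Z] by (simp only: ennreal_plus mult_nonneg_nonneg zero_le_power2)
    qed
    then have DJ: "pair_integral d D = pair_integral d (J s) + pair_integral d J'"
      using pair_integral_add[of "J s" J' d] by simp
    \<comment> \<open>A rise along the step is a drop along the reversed step; rotating the pair
      back exchanges the endpoints and replaces \<open>s\<close> by \<open>- s\<close>.\<close>
    have "J' (rot c (- s) Z) = J (- s) Z" for Z
    proof -
      have "?x1 s (rot c (- s) Z) = (c\<^sup>2 + s\<^sup>2) *\<^sub>R fst Z"
        by (simp add: rot_def power2_eq_square algebra_simps)
      then have "?x1 s (rot c (- s) Z) = fst Z" by (simp add: cs)
      moreover have "gram (rot c (- s) Z) = gram Z" by (rule gram_rot) (simp add: cs)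
      ultimately show ?thesis unfolding J'_def J_def by (simp add: rot_def)
    qed
    then have J': "pair_integral d J' = pair_integral d (J (- s))"
      using pair_integral_rot[of J' c "- s" d] cs s0 by simp
    define B where "B = (2 * s\<^sup>2 * L\<^sup>2 / real d + 1024 * N\<^sup>2 * e ^ 3 + 4 * e ^ 4) * m + 256 * N\<^sup>2 * e\<^sup>2 * (e * V) * V"
    have B0: "0 \<le> B" using e m V by (simp add: B_def)
    have JB: "pair_integral d (J t) \<le> ennreal B" if t: "t = s \<or> t = - s" for t
    proof -
      have "pair_integral d (J t) \<le> ennreal (2 * t\<^sup>2 * L\<^sup>2 / real d + 1024 * (L + M)\<^sup>2 * e ^ 3 + 4 * e ^ 4) * pair_integral d (\<lambda>_. 1)
        + ennreal (256 * (L + M)\<^sup>2 * e\<^sup>2) * emeasure (leb d) (cball 0 (sqrt e)) * ball_vol d"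
        unfolding J_def
        by (rule path_step_integral[OF d0 k sub nonneg _ c _ e(1)]) (use t s cs in auto)
      also have "emeasure (leb d) (cball 0 (sqrt e)) \<le> ennreal (e * V)"
      proof -
        \<comment> \<open>\<open>e \<le> 1\<close> makes higher powers smaller, so the ball has
          measure at most \<open>e * V\<close> in every dimension here.\<close>
        have "sqrt e ^ d \<le> sqrt e ^ 2" using e d by (intro power_decreasing) auto
        then have "sqrt e ^ d * V \<le> e * V" using e V by (intro mult_right_mono) auto
        moreover have "emeasure (leb d) (cball 0 (sqrt e)) = ennreal (sqrt e ^ d * V)"
          using e V by (simp add: emeasure_leb_cball ennreal_mult)
        ultimately show ?thesis by (simp add: ennreal_leI)
      qed
      also have "ennreal (2 * t\<^sup>2 * L\<^sup>2 / real d + 1024 * (L + M)\<^sup>2 * e ^ 3 + 4 * e ^ 4) * pair_integral d (\<lambda>_. 1)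
        + ennreal (256 * (L + M)\<^sup>2 * e\<^sup>2) * ennreal (e * V) * ball_vol d = ennreal B"
      proof -
        have "t\<^sup>2 = s\<^sup>2" using t by auto
        then show ?thesis
          unfolding m(1) V(1) B_def N_def using e m V
          by (simp add: ennreal_mult[symmetric] ennreal_plus[symmetric] del: ennreal_plus)
      qed
      finally show ?thesis by (simp add: mult_left_mono mult_right_mono add_left_mono)
    qed
    have "pair_integral d D \<le> ennreal B + ennreal B"
      unfolding DJ J' by (intro add_mono JB) auto
    then have DB: "pair_integral d D \<le> ennreal (2 * B)" using B0 by (simp flip: ennreal_plus)
    have "ennreal m * E \<le> 32 * pair_integral d (\<lambda>Z. ennreal (gram Z) * ennreal ((k (sgn (fst Z)) - k (- sgn (fst Z)))\<^sup>2))"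
      using pair_integral_direction_lower[OF d, of "\<lambda>z. ennreal ((k z - k (- z))\<^sup>2)"]
      unfolding m(1) E_def[symmetric] by simp
    also have "\<dots> \<le> 32 * pair_integral d (\<lambda>Z. ennreal (real K) * (\<Sum>j<K. ennreal (gram Z * (k (sgn (X j Z)) - k (sgn (X (Suc j) Z)))\<^sup>2)))"
    proof (intro mult_left_mono pair_integral_mono)
      fix x y :: fseq
      let ?Z = "(x, y)"
      let ?a = "\<lambda>j. k (sgn (X j ?Z)) - k (sgn (X (Suc j) ?Z))"
      have "(\<Sum>j<K. ?a j) = k (sgn x) - k (- sgn x)"
        using sum_lessThan_telescope'[of "\<lambda>j. k (sgn (X j ?Z))" K] by (simp add: X0 XK sgn_minus)
      then have "(k (sgn x) - k (- sgn x))\<^sup>2 \<le> (\<Sum>j<K. (?a j)\<^sup>2) * real K"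
        using sum_squared_le_sum_of_squares[of ?a "{..<K}"] by simp
      then have "gram ?Z * (k (sgn x) - k (- sgn x))\<^sup>2 \<le> gram ?Z * ((\<Sum>j<K. (?a j)\<^sup>2) * real K)"
        by (intro mult_left_mono gram_nonneg)
      also have "\<dots> = real K * (\<Sum>j<K. gram ?Z * (?a j)\<^sup>2)"
        by (simp add: sum_distrib_left mult_ac)
      finally show "ennreal (gram ?Z) * ennreal ((k (sgn (fst ?Z)) - k (- sgn (fst ?Z)))\<^sup>2)
          \<le> ennreal (real K) * (\<Sum>j<K. ennreal (gram ?Z * (?a j)\<^sup>2))"
        by (simp add: ennreal_mult[symmetric] gram_nonneg sum_nonneg ennreal_leI)
    qed (use d in auto)
    also have "pair_integral d (\<lambda>Z. ennreal (real K) * (\<Sum>j<K. ennreal (gram Z * (k (sgn (X j Z)) - k (sgn (X (Suc j) Z)))\<^sup>2)))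
        = ennreal (real K) * (\<Sum>j<K. pair_integral d (\<lambda>Z. ennreal (gram Z * (k (sgn (X j Z)) - k (sgn (X (Suc j) Z)))\<^sup>2)))"
      by (subst pair_integral_cmult, measurable, subst pair_integral_sum, measurable)
    also have "\<dots> = ennreal (real K) * (\<Sum>j<K. pair_integral d D)"
      by (intro arg_cong2[where f = "(*)"] sum.cong Dj) auto
    also have "\<dots> \<le> ennreal (real K) * (\<Sum>j<K. ennreal (2 * B))"
      by (intro mult_left_mono sum_mono DB) auto
    also have "32 * (ennreal (real K) * (\<Sum>j<K. ennreal (2 * B))) = ennreal (64 * (real K)\<^sup>2 * B)"
      using B0 by (simp add: ennreal_mult[symmetric] ennreal_of_nat_eq_real_of_nat power2_eq_square mult_ac flip: ennreal_numeral)
    also have "64 * (real K)\<^sup>2 * B \<le> 2048 * L\<^sup>2 / real d * m + Cst * e"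
    proof -
      have "(real K * e)\<^sup>2 \<le> 4\<^sup>2" unfolding Ke using pi_less_4 by (intro power_mono) auto
      then have Ke2: "(real K)\<^sup>2 * e\<^sup>2 \<le> 16" by (simp add: power_mult_distrib)
      have "s\<^sup>2 \<le> e\<^sup>2" using s e by (metis abs_le_square_iff abs_of_pos)
      then have "(real K)\<^sup>2 * s\<^sup>2 \<le> (real K)\<^sup>2 * e\<^sup>2" by (intro mult_left_mono) auto
      with Ke2 have Ks2: "(real K)\<^sup>2 * s\<^sup>2 \<le> 16" by linarith
      have e4: "e ^ 4 \<le> e ^ 3" using e by (intro power_decreasing) auto
      have "64 * (real K)\<^sup>2 * B = 128 * (L\<^sup>2 / real d * m) * ((real K)\<^sup>2 * s\<^sup>2)
          + 64 * (real K)\<^sup>2 * ((1024 * N\<^sup>2 * e ^ 3 + 4 * e ^ 4) * m + 256 * N\<^sup>2 * e ^ 3 * V * V)"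
        by (simp add: B_def algebra_simps power2_eq_square power3_eq_cube)
      also have "\<dots> \<le> 128 * (L\<^sup>2 / real d * m) * 16
          + 64 * (real K)\<^sup>2 * ((1024 * N\<^sup>2 * e ^ 3 + 4 * e ^ 3) * m + 256 * N\<^sup>2 * e ^ 3 * V * V)"
        using m e4 e V by (intro add_mono mult_left_mono Ks2 mult_right_mono) auto
      also have "\<dots> = 2048 * L\<^sup>2 / real d * m + (Cst / 16 * e) * ((real K)\<^sup>2 * e\<^sup>2)"
        by (simp add: Cst_def algebra_simps power2_eq_square power3_eq_cube)
      also have "\<dots> \<le> 2048 * L\<^sup>2 / real d * m + (Cst / 16 * e) * 16"
        using Cst e by (intro add_mono mult_left_mono Ke2) auto
      finally show ?thesis by simp
    qed
    finally show ?thesis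
      unfolding e_def[symmetric] by (simp add: mult_left_mono ennreal_leI)
  qed
  \<comment> \<open>Let \<open>K\<close> tend to infinity.\<close>
  have "ennreal m * E \<le> ennreal (2048 * L\<^sup>2 / real d * m)"
  proof (rule ennreal_le_epsilon)
    fix y :: real assume y: "0 < y"
    obtain K :: nat where K: "Cst * pi / y < real K" using reals_Archimedean2 by blast
    define K' where "K' = max K 4"
    have "Cst * pi / y \<le> real K'" using K by (simp add: K'_def)
    moreover have "0 < real K'" by (simp add: K'_def)
    ultimately have "Cst * (pi / real K') \<le> y" using y by (simp add: field_simps)
    then have "ennreal m * E \<le> ennreal (2048 * L\<^sup>2 / real d * m + y)"
      using main[of K'] by (intro order_trans[OF main[of K']] ennreal_leI) (auto simp: K'_def)
    also have "\<dots> = ennreal (2048 * L\<^sup>2 / real d * m) + ennreal y"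
      using m y by (intro ennreal_plus) auto
    finally show "ennreal m * E \<le> ennreal (2048 * L\<^sup>2 / real d * m) + ennreal y" .
  qed
  then have "ennreal m * E \<le> ennreal m * ennreal (2048 * L\<^sup>2 / real d)"
    using m by (simp add: ennreal_mult[symmetric] mult.commute)
  then show ?thesis
    using m unfolding E_def[symmetric] by (subst (asm) ennreal_mult_le_mult_iff) auto
qed

subsection \<open>The divergence theorem for the ball\<close>

definition vol :: "nat \<Rightarrow> real" where
  "vol d = enn2real (ball_vol d)"

lemma ball_vol_eq: "ball_vol d = ennreal (vol d)"
  by (simp add: vol_def)

lemma vol_pos: "0 < vol d"
  using ball_vol(4)[of d] by (simp add: ball_vol_eq)

text \<open>The surface area of the sphere of radius \<open>r\<close>; together with the normalised
  \<open>uniform_sphere\<close> it gives polar coordinates.\<close>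

definition radial_density :: "nat \<Rightarrow> real \<Rightarrow> real" where
  "radial_density d r = vol d * (real d * r ^ (d - 1)) * indicator {0<..} r"

lemma measurable_radial_density [measurable]: "radial_density d \<in> borel_measurable borel"
  unfolding radial_density_def by measurable

lemma radial_density_nonneg: "0 \<le> radial_density d r"
  using vol_pos[of d] by (auto simp: radial_density_def indicator_def)

interpretation lborel_sph: pair_sigma_finite "lborel :: real measure" "uniform_sphere d"
  by standard

text \<open>The polar formula as an identity of measures, in which form it transfers to integrals of
  signed functions.\<close>

lemma leb_eq_polar:
  assumes d: "0 < d"
  shows "leb d = distr (density (lborel \<Otimes>\<^sub>M uniform_sphere d) (\<lambda>Z. ennreal (radial_density d (fst Z))))
    borel (\<lambda>Z. fst Z *\<^sub>R snd Z)"
proof (rule measure_eqI)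
  fix A assume "A \<in> sets (leb d)"
  then have [measurable]: "A \<in> sets borel" by simp
  let ?P = "lborel \<Otimes>\<^sub>M uniform_sphere d"
  have "emeasure (leb d) A = (\<integral>\<^sup>+u. indicator A u \<partial>leb d)" by simp
  also have "\<dots> = ball_vol d * (\<integral>\<^sup>+r. ennreal (real d * r ^ (d - 1)) * indicator {0<..} r
      * (\<integral>\<^sup>+z. indicator A (r *\<^sub>R z) \<partial>uniform_sphere d) \<partial>lborel)"
    by (rule nn_integral_leb_polar[OF _ d]) simp
  also have "\<dots> = (\<integral>\<^sup>+r. ball_vol d * (ennreal (real d * r ^ (d - 1)) * indicator {0<..} r
      * (\<integral>\<^sup>+z. indicator A (r *\<^sub>R z) \<partial>uniform_sphere d)) \<partial>lborel)"
    by (rule nn_integral_cmult[symmetric]) measurable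
  also have "\<dots> = (\<integral>\<^sup>+r. (\<integral>\<^sup>+z. ennreal (radial_density d r) * indicator A (r *\<^sub>R z) \<partial>uniform_sphere d) \<partial>lborel)"
  proof (rule nn_integral_cong)
    fix r :: real
    have "ball_vol d * (ennreal (real d * r ^ (d - 1)) * indicator {0<..} r) = ennreal (radial_density d r)"
      using vol_pos[of d] by (auto simp: radial_density_def ball_vol_eq indicator_def ennreal_mult[symmetric])
    then show "ball_vol d * (ennreal (real d * r ^ (d - 1)) * indicator {0<..} r
        * (\<integral>\<^sup>+z. indicator A (r *\<^sub>R z) \<partial>uniform_sphere d))
        = (\<integral>\<^sup>+z. ennreal (radial_density d r) * indicator A (r *\<^sub>R z) \<partial>uniform_sphere d)"
      by (subst nn_integral_cmult, measurable) (simp only: mult.assoc[symmetric])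
  qed
  also have "\<dots> = (\<integral>\<^sup>+Z. ennreal (radial_density d (fst Z)) * indicator A (fst Z *\<^sub>R snd Z) \<partial>?P)"
    by (subst sph.nn_integral_fst[symmetric]) simp_all
  also have "\<dots> = (\<integral>\<^sup>+Z. indicator A (fst Z *\<^sub>R snd Z) \<partial>density ?P (\<lambda>Z. ennreal (radial_density d (fst Z))))"
    by (rule nn_integral_density[symmetric]) measurable
  also have "\<dots> = (\<integral>\<^sup>+u. indicator A u \<partial>distr (density ?P (\<lambda>Z. ennreal (radial_density d (fst Z)))) borel (\<lambda>Z. fst Z *\<^sub>R snd Z))"
    by (rule nn_integral_distr[symmetric]) measurable
  finally show "emeasure (leb d) A = emeasure (distr (density ?P (\<lambda>Z. ennreal (radial_density d (fst Z)))) borel (\<lambda>Z. fst Z *\<^sub>R snd Z)) A"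
    by simp
qed simp

lemma integral_leb_polar:
  fixes h :: "fseq \<Rightarrow> real"
  assumes d: "0 < d" and h: "integrable (leb d) h"
  shows "(\<integral>u. h u \<partial>leb d) = (\<integral>z. (\<integral>r. radial_density d r * h (r *\<^sub>R z) \<partial>lborel) \<partial>uniform_sphere d)"
proof -
  let ?P = "lborel \<Otimes>\<^sub>M uniform_sphere d"
  have [measurable]: "h \<in> borel_measurable borel" using borel_measurable_integrable[OF h] by simp
  have "integrable (density ?P (\<lambda>Z. ennreal (radial_density d (fst Z)))) (\<lambda>Z. h (fst Z *\<^sub>R snd Z))"
    using h unfolding leb_eq_polar[OF d] by (subst (asm) integrable_distr_eq) measurable
  then have int: "integrable ?P (\<lambda>Z. radial_density d (fst Z) *\<^sub>R h (fst Z *\<^sub>R snd Z))"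
    by (subst (asm) integrable_density) (auto simp: radial_density_nonneg)
  have "(\<integral>u. h u \<partial>leb d) = (\<integral>Z. h (fst Z *\<^sub>R snd Z) \<partial>density ?P (\<lambda>Z. ennreal (radial_density d (fst Z))))"
    by (subst leb_eq_polar[OF d], subst integral_distr) measurable
  also have "\<dots> = (\<integral>Z. radial_density d (fst Z) *\<^sub>R h (fst Z *\<^sub>R snd Z) \<partial>?P)"
    by (rule integral_density) (auto simp: radial_density_nonneg)
  also have "\<dots> = (\<integral>z. (\<integral>r. radial_density d r * h (r *\<^sub>R z) \<partial>lborel) \<partial>uniform_sphere d)"
    using lborel_sph.integral_snd[of d "\<lambda>r z. radial_density d r *\<^sub>R h (r *\<^sub>R z)"] int
    by (simp add: split_beta')
  finally show ?thesis .
qed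

lemma integral_leb_translate:
  fixes h :: "fseq \<Rightarrow> real"
  assumes [measurable]: "h \<in> borel_measurable borel" and v: "v \<in> Rn d"
  shows "(\<integral>u. h (u + v) \<partial>leb d) = (\<integral>u. h u \<partial>leb d)"
proof -
  have "distr (leb d) borel (\<lambda>u. u + v) = leb d"
  proof (rule measure_eqI)
    fix A assume "A \<in> sets (distr (leb d) borel (\<lambda>u. u + v))"
    then have [measurable]: "A \<in> sets borel" by simp
    have "emeasure (distr (leb d) borel (\<lambda>u. u + v)) A = (\<integral>\<^sup>+u. indicator A u \<partial>distr (leb d) borel (\<lambda>u. u + v))" by simp
    also have "\<dots> = (\<integral>\<^sup>+u. indicator A (u + v) \<partial>leb d)" by (rule nn_integral_distr) measurable
    also have "\<dots> = (\<integral>\<^sup>+u. indicator A u \<partial>leb d)" by (rule nn_integral_leb_translate[OF _ v]) measurable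
    finally show "emeasure (distr (leb d) borel (\<lambda>u. u + v)) A = emeasure (leb d) A" by simp
  qed simp
  then have "(\<integral>u. h u \<partial>leb d) = (\<integral>u. h u \<partial>distr (leb d) borel (\<lambda>u. u + v))" by simp
  also have "\<dots> = (\<integral>u. h (u + v) \<partial>leb d)" by (rule integral_distr) measurable
  finally show ?thesis by simp
qed

lemma integrable_leb_bounded_support:
  fixes h :: "fseq \<Rightarrow> real"
  assumes [measurable]: "h \<in> borel_measurable borel" and "\<And>u. \<bar>h u\<bar> \<le> C" "\<And>u. r < norm u \<Longrightarrow> h u = 0"
  shows "integrable (leb d) h"
proof (rule integrableI_bounded_set[where A = "cball 0 r" and B = C])
  show "AE u in leb d. u \<notin> cball 0 r \<longrightarrow> h u = 0" using assms(3) by auto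
qed (use assms(2) emeasure_leb_cball_finite[of d r] in auto)

text \<open>The integrand is, up to endpoints, the indicator of the interval between 0 and
  \<open>b\<close>, taken with the sign of \<open>b\<close>. It is the limiting shape of the
  boundary layer below.\<close>

lemma integral_interval_difference:
  "(\<integral>t. indicator {..<b} t - indicator {..0} t \<partial>lborel) = (b :: real)"
proof (cases "0 \<le> b")
  case True
  have "(\<integral>t. indicator {..<b} t - indicator {..0} t \<partial>lborel) = (\<integral>t. indicator {0<..<b} t - (if b = 0 then indicator {0} t else 0) \<partial>lborel :: real)"
    using True by (intro Bochner_Integration.integral_cong) (auto simp: indicator_def)
  also have "\<dots> = (\<integral>t. indicator {0<..<b} t \<partial>lborel :: real)"
    by (rule integral_cong_AE, measurable, use AE_lborel_singleton[of 0] in eventually_elim) auto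
  also have "\<dots> = b" using True by simp
  finally show ?thesis .
next
  case False
  have "(\<integral>t. indicator {..<b} t - indicator {..0} t \<partial>lborel) = (\<integral>t. - indicator {b..0} t \<partial>lborel :: real)"
    using False by (intro Bochner_Integration.integral_cong) (auto simp: indicator_def)
  also have "\<dots> = b" using False by simp
  finally show ?thesis .
qed

text \<open>Both sides are the derivative at \<open>\<tau> = 0\<close> of the integral of \<open>q\<close> over the ball translated by
  \<open>\<tau> p\<close>; the substitution \<open>r = 1 + \<tau> t\<close> blows up the boundary layer.\<close>

lemma sphere_divergence_limit:
  fixes q :: "fseq \<Rightarrow> real"
  assumes d: "0 < d" and q [measurable]: "q \<in> borel_measurable borel" and C: "\<And>u. \<bar>q u\<bar> \<le> C"
    and cont: "\<And>z. z \<in> Rn d \<Longrightarrow> norm z = 1 \<Longrightarrow> isCont (\<lambda>r. q (r *\<^sub>R z)) 1"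
    and p: "p \<in> Rn d"
  defines "\<tau> \<equiv> \<lambda>j :: nat. 1 / (real j + 1 + norm p)"
  shows "(\<lambda>j. (\<integral>u. indicator (cball 0 1) u * (q (u + \<tau> j *\<^sub>R p) - q u) \<partial>leb d) / \<tau> j)
    \<longlonglongrightarrow> vol d * real d * (\<integral>z. q z * inner p z \<partial>uniform_sphere d)"
proof -
  \<comment> \<open>Signed indicator of the boundary layer: what the ball gains and loses when
    translated by \<open>\<tau> *\<^sub>R p\<close>.\<close>
  define bd :: "real \<Rightarrow> fseq \<Rightarrow> real" where
    "bd \<tau> u = indicator (cball 0 1) (u - \<tau> *\<^sub>R p) - indicator (cball 0 1) u" for \<tau> u
  have [measurable]: "bd t \<in> borel_measurable borel" for t unfolding bd_def by measurable
  have C0: "0 \<le> C" using C[of 0] by simp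
  \<comment> \<open>The summand \<open>norm p\<close> in the denominator keeps the layer inside
    radius 2, where the radial density is at most \<open>D\<close>.\<close>
  have \<tau>: "0 < \<tau> j" "\<tau> j * norm p \<le> 1" for j
  proof -
    have "0 < real j + 1 + norm p" by (simp add: add_pos_nonneg)
    then show "0 < \<tau> j" "\<tau> j * norm p \<le> 1" by (simp_all add: \<tau>_def field_simps)
  qed
  have \<tau>0: "\<tau> \<longlonglongrightarrow> 0"
  proof -
    have "filterlim (\<lambda>j. norm p + 1 + real j) at_top sequentially"
      by (rule filterlim_tendsto_add_at_top[OF tendsto_const filterlim_real_sequentially])
    then have "(\<lambda>j. 1 / (norm p + 1 + real j)) \<longlonglongrightarrow> 0"
      by (rule real_tendsto_divide_at_top[OF tendsto_const])
    then show ?thesis unfolding \<tau>_def by (simp add: add_ac)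
  qed
  define I where "I t z = (\<integral>x. radial_density d (1 + t * x) * (q ((1 + t * x) *\<^sub>R z) * bd t ((1 + t * x) *\<^sub>R z)) \<partial>lborel)" for t z
  define D where "D = vol d * (real d * 2 ^ (d - 1))"
  have D: "0 \<le> D" using vol_pos[of d] by (simp add: D_def)
  \<comment> \<open>By the triangle inequality the layer is confined to radii
    \<open>1 + \<tau> * x\<close> with \<open>\<bar>x\<bar> \<le> norm p\<close>, so one compactly
    supported function dominates all scales.\<close>
  let ?w = "\<lambda>x. D * C * indicator {- norm p..norm p} x"
  have dom: "\<bar>radial_density d (1 + \<tau> j * x) * (q ((1 + \<tau> j * x) *\<^sub>R z) * bd (\<tau> j) ((1 + \<tau> j * x) *\<^sub>R z))\<bar> \<le> ?w x"
    if z: "norm z = 1" for j x z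
  proof (cases "1 + \<tau> j * x \<le> 0")
    case True
    then show ?thesis using D C0 by (simp add: radial_density_def)
  next
    case r: False
    define r where "r = 1 + \<tau> j * x"
    have r0: "0 < r" using r by (simp add: r_def)
    show ?thesis
    proof (cases "\<bar>x\<bar> \<le> norm p")
      case True
      have "\<tau> j * x \<le> \<tau> j * norm p" using True \<tau>[of j] by (intro mult_left_mono) auto
      then have "r \<le> 2" using \<tau>(2)[of j] by (simp add: r_def)
      then have "radial_density d r \<le> D"
        using r0 vol_pos[of d] unfolding radial_density_def D_def by (simp add: mult_left_mono power_mono)
      moreover have "\<bar>bd (\<tau> j) (r *\<^sub>R z)\<bar> \<le> 1" by (auto simp: bd_def indicator_def)
      then have "\<bar>q (r *\<^sub>R z)\<bar> * \<bar>bd (\<tau> j) (r *\<^sub>R z)\<bar> \<le> C * 1"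
        using C C0 by (intro mult_mono) auto
      then have qb: "\<bar>q (r *\<^sub>R z)\<bar> * \<bar>bd (\<tau> j) (r *\<^sub>R z)\<bar> \<le> C" by simp
      ultimately have "radial_density d r * (\<bar>q (r *\<^sub>R z)\<bar> * \<bar>bd (\<tau> j) (r *\<^sub>R z)\<bar>) \<le> D * C"
        by (intro mult_mono D) auto
      then show ?thesis using True radial_density_nonneg[of d r]
        by (simp add: r_def[symmetric] abs_mult indicator_def abs_le_iff)
    next
      case False
      have nz: "norm (r *\<^sub>R z) = r" using z r0 by simp
      have diff: "\<bar>norm (r *\<^sub>R z - \<tau> j *\<^sub>R p) - r\<bar> \<le> \<tau> j * norm p"
        using norm_triangle_ineq3[of "r *\<^sub>R z - \<tau> j *\<^sub>R p" "r *\<^sub>R z"] \<tau>(1)[of j] nz by simp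
      have tp: "0 \<le> \<tau> j * norm p" using \<tau>(1)[of j] by simp
      have "bd (\<tau> j) (r *\<^sub>R z) = 0"
      proof (cases "0 \<le> x")
        case True
        then have "\<tau> j * norm p < \<tau> j * x" using False \<tau>(1)[of j] by simp
        then have "1 < r" "1 < norm (r *\<^sub>R z - \<tau> j *\<^sub>R p)"
          using diff[unfolded abs_le_iff] tp unfolding r_def by linarith+
        then show ?thesis using nz by (simp add: bd_def)
      next
        case neg: False
        then have "\<tau> j * norm p < \<tau> j * (- x)" using False \<tau>(1)[of j] by (intro mult_strict_left_mono) auto
        then have "\<tau> j * norm p < - (\<tau> j * x)" by simp
        then have "r \<le> 1" "norm (r *\<^sub>R z - \<tau> j *\<^sub>R p) \<le> 1"
          using diff[unfolded abs_le_iff] tp unfolding r_def by linarith+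
        then show ?thesis using nz by (simp add: bd_def)
      qed
      then show ?thesis using D C0 by (simp add: r_def[symmetric])
    qed
  qed
  have wint: "integrable lborel ?w" by (intro integrable_mult_right) (auto intro: integrable_real_indicator)
  have Ilim: "(\<lambda>j. I (\<tau> j) z) \<longlonglongrightarrow> vol d * real d * (q z * inner p z)" if z: "z \<in> Rn d" "norm z = 1" for z
  proof -
    define b where "b = inner p z"
    let ?f = "\<lambda>x. vol d * real d * q z * (indicator {..<b} x - indicator {..0} x)"
    have "(\<lambda>j. I (\<tau> j) z) \<longlonglongrightarrow> (\<integral>x. ?f x \<partial>lborel)"
      unfolding I_def
    proof (rule integral_dominated_convergence[OF _ _ wint])
      \<comment> \<open>The point \<open>x = b\<close> is left out: there the first-order term
        vanishes and the limit of the indicator is undecided.\<close>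
      show "AE x in lborel. (\<lambda>j. radial_density d (1 + \<tau> j * x) * (q ((1 + \<tau> j * x) *\<^sub>R z) * bd (\<tau> j) ((1 + \<tau> j * x) *\<^sub>R z))) \<longlonglongrightarrow> ?f x"
        using AE_lborel_singleton[of b]
      proof eventually_elim
        fix x :: real assume xb: "x \<noteq> b"
        have r1: "(\<lambda>j. 1 + \<tau> j * x) \<longlonglongrightarrow> 1" by (rule tendsto_eq_intros \<tau>0 refl | simp)+
        have rpos: "\<forall>\<^sub>F j in sequentially. 0 < 1 + \<tau> j * x" by (rule order_tendstoD(1)[OF r1]) simp
        have l1: "(\<lambda>j. radial_density d (1 + \<tau> j * x)) \<longlonglongrightarrow> vol d * real d"
        proof (rule Lim_transform_eventually)
          show "(\<lambda>j. vol d * (real d * (1 + \<tau> j * x) ^ (d - 1))) \<longlonglongrightarrow> vol d * real d"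
            by (rule tendsto_eq_intros r1 refl | simp)+
          show "\<forall>\<^sub>F j in sequentially. vol d * (real d * (1 + \<tau> j * x) ^ (d - 1)) = radial_density d (1 + \<tau> j * x)"
            using rpos by eventually_elim (simp add: radial_density_def)
        qed
        have l2: "(\<lambda>j. q ((1 + \<tau> j * x) *\<^sub>R z)) \<longlonglongrightarrow> q z"
          using isCont_tendsto_compose[OF cont[OF z] r1] by simp
        have l3: "(\<lambda>j. bd (\<tau> j) ((1 + \<tau> j * x) *\<^sub>R z)) \<longlonglongrightarrow> indicator {..<b} x - indicator {..0} x"
        proof (rule tendsto_eventually)
          \<comment> \<open>The expression is \<open>(norm ((1 + \<tau> j * x) *\<^sub>R z - \<tau>
            j *\<^sub>R p))\<^sup>2 - 1\<close> divided by \<open>\<tau> j\<close>; its sign decides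
            membership in the translated ball and tends to the sign of \<open>x - b\<close>.\<close>
          have "(\<lambda>j. 2 * (x - b) + \<tau> j * (x\<^sup>2 - 2 * x * b + (norm p)\<^sup>2)) \<longlonglongrightarrow> 2 * (x - b)"
            by (rule tendsto_eq_intros \<tau>0 refl | simp)+
          note lim = this
          have "\<forall>\<^sub>F j in sequentially. (2 * (x - b) + \<tau> j * (x\<^sup>2 - 2 * x * b + (norm p)\<^sup>2) \<le> 0) = (x < b)"
          proof (cases "x < b")
            case True
            then have "2 * (x - b) < 0" by simp
            from order_tendstoD(2)[OF lim this] show ?thesis
              by eventually_elim (use True in auto)
          next
            case False
            then have "0 < 2 * (x - b)" using xb by simp
            from order_tendstoD(1)[OF lim this] show ?thesis
              by eventually_elim (use False in auto)
          qed
          with rpos show "\<forall>\<^sub>F j in sequentially. bd (\<tau> j) ((1 + \<tau> j * x) *\<^sub>R z) = indicator {..<b} x - indicator {..0} x"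
          proof eventually_elim
            fix j
            assume pos: "0 < 1 + \<tau> j * x"
              and eq: "(2 * (x - b) + \<tau> j * (x\<^sup>2 - 2 * x * b + (norm p)\<^sup>2) \<le> 0) = (x < b)"
            have "(norm ((1 + \<tau> j * x) *\<^sub>R z - \<tau> j *\<^sub>R p))\<^sup>2
                = (1 + \<tau> j * x)\<^sup>2 * inner z z - 2 * (1 + \<tau> j * x) * \<tau> j * inner p z + (\<tau> j)\<^sup>2 * inner p p"
              unfolding power2_norm_eq_inner
              by (simp add: inner_diff_left inner_diff_right inner_commute[of z p] power2_eq_square algebra_simps)
            also have "inner z z = 1" using z by (simp add: dot_square_norm)
            also have "inner p p = (norm p)\<^sup>2" by (simp add: dot_square_norm)
            finally have "(norm ((1 + \<tau> j * x) *\<^sub>R z - \<tau> j *\<^sub>R p))\<^sup>2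
                = 1 + \<tau> j * (2 * (x - b) + \<tau> j * (x\<^sup>2 - 2 * x * b + (norm p)\<^sup>2))"
              by (simp add: b_def power2_eq_square algebra_simps)
            moreover have "norm ((1 + \<tau> j * x) *\<^sub>R z - \<tau> j *\<^sub>R p) \<le> 1 \<longleftrightarrow> (norm ((1 + \<tau> j * x) *\<^sub>R z - \<tau> j *\<^sub>R p))\<^sup>2 \<le> 1"
              by (simp add: abs_square_le_1)
            ultimately have "norm ((1 + \<tau> j * x) *\<^sub>R z - \<tau> j *\<^sub>R p) \<le> 1 \<longleftrightarrow> x < b"
              using \<tau>(1)[of j] eq by (simp add: mult_le_0_iff)
            moreover have "norm ((1 + \<tau> j * x) *\<^sub>R z) \<le> 1 \<longleftrightarrow> x \<le> 0"
              using pos z \<tau>(1)[of j] by (simp add: mult_le_0_iff)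
            ultimately show "bd (\<tau> j) ((1 + \<tau> j * x) *\<^sub>R z) = indicator {..<b} x - indicator {..0} x"
              by (simp add: bd_def indicator_def)
          qed
        qed
        show "(\<lambda>j. radial_density d (1 + \<tau> j * x) * (q ((1 + \<tau> j * x) *\<^sub>R z) * bd (\<tau> j) ((1 + \<tau> j * x) *\<^sub>R z))) \<longlonglongrightarrow> ?f x"
          using tendsto_mult[OF l1 tendsto_mult[OF l2 l3]] by (simp add: mult_ac)
      qed
    next
      fix j
      show "AE x in lborel. norm (radial_density d (1 + \<tau> j * x) * (q ((1 + \<tau> j * x) *\<^sub>R z) * bd (\<tau> j) ((1 + \<tau> j * x) *\<^sub>R z))) \<le> ?w x"
        using dom[OF z(2), of j] by simp
    qed measurable
    also have "(\<integral>x. ?f x \<partial>lborel) = vol d * real d * (q z * inner p z)"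
      by (simp add: integral_interval_difference b_def)
    finally show ?thesis .
  qed
  have Ibound: "\<bar>I (\<tau> j) z\<bar> \<le> D * C * (2 * norm p)" if z: "norm z = 1" for j z
  proof -
    have "norm (I (\<tau> j) z) \<le> (\<integral>x. ?w x \<partial>lborel)"
      unfolding I_def
    proof (rule Bochner_Integration.integral_norm_bound_integral[OF _ wint])
      show "integrable lborel (\<lambda>x. radial_density d (1 + \<tau> j * x) * (q ((1 + \<tau> j * x) *\<^sub>R z) * bd (\<tau> j) ((1 + \<tau> j * x) *\<^sub>R z)))"
      proof (rule Bochner_Integration.integrable_bound[OF wint])
        show "AE x in lborel. norm (radial_density d (1 + \<tau> j * x) * (q ((1 + \<tau> j * x) *\<^sub>R z) * bd (\<tau> j) ((1 + \<tau> j * x) *\<^sub>R z))) \<le> norm (?w x)"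
          by (rule AE_I2, unfold real_norm_def, rule order_trans[OF dom[OF z] abs_ge_self])
      qed measurable
      show "norm (radial_density d (1 + \<tau> j * x) * (q ((1 + \<tau> j * x) *\<^sub>R z) * bd (\<tau> j) ((1 + \<tau> j * x) *\<^sub>R z))) \<le> ?w x" for x
        unfolding real_norm_def by (rule dom[OF z])
    qed
    then show ?thesis by (simp add: mult_ac)
  qed
  have quot: "(\<integral>u. indicator (cball 0 1) u * (q (u + \<tau> j *\<^sub>R p) - q u) \<partial>leb d) / \<tau> j = (\<integral>z. I (\<tau> j) z \<partial>uniform_sphere d)" for j
  proof -
    define v where "v = \<tau> j *\<^sub>R p"
    have v: "v \<in> Rn d" using p by (auto simp: v_def)
    have i1: "integrable (leb d) (\<lambda>u. indicator (cball 0 1) u * q u)"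
      by (rule integrable_leb_bounded_support[where r = 1 and C = C]) (use C C0 in \<open>auto simp: indicator_def\<close>)
    have i2: "integrable (leb d) (\<lambda>u. indicator (cball 0 1) u * q (u + v))"
      by (rule integrable_leb_bounded_support[where r = 1 and C = C]) (use C C0 in \<open>auto simp: indicator_def\<close>)
    have i3: "integrable (leb d) (\<lambda>u. indicator (cball 0 1) (u - v) * q u)"
    proof (rule integrable_leb_bounded_support[where r = "1 + norm v" and C = C])
      fix u :: fseq assume "1 + norm v < norm u"
      then have "\<not> norm (u - v) \<le> 1" using norm_triangle_sub[of u v] by linarith
      then show "indicator (cball 0 1) (u - v) * q u = 0" by simp
    qed (use C C0 in \<open>auto simp: indicator_def\<close>)
    have "(\<integral>u. indicator (cball 0 1) u * (q (u + v) - q u) \<partial>leb d)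
        = (\<integral>u. indicator (cball 0 1) u * q (u + v) \<partial>leb d) - (\<integral>u. indicator (cball 0 1) u * q u \<partial>leb d)"
      using i1 i2 by (simp add: right_diff_distrib)
    also have "(\<integral>u. indicator (cball 0 1) u * q (u + v) \<partial>leb d) = (\<integral>u. indicator (cball 0 1) (u - v) * q u \<partial>leb d)"
      using integral_leb_translate[OF _ v, of "\<lambda>u. indicator (cball 0 1) (u - v) * q u"] by simp
    also have "(\<integral>u. indicator (cball 0 1) (u - v) * q u \<partial>leb d) - (\<integral>u. indicator (cball 0 1) u * q u \<partial>leb d)
        = (\<integral>u. q u * bd (\<tau> j) u \<partial>leb d)"
      using i1 i3 by (subst Bochner_Integration.integral_diff[symmetric]) (auto simp: bd_def v_def algebra_simps)
    also have "\<dots> = (\<integral>z. (\<integral>r. radial_density d r * (q (r *\<^sub>R z) * bd (\<tau> j) (r *\<^sub>R z)) \<partial>lborel) \<partial>uniform_sphere d)"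
    proof (rule integral_leb_polar[OF d])
      have "integrable (leb d) (\<lambda>u. indicator (cball 0 1) (u - v) * q u - indicator (cball 0 1) u * q u)"
        using i1 i3 by simp
      then show "integrable (leb d) (\<lambda>u. q u * bd (\<tau> j) u)" by (simp add: bd_def v_def algebra_simps)
    qed
    \<comment> \<open>The substitution \<open>r = 1 + \<tau> j * x\<close> supplies the factor that
      cancels the denominator of the difference quotient.\<close>
    also have "\<dots> = (\<integral>z. \<tau> j * I (\<tau> j) z \<partial>uniform_sphere d)"
    proof (rule Bochner_Integration.integral_cong[OF refl])
      fix z
      show "(\<integral>r. radial_density d r * (q (r *\<^sub>R z) * bd (\<tau> j) (r *\<^sub>R z)) \<partial>lborel) = \<tau> j * I (\<tau> j) z"
        unfolding I_def using \<tau>(1)[of j]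
        by (subst lborel_integral_real_affine[where c = "\<tau> j" and t = 1]) auto
    qed
    finally show ?thesis using \<tau>(1)[of j] by (simp add: v_def)
  qed
  have AEz: "AE z in uniform_sphere d. z \<in> Rn d \<and> norm z = 1" by (rule AE_uniform_sphere[OF d])
  have [measurable]: "(\<lambda>z. I t z) \<in> borel_measurable (uniform_sphere d)" for t
    unfolding I_def by measurable
  have "(\<lambda>j. \<integral>z. I (\<tau> j) z \<partial>uniform_sphere d) \<longlonglongrightarrow> (\<integral>z. vol d * real d * (q z * inner p z) \<partial>uniform_sphere d)"
  proof (rule integral_dominated_convergence[where w = "\<lambda>_. D * C * (2 * norm p)"])
    show "AE z in uniform_sphere d. (\<lambda>j. I (\<tau> j) z) \<longlonglongrightarrow> vol d * real d * (q z * inner p z)"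
      using AEz by eventually_elim (use Ilim in auto)
    show "AE z in uniform_sphere d. norm (I (\<tau> j) z) \<le> D * C * (2 * norm p)" for j
      using AEz by eventually_elim (use Ibound in auto)
    show "(\<lambda>z. vol d * real d * (q z * inner p z)) \<in> borel_measurable (uniform_sphere d)" by measurable
    show "I (\<tau> j) \<in> borel_measurable (uniform_sphere d)" for j by measurable
    show "integrable (uniform_sphere d) (\<lambda>_. D * C * (2 * norm p))" by simp
  qed
  then show ?thesis unfolding quot by simp
qed

subsection \<open>Weakly convex Lipschitz functions on a ball\<close>

lemma norm_convex_combination_sq:
  fixes x y :: fseq
  shows "(norm ((1 - t) *\<^sub>R x + t *\<^sub>R y))\<^sup>2 = (1 - t) * (norm x)\<^sup>2 + t * (norm y)\<^sup>2 - t * (1 - t) * (norm (x - y))\<^sup>2"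
  unfolding power2_norm_eq_inner
  by (simp add: inner_add_left inner_add_right inner_diff_left inner_diff_right inner_commute[of y x]
      power2_eq_square algebra_simps)

lemma norm_add_scaleR_sq:
  fixes a b :: fseq
  shows "(norm (a + l *\<^sub>R b))\<^sup>2 = (norm a)\<^sup>2 + 2 * l * inner a b + l\<^sup>2 * (norm b)\<^sup>2"
  unfolding power2_norm_eq_inner
  by (simp add: inner_add_left inner_add_right inner_commute[of b a] power2_eq_square algebra_simps)

text \<open>The limit \<open>l\<close> to 0, in a form that suits first-order optimality
  arguments.\<close>

lemma nonneg_if_perturbed_nonneg:
  fixes A K :: real
  assumes "\<And>l. 0 < l \<Longrightarrow> l \<le> 1 \<Longrightarrow> 0 \<le> A + l * K" "0 \<le> K"
  shows "0 \<le> A"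
proof (rule ccontr)
  assume "\<not> 0 \<le> A"
  then have A: "0 < - A" by simp
  define l where "l = min 1 (- A / (2 * (K + 1)))"
  have "0 < - A / (2 * (K + 1))" using A assms(2) by (intro divide_pos_pos) auto
  then have l: "0 < l" "l \<le> 1" by (simp_all add: l_def)
  have "l * K \<le> - A / (2 * (K + 1)) * K" using assms(2) by (intro mult_right_mono) (auto simp: l_def)
  also have "\<dots> = - A / 2 * (K / (K + 1))" by (simp add: field_simps)
  also have "\<dots> \<le> - A / 2 * 1" using A assms(2) by (intro mult_left_mono) auto
  finally show False using assms(1)[OF l] A by simp
qed

text \<open>A ball of the sequence space is infinite-dimensional, hence the intersection with
  \<open>Rn d\<close>. Its compactness will come from that of the sublevel sets.\<close>

locale weakly_convex_ball =
  fixes d :: nat and x0 :: fseq and rad g \<mu> :: real and f :: "fseq \<Rightarrow> real"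
  assumes d: "3 \<le> d" and x0: "x0 \<in> Rn d" and rad: "0 < rad" and g: "0 < g" and \<mu>: "0 \<le> \<mu>"
    and compact_ball: "compact (cball x0 rad \<inter> Rn d)"
    and lip: "\<And>x y. x \<in> cball x0 rad \<inter> Rn d \<Longrightarrow> y \<in> cball x0 rad \<inter> Rn d \<Longrightarrow> \<bar>f x - f y\<bar> \<le> g * norm (x - y)"
    and weakly_convex: "convex_on (cball x0 rad \<inter> Rn d) (\<lambda>x. f x + \<mu> / 2 * (norm x)\<^sup>2)"
begin

abbreviation B where "B \<equiv> cball x0 rad \<inter> Rn d"

text \<open>Extension by zero makes the function measurable and bounded on the whole space, so it
  can be integrated without tracking where its argument lies.\<close>

definition F where "F x = (if x \<in> B then f x else 0)"

lemma d0: "0 < d" using d by simp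

lemma BI: "x \<in> Rn d \<Longrightarrow> norm (x - x0) \<le> rad \<Longrightarrow> x \<in> B"
  by (simp add: dist_norm norm_minus_commute)

lemma x0_B: "x0 \<in> B" using x0 rad by simp

lemma convex_B: "convex B" by (intro convex_Int convex_cball convex_Rn)

lemma F_lip: "x \<in> B \<Longrightarrow> y \<in> B \<Longrightarrow> \<bar>F x - F y\<bar> \<le> g * norm (x - y)"
  using lip by (simp add: F_def)

lemma continuous_on_F: "continuous_on B F"
proof -
  have "g-lipschitz_on B F"
    using F_lip g by (intro lipschitz_onI) (auto simp: dist_norm)
  then show ?thesis by (rule lipschitz_on_continuous_on)
qed

lemma measurable_F [measurable]: "F \<in> borel_measurable borel"
proof -
  have "(\<lambda>x. indicator B x *\<^sub>R F x) \<in> borel_measurable borel"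
    by (rule borel_measurable_continuous_on_indicator[OF _ continuous_on_F]) measurable
  moreover have "(\<lambda>x. indicator B x *\<^sub>R F x) = F" by (auto simp: F_def fun_eq_iff)
  ultimately show ?thesis by simp
qed

lemma F_bounded: "\<bar>F x\<bar> \<le> \<bar>F x0\<bar> + g * rad"
proof (cases "x \<in> B")
  case True
  have "\<bar>F x - F x0\<bar> \<le> g * norm (x - x0)" by (rule F_lip[OF True x0_B])
  also have "\<dots> \<le> g * rad" using True g by (intro mult_left_mono) (auto simp: dist_norm norm_minus_commute)
  finally show ?thesis by linarith
next
  case False
  then have "F x = 0" by (simp only: F_def if_False)
  then show ?thesis using mult_pos_pos[OF g rad] by simp
qed

text \<open>Expanding the squared norm of a convex combination leaves a defect that depends only on
  \<open>norm (x - y)\<close>.\<close>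

lemma F_segment:
  assumes "x \<in> B" "y \<in> B" "0 \<le> t" "t \<le> 1"
  shows "F ((1 - t) *\<^sub>R x + t *\<^sub>R y) \<le> (1 - t) * F x + t * F y + \<mu> / 2 * (t * (1 - t)) * (norm (x - y))\<^sup>2"
proof -
  have c: "(1 - t) *\<^sub>R x + t *\<^sub>R y \<in> B"
    using convexD_alt[OF convex_B assms(1,2,3,4)] .
  have "f ((1 - t) *\<^sub>R x + t *\<^sub>R y) + \<mu> / 2 * (norm ((1 - t) *\<^sub>R x + t *\<^sub>R y))\<^sup>2
      \<le> (1 - t) * (f x + \<mu> / 2 * (norm x)\<^sup>2) + t * (f y + \<mu> / 2 * (norm y)\<^sup>2)"
    by (rule convex_onD[OF weakly_convex assms(3,4,1,2)])
  moreover have "F ((1 - t) *\<^sub>R x + t *\<^sub>R y) = f ((1 - t) *\<^sub>R x + t *\<^sub>R y)" "F x = f x" "F y = f y"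
    using c assms(1,2) by (simp_all only: F_def if_True)
  ultimately show ?thesis
    unfolding norm_convex_combination_sq by (simp add: algebra_simps add_divide_distrib diff_divide_distrib)
qed

text \<open>First-order optimality of a constrained proximal point: compare \<open>v\<close> with
  the points of the segment from \<open>v\<close> to \<open>y\<close>, divide by the segment
  parameter and let it tend to 0. Convexity of the ball keeps the segment admissible.\<close>

lemma prox_subgradient:
  assumes v: "v \<in> B" and t: "0 < t"
    and min: "\<And>y. y \<in> B \<Longrightarrow> F v + (norm (v - w))\<^sup>2 / (2 * t) \<le> F y + (norm (y - w))\<^sup>2 / (2 * t)" and y: "y \<in> B"
  shows "F v + inner ((1 / t) *\<^sub>R (w - v)) (y - v) - \<mu> / 2 * (norm (y - v))\<^sup>2 \<le> F y"
proof -
  define A where "A = F y - F v + \<mu> / 2 * (norm (y - v))\<^sup>2 + inner (v - w) (y - v) / t"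
  define K where "K = (norm (y - v))\<^sup>2 / (2 * t)"
  have K: "0 \<le> K" using t by (simp add: K_def)
  have "0 \<le> A + l * K" if l: "0 < l" "l \<le> 1" for l
  proof -
    define u where "u = (1 - l) *\<^sub>R v + l *\<^sub>R y"
    have u: "u \<in> B" unfolding u_def using convexD_alt[OF convex_B v y] l by simp
    have uw: "(norm (u - w))\<^sup>2 = (norm (v - w))\<^sup>2 + 2 * l * inner (v - w) (y - v) + l\<^sup>2 * (norm (y - v))\<^sup>2"
    proof -
      have "u - w = (v - w) + l *\<^sub>R (y - v)" by (simp add: u_def algebra_simps)
      then show ?thesis by (simp only: norm_add_scaleR_sq)
    qed
    have "F v + (norm (v - w))\<^sup>2 / (2 * t) \<le> F u + (norm (u - w))\<^sup>2 / (2 * t)" by (rule min[OF u])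
    also have "F u \<le> (1 - l) * F v + l * F y + \<mu> / 2 * (l * (1 - l)) * (norm (v - y))\<^sup>2"
      unfolding u_def by (rule F_segment[OF v y]) (use l in auto)
    also have "\<mu> / 2 * (l * (1 - l)) * (norm (v - y))\<^sup>2 \<le> \<mu> / 2 * (l * 1) * (norm (v - y))\<^sup>2"
      using l \<mu> by (intro mult_right_mono mult_left_mono) auto
    finally have "0 \<le> l * (F y - F v) + \<mu> / 2 * l * (norm (y - v))\<^sup>2
        + ((norm (u - w))\<^sup>2 - (norm (v - w))\<^sup>2) / (2 * t)"
      by (simp add: norm_minus_commute[of v y] algebra_simps diff_divide_distrib)
    also have "((norm (u - w))\<^sup>2 - (norm (v - w))\<^sup>2) / (2 * t) = l * (inner (v - w) (y - v) / t + l * K)"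
      unfolding uw K_def using t by (simp add: field_simps power2_eq_square)
    finally have "0 \<le> l * (A + l * K)" by (simp add: A_def algebra_simps)
    then show ?thesis using l by (simp add: zero_le_mult_iff)
  qed
  then have "0 \<le> A" using K by (rule nonneg_if_perturbed_nonneg)
  moreover have "inner ((1 / t) *\<^sub>R (w - v)) (y - v) = - (inner (v - w) (y - v) / t)"
    by (simp add: inner_diff_left diff_divide_distrib)
  ultimately show ?thesis by (simp add: A_def)
qed

text \<open>The proximal point \<open>v\<close> of \<open>w\<close> for a short step
  \<open>t\<close> lies within \<open>2 * g * t\<close> of \<open>w\<close> by the Lipschitz
  property, so \<open>(w - v) / t\<close> has norm at most \<open>2 * g\<close> and is a subgradient
  at a point close to \<open>w\<close>. This works on the boundary of the ball as well.\<close>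

lemma approx_subgradient:
  assumes w: "w \<in> B" and \<tau>: "0 < \<tau>"
  shows "\<exists>s\<in>Rn d. norm s \<le> 2 * g \<and> (\<forall>y\<in>B. F w + inner s (y - w) - \<mu> * (norm (y - w))\<^sup>2 - \<tau> \<le> F y)"
proof -
  \<comment> \<open>Transferring the inequality from \<open>v\<close> to \<open>w\<close> costs
    \<open>2 * g * e\<close> in the linear term, \<open>g * e\<close> in the value and
    \<open>\<mu> * e\<^sup>2\<close> in the quadratic term.\<close>
  define e where "e = min 1 (\<tau> / (3 * g + \<mu>))"
  have gm: "0 < 3 * g + \<mu>" using g \<mu> by simp
  have e: "0 < e" "e \<le> 1" using \<tau> gm by (auto simp: e_def)
  have e\<tau>: "3 * g * e + \<mu> * e\<^sup>2 \<le> \<tau>"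
  proof -
    have "e\<^sup>2 \<le> e" using e by (simp add: power2_eq_square mult_le_one)
    then have "\<mu> * e\<^sup>2 \<le> \<mu> * e" using \<mu> by (rule mult_left_mono)
    then have "3 * g * e + \<mu> * e\<^sup>2 \<le> (3 * g + \<mu>) * e" by (simp add: algebra_simps)
    also have "\<dots> \<le> (3 * g + \<mu>) * (\<tau> / (3 * g + \<mu>))" using gm by (intro mult_left_mono) (auto simp: e_def)
    finally show ?thesis using gm by simp
  qed
  define t where "t = e / (2 * g)"
  have t: "0 < t" "2 * g * t = e" using e g by (auto simp: t_def)
  have cont: "continuous_on B (\<lambda>v. F v + (norm (v - w))\<^sup>2 / (2 * t))"
    by (intro continuous_intros continuous_on_F) (use t in auto)
  obtain v where v: "v \<in> B" and min: "\<And>y. y \<in> B \<Longrightarrow> F v + (norm (v - w))\<^sup>2 / (2 * t) \<le> F y + (norm (y - w))\<^sup>2 / (2 * t)"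
    using continuous_attains_inf[OF compact_ball _ cont] x0_B by blast
  define s where "s = (1 / t) *\<^sub>R (w - v)"
  have vw: "norm (v - w) \<le> e"
  proof -
    have "(norm (v - w))\<^sup>2 / (2 * t) \<le> F w - F v" using min[OF w] by simp
    also have "\<dots> \<le> g * norm (v - w)" using F_lip[OF v w] by linarith
    finally have "(norm (v - w))\<^sup>2 \<le> (g * norm (v - w)) * (2 * t)"
      using t(1) by (simp only: divide_le_eq)
    then have "norm (v - w) * norm (v - w) \<le> (2 * g * t) * norm (v - w)"
      unfolding power2_eq_square by (simp only: mult_ac)
    then have "norm (v - w) \<le> 2 * g * t \<or> norm (v - w) = 0"
      by (metis mult_right_le_imp_le norm_ge_zero less_eq_real_def)
    then show ?thesis using t e by auto
  qed
  have s: "s \<in> Rn d" using v w by (auto simp: s_def)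
  have ns: "norm s \<le> 2 * g"
  proof -
    have "norm s = norm (v - w) / t" using t by (simp add: s_def norm_minus_commute)
    also have "\<dots> \<le> e / t" using vw t by (intro divide_right_mono) auto
    also have "\<dots> = 2 * g" using t by (simp add: field_simps)
    finally show ?thesis .
  qed
  have "F w + inner s (y - w) - \<mu> * (norm (y - w))\<^sup>2 - \<tau> \<le> F y" if y: "y \<in> B" for y
  proof -
    have 1: "F v + inner s (y - v) - \<mu> / 2 * (norm (y - v))\<^sup>2 \<le> F y"
      unfolding s_def by (rule prox_subgradient[OF v t(1) min y])
    have "inner s (y - v) = inner s (y - w) + inner s (w - v)" by (simp add: inner_diff_right)
    moreover have "\<bar>inner s (w - v)\<bar> \<le> norm s * norm (w - v)" by (rule Cauchy_Schwarz_ineq2)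
    moreover have "norm s * norm (w - v) \<le> (2 * g) * e"
      using ns vw g by (intro mult_mono) (auto simp: norm_minus_commute)
    ultimately have 2: "inner s (y - w) - 2 * g * e \<le> inner s (y - v)" by linarith
    have "g * norm (v - w) \<le> g * e" using vw g by (intro mult_left_mono) auto
    then have 3: "F w - g * e \<le> F v" using F_lip[OF v w] by linarith
    \<comment> \<open>Recentring the quadratic at \<open>w\<close> doubles its coefficient from
      \<open>\<mu> / 2\<close> to \<open>\<mu>\<close>.\<close>
    have "norm (y - v) \<le> norm (y - w) + e"
      using norm_triangle_ineq[of "y - w" "w - v"] vw by (simp add: norm_minus_commute)
    then have "(norm (y - v))\<^sup>2 \<le> (norm (y - w) + e)\<^sup>2" by (intro power_mono) auto
    also have "\<dots> \<le> 2 * (norm (y - w))\<^sup>2 + 2 * e\<^sup>2"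
      using sum_squares_bound[of "norm (y - w)" e] by (simp add: power2_sum)
    finally have "\<mu> / 2 * (norm (y - v))\<^sup>2 \<le> \<mu> / 2 * (2 * (norm (y - w))\<^sup>2 + 2 * e\<^sup>2)"
      using \<mu> by (intro mult_left_mono) auto
    then have 4: "\<mu> / 2 * (norm (y - v))\<^sup>2 \<le> \<mu> * (norm (y - w))\<^sup>2 + \<mu> * e\<^sup>2" by (simp add: algebra_simps)
    show ?thesis using 1 2 3 4 e\<tau> by linarith
  qed
  then show ?thesis using s ns by blast
qed

end

text \<open>Strictness of the last assumption leaves a collar around the smoothing sphere, on which
  the function is still continuous in the radial direction.\<close>

locale gradient_estimate = weakly_convex_ball +
  fixes x :: fseq and \<nu> :: real
  assumes x: "x \<in> Rn d" and \<nu>: "0 < \<nu>" and x\<nu>: "norm (x - x0) + \<nu> < rad"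
begin

lemma shifted_in_B:
  assumes "u \<in> Rn d" "norm u \<le> 1" "v \<in> Rn d" "norm (x - x0) + \<nu> + norm v \<le> rad"
  shows "x + \<nu> *\<^sub>R u + v \<in> B"
proof (rule BI)
  show "x + \<nu> *\<^sub>R u + v \<in> Rn d" using assms x by auto
  have "norm (x + \<nu> *\<^sub>R u + v - x0) = norm ((x - x0) + (\<nu> *\<^sub>R u + v))" by (simp add: algebra_simps)
  also have "\<dots> \<le> norm (x - x0) + (norm (\<nu> *\<^sub>R u) + norm v)"
    by (intro norm_triangle_le add_left_mono norm_triangle_ineq)
  also have "norm (\<nu> *\<^sub>R u) \<le> \<nu>" using assms(2) \<nu> by (simp add: mult_left_le)
  finally show "norm (x + \<nu> *\<^sub>R u + v - x0) \<le> rad" using assms(4) by linarith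
qed

lemma shifted_in_B0: "u \<in> Rn d \<Longrightarrow> norm u \<le> 1 \<Longrightarrow> x + \<nu> *\<^sub>R u \<in> B"
  using shifted_in_B[of u 0] x\<nu> by auto

text \<open>Poincare for \<open>z \<mapsto> F (x + \<nu> *\<^sub>R z)\<close>: scaling by \<nu>
  gives subgradients of norm at most \<open>2 * g * \<nu>\<close> and curvature
  \<open>\<mu> * \<nu>\<^sup>2\<close>.\<close>

lemma second_moment:
  "(\<integral>\<^sup>+z. ennreal ((F (x + \<nu> *\<^sub>R z) - F (x - \<nu> *\<^sub>R z))\<^sup>2) \<partial>uniform_sphere d) \<le> ennreal (8192 * g\<^sup>2 * \<nu>\<^sup>2 / real d)"
proof -
  have "(\<integral>\<^sup>+z. ennreal ((F (x + \<nu> *\<^sub>R z) - F (x + \<nu> *\<^sub>R (- z)))\<^sup>2) \<partial>uniform_sphere d)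
      \<le> ennreal (2048 * (2 * g * \<nu>)\<^sup>2 / real d)"
  proof (rule uniform_sphere_poincare[OF d, where k = "\<lambda>z. F (x + \<nu> *\<^sub>R z)" and M = "\<mu> * \<nu>\<^sup>2"])
    fix z \<tau> assume z: "z \<in> Rn d" "norm z = 1" and \<tau>: "(0 :: real) < \<tau>"
    have "x + \<nu> *\<^sub>R z \<in> B" using z by (intro shifted_in_B0) auto
    from approx_subgradient[OF this \<tau>] obtain s where s: "s \<in> Rn d" "norm s \<le> 2 * g"
      "\<And>y. y \<in> B \<Longrightarrow> F (x + \<nu> *\<^sub>R z) + inner s (y - (x + \<nu> *\<^sub>R z)) - \<mu> * (norm (y - (x + \<nu> *\<^sub>R z)))\<^sup>2 - \<tau> \<le> F y"
      by blast
    show "\<exists>v\<in>Rn d. norm v \<le> 2 * g * \<nu> \<and> (\<forall>z'\<in>Rn d. norm z' = 1 \<longrightarrow>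
        F (x + \<nu> *\<^sub>R z) + inner v (z' - z) - \<mu> * \<nu>\<^sup>2 * (norm (z' - z))\<^sup>2 - \<tau> \<le> F (x + \<nu> *\<^sub>R z'))"
    proof (intro bexI[of _ "\<nu> *\<^sub>R s"] conjI ballI impI)
      show "norm (\<nu> *\<^sub>R s) \<le> 2 * g * \<nu>" using s(2) \<nu> by (simp add: mult.commute)
      fix z' assume z': "z' \<in> Rn d" "norm z' = 1"
      have "x + \<nu> *\<^sub>R z' \<in> B" using z' by (intro shifted_in_B0) auto
      from s(3)[OF this] have "F (x + \<nu> *\<^sub>R z) + inner s (\<nu> *\<^sub>R (z' - z)) - \<mu> * (norm (\<nu> *\<^sub>R (z' - z)))\<^sup>2 - \<tau> \<le> F (x + \<nu> *\<^sub>R z')"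
        by (simp only: add_diff_cancel_left scaleR_diff_right)
      then show "F (x + \<nu> *\<^sub>R z) + inner (\<nu> *\<^sub>R s) (z' - z) - \<mu> * \<nu>\<^sup>2 * (norm (z' - z))\<^sup>2 - \<tau> \<le> F (x + \<nu> *\<^sub>R z')"
        by (simp add: power_mult_distrib mult.assoc)
    qed (use s in auto)
  qed (use g \<mu> \<nu> in auto)
  then show ?thesis by (simp add: power_mult_distrib mult_ac)
qed

text \<open>The right side is the derivative, in direction \<open>y\<close>, of the ball average of
  \<open>F\<close>. Weak convexity bounds each forward slope at a point \<open>w\<close> of the ball
  from below by the backward difference \<open>F w - F (w - y)\<close> up to the quadratic defect.
  Replacing \<open>w\<close> by \<open>x\<close> in both terms costs \<open>g * \<nu>\<close>
  twice.\<close>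

lemma sphere_mean_lower:
  assumes y: "y \<in> Rn d" and xy: "norm (x - x0) + \<nu> + norm y \<le> rad"
  shows "F x - F (x - y) - 2 * g * \<nu> - \<mu> / 2 * (norm y)\<^sup>2
    \<le> real d / \<nu> * (\<integral>z. F (x + \<nu> *\<^sub>R z) * inner y z \<partial>uniform_sphere d)"
proof -
  define q where "q u = F (x + \<nu> *\<^sub>R u)" for u
  define p where "p = (1 / \<nu>) *\<^sub>R y"
  have p: "p \<in> Rn d" using y by (auto simp: p_def)
  have \<nu>p: "\<nu> *\<^sub>R p = y" using \<nu> by (simp add: p_def)
  have [measurable]: "q \<in> borel_measurable borel" unfolding q_def by measurable
  define \<tau> where "\<tau> j = 1 / (real j + 1 + norm p)" for j :: nat
  have pos: "0 < real j + 1 + norm p" for j by (simp add: add_pos_nonneg)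
  have \<tau>: "0 < \<tau> j" "\<tau> j \<le> 1" for j using pos[of j] by (simp_all add: \<tau>_def field_simps)
  define c where "c = F x - F (x - y) - 2 * g * \<nu>"
  define Cq where "Cq = \<bar>F x0\<bar> + g * rad"
  have lim: "(\<lambda>j. (\<integral>u. indicator (cball 0 1) u * (q (u + \<tau> j *\<^sub>R p) - q u) \<partial>leb d) / \<tau> j)
    \<longlonglongrightarrow> vol d * real d * (\<integral>z. q z * inner p z \<partial>uniform_sphere d)"
    unfolding \<tau>_def
  proof (rule sphere_divergence_limit[OF d0 _ _ _ p])
    show "\<bar>q u\<bar> \<le> Cq" for u unfolding q_def Cq_def by (rule F_bounded)
    fix z assume z: "z \<in> Rn d" "norm z = 1"
    \<comment> \<open>The relative width of the collar between the smoothing sphere and the boundary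
      of the ball.\<close>
    define e where "e = (rad - norm (x - x0) - \<nu>) / \<nu>"
    have e: "0 < e" using x\<nu> \<nu> by (simp add: e_def)
    have inB: "x + \<nu> *\<^sub>R (r *\<^sub>R z) \<in> B" if r: "\<bar>r - 1\<bar> \<le> e" for r
    proof -
      have "norm ((\<nu> * (r - 1)) *\<^sub>R z) \<le> \<nu> * e" using z r \<nu> by (simp add: abs_mult)
      also have "\<nu> * e = rad - norm (x - x0) - \<nu>" using \<nu> by (simp add: e_def)
      finally have "x + \<nu> *\<^sub>R z + (\<nu> * (r - 1)) *\<^sub>R z \<in> B"
        using z by (intro shifted_in_B) auto
      moreover have "x + \<nu> *\<^sub>R z + (\<nu> * (r - 1)) *\<^sub>R z = x + \<nu> *\<^sub>R (r *\<^sub>R z)" by (simp add: algebra_simps)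
      ultimately show ?thesis by simp
    qed
    have img: "(\<lambda>r. x + \<nu> *\<^sub>R (r *\<^sub>R z)) ` {1 - e..1 + e} \<subseteq> B"
      by (rule image_subsetI, rule inB) (auto simp: abs_le_iff)
    have "continuous_on {1 - e..1 + e} (\<lambda>r. q (r *\<^sub>R z))"
      unfolding q_def
      by (rule continuous_on_compose2[OF continuous_on_F _ img]) (intro continuous_intros)
    then show "isCont (\<lambda>r. q (r *\<^sub>R z)) 1"
      by (rule continuous_on_interior) (use e in auto)
  qed measurable
  have lower: "vol d * (c - \<mu> / 2 * (1 + \<tau> j) * (norm y)\<^sup>2) \<le> (\<integral>u. indicator (cball 0 1) u * (q (u + \<tau> j *\<^sub>R p) - q u) \<partial>leb d) / \<tau> j" for j
  proof -
    have pw: "\<tau> j * (c - \<mu> / 2 * (1 + \<tau> j) * (norm y)\<^sup>2) \<le> q (u + \<tau> j *\<^sub>R p) - q u"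
      if u: "u \<in> Rn d" "norm u \<le> 1" for u
    proof -
      define t where "t = \<tau> j"
      have t: "0 < t" "t \<le> 1" using \<tau> by (auto simp: t_def)
      define w where "w = x + \<nu> *\<^sub>R u"
      have w: "w \<in> B" unfolding w_def by (rule shifted_in_B0[OF u])
      have wp: "w + t *\<^sub>R y \<in> B"
        unfolding w_def
      proof (rule shifted_in_B[OF u])
        have "norm (t *\<^sub>R y) \<le> norm y" using t by (simp add: mult_left_le_one_le)
        then show "norm (x - x0) + \<nu> + norm (t *\<^sub>R y) \<le> rad" using xy by linarith
      qed (use y in auto)
      have wm: "w - y \<in> B"
        using shifted_in_B[OF u, of "- y"] y xy unfolding w_def by auto
      have xB: "x \<in> B" using shifted_in_B0[of 0] by auto
      have xyB: "x - y \<in> B" using shifted_in_B[of 0 "- y"] y xy by auto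
      \<comment> \<open>With this ratio \<open>w\<close> divides the segment from
        \<open>w + t *\<^sub>R y\<close> to \<open>w - y\<close>.\<close>
      define l where "l = t / (1 + t)"
      have l: "0 \<le> l" "l \<le> 1" "l * (1 + t) = t" "(1 - l) * (1 + t) = 1" using t by (auto simp: l_def field_simps)
      have comb: "(1 - l) *\<^sub>R (w + t *\<^sub>R y) + l *\<^sub>R (w - y) = w"
      proof -
        have "(1 - l) * t - l = 0" using l by (simp add: algebra_simps)
        moreover have "(1 - l) *\<^sub>R (w + t *\<^sub>R y) + l *\<^sub>R (w - y) = w + ((1 - l) * t - l) *\<^sub>R y" by (simp add: algebra_simps)
        ultimately show ?thesis by simp
      qed
      have ndiff: "(norm ((w + t *\<^sub>R y) - (w - y)))\<^sup>2 = (1 + t)\<^sup>2 * (norm y)\<^sup>2"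
      proof -
        have "(w + t *\<^sub>R y) - (w - y) = (1 + t) *\<^sub>R y" by (simp add: algebra_simps)
        then show ?thesis by (simp add: power_mult_distrib)
      qed
      have "F w \<le> (1 - l) * F (w + t *\<^sub>R y) + l * F (w - y) + \<mu> / 2 * (l * (1 - l)) * ((1 + t)\<^sup>2 * (norm y)\<^sup>2)"
        using F_segment[OF wp wm l(1,2)] unfolding comb ndiff .
      then have "(1 + t) * F w \<le> (1 + t) * ((1 - l) * F (w + t *\<^sub>R y) + l * F (w - y) + \<mu> / 2 * (l * (1 - l)) * ((1 + t)\<^sup>2 * (norm y)\<^sup>2))"
        using t by (intro mult_left_mono) auto
      also have "\<dots> = ((1 - l) * (1 + t)) * F (w + t *\<^sub>R y) + (l * (1 + t)) * F (w - y)
          + \<mu> / 2 * (1 + t) * ((l * (1 + t)) * ((1 - l) * (1 + t))) * (norm y)\<^sup>2"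
      proof -
        have "(1 + t) * (a * P + l * Q + \<mu> / 2 * (l * a) * ((1 + t)\<^sup>2 * n)) = (a * (1 + t)) * P + (l * (1 + t)) * Q
          + \<mu> / 2 * (1 + t) * ((l * (1 + t)) * (a * (1 + t))) * n" for a P Q n :: real
          by (simp add: power2_eq_square algebra_simps)
        then show ?thesis .
      qed
      also have "\<dots> = F (w + t *\<^sub>R y) + t * F (w - y) + \<mu> / 2 * (1 + t) * t * (norm y)\<^sup>2"
        unfolding l(3,4) by simp
      finally have 1: "F w + t * F w \<le> F (w + t *\<^sub>R y) + t * F (w - y) + \<mu> / 2 * (1 + t) * t * (norm y)\<^sup>2"
        by (simp add: algebra_simps)
      have "norm (w - x) \<le> \<nu>" using u \<nu> by (simp add: w_def mult_left_le)
      then have gn: "g * norm (w - x) \<le> g * \<nu>" using g by (intro mult_left_mono) auto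
      have "\<bar>F w - F x\<bar> \<le> g * norm (w - x)" by (rule F_lip[OF w xB])
      moreover have "\<bar>F (w - y) - F (x - y)\<bar> \<le> g * norm (w - x)" using F_lip[OF wm xyB] by simp
      ultimately have "c \<le> F w - F (w - y)" using gn unfolding c_def abs_le_iff by linarith
      then have "t * c \<le> t * (F w - F (w - y))" using t by (intro mult_left_mono) auto
      then have "t * (c - \<mu> / 2 * (1 + t) * (norm y)\<^sup>2) \<le> F (w + t *\<^sub>R y) - F w"
        using 1 by (simp add: algebra_simps)
      moreover have "q (u + \<tau> j *\<^sub>R p) = F (w + t *\<^sub>R y)"
        by (simp add: q_def w_def t_def \<nu>p[symmetric] algebra_simps)
      ultimately show ?thesis by (simp add: t_def q_def w_def)
    qed
    define k where "k = \<tau> j * (c - \<mu> / 2 * (1 + \<tau> j) * (norm y)\<^sup>2)"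
    have int1: "integrable (leb d) (\<lambda>u. indicator (cball 0 1) u * k)"
      by (rule integrable_leb_bounded_support[where r = 1 and C = "\<bar>k\<bar>"]) (auto simp: indicator_def)
    have int2: "integrable (leb d) (\<lambda>u. indicator (cball 0 1) u * (q (u + \<tau> j *\<^sub>R p) - q u))"
    proof (rule integrable_leb_bounded_support[where r = 1 and C = "Cq + Cq"])
      fix u
      have "\<bar>q (u + \<tau> j *\<^sub>R p)\<bar> \<le> Cq" "\<bar>q u\<bar> \<le> Cq" unfolding q_def Cq_def by (rule F_bounded)+
      then show "\<bar>indicator (cball 0 1) u * (q (u + \<tau> j *\<^sub>R p) - q u)\<bar> \<le> Cq + Cq"
        by (auto simp: indicator_def)
    qed auto
    have "measure (leb d) (cball 0 1) = vol d" by (simp add: measure_def vol_def ball_vol_def)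
    then have "vol d * k = (\<integral>u. indicator (cball 0 1) u * k \<partial>leb d)" by simp
    also have "\<dots> \<le> (\<integral>u. indicator (cball 0 1) u * (q (u + \<tau> j *\<^sub>R p) - q u) \<partial>leb d)"
    proof (rule integral_mono_AE[OF int1 int2], use AE_leb_Rn[of d] in eventually_elim)
      fix u assume "u \<in> Rn d"
      then show "indicator (cball 0 1) u * k \<le> indicator (cball 0 1) u * (q (u + \<tau> j *\<^sub>R p) - q u)"
        using pw[of u] by (auto simp: k_def indicator_def)
    qed
    finally show ?thesis using \<tau>(1)[of j] by (simp add: k_def field_simps)
  qed
  have \<tau>0: "\<tau> \<longlonglongrightarrow> 0"
  proof -
    have "filterlim (\<lambda>j. norm p + 1 + real j) at_top sequentially"
      by (rule filterlim_tendsto_add_at_top[OF tendsto_const filterlim_real_sequentially])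
    then have "(\<lambda>j. 1 / (norm p + 1 + real j)) \<longlonglongrightarrow> 0"
      by (rule real_tendsto_divide_at_top[OF tendsto_const])
    then show ?thesis unfolding \<tau>_def by (simp add: add_ac)
  qed
  have "(\<lambda>j. vol d * (c - \<mu> / 2 * (1 + \<tau> j) * (norm y)\<^sup>2)) \<longlonglongrightarrow> vol d * (c - \<mu> / 2 * (1 + 0) * (norm y)\<^sup>2)"
    by (intro tendsto_intros \<tau>0)
  from LIMSEQ_le[OF this lim] lower
  have "vol d * (c - \<mu> / 2 * (norm y)\<^sup>2) \<le> vol d * (real d * (\<integral>z. q z * inner p z \<partial>uniform_sphere d))"
    by (simp add: mult.assoc)
  then have "c - \<mu> / 2 * (norm y)\<^sup>2 \<le> real d * (\<integral>z. q z * inner p z \<partial>uniform_sphere d)"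
    using vol_pos[of d] by simp
  also have "(\<integral>z. q z * inner p z \<partial>uniform_sphere d) = (\<integral>z. F (x + \<nu> *\<^sub>R z) * inner y z \<partial>uniform_sphere d) / \<nu>"
    by (simp add: q_def p_def)
  finally show ?thesis by (simp add: c_def)
qed

definition G :: "fseq \<Rightarrow> fseq" where
  "G z = (real d * ((F (x + \<nu> *\<^sub>R z) - F (x - \<nu> *\<^sub>R z)) / (2 * \<nu>))) *\<^sub>R z"

lemma measurable_G [measurable]: "G \<in> borel_measurable borel"
  unfolding G_def by measurable

lemma F_diff_bound:
  assumes "z \<in> Rn d" "norm z = 1"
  shows "\<bar>F (x + \<nu> *\<^sub>R z) - F (x - \<nu> *\<^sub>R z)\<bar> \<le> 2 * g * \<nu>"
proof -
  have "x + \<nu> *\<^sub>R z \<in> B" "x - \<nu> *\<^sub>R z \<in> B"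
    using shifted_in_B0[of z] shifted_in_B0[of "- z"] assms by auto
  then have "\<bar>F (x + \<nu> *\<^sub>R z) - F (x - \<nu> *\<^sub>R z)\<bar> \<le> g * norm ((x + \<nu> *\<^sub>R z) - (x - \<nu> *\<^sub>R z))" by (rule F_lip)
  also have "(x + \<nu> *\<^sub>R z) - (x - \<nu> *\<^sub>R z) = (2 * \<nu>) *\<^sub>R z" by (simp add: scaleR_2 algebra_simps flip: scaleR_scaleR)
  finally show ?thesis using assms \<nu> by (simp add: mult_ac)
qed

lemma norm_G_le:
  assumes "z \<in> Rn d" "norm z = 1"
  shows "norm (G z) \<le> real d * g"
proof -
  have "\<bar>(F (x + \<nu> *\<^sub>R z) - F (x - \<nu> *\<^sub>R z)) / (2 * \<nu>)\<bar> \<le> g"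
    using F_diff_bound[OF assms] \<nu> by (simp add: field_simps)
  then have "real d * \<bar>(F (x + \<nu> *\<^sub>R z) - F (x - \<nu> *\<^sub>R z)) / (2 * \<nu>)\<bar> \<le> real d * g"
    by (rule mult_left_mono) simp
  then show ?thesis using assms(2) by (simp add: G_def abs_mult)
qed

lemma integral_bound_by_nn:
  fixes h :: "fseq \<Rightarrow> real"
  assumes "(\<integral>\<^sup>+z. ennreal (h z) \<partial>uniform_sphere d) \<le> ennreal c" "\<And>z. 0 \<le> h z" "0 \<le> c"
    and "h \<in> borel_measurable borel"
  shows "(\<integral>z. h z \<partial>uniform_sphere d) \<le> c"
  using assms by (subst integral_eq_nn_integral) (auto intro!: enn2real_leI simp: measurable_cong_sets[OF sets_uniform_sphere refl])

lemma G_second_moment: "(\<integral>z. (norm (G z))\<^sup>2 \<partial>uniform_sphere d) \<le> 2048 * real d * g\<^sup>2"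
proof (rule integral_bound_by_nn)
  let ?D = "\<lambda>z. (F (x + \<nu> *\<^sub>R z) - F (x - \<nu> *\<^sub>R z))\<^sup>2"
  define a where "a = (real d)\<^sup>2 / (4 * \<nu>\<^sup>2)"
  have "(\<integral>\<^sup>+z. ennreal ((norm (G z))\<^sup>2) \<partial>uniform_sphere d) = (\<integral>\<^sup>+z. ennreal a * ennreal (?D z) \<partial>uniform_sphere d)"
    by (rule nn_integral_cong_AE, use AE_uniform_sphere[OF d0] in eventually_elim)
      (auto simp: G_def a_def ennreal_mult[symmetric] power_mult_distrib power_divide)
  also have "\<dots> = ennreal a * (\<integral>\<^sup>+z. ennreal (?D z) \<partial>uniform_sphere d)" by (rule nn_integral_cmult) measurable
  also have "\<dots> \<le> ennreal a * ennreal (8192 * g\<^sup>2 * \<nu>\<^sup>2 / real d)" by (rule mult_left_mono[OF second_moment]) simp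
  also have "\<dots> = ennreal (2048 * real d * g\<^sup>2)"
    using \<nu> d0 by (simp add: a_def ennreal_mult[symmetric] power2_eq_square field_simps)
  finally show "(\<integral>\<^sup>+z. ennreal ((norm (G z))\<^sup>2) \<partial>uniform_sphere d) \<le> ennreal (2048 * real d * g\<^sup>2)" .
qed auto

text \<open>The pointwise bound \<open>real d * g\<close> on the scalar factor suffices here: the
  mean of \<open>(inner y z)\<^sup>2\<close> contributes \<open>1 / d\<close>, so one factor
  \<open>real d\<close> remains.\<close>

lemma G_directional_second_moment:
  assumes y: "y \<in> Rn d"
  shows "(\<integral>z. (inner (G z) y)\<^sup>2 \<partial>uniform_sphere d) \<le> real d * g\<^sup>2 * (norm y)\<^sup>2"
proof (rule integral_bound_by_nn)
  have "(\<integral>\<^sup>+z. ennreal ((inner (G z) y)\<^sup>2) \<partial>uniform_sphere d) \<le> (\<integral>\<^sup>+z. ennreal ((real d * g)\<^sup>2) * ennreal ((inner y z)\<^sup>2) \<partial>uniform_sphere d)"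
  proof (rule nn_integral_mono_AE, use AE_uniform_sphere[OF d0] in eventually_elim)
    fix z assume z: "z \<in> Rn d \<and> norm z = 1"
    define a where "a = real d * ((F (x + \<nu> *\<^sub>R z) - F (x - \<nu> *\<^sub>R z)) / (2 * \<nu>))"
    have "\<bar>a\<bar> \<le> real d * g" using norm_G_le[of z] z by (simp add: G_def a_def)
    then have "a\<^sup>2 \<le> (real d * g)\<^sup>2" by (metis abs_ge_zero power2_abs power_mono)
    moreover have "inner (G z) y = a * inner y z" by (simp add: G_def a_def inner_commute)
    ultimately have "(inner (G z) y)\<^sup>2 \<le> (real d * g)\<^sup>2 * (inner y z)\<^sup>2"
      by (simp add: power_mult_distrib mult_right_mono)
    then show "ennreal ((inner (G z) y)\<^sup>2) \<le> ennreal ((real d * g)\<^sup>2) * ennreal ((inner y z)\<^sup>2)"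
      by (simp add: ennreal_mult[symmetric] ennreal_leI)
  qed
  also have "\<dots> = ennreal ((real d * g)\<^sup>2) * (\<integral>\<^sup>+z. ennreal ((inner y z)\<^sup>2) \<partial>uniform_sphere d)"
    by (rule nn_integral_cmult) measurable
  also have "\<dots> = ennreal (real d * g\<^sup>2 * (norm y)\<^sup>2)"
  proof -
    have "ennreal ((real d * g)\<^sup>2) * ennreal ((norm y)\<^sup>2 / real d) = ennreal ((real d * g)\<^sup>2 * ((norm y)\<^sup>2 / real d))"
      by (rule ennreal_mult[symmetric]) auto
    also have "(real d * g)\<^sup>2 * ((norm y)\<^sup>2 / real d) = real d * g\<^sup>2 * (norm y)\<^sup>2"
      using d0 by (simp add: power2_eq_square field_simps)
    finally show ?thesis unfolding nn_integral_uniform_sphere_inner_square[OF y d0] .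
  qed
  finally show "(\<integral>\<^sup>+z. ennreal ((inner (G z) y)\<^sup>2) \<partial>uniform_sphere d) \<le> ennreal (real d * g\<^sup>2 * (norm y)\<^sup>2)" .
qed auto

lemma integral_uniform_sphere_reflect:
  fixes h :: "fseq \<Rightarrow> real"
  assumes [measurable]: "h \<in> borel_measurable borel"
  shows "(\<integral>z. h (- z) \<partial>uniform_sphere d) = (\<integral>z. h z \<partial>uniform_sphere d)"
proof -
  have "distr (uniform_sphere d) borel uminus = uniform_sphere d"
  proof (rule measure_eqI)
    fix A assume "A \<in> sets (distr (uniform_sphere d) borel uminus)"
    then have [measurable]: "A \<in> sets borel" by simp
    have "emeasure (distr (uniform_sphere d) borel uminus) A = (\<integral>\<^sup>+z. indicator A z \<partial>distr (uniform_sphere d) borel uminus)" by simp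
    also have "\<dots> = (\<integral>\<^sup>+z. indicator A (- z) \<partial>uniform_sphere d)" by (rule nn_integral_distr) measurable
    also have "\<dots> = (\<integral>\<^sup>+u. indicator A (- sgn u) * indicator (cball 0 1) u \<partial>leb d) / ball_vol d"
      by (rule nn_integral_uniform_sphere) measurable
    also have "(\<integral>\<^sup>+u. indicator A (- sgn u) * indicator (cball 0 1) u \<partial>leb d)
        = ennreal (\<bar>- 1\<bar> ^ d) * (\<integral>\<^sup>+u. indicator A (- sgn ((- 1) *\<^sub>R u)) * indicator (cball 0 1) ((- 1) *\<^sub>R u :: fseq) \<partial>leb d)"
      by (rule nn_integral_leb_scale) auto
    also have "\<dots> = (\<integral>\<^sup>+u. indicator A (sgn u) * indicator (cball 0 1) u \<partial>leb d)"
      by (simp add: sgn_minus indicator_def)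
    also have "(\<integral>\<^sup>+u. indicator A (sgn u) * indicator (cball 0 1) u \<partial>leb d) / ball_vol d = (\<integral>\<^sup>+z. indicator A z \<partial>uniform_sphere d)"
      by (rule nn_integral_uniform_sphere[symmetric]) measurable
    finally show "emeasure (distr (uniform_sphere d) borel uminus) A = emeasure (uniform_sphere d) A" by simp
  qed simp
  then have "(\<integral>z. h z \<partial>uniform_sphere d) = (\<integral>z. h z \<partial>distr (uniform_sphere d) borel uminus)" by simp
  also have "\<dots> = (\<integral>z. h (- z) \<partial>uniform_sphere d)" by (rule integral_distr) measurable
  finally show ?thesis by simp
qed

text \<open>Reflection symmetry of the sphere makes both halves of the two-point estimator
  contribute equally, so its mean is the one-sided integral bounded above.\<close>

lemma G_mean_lower:
  assumes y: "y \<in> Rn d" and xy: "norm (x - x0) + \<nu> + norm y \<le> rad"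
  shows "F x - F (x - y) - 2 * g * \<nu> - \<mu> / 2 * (norm y)\<^sup>2 \<le> (\<integral>z. inner (G z) y \<partial>uniform_sphere d)"
proof -
  let ?h = "\<lambda>z. F (x + \<nu> *\<^sub>R z) * inner y z"
  have [measurable]: "?h \<in> borel_measurable borel" by measurable
  have int: "integrable (uniform_sphere d) h'" if "h' \<in> borel_measurable borel" "\<And>z. norm z = 1 \<Longrightarrow> \<bar>h' z\<bar> \<le> (\<bar>F x0\<bar> + g * rad) * norm y" for h'
  proof (rule sph.integrable_const_bound)
    show "AE z in uniform_sphere d. norm (h' z) \<le> (\<bar>F x0\<bar> + g * rad) * norm y"
      using AE_uniform_sphere[OF d0] by eventually_elim (use that in auto)
  qed (use that in \<open>simp add: measurable_cong_sets[OF sets_uniform_sphere refl]\<close>)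
  have bd: "\<bar>F w * inner y z\<bar> \<le> (\<bar>F x0\<bar> + g * rad) * norm y" if "norm z = 1" for z w
    using Cauchy_Schwarz_ineq2[of y z] that F_bounded[of w] g rad by (simp add: abs_mult) (intro mult_mono, auto)
  have i1: "integrable (uniform_sphere d) ?h" by (rule int) (use bd in auto)
  have i2: "integrable (uniform_sphere d) (\<lambda>z. F (x - \<nu> *\<^sub>R z) * inner y z)" by (rule int) (use bd in auto)
  have refl: "(\<integral>z. F (x - \<nu> *\<^sub>R z) * inner y z \<partial>uniform_sphere d) = - (\<integral>z. ?h z \<partial>uniform_sphere d)"
    using integral_uniform_sphere_reflect[of ?h] by simp
  have "(\<integral>z. inner (G z) y \<partial>uniform_sphere d)
      = (\<integral>z. real d / (2 * \<nu>) * (?h z - F (x - \<nu> *\<^sub>R z) * inner y z) \<partial>uniform_sphere d)"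
    by (intro Bochner_Integration.integral_cong) (auto simp: G_def inner_commute[of _ y] algebra_simps diff_divide_distrib)
  also have "\<dots> = real d / (2 * \<nu>) * ((\<integral>z. ?h z \<partial>uniform_sphere d) - (\<integral>z. F (x - \<nu> *\<^sub>R z) * inner y z \<partial>uniform_sphere d))"
    using i1 i2 by simp
  also have "\<dots> = real d / \<nu> * (\<integral>z. ?h z \<partial>uniform_sphere d)"
    unfolding refl by (simp add: field_simps)
  finally show ?thesis using sphere_mean_lower[OF y xy] by simp
qed

end

subsection \<open>Resampling independent directions\<close>

lemma space_directions [simp]: "space (directions d) = UNIV"
  by (simp add: directions_def space_PiM)

lemma prob_space_directions: "prob_space (directions d)"
  unfolding directions_def by (intro prob_space_PiM prob_space_uniform_sphere)

interpretation dirs: prob_space "directions d"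
  by (rule prob_space_directions)

lemma measurable_directions_component [measurable]:
  "(\<lambda>z. z i) \<in> measurable (directions d) borel"
proof -
  have "(\<lambda>z. z i) \<in> measurable (directions d) (uniform_sphere d)"
    unfolding directions_def by (rule measurable_component_singleton) simp
  then show ?thesis by (simp cong: measurable_cong_sets)
qed

lemma measurable_into_directions:
  assumes "\<And>i. (\<lambda>w. g w i) \<in> measurable M borel"
  shows "g \<in> measurable M (directions d)"
  unfolding directions_def
proof (rule measurable_PiM_single')
  show "(\<lambda>w. g w i) \<in> measurable M (uniform_sphere d)" for i
    using assms[of i] by (simp cong: measurable_cong_sets)
qed (auto simp: PiE_iff)

lemma emeasure_directions_cylinder:
  assumes "finite J" "\<And>i. i \<in> J \<Longrightarrow> A i \<in> sets borel"
  shows "emeasure (directions d) {z. \<forall>i\<in>J. z i \<in> A i} = (\<Prod>i\<in>J. emeasure (uniform_sphere d) (A i))"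
proof -
  have "prod_emb UNIV (\<lambda>_. uniform_sphere d) J (Pi\<^sub>E J A) = {z. \<forall>i\<in>J. z i \<in> A i}"
    by (auto simp: prod_emb_def PiE_iff space_PiM)
  then show ?thesis
    using emeasure_PiM_emb[of UNIV "\<lambda>_. uniform_sphere d" J A] assms
    by (simp add: directions_def prob_space_uniform_sphere)
qed

definition resample :: "('i \<Rightarrow> bool) \<Rightarrow> ('i \<Rightarrow> 'a) \<Rightarrow> ('i \<Rightarrow> 'a) \<Rightarrow> 'i \<Rightarrow> 'a" where
  "resample P z w i = (if P i then w i else z i)"

lemma measurable_resample [measurable]:
  "(\<lambda>x. resample P (fst x) (snd x)) \<in> measurable (directions d \<Otimes>\<^sub>M directions d) (directions d)"
proof (rule measurable_into_directions)
  fix i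
  show "(\<lambda>x. resample P (fst x) (snd x) i) \<in> measurable (directions d \<Otimes>\<^sub>M directions d) borel"
    unfolding resample_def by (cases "P i") (simp_all add: measurable_compose[OF measurable_fst measurable_directions_component]
        measurable_compose[OF measurable_snd measurable_directions_component])
qed

text \<open>Independence in the form used throughout: replacing any selection of components by those
  of an independent copy preserves the law. Cylinder sets split into a product over kept and
  replaced components.\<close>

lemma distr_resample:
  "distr (directions d \<Otimes>\<^sub>M directions d) (directions d) (\<lambda>x. resample P (fst x) (snd x)) = directions d"
proof -
  let ?D = "distr (directions d \<Otimes>\<^sub>M directions d) (directions d) (\<lambda>x. resample P (fst x) (snd x))"
  interpret pp: pair_prob_space "directions d" "directions d" by standard
  have "?D = PiM UNIV (\<lambda>_. uniform_sphere d)"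
  proof (rule measure_eqI_PiM_infinite)
    show "finite_measure ?D"
      by (intro prob_space.finite_measure pp.prob_space_distr) measurable
    fix A :: "nat \<times> nat \<Rightarrow> fseq set" and J
    assume J: "finite J" and A: "\<And>i. i \<in> J \<Longrightarrow> A i \<in> sets (uniform_sphere d)"
    let ?X = "{z. \<forall>i\<in>J. z i \<in> A i}"
    have X: "prod_emb UNIV (\<lambda>_. uniform_sphere d) J (Pi\<^sub>E J A) = ?X"
      by (auto simp: prod_emb_def PiE_iff space_PiM)
    have A': "\<And>i. i \<in> J \<Longrightarrow> A i \<in> sets borel" using A by simp
    have cyl: "{z. \<forall>i\<in>J'. z i \<in> A i} \<in> sets (directions d)" if "J' \<subseteq> J" for J'
    proof -
      have "{z \<in> space (directions d). \<forall>i\<in>J'. z i \<in> A i} \<in> sets (directions d)"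
      proof (rule sets.sets_Collect_finite_All)
        show "finite J'" using that J finite_subset by blast
        fix i assume "i \<in> J'"
        then have [measurable]: "A i \<in> sets borel" using that A' by blast
        show "{z \<in> space (directions d). z i \<in> A i} \<in> sets (directions d)" by measurable
      qed
      then show ?thesis by simp
    qed
    let ?J1 = "{i\<in>J. \<not> P i}" and ?J2 = "{i\<in>J. P i}"
    have "emeasure ?D ?X = emeasure (directions d \<Otimes>\<^sub>M directions d)
        ((\<lambda>x. resample P (fst x) (snd x)) -` ?X \<inter> space (directions d \<Otimes>\<^sub>M directions d))"
      by (rule emeasure_distr) (auto intro!: cyl)
    also have "(\<lambda>x. resample P (fst x) (snd x)) -` ?X \<inter> space (directions d \<Otimes>\<^sub>M directions d)
        = {z. \<forall>i\<in>?J1. z i \<in> A i} \<times> {z. \<forall>i\<in>?J2. z i \<in> A i}"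
      by (auto simp: resample_def space_pair_measure split: if_splits)
    also have "emeasure (directions d \<Otimes>\<^sub>M directions d) \<dots>
        = emeasure (directions d) {z. \<forall>i\<in>?J1. z i \<in> A i} * emeasure (directions d) {z. \<forall>i\<in>?J2. z i \<in> A i}"
      by (intro dirs.emeasure_pair_measure_Times cyl) auto
    also have "\<dots> = (\<Prod>i\<in>?J1. emeasure (uniform_sphere d) (A i)) * (\<Prod>i\<in>?J2. emeasure (uniform_sphere d) (A i))"
      using J A' by (intro arg_cong2[where f = "(*)"] emeasure_directions_cylinder) auto
    also have "\<dots> = (\<Prod>i\<in>J. emeasure (uniform_sphere d) (A i))"
      using J by (subst prod.union_disjoint[symmetric]) (auto intro!: prod.cong)
    also have "\<dots> = emeasure (directions d) ?X"
      by (rule emeasure_directions_cylinder[symmetric]) (use J A' in auto)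
    finally show "emeasure ?D (prod_emb UNIV (\<lambda>_. uniform_sphere d) J (Pi\<^sub>E J A))
        = emeasure (PiM UNIV (\<lambda>_. uniform_sphere d)) (prod_emb UNIV (\<lambda>_. uniform_sphere d) J (Pi\<^sub>E J A))"
      unfolding X by (simp add: directions_def)
  qed (simp_all add: directions_def)
  then show ?thesis by (simp add: directions_def)
qed

lemma nn_integral_resample:
  assumes [measurable]: "H \<in> borel_measurable (directions d)"
  shows "(\<integral>\<^sup>+z. H z \<partial>directions d) = (\<integral>\<^sup>+z. \<integral>\<^sup>+w. H (resample P z w) \<partial>directions d \<partial>directions d)"
proof -
  have "(\<integral>\<^sup>+z. H z \<partial>directions d)
      = (\<integral>\<^sup>+z. H z \<partial>distr (directions d \<Otimes>\<^sub>M directions d) (directions d) (\<lambda>x. resample P (fst x) (snd x)))"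
    unfolding distr_resample ..
  also have "\<dots> = (\<integral>\<^sup>+x. H (resample P (fst x) (snd x)) \<partial>(directions d \<Otimes>\<^sub>M directions d))"
    by (rule nn_integral_distr) measurable
  also have "\<dots> = (\<integral>\<^sup>+z. \<integral>\<^sup>+w. H (resample P z w) \<partial>directions d \<partial>directions d)"
    by (subst dirs.nn_integral_fst[symmetric]) simp_all
  finally show ?thesis .
qed

lemma nn_integral_directions_component:
  assumes [measurable]: "h \<in> borel_measurable borel"
  shows "(\<integral>\<^sup>+w. h (w i) \<partial>directions d) = (\<integral>\<^sup>+v. h v \<partial>uniform_sphere d)"
proof -
  have m: "(\<lambda>w. w i) \<in> measurable (directions d) (uniform_sphere d)"
    using measurable_directions_component[of i d] by (simp cong: measurable_cong_sets)
  have dd: "distr (directions d) (uniform_sphere d) (\<lambda>w. w i) = uniform_sphere d"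
    unfolding directions_def by (rule distr_PiM_component) (auto intro: prob_space_uniform_sphere)
  have h: "h \<in> borel_measurable (uniform_sphere d)"
    using assms unfolding measurable_cong_sets[OF sets_uniform_sphere refl] .
  have "(\<integral>\<^sup>+v. h v \<partial>uniform_sphere d) = (\<integral>\<^sup>+v. h v \<partial>distr (directions d) (uniform_sphere d) (\<lambda>w. w i))"
    unfolding dd ..
  also have "\<dots> = (\<integral>\<^sup>+w. h (w i) \<partial>directions d)" by (rule nn_integral_distr[OF m]) (use h in simp)
  finally show ?thesis by simp
qed

subsection \<open>Supermartingale estimate\<close>

primrec run :: "(nat \<Rightarrow> 's \<Rightarrow> fseq \<Rightarrow> 's) \<Rightarrow> 's \<Rightarrow> (nat \<Rightarrow> fseq) \<Rightarrow> nat \<Rightarrow> 's" where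
  "run F s0 z 0 = s0"
| "run F s0 z (Suc t) = F t (run F s0 z t) (z (Suc t))"

lemma run_cong: "(\<And>i. i \<le> t \<Longrightarrow> z i = z' i) \<Longrightarrow> run F s0 z t = run F s0 z' t"
  by (induction t) auto

lemma measurable_run:
  assumes F: "\<And>t. case_prod (F t) \<in> measurable (S \<Otimes>\<^sub>M borel) S" and s0: "s0 \<in> space S"
  shows "(\<lambda>z. run F s0 (\<lambda>t. z (n, t)) t) \<in> measurable (directions d) S"
proof (induction t)
  case (Suc t)
  have "(\<lambda>z. (run F s0 (\<lambda>t. z (n, t)) t, z (n, Suc t))) \<in> measurable (directions d) (S \<Otimes>\<^sub>M borel)"
    by (intro measurable_Pair Suc measurable_directions_component)
  from measurable_compose[OF this F[of t]] show ?case by simp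
qed (simp add: s0)

text \<open>The expectation of a nonnegative supermartingale decreases. Conditioning is replaced by
  resampling component \<open>(n, Suc t)\<close>, on which the state after \<open>t\<close> steps
  does not depend.\<close>

lemma nn_integral_run_le:
  assumes F: "\<And>t. case_prod (F t) \<in> measurable (S \<Otimes>\<^sub>M borel) S" and s0: "s0 \<in> space S"
    and V: "\<And>t. V t \<in> borel_measurable S"
    and step: "\<And>t s. s \<in> space S \<Longrightarrow> t < T \<Longrightarrow> (\<integral>\<^sup>+v. V (Suc t) (F t s v) \<partial>uniform_sphere d) \<le> V t s"
  shows "t \<le> T \<Longrightarrow> (\<integral>\<^sup>+z. V t (run F s0 (\<lambda>t. z (n, t)) t) \<partial>directions d) \<le> V 0 s0"
proof (induction t)
  case 0
  show ?case by (simp add: dirs.emeasure_space_1[simplified])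
next
  case (Suc t)
  note [measurable] = measurable_run[OF F s0] V F
  let ?R = "\<lambda>z. run F s0 (\<lambda>t. z (n, t))"
  let ?P = "\<lambda>i. i = (n, Suc t)"
  have "(\<integral>\<^sup>+z. V (Suc t) (?R z (Suc t)) \<partial>directions d)
      = (\<integral>\<^sup>+z. \<integral>\<^sup>+w. V (Suc t) (?R (resample ?P z w) (Suc t)) \<partial>directions d \<partial>directions d)"
    by (rule nn_integral_resample) measurable
  also have "\<dots> = (\<integral>\<^sup>+z. \<integral>\<^sup>+w. V (Suc t) (F t (?R z t) (w (n, Suc t))) \<partial>directions d \<partial>directions d)"
  proof (intro nn_integral_cong)
    fix z w
    have "?R (resample ?P z w) t = ?R z t" by (rule run_cong) (simp add: resample_def)
    then show "V (Suc t) (?R (resample ?P z w) (Suc t)) = V (Suc t) (F t (?R z t) (w (n, Suc t)))"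
      by (simp add: resample_def)
  qed
  also have "\<dots> \<le> (\<integral>\<^sup>+z. V t (?R z t) \<partial>directions d)"
  proof (rule nn_integral_mono)
    fix z
    have R: "?R z t \<in> space S" using measurable_space[OF measurable_run[OF F s0]] by simp
    have "(\<lambda>v. case_prod (F t) (?R z t, v)) \<in> measurable borel S"
      by (rule measurable_compose[OF _ F]) (use R in measurable)
    then have "(\<lambda>v. V (Suc t) (F t (?R z t) v)) \<in> borel_measurable borel"
      using measurable_compose[OF _ V] by simp
    then have "(\<integral>\<^sup>+w. V (Suc t) (F t (?R z t) (w (n, Suc t))) \<partial>directions d)
        = (\<integral>\<^sup>+v. V (Suc t) (F t (?R z t) v) \<partial>uniform_sphere d)"
      by (rule nn_integral_directions_component)
    also have "\<dots> \<le> V t (?R z t)" using step[OF R] Suc.prems by simp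
    finally show "(\<integral>\<^sup>+w. V (Suc t) (F t (?R z t) (w (n, Suc t))) \<partial>directions d) \<le> V t (?R z t)" .
  qed
  also have "\<dots> \<le> V 0 s0" using Suc by simp
  finally show ?case .
qed

subsection \<open>Measurability of the algorithm\<close>

text \<open>Gives optional points a measurable structure: a flag and a value, which is 0 when the
  flag is \<open>False\<close>.\<close>

definition enc :: "fseq option \<Rightarrow> bool \<times> fseq" where
  "enc o' = (case o' of None \<Rightarrow> (False, 0) | Some x \<Rightarrow> (True, x))"

lemma enc_simps [simp]: "enc None = (False, 0)" "enc (Some x) = (True, x)"
  by (simp_all add: enc_def)

abbreviation opt_space :: "(bool \<times> fseq) measure" where
  "opt_space \<equiv> count_space UNIV \<Otimes>\<^sub>M borel"

lemma measurable_enc_Some: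
  assumes "h \<in> borel_measurable M"
  shows "(\<lambda>w. enc (Some (h w))) \<in> measurable M opt_space"
  using assms by simp

text \<open>The continuation must be jointly measurable in the sample point and the value passed on,
  because \<open>k\<close> may use the sample point again.\<close>

lemma measurable_enc_bind:
  assumes \<phi>: "(\<lambda>w. enc (\<phi> w)) \<in> measurable M opt_space"
    and k: "(\<lambda>y. enc (k (fst y) (snd y))) \<in> measurable (M \<Otimes>\<^sub>M borel) opt_space"
  shows "(\<lambda>w. enc (Option.bind (\<phi> w) (k w))) \<in> measurable M opt_space"
proof -
  have eq: "enc (Option.bind (\<phi> w) (k w))
      = (if fst (enc (\<phi> w)) then (\<lambda>y. enc (k (fst y) (snd y))) (w, snd (enc (\<phi> w))) else (False, 0))" for w
    by (cases "\<phi> w") auto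
  have 1: "(\<lambda>w. fst (enc (\<phi> w))) \<in> measurable M (count_space UNIV)"
    by (rule measurable_compose[OF \<phi> measurable_fst])
  have 2: "(\<lambda>w. (w, snd (enc (\<phi> w)))) \<in> measurable M (M \<Otimes>\<^sub>M borel)"
    by (intro measurable_Pair measurable_ident_sets refl measurable_compose[OF \<phi> measurable_snd])
  show ?thesis
    unfolding eq
    by (rule measurable_If[OF measurable_compose[OF 2 k]]) (use 1 in \<open>auto simp: pred_def\<close>)
qed

context
  fixes d :: nat and X :: "fseq set" and f :: "fseq \<Rightarrow> real"
  assumes X [measurable]: "X \<in> sets borel" and fX [measurable]: "(\<lambda>x. if x \<in> X then f x else 0) \<in> borel_measurable borel"
begin

lemma measurable_grad_est:
  assumes [measurable]: "x \<in> borel_measurable M" "z \<in> borel_measurable M"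
  shows "(\<lambda>w. enc (grad_est d X f \<nu> (x w) (z w))) \<in> measurable M opt_space"
proof -
  define f' where "f' = (\<lambda>x. if x \<in> X then f x else 0)"
  have [measurable]: "f' \<in> borel_measurable borel" using fX by (simp add: f'_def)
  have "enc (grad_est d X f \<nu> (x w) (z w)) =
    (if x w \<in> X \<and> x w + \<nu> *\<^sub>R z w \<in> X \<and> x w - \<nu> *\<^sub>R z w \<in> X
     then (True, (real d * ((f' (x w + \<nu> *\<^sub>R z w) - f' (x w - \<nu> *\<^sub>R z w)) / (2 * \<nu>))) *\<^sub>R z w)
     else (False, 0))" for w
    by (auto simp: grad_est_def f'_def)
  then show ?thesis by simp
qed

lemma measurable_zogd_iter:
  assumes x0: "x0 \<in> borel_measurable M" and z: "\<And>i. (\<lambda>w. z w i) \<in> borel_measurable M"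
  shows "(\<lambda>w. enc (zogd_iter d X f m \<nu> t0 (x0 w) (z w) t)) \<in> measurable M opt_space"
proof (induction t)
  case (Suc t)
  have k: "(\<lambda>y. enc (Option.bind (grad_est d X f \<nu> (snd y) (z (fst y) (Suc t))) (\<lambda>g.
        Some (snd y - (3 / (m * (real (Suc t) + t0))) *\<^sub>R (g + (2 * m) *\<^sub>R (snd y - x0 (fst y)))))))
      \<in> measurable (M \<Otimes>\<^sub>M borel) opt_space"
  proof (rule measurable_enc_bind)
    show "(\<lambda>y. enc (grad_est d X f \<nu> (snd y) (z (fst y) (Suc t)))) \<in> measurable (M \<Otimes>\<^sub>M borel) opt_space"
      by (rule measurable_grad_est[OF measurable_snd measurable_compose[OF measurable_fst z]])
    have [measurable]: "(\<lambda>v. x0 (fst (fst v))) \<in> borel_measurable ((M \<Otimes>\<^sub>M borel) \<Otimes>\<^sub>M borel)"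
      by (rule measurable_compose[OF measurable_compose[OF measurable_fst measurable_fst] x0])
    show "(\<lambda>v. enc (Some (snd (fst v) - (3 / (m * (real (Suc t) + t0))) *\<^sub>R (snd v + (2 * m) *\<^sub>R (snd (fst v) - x0 (fst (fst v)))))))
        \<in> measurable ((M \<Otimes>\<^sub>M borel) \<Otimes>\<^sub>M borel) opt_space"
      by (rule measurable_enc_Some) measurable
  qed
  show ?case
    unfolding zogd_iter.simps by (rule measurable_enc_bind[OF Suc k])
next
  case 0
  show ?case unfolding zogd_iter.simps by (rule measurable_enc_Some[OF x0])
qed

lemma measurable_zogd:
  assumes x0: "x0 \<in> borel_measurable M" and z: "\<And>i. (\<lambda>w. z w i) \<in> borel_measurable M"
  shows "(\<lambda>w. enc (zogd d X f m \<nu> T t0 (z w) (x0 w))) \<in> measurable M opt_space"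
proof -
  let ?it = "\<lambda>w t. zogd_iter d X f m \<nu> t0 (x0 w) (z w) t"
  have it [measurable]: "(\<lambda>w. enc (?it w t)) \<in> measurable M opt_space" for t
    by (rule measurable_zogd_iter[OF x0 z])
  \<comment> \<open>\<open>the None\<close> is some fixed vector, so the right side is a measurable
    case distinction.\<close>
  have "the (?it w t) = (if fst (enc (?it w t)) then snd (enc (?it w t)) else the None)" for w t
    by (cases "?it w t") auto
  moreover have "(\<lambda>w. if fst (enc (?it w t)) then snd (enc (?it w t)) else the None) \<in> borel_measurable M" for t
    by measurable
  ultimately have the [measurable]: "(\<lambda>w. the (?it w t)) \<in> borel_measurable M" for t by simp
  have "enc (zogd d X f m \<nu> T t0 (z w) (x0 w)) = (if fst (enc (?it w T)) then (True, (2 / (real T * (real T + 2 * t0 - 1))) *\<^sub>R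
       (\<Sum>t=1..T. (real t + t0 - 1) *\<^sub>R the (?it w (t - 1)))) else (False, 0))" for w
    by (cases "?it w T") (auto simp: zogd_def)
  then show ?thesis by simp
qed

lemma measurable_zoppa:
  "(\<lambda>z. enc (zoppa d X f m \<nu> T t0 x0 z n)) \<in> measurable (directions d') opt_space"
proof (induction n)
  case (Suc n)
  show ?case
    unfolding zoppa.simps
    by (rule measurable_enc_bind[OF Suc]) (rule measurable_zogd, auto intro: measurable_compose[OF measurable_fst])
qed simp

lemma sets_zoppa_level [measurable]:
  "{z. \<exists>x. zoppa d X f m \<nu> T t0 x0 z n = Some x \<and> x \<in> X \<and> f x \<le> c} \<in> sets (directions d')"
proof -
  note [measurable] = measurable_zoppa
  define f' where "f' = (\<lambda>x. if x \<in> X then f x else 0)"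
  have [measurable]: "f' \<in> borel_measurable borel" using fX by (simp add: f'_def)
  let ?e = "\<lambda>z. enc (zoppa d X f m \<nu> T t0 x0 z n)"
  have "{z. \<exists>x. zoppa d X f m \<nu> T t0 x0 z n = Some x \<and> x \<in> X \<and> f x \<le> c}
      = {z \<in> space (directions d'). fst (?e z) \<and> snd (?e z) \<in> X \<and> f' (snd (?e z)) \<le> c}"
  proof (intro set_eqI)
    fix z
    show "z \<in> {z. \<exists>x. zoppa d X f m \<nu> T t0 x0 z n = Some x \<and> x \<in> X \<and> f x \<le> c}
      \<longleftrightarrow> z \<in> {z \<in> space (directions d'). fst (?e z) \<and> snd (?e z) \<in> X \<and> f' (snd (?e z)) \<le> c}"
      by (cases "zoppa d X f m \<nu> T t0 x0 z n") (auto simp: f'_def)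
  qed
  also have "\<dots> \<in> sets (directions d')" by measurable
  finally show ?thesis .
qed

lemma zoppa_cong: "(\<And>i t. i \<le> n \<Longrightarrow> z (i, t) = z' (i, t)) \<Longrightarrow> zoppa d X f m \<nu> T t0 x0 z n = zoppa d X f m \<nu> T t0 x0 z' n"
  by (induction n) simp_all

text \<open>One epoch: the directions of epoch \<open>n + 1\<close> are independent of the state reached before.\<close>

lemma emeasure_zoppa_step:
  assumes epoch: "\<And>x. x \<in> X \<Longrightarrow> f x \<le> c \<Longrightarrow>
    emeasure (directions d') {w. \<not> (\<exists>y. zogd d X f m (\<nu> (Suc n)) (T (Suc n)) (t0 (Suc n)) (\<lambda>t. w (Suc n, t)) x = Some y \<and> y \<in> X \<and> f y \<le> c')} \<le> p"
  shows "emeasure (directions d') {z. (\<exists>x. zoppa d X f m \<nu> T t0 x0 z n = Some x \<and> x \<in> X \<and> f x \<le> c)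
      \<and> \<not> (\<exists>x. zoppa d X f m \<nu> T t0 x0 z (Suc n) = Some x \<and> x \<in> X \<and> f x \<le> c')} \<le> p"
proof -
  let ?G = "\<lambda>z. \<exists>x. zoppa d X f m \<nu> T t0 x0 z n = Some x \<and> x \<in> X \<and> f x \<le> c"
  let ?G' = "\<lambda>z. \<exists>x. zoppa d X f m \<nu> T t0 x0 z (Suc n) = Some x \<and> x \<in> X \<and> f x \<le> c'"
  let ?B = "{z. ?G z \<and> \<not> ?G' z}"
  \<comment> \<open>All directions of the new epoch are resampled at once; the earlier epochs are
    kept.\<close>
  let ?P = "\<lambda>i. fst i = Suc n"
  have "{z. ?G z} \<in> sets (directions d')" "{z. ?G' z} \<in> sets (directions d')" by (rule sets_zoppa_level)+
  moreover have "?B = {z. ?G z} - {z. ?G' z}" by auto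
  ultimately have B [measurable]: "?B \<in> sets (directions d')" by auto
  have "emeasure (directions d') ?B = (\<integral>\<^sup>+z. indicator ?B z \<partial>directions d')"
    by (rule nn_integral_indicator[OF B, symmetric])
  also have "\<dots> = (\<integral>\<^sup>+z. \<integral>\<^sup>+w. indicator ?B (resample ?P z w) \<partial>directions d' \<partial>directions d')"
    by (rule nn_integral_resample) measurable
  also have "\<dots> \<le> (\<integral>\<^sup>+z. p \<partial>directions d')"
  proof (rule nn_integral_mono)
    fix z :: "nat \<times> nat \<Rightarrow> fseq"
    have c: "zoppa d X f m \<nu> T t0 x0 (resample ?P z w) n = zoppa d X f m \<nu> T t0 x0 z n" for w
      by (rule zoppa_cong) (simp add: resample_def)
    show "(\<integral>\<^sup>+w. indicator ?B (resample ?P z w) \<partial>directions d') \<le> p"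
    proof (cases "?G z")
      case True
      then obtain x where x: "zoppa d X f m \<nu> T t0 x0 z n = Some x" "x \<in> X" "f x \<le> c" by blast
      let ?E = "{w. \<not> (\<exists>y. zogd d X f m (\<nu> (Suc n)) (T (Suc n)) (t0 (Suc n)) (\<lambda>t. w (Suc n, t)) x = Some y \<and> y \<in> X \<and> f y \<le> c')}"
      have E: "resample ?P z w \<in> ?B \<longleftrightarrow> w \<in> ?E" for w
        using x by (auto simp: c) (auto simp: resample_def)
      have rm: "(\<lambda>w. resample ?P z w) \<in> measurable (directions d') (directions d')"
        by (rule measurable_into_directions) (auto simp: resample_def)
      \<comment> \<open>The failure event of one epoch from a fixed start is a section of the
        measurable event \<open>?B\<close>, hence measurable.\<close>
      have "?E = (\<lambda>w. resample ?P z w) -` ?B \<inter> space (directions d')" using E by auto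
      then have "?E \<in> sets (directions d')" using measurable_sets[OF rm B] by simp
      then have "(\<integral>\<^sup>+w. indicator ?E w \<partial>directions d') = emeasure (directions d') ?E" by simp
      moreover have "(\<integral>\<^sup>+w. indicator ?B (resample ?P z w) \<partial>directions d') = (\<integral>\<^sup>+w. indicator ?E w \<partial>directions d')"
        by (intro nn_integral_cong) (simp only: indicator_def E)
      ultimately show ?thesis using epoch[OF x(2,3)] by simp
    next
      case False
      then have "indicator ?B (resample ?P z w) = (0 :: ennreal)" for w by (simp add: c)
      then show ?thesis by simp
    qed
  qed
  also have "\<dots> = p" by (simp add: dirs.emeasure_space_1[simplified])
  finally show ?thesis .
qed

end

subsection \<open>One epoch of the algorithm\<close>

declare measurable_directions_component [measurable del]

lemma exp_le_quadratic:
  fixes x :: real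
  assumes "\<bar>x\<bar> \<le> 1"
  shows "exp x \<le> 1 + x + x\<^sup>2"
proof (cases "0 \<le> x")
  case True
  then show ?thesis using exp_bound[of x] assms by simp
next
  case False
  have "exp x \<le> 1 + x + x\<^sup>2 / 2 * exp 0"
  proof -
    obtain t where t: "x < t" "t < 0" "exp x = (\<Sum>m<2. (\<lambda>_. exp 0) m / fact m * x ^ m) + exp t / fact 2 * x ^ 2"
      using Maclaurin_minus[of x 2 "\<lambda>_. exp" exp] False by (auto intro!: derivative_eq_intros)
    then have "exp x = 1 + x + exp t / 2 * x\<^sup>2" by (simp add: numeral_2_eq_2)
    moreover have "exp t / 2 * x\<^sup>2 \<le> 1 / 2 * x\<^sup>2" using t by (intro mult_right_mono) auto
    ultimately show ?thesis by simp
  qed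
  then have "exp x \<le> 1 + x + x\<^sup>2 / 2" by simp
  then show ?thesis using zero_le_power2[of x] by linarith
qed

lemma one_le_ennreal_exp: "0 \<le> a \<Longrightarrow> 1 \<le> ennreal (exp a)"
  by (metis ennreal_1 ennreal_leI one_le_exp_iff)

lemma ennreal_exp_add: "ennreal (exp (a + b)) = ennreal (exp a) * ennreal (exp b)"
  by (simp add: exp_add ennreal_mult')

text \<open>\<open>R\<close> bounds the distance of the proximal minimiser \<open>xs\<close> from
  the centre, and \<open>L\<close> is the logarithm of the inverse failure probability of each of
  the two tail bounds.\<close>

locale epoch = weakly_convex_ball d x0 rad g \<mu> f
  for d :: nat and x0 :: fseq and rad g \<mu> :: real and f :: "fseq \<Rightarrow> real" +
  fixes m R :: real and X :: "fseq set" and xs :: fseq and \<nu> t0 :: real and T :: nat and L :: real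
  assumes m: "0 < m" and R_def: "R = g / m" and rad_eq: "rad = 10 * (g / m)" and \<mu>m: "\<mu> \<le> m"
    and BX: "cball x0 rad \<inter> Rn d \<subseteq> X"
    and xs: "xs \<in> Rn d" "norm (xs - x0) \<le> g / m"
    and xs_min: "\<And>y. y \<in> cball x0 rad \<inter> Rn d \<Longrightarrow>
      f xs + m * (norm (xs - x0))\<^sup>2 \<le> f y + m * (norm (y - x0))\<^sup>2"
    and \<nu>: "0 < \<nu>" "\<nu> \<le> (g / m) / 12"
    and L: "0 \<le> L" and t0: "real d * (40000 + 100 * L) \<le> t0"
begin

lemma R: "0 < R" "m * R = g" using g m by (auto simp: R_def)

lemma rad_R: "rad = 10 * R" by (simp add: R_def rad_eq)

lemma F_eq: "y \<in> B \<Longrightarrow> F y = f y" by (simp only: F_def if_True)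

lemma d3: "3 \<le> real d" using d by simp

lemma t0_ge: "40000 * real d \<le> t0" "real d \<le> t0" "120000 \<le> t0" "1 \<le> t0"
proof -
  have "real d * 40000 \<le> real d * (40000 + 100 * L)" using L by (intro mult_left_mono) auto
  then show "40000 * real d \<le> t0" using t0 by linarith
  then show "real d \<le> t0" "120000 \<le> t0" "1 \<le> t0" using d3 by linarith+
qed

definition good :: "fseq \<Rightarrow> bool" where
  "good y \<longleftrightarrow> y \<in> Rn d \<and> norm (y - xs) \<le> 2 * R"

definition gap :: "fseq \<Rightarrow> real" where
  "gap y = F y + m * (norm (y - x0))\<^sup>2 - (F xs + m * (norm (xs - x0))\<^sup>2)"

text \<open>The estimator formed with the total function \<open>F\<close>: it never fails, and at
  good points it coincides with the algorithm's.\<close>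

definition est :: "fseq \<Rightarrow> fseq \<Rightarrow> fseq" where
  "est y v = (real d * ((F (y + \<nu> *\<^sub>R v) - F (y - \<nu> *\<^sub>R v)) / (2 * \<nu>))) *\<^sub>R v"

text \<open>\<open>s\<close> stands for the shifted time \<open>t + t0\<close>, so
  \<open>3 / (m * s)\<close> is the step size of the algorithm.\<close>

definition descent :: "real \<Rightarrow> fseq \<Rightarrow> fseq \<Rightarrow> fseq" where
  "descent s y v = y - (3 / (m * s)) *\<^sub>R (est y v + (2 * m) *\<^sub>R (y - x0))"

lemma measurable_gap [measurable]: "gap \<in> borel_measurable borel"
  unfolding gap_def by measurable

lemma measurable_descent [measurable]: "case_prod (descent s) \<in> borel_measurable (borel \<Otimes>\<^sub>M borel)"
  unfolding descent_def est_def by measurable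

lemma measurable_good [measurable]: "Measurable.pred borel good"
  unfolding good_def by measurable

lemma xs_B: "xs \<in> B"
proof (rule BI)
  show "norm (xs - x0) \<le> rad" using xs(2) R(1) unfolding rad_R R_def[symmetric] by linarith
qed (rule xs)

lemma gap_nonneg:
  assumes y: "y \<in> B"
  shows "0 \<le> gap y"
  using xs_min[OF y] unfolding gap_def F_eq[OF xs_B] F_eq[OF y] by linarith

lemma good_x0: "good x0"
  unfolding good_def using x0 xs(2) R(1) by (simp add: norm_minus_commute R_def[symmetric])

lemma good_dist:
  assumes "good y"
  shows "y \<in> Rn d" "norm (y - x0) \<le> 3 * R" "norm (y - xs) \<le> 2 * R" "y \<in> B"
proof -
  show "y \<in> Rn d" "norm (y - xs) \<le> 2 * R" using assms by (auto simp: good_def)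
  then show *: "norm (y - x0) \<le> 3 * R"
    using norm_triangle_ineq[of "y - xs" "xs - x0"] xs by (simp add: R_def)
  show "y \<in> B" by (rule BI) (use \<open>y \<in> Rn d\<close> * R in \<open>auto simp: rad_R\<close>)
qed

lemma descent_in_Rn: "good y \<Longrightarrow> v \<in> Rn d \<Longrightarrow> descent s y v \<in> Rn d"
  unfolding descent_def est_def using good_dist(1) x0 by (intro Rn_intros) auto

lemma gradient_estimate_good:
  assumes "good y"
  shows "gradient_estimate d x0 rad g \<mu> f y \<nu>"
proof
  show "y \<in> Rn d" using assms by (rule good_dist)
  show "norm (y - x0) + \<nu> < rad"
    using good_dist(2)[OF assms] \<nu>(2) R(1) unfolding rad_R R_def[symmetric] by linarith
qed (rule \<nu>)

text \<open>The exponential moment of one step. All random terms are at most 1/2 by the choice of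
  \<open>\<kappa>\<close>, so \<open>exp z \<le> 1 + z + z\<^sup>2\<close> applies; the variance of the martingale term is
  proportional to \<open>\<bar>y - xs\<bar>\<^sup>2\<close> and is absorbed by strong convexity.\<close>

lemma one_step:
  assumes y: "good y" and s: "t0 + 1 \<le> s" and \<kappa>: "0 \<le> \<kappa>" "\<kappa> * (200 * real d * R\<^sup>2 * s) \<le> 1"
  shows "(\<integral>\<^sup>+v. ennreal (exp (\<kappa> * (s * (s - 1) * (norm (descent s y v - xs))\<^sup>2 + 6 / m * (s - 1) * gap y))) \<partial>uniform_sphere d)
    \<le> ennreal (exp (\<kappa> * ((s - 1) * (s - 2) * (norm (y - xs))\<^sup>2 + 75000 * real d * R\<^sup>2 + 12 / m * (s - 1) * (g * \<nu>))))"
proof -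
  interpret G: gradient_estimate d x0 rad g \<mu> f y \<nu> by (rule gradient_estimate_good[OF y])
  have est: "est y = G.G" by (rule ext) (simp only: est_def G.G_def)
  define u where "u = y - xs"
  define e where "e = (2 * m) *\<^sub>R (y - x0)"
  have u: "u \<in> Rn d" "norm u \<le> 2 * R" using good_dist[OF y] xs by (auto simp: u_def)
  have ne: "norm e \<le> 6 * g"
  proof -
    have "norm e = 2 * m * norm (y - x0)" using m by (simp add: e_def)
    also have "\<dots> \<le> 2 * m * (3 * R)" using m good_dist(2)[OF y] by (intro mult_left_mono) auto
    also have "\<dots> = 6 * g" using R(2) by simp
    finally show ?thesis .
  qed
  have s': "120000 \<le> s" "real d \<le> s" "0 < s" "0 \<le> s - 1" using s t0_ge by linarith+
  \<comment> \<open>\<open>A\<close> and \<open>b\<close> are the coefficients of the linear and the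
    quadratic term when \<open>\<kappa> * s * (s - 1)\<close> times the squared distance after the
    step is expanded.\<close>
  define A where "A = \<kappa> * (6 / m) * (s - 1)"
  define b where "b = 9 * \<kappa> * (s - 1) / (m\<^sup>2 * s)"
  have A0: "0 \<le> A" and b0: "0 \<le> b" using \<kappa> m s' by (auto simp: A_def b_def)
  have b_le: "b \<le> 9 * \<kappa> / m\<^sup>2"
  proof -
    have "b = 9 * \<kappa> / m\<^sup>2 * ((s - 1) / s)" by (simp add: b_def)
    also have "\<dots> \<le> 9 * \<kappa> / m\<^sup>2 * 1" using \<kappa> s' by (intro mult_left_mono) auto
    finally show ?thesis by simp
  qed
  have A_le: "A \<le> 6 * \<kappa> * s / m"
    using \<kappa> m s' by (simp add: A_def field_simps mult_left_mono)
  have \<kappa>ds: "\<kappa> * (real d * R\<^sup>2 * s) \<le> 1 / 200" using \<kappa>(2) by (simp add: algebra_simps)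
  have \<kappa>dd: "\<kappa> * ((real d)\<^sup>2 * R\<^sup>2) \<le> 1 / 200"
  proof -
    have "\<kappa> * ((real d)\<^sup>2 * R\<^sup>2) = \<kappa> * (real d * R\<^sup>2) * real d" by (simp add: power2_eq_square)
    also have "\<dots> \<le> \<kappa> * (real d * R\<^sup>2) * s" using \<kappa> s' by (intro mult_left_mono) auto
    finally show ?thesis using \<kappa>ds by (simp add: algebra_simps)
  qed
  define P where "P v = inner (G.G v) u" for v
  define N where "N v = (norm (G.G v + e))\<^sup>2" for v
  have [measurable]: "P \<in> borel_measurable borel" "N \<in> borel_measurable borel"
    unfolding P_def N_def by measurable
  have P_bound: "\<bar>A * P v\<bar> \<le> 1 / 2" and N_bound: "b * N v \<le> 1 / 2" if v: "v \<in> Rn d" "norm v = 1" for v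
  proof -
    have nG: "norm (G.G v) \<le> real d * g" by (rule G.norm_G_le[OF v])
    have "\<bar>P v\<bar> \<le> norm (G.G v) * norm u" unfolding P_def by (rule Cauchy_Schwarz_ineq2)
    also have "\<dots> \<le> (real d * g) * (2 * R)" by (rule mult_mono[OF nG u(2)]) (use g in auto)
    finally have Pb: "\<bar>P v\<bar> \<le> (real d * g) * (2 * R)" .
    have "A * \<bar>P v\<bar> \<le> (6 * \<kappa> * s / m) * ((real d * g) * (2 * R))"
      by (rule mult_mono[OF A_le Pb order_trans[OF A0 A_le]]) simp
    also have "\<dots> = 12 * (\<kappa> * (real d * R\<^sup>2 * s))"
      using m by (simp add: R(2)[symmetric] power2_eq_square)
    also have "\<dots> \<le> 12 * (1 / 200)" by (intro mult_left_mono \<kappa>ds) simp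
    finally show "\<bar>A * P v\<bar> \<le> 1 / 2" using A0 by (simp add: abs_mult)
    have "norm (G.G v + e) \<le> real d * g + 6 * g" using norm_triangle_ineq[of "G.G v" e] nG ne by linarith
    also have "\<dots> \<le> 3 * (real d * g)" using mult_right_mono[OF d3, of g] g by linarith
    finally have Nb: "N v \<le> (3 * (real d * g))\<^sup>2" unfolding N_def by (intro power_mono) auto
    have "b * N v \<le> (9 * \<kappa> / m\<^sup>2) * (3 * (real d * g))\<^sup>2"
      by (rule mult_mono[OF b_le Nb order_trans[OF b0 b_le]]) (simp add: N_def)
    also have "\<dots> = 81 * (\<kappa> * ((real d)\<^sup>2 * R\<^sup>2))"
      using m by (simp add: R(2)[symmetric] power_mult_distrib)
    also have "\<dots> \<le> 81 * (1 / 200)" by (intro mult_left_mono \<kappa>dd) simp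
    finally show "b * N v \<le> 1 / 2" by simp
  qed
  define W where "W v = 1 - A * P v + 2 * A\<^sup>2 * (P v)\<^sup>2 + 2 * b * N v" for v
  have expW: "exp (- A * P v + b * N v) \<le> W v" if v: "v \<in> Rn d" "norm v = 1" for v
  proof -
    define p q where "p = - A * P v" and "q = b * N v"
    have pq: "\<bar>p\<bar> \<le> 1 / 2" "0 \<le> q" "q \<le> 1 / 2"
      using P_bound[OF v] N_bound[OF v] mult_nonneg_nonneg[OF b0 zero_le_power2] by (simp_all add: p_def q_def N_def)
    have "exp (p + q) \<le> 1 + (p + q) + (p + q)\<^sup>2" by (rule exp_le_quadratic) (use pq in auto)
    also have "(p + q)\<^sup>2 \<le> 2 * p\<^sup>2 + 2 * q\<^sup>2" using sum_squares_bound[of p q] by (simp add: power2_sum)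
    also have "2 * q\<^sup>2 \<le> q" using pq mult_left_mono[of q "1/2" q] by (simp add: power2_eq_square)
    finally have "exp (p + q) \<le> 1 + p + 2 * p\<^sup>2 + 2 * q" by linarith
    then show ?thesis by (simp add: p_def q_def W_def power_mult_distrib)
  qed
  have AEv: "AE v in uniform_sphere d. v \<in> Rn d \<and> norm v = 1" by (rule AE_uniform_sphere[OF d0])
  have int: "integrable (uniform_sphere d) h" if [measurable]: "h \<in> borel_measurable borel"
    and "\<And>v. v \<in> Rn d \<Longrightarrow> norm v = 1 \<Longrightarrow> \<bar>h v\<bar> \<le> C" for h :: "fseq \<Rightarrow> real" and C
  proof (rule sph.integrable_const_bound)
    show "AE v in uniform_sphere d. norm (h v) \<le> C" using AEv by eventually_elim (use that in auto)
  qed (use that in \<open>simp add: measurable_cong_sets[OF sets_uniform_sphere refl]\<close>)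
  have iP: "integrable (uniform_sphere d) P"
  proof (rule int)
    fix v assume v: "v \<in> Rn d" "norm v = 1"
    have "\<bar>P v\<bar> \<le> norm (G.G v) * norm u" unfolding P_def by (rule Cauchy_Schwarz_ineq2)
    also have "\<dots> \<le> (real d * g) * norm u" by (intro mult_right_mono G.norm_G_le[OF v]) auto
    finally show "\<bar>P v\<bar> \<le> (real d * g) * norm u" .
  qed measurable
  have iP2: "integrable (uniform_sphere d) (\<lambda>v. (P v)\<^sup>2)"
  proof (rule int)
    fix v assume v: "v \<in> Rn d" "norm v = 1"
    have "\<bar>P v\<bar> \<le> norm (G.G v) * norm u" unfolding P_def by (rule Cauchy_Schwarz_ineq2)
    also have "\<dots> \<le> (real d * g) * norm u" by (intro mult_right_mono G.norm_G_le[OF v]) auto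
    finally have "\<bar>P v\<bar>\<^sup>2 \<le> ((real d * g) * norm u)\<^sup>2" by (intro power_mono) auto
    then show "\<bar>(P v)\<^sup>2\<bar> \<le> ((real d * g) * norm u)\<^sup>2" by simp
  qed measurable
  have iG: "integrable (uniform_sphere d) (\<lambda>v. (norm (G.G v))\<^sup>2)"
  proof (rule int)
    fix v assume v: "v \<in> Rn d" "norm v = 1"
    show "\<bar>(norm (G.G v))\<^sup>2\<bar> \<le> (real d * g)\<^sup>2"
      using power_mono[OF G.norm_G_le[OF v], of 2] by simp
  qed measurable
  have iN: "integrable (uniform_sphere d) N"
  proof (rule int)
    fix v assume v: "v \<in> Rn d" "norm v = 1"
    have "norm (G.G v + e) \<le> real d * g + 6 * g"
      using norm_triangle_ineq[of "G.G v" e] G.norm_G_le[OF v] ne by linarith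
    then have "N v \<le> (real d * g + 6 * g)\<^sup>2" unfolding N_def by (intro power_mono) auto
    then show "\<bar>N v\<bar> \<le> (real d * g + 6 * g)\<^sup>2" by (simp add: N_def)
  qed measurable
  have iW: "integrable (uniform_sphere d) W" unfolding W_def using iP iP2 iN by simp
  have EP: "gap y + m / 2 * (norm u)\<^sup>2 - 2 * g * \<nu> \<le> (\<integral>v. P v \<partial>uniform_sphere d) + inner e u"
  proof -
    have yu: "y - u = xs" by (simp add: u_def)
    have "norm (y - x0) + \<nu> + norm u \<le> rad"
      using good_dist(2)[OF y] u(2) \<nu>(2) R(1) unfolding rad_R R_def[symmetric] by linarith
    from G.G_mean_lower[OF u(1) this] have 1: "F y - F xs - 2 * g * \<nu> - \<mu> / 2 * (norm u)\<^sup>2 \<le> (\<integral>v. P v \<partial>uniform_sphere d)"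
      unfolding yu P_def .
    have "xs - x0 = (y - x0) + (- 1) *\<^sub>R u" by (simp add: u_def)
    moreover define k where "k = inner (y - x0) u"
    ultimately have n: "(norm (xs - x0))\<^sup>2 = (norm (y - x0))\<^sup>2 - 2 * k + (norm u)\<^sup>2"
      by (simp only: norm_add_scaleR_sq) simp
    have eu: "inner e u = 2 * m * k" by (simp add: e_def k_def)
    have 2: "inner e u = m * (norm (y - x0))\<^sup>2 + m * (norm u)\<^sup>2 - m * (norm (xs - x0))\<^sup>2"
      unfolding n eu by (simp add: algebra_simps)
    have "\<mu> / 2 * (norm u)\<^sup>2 \<le> m / 2 * (norm u)\<^sup>2" using \<mu>m by (intro mult_right_mono) auto
    then show ?thesis using 1 2 by (simp add: gap_def)
  qed
  have EP2: "(\<integral>v. (P v)\<^sup>2 \<partial>uniform_sphere d) \<le> real d * g\<^sup>2 * (norm u)\<^sup>2"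
    unfolding P_def by (rule G.G_directional_second_moment[OF u(1)])
  \<comment> \<open>\<open>4120 = 2 * 2048 + 24\<close>, where \<open>72 * g\<^sup>2\<close> is at
    most \<open>24 * real d * g\<^sup>2\<close> as \<open>d \<ge> 3\<close>.\<close>
  have EN: "(\<integral>v. N v \<partial>uniform_sphere d) \<le> 4120 * (real d * g\<^sup>2)"
  proof -
    have "(\<integral>v. N v \<partial>uniform_sphere d) \<le> (\<integral>v. 2 * (norm (G.G v))\<^sup>2 + 2 * (6 * g)\<^sup>2 \<partial>uniform_sphere d)"
    proof (rule integral_mono[OF iN])
      fix v
      have "N v \<le> (norm (G.G v) + norm e)\<^sup>2" unfolding N_def by (intro power_mono norm_triangle_ineq) auto
      also have "\<dots> \<le> 2 * (norm (G.G v))\<^sup>2 + 2 * (norm e)\<^sup>2"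
        using sum_squares_bound[of "norm (G.G v)" "norm e"] by (simp add: power2_sum)
      also have "(norm e)\<^sup>2 \<le> (6 * g)\<^sup>2" using ne by (intro power_mono) auto
      finally show "N v \<le> 2 * (norm (G.G v))\<^sup>2 + 2 * (6 * g)\<^sup>2" by simp
    qed (use iG in simp)
    also have "\<dots> = 2 * (\<integral>v. (norm (G.G v))\<^sup>2 \<partial>uniform_sphere d) + 72 * g\<^sup>2"
      using iG by (simp add: sph.prob_space[simplified] power_mult_distrib)
    also have "\<dots> \<le> 2 * (2048 * real d * g\<^sup>2) + 24 * (real d * g\<^sup>2)"
      using G.G_second_moment mult_right_mono[OF d3, of "g\<^sup>2"] by (intro add_mono) auto
    finally show ?thesis by simp
  qed
  define K where "K = \<kappa> * (s * (s - 1) * (norm u)\<^sup>2) - A * inner e u + A * gap y"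
  have expo: "\<kappa> * (s * (s - 1) * (norm (descent s y v - xs))\<^sup>2 + 6 / m * (s - 1) * gap y) = K + (- A * P v + b * N v)" for v
  proof -
    have "descent s y v - xs = u + (- (3 / (m * s))) *\<^sub>R (G.G v + e)"
      by (simp add: descent_def est e_def u_def)
    then have n: "(norm (descent s y v - xs))\<^sup>2 = (norm u)\<^sup>2 + 2 * (- (3 / (m * s))) * inner u (G.G v + e) + (- (3 / (m * s)))\<^sup>2 * N v"
      by (simp only: norm_add_scaleR_sq N_def)
    have i: "inner u (G.G v + e) = P v + inner e u" by (simp add: P_def inner_add_right inner_commute)
    have c1: "\<kappa> * (s * (s - 1)) * (2 * (- (3 / (m * s)))) = - A" using s' m by (simp add: A_def field_simps)
    have c2: "\<kappa> * (s * (s - 1)) * (- (3 / (m * s)))\<^sup>2 = b" using s' m by (simp add: b_def power2_eq_square field_simps)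
    have "\<kappa> * (s * (s - 1) * (norm (descent s y v - xs))\<^sup>2) = \<kappa> * (s * (s - 1) * (norm u)\<^sup>2)
        + \<kappa> * (s * (s - 1)) * (2 * (- (3 / (m * s)))) * (P v + inner e u) + \<kappa> * (s * (s - 1)) * (- (3 / (m * s)))\<^sup>2 * N v"
      unfolding n i by (simp only: distrib_left mult.assoc)
    then have "\<kappa> * (s * (s - 1) * (norm (descent s y v - xs))\<^sup>2) = \<kappa> * (s * (s - 1) * (norm u)\<^sup>2)
        + - A * (P v + inner e u) + b * N v" unfolding c1 c2 .
    moreover have "\<kappa> * (6 / m * (s - 1) * gap y) = A * gap y" by (simp add: A_def)
    ultimately show ?thesis
      unfolding distrib_left[of \<kappa>] K_def by (simp add: distrib_left)
  qed
  have "(\<integral>\<^sup>+v. ennreal (exp (\<kappa> * (s * (s - 1) * (norm (descent s y v - xs))\<^sup>2 + 6 / m * (s - 1) * gap y))) \<partial>uniform_sphere d)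
      \<le> (\<integral>\<^sup>+v. ennreal (exp K) * ennreal (W v) \<partial>uniform_sphere d)"
  proof (rule nn_integral_mono_AE, use AEv in eventually_elim)
    fix v assume "v \<in> Rn d \<and> norm v = 1"
    then have "exp K * exp (- A * P v + b * N v) \<le> exp K * W v" using expW[of v] by (intro mult_left_mono) auto
    then show "ennreal (exp (\<kappa> * (s * (s - 1) * (norm (descent s y v - xs))\<^sup>2 + 6 / m * (s - 1) * gap y))) \<le> ennreal (exp K) * ennreal (W v)"
      unfolding expo exp_add by (simp add: ennreal_mult'[symmetric] ennreal_leI)
  qed
  also have "\<dots> = ennreal (exp K) * (\<integral>\<^sup>+v. ennreal (W v) \<partial>uniform_sphere d)"
    by (rule nn_integral_cmult) (use borel_measurable_integrable[OF iW] in measurable)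
  also have "(\<integral>\<^sup>+v. ennreal (W v) \<partial>uniform_sphere d) = ennreal (\<integral>v. W v \<partial>uniform_sphere d)"
  proof (rule nn_integral_eq_integral[OF iW])
    show "AE v in uniform_sphere d. 0 \<le> W v"
      using AEv by eventually_elim (use expW in \<open>auto intro: order_trans[OF exp_ge_zero]\<close>)
  qed
  also have "ennreal (exp K) * ennreal (\<integral>v. W v \<partial>uniform_sphere d) = ennreal (exp K * (\<integral>v. W v \<partial>uniform_sphere d))"
    by (rule ennreal_mult'[symmetric]) simp
  also have "\<dots> \<le> ennreal (exp (\<kappa> * ((s - 1) * (s - 2) * (norm (y - xs))\<^sup>2 + 75000 * real d * R\<^sup>2 + 12 / m * (s - 1) * (g * \<nu>))))"
  proof (rule ennreal_leI)
    have EW: "(\<integral>v. W v \<partial>uniform_sphere d) = 1 - A * (\<integral>v. P v \<partial>uniform_sphere d)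
        + 2 * A\<^sup>2 * (\<integral>v. (P v)\<^sup>2 \<partial>uniform_sphere d) + 2 * b * (\<integral>v. N v \<partial>uniform_sphere d)"
      unfolding W_def using iP iP2 iN by (simp add: sph.prob_space[simplified])
    \<comment> \<open>The variance of the noise is proportional to \<open>(norm u)\<^sup>2\<close>,
      and the cap on \<kappa> makes it at most one unit
      \<open>\<kappa> * (s - 1) * (norm u)\<^sup>2\<close>.\<close>
    have h1: "2 * A\<^sup>2 * (\<integral>v. (P v)\<^sup>2 \<partial>uniform_sphere d) \<le> \<kappa> * (s - 1) * (norm u)\<^sup>2"
    proof -
      have "2 * A\<^sup>2 * (\<integral>v. (P v)\<^sup>2 \<partial>uniform_sphere d) \<le> 2 * A\<^sup>2 * (real d * g\<^sup>2 * (norm u)\<^sup>2)"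
        by (intro mult_left_mono EP2) auto
      also have "\<dots> = A * (2 * (real d * g\<^sup>2 * (norm u)\<^sup>2)) * A" by (simp add: power2_eq_square)
      also have "\<dots> \<le> A * (2 * (real d * g\<^sup>2 * (norm u)\<^sup>2)) * (6 * \<kappa> * s / m)"
        using A0 by (intro mult_left_mono A_le) auto
      also have "\<dots> = (\<kappa> * (s - 1) * (norm u)\<^sup>2) * (72 * (\<kappa> * (real d * R\<^sup>2 * s)))"
        using m by (simp add: A_def R(2)[symmetric] power2_eq_square)
      also have "\<dots> \<le> (\<kappa> * (s - 1) * (norm u)\<^sup>2) * 1"
        using \<kappa>ds \<kappa>(1) s' by (intro mult_left_mono) auto
      finally show ?thesis by simp
    qed
    have h2: "2 * b * (\<integral>v. N v \<partial>uniform_sphere d) \<le> \<kappa> * (75000 * real d * R\<^sup>2)"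
    proof -
      have "2 * b * (\<integral>v. N v \<partial>uniform_sphere d) \<le> 2 * (9 * \<kappa> / m\<^sup>2) * (4120 * (real d * g\<^sup>2))"
      proof (rule mult_mono[OF _ EN])
        show "2 * b \<le> 2 * (9 * \<kappa> / m\<^sup>2)" using b_le by simp
      qed (use \<kappa>(1) in \<open>auto simp: N_def intro!: integral_nonneg_AE\<close>)
      also have "\<dots> = 74160 * (\<kappa> * (real d * R\<^sup>2))" using m by (simp add: R(2)[symmetric] power_mult_distrib)
      also have "\<dots> \<le> 75000 * (\<kappa> * (real d * R\<^sup>2))" using \<kappa>(1) by (intro mult_right_mono) auto
      finally show ?thesis by (simp add: mult_ac)
    qed
    have h3: "A * (gap y + m / 2 * (norm u)\<^sup>2 - 2 * g * \<nu>) \<le> A * ((\<integral>v. P v \<partial>uniform_sphere d) + inner e u)"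
      by (intro mult_left_mono EP A0)
    \<comment> \<open>Strong convexity yields three such units. One cancels the variance, and
      \<open>s * (s - 1) - 2 * (s - 1) = (s - 1) * (s - 2)\<close> is the weight of the previous
      time.\<close>
    have Am: "A * (m / 2) = 3 * \<kappa> * (s - 1)" using m by (simp add: A_def)
    have "exp K * (\<integral>v. W v \<partial>uniform_sphere d) \<le> exp K * exp ((\<integral>v. W v \<partial>uniform_sphere d) - 1)"
      using exp_ge_add_one_self[of "(\<integral>v. W v \<partial>uniform_sphere d) - 1"] by (intro mult_left_mono) auto
    also have "\<dots> = exp (K + ((\<integral>v. W v \<partial>uniform_sphere d) - 1))" by (simp add: exp_add)
    also have "\<dots> \<le> exp (\<kappa> * ((s - 1) * (s - 2) * (norm u)\<^sup>2 + 75000 * real d * R\<^sup>2 + 12 / m * (s - 1) * (g * \<nu>)))"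
    proof -
      have "K + ((\<integral>v. W v \<partial>uniform_sphere d) - 1) \<le> \<kappa> * (s * (s - 1) * (norm u)\<^sup>2) + A * gap y
          - A * (gap y + m / 2 * (norm u)\<^sup>2 - 2 * g * \<nu>) + \<kappa> * (s - 1) * (norm u)\<^sup>2 + \<kappa> * (75000 * real d * R\<^sup>2)"
        using h1 h2 h3 unfolding EW K_def by (simp add: distrib_left)
      also have "\<dots> = \<kappa> * (s * (s - 1) * (norm u)\<^sup>2) - A * (m / 2) * (norm u)\<^sup>2 + A * (2 * g * \<nu>)
          + \<kappa> * (s - 1) * (norm u)\<^sup>2 + \<kappa> * (75000 * real d * R\<^sup>2)"
        by (simp add: algebra_simps)
      also have "\<dots> = \<kappa> * ((s - 1) * (s - 2) * (norm u)\<^sup>2 + 75000 * real d * R\<^sup>2 + 12 / m * (s - 1) * (g * \<nu>))"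
        unfolding Am by (simp add: A_def algebra_simps)
      finally show ?thesis by simp
    qed
    finally show "exp K * (\<integral>v. W v \<partial>uniform_sphere d)
      \<le> exp (\<kappa> * ((s - 1) * (s - 2) * (norm (y - xs))\<^sup>2 + 75000 * real d * R\<^sup>2 + 12 / m * (s - 1) * (g * \<nu>)))"
      unfolding u_def .
  qed
  finally show ?thesis .
qed

text \<open>State: the iterate, frozen when it leaves the good region, and the weighted sum of the gaps.\<close>

definition trans :: "nat \<Rightarrow> fseq \<times> real \<Rightarrow> fseq \<Rightarrow> fseq \<times> real" where
  "trans t S v = (if good (fst S)
    then (descent (real (Suc t) + t0) (fst S) v, snd S + (real (Suc t) + t0 - 1) * gap (fst S)) else S)"

lemma measurable_trans: "case_prod (trans t) \<in> measurable ((borel \<Otimes>\<^sub>M borel) \<Otimes>\<^sub>M borel) (borel \<Otimes>\<^sub>M borel)"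
proof -
  have "case_prod (trans t) = (\<lambda>p. if good (fst (fst p))
    then (case_prod (descent (real (Suc t) + t0)) (fst (fst p), snd p), snd (fst p) + (real (Suc t) + t0 - 1) * gap (fst (fst p)))
    else fst p)"
    by (auto simp: trans_def fun_eq_iff)
  also have "\<dots> \<in> measurable ((borel \<Otimes>\<^sub>M borel) \<Otimes>\<^sub>M borel) (borel \<Otimes>\<^sub>M borel)" by measurable
  finally show ?thesis .
qed

abbreviation states :: "nat \<Rightarrow> (nat \<times> nat \<Rightarrow> fseq) \<Rightarrow> nat \<Rightarrow> fseq \<times> real" where
  "states n z t \<equiv> run trans (x0, 0) (\<lambda>t. z (n, t)) t"

lemma measurable_states [measurable]: "(\<lambda>z. states n z t) \<in> measurable (directions d) (borel \<Otimes>\<^sub>M borel)"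
  by (rule measurable_run[OF measurable_trans]) (simp add: space_pair_measure)

text \<open>The exponent grows like \<open>s\<close> times the squared distance, so at the exit
  radius \<open>2 * R\<close> it exceeds the initial value plus all accumulated drift plus
  \<open>L\<close>. The potential is thus at least 1 on leaving and can be frozen at 1, whereas it
  starts at \<open>exp (- L)\<close>.\<close>

lemma prob_leave: "emeasure (directions d) {z. \<not> good (fst (states n z T))} \<le> ennreal (exp (- L))"
proof -
  \<comment> \<open>Drift per step: \<open>375 = 75000 / 200\<close> from the noise, the second term
    from the smoothing bias.\<close>
  define e where "e = 375 / t0 + 3 * \<nu> / (50 * real d * R)"
  define l where "l = (t0 - 1) * (norm (x0 - xs))\<^sup>2 / (200 * real d * R\<^sup>2) + L"
  define \<psi> where "\<psi> t y = (real t + t0 - 1) * (norm (y - xs))\<^sup>2 / (200 * real d * R\<^sup>2) - real t * e - l" for t :: nat and y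
  define V where "V t S = (if good (fst S) then ennreal (exp (\<psi> t (fst S))) else 1)" for t and S :: "fseq \<times> real"
  have dR: "0 < real d * R\<^sup>2" using d0 R by simp
  have [measurable]: "V t \<in> borel_measurable (borel \<Otimes>\<^sub>M borel)" for t
    unfolding V_def \<psi>_def by measurable
  have exit: "0 \<le> \<psi> (Suc t) y" if "2 * R < norm (y - xs)" for t y
  proof -
    define s where "s = real (Suc t) + t0 - 1"
    have st: "t0 \<le> s" "real (Suc t) \<le> s" "0 < s" using t0_ge by (auto simp: s_def)
    have "(2 * R)\<^sup>2 \<le> (norm (y - xs))\<^sup>2" using that R by (intro power_mono) auto
    then have "s * (4 * R\<^sup>2) \<le> s * (norm (y - xs))\<^sup>2" using st by (intro mult_left_mono) (auto simp: power_mult_distrib)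
    then have "s * (4 * R\<^sup>2) / (200 * real d * R\<^sup>2) \<le> s * (norm (y - xs))\<^sup>2 / (200 * real d * R\<^sup>2)"
      using dR by (intro divide_right_mono) auto
    moreover have "s * (4 * R\<^sup>2) / (200 * real d * R\<^sup>2) = s / (50 * real d)" using R d0 by (simp add: field_simps)
    ultimately have a: "s / (50 * real d) \<le> s * (norm (y - xs))\<^sup>2 / (200 * real d * R\<^sup>2)" by simp
    have "(norm (x0 - xs))\<^sup>2 \<le> R\<^sup>2" using xs R by (intro power_mono) (auto simp: R_def norm_minus_commute)
    then have "(t0 - 1) * (norm (x0 - xs))\<^sup>2 \<le> s * R\<^sup>2" using st t0_ge by (intro mult_mono) auto
    then have "(t0 - 1) * (norm (x0 - xs))\<^sup>2 / (200 * real d * R\<^sup>2) \<le> s * R\<^sup>2 / (200 * real d * R\<^sup>2)"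
      using dR by (intro divide_right_mono) auto
    then have b: "l \<le> s / (200 * real d) + L" using R d0 by (simp add: l_def)
    have e0: "0 \<le> e" using t0_ge \<nu> R d0 by (simp add: e_def)
    have "3 * \<nu> / (50 * real d * R) \<le> 3 * (R / 12) / (50 * real d * R)"
      using \<nu> R d0 by (intro divide_right_mono mult_left_mono) (auto simp: R_def[symmetric])
    also have "\<dots> = 1 / (200 * real d)" using R d0 by (simp add: field_simps)
    finally have "e \<le> 375 / t0 + 1 / (200 * real d)" by (simp add: e_def)
    then have "real (Suc t) * e \<le> s * (375 / t0 + 1 / (200 * real d))" using st e0 by (intro mult_mono) auto
    then have c: "real (Suc t) * e \<le> s * (375 / t0) + s / (200 * real d)" by (simp add: distrib_left)
    have "L * t0 \<le> L * s" using L st by (intro mult_left_mono) auto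
    then have Ls: "L \<le> s * (L / t0)" using t0_ge by (simp add: field_simps)
    \<comment> \<open>Here the lower bound on \<open>t0\<close> enters. Leaving supplies
      \<open>s / (50 * real d)\<close>: half of it pays for noise and \<open>L\<close>, a quarter
      each for the bias and the initial distance.\<close>
    have "(375 + L) / t0 \<le> 1 / (100 * real d)"
    proof -
      have "100 * real d * (375 + L) \<le> t0" using t0 d3 by (simp add: algebra_simps)
      then show ?thesis using t0_ge d0 by (simp add: field_simps)
    qed
    then have "s * ((375 + L) / t0) \<le> s * (1 / (100 * real d))" using st by (intro mult_left_mono) auto
    then have "s * (375 / t0) + s * (L / t0) \<le> s / (100 * real d)" by (simp add: add_divide_distrib distrib_left)
    moreover have "s / (50 * real d) = s / (100 * real d) + s / (200 * real d) + s / (200 * real d)"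
      using d0 by (simp add: field_simps)
    ultimately have "real (Suc t) * e + l \<le> s / (50 * real d)" using b c Ls by linarith
    then show ?thesis using a by (simp add: \<psi>_def s_def)
  qed
  have step: "(\<integral>\<^sup>+v. V (Suc t) (trans t S v) \<partial>uniform_sphere d) \<le> V t S" for t S
  proof (cases "good (fst S)")
    case False
    then show ?thesis by (simp add: trans_def V_def sph.emeasure_space_1[simplified])
  next
    case True
    define y where "y = fst S"
    define s where "s = real (Suc t) + t0"
    \<comment> \<open>The largest value \<open>one_step\<close> admits at time \<open>s\<close>. It
      varies with time, so the potential carries the weight \<open>s - 1\<close> instead of
      \<open>s * (s - 1)\<close>.\<close>
    define \<kappa> where "\<kappa> = 1 / (200 * real d * R\<^sup>2 * s)"
    have s: "t0 + 1 \<le> s" "0 < s" "1 < s" "2 \<le> s" using t0_ge by (auto simp: s_def)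
    have \<kappa>: "0 \<le> \<kappa>" "\<kappa> * (200 * real d * R\<^sup>2 * s) \<le> 1" "\<kappa> * (s * (s - 1)) = (s - 1) / (200 * real d * R\<^sup>2)"
      using s R d0 by (auto simp: \<kappa>_def)
    have y: "good y" using True by (simp add: y_def)
    have gy: "0 \<le> 6 / m * (s - 1) * gap y" using m s gap_nonneg[OF good_dist(4)[OF y]] by auto
    let ?c = "exp (- (real (Suc t) * e) - l)"
    have "(\<integral>\<^sup>+v. V (Suc t) (trans t S v) \<partial>uniform_sphere d)
        \<le> (\<integral>\<^sup>+v. ennreal ?c * ennreal (exp (\<kappa> * (s * (s - 1) * (norm (descent s y v - xs))\<^sup>2 + 6 / m * (s - 1) * gap y))) \<partial>uniform_sphere d)"
    proof (rule nn_integral_mono_AE, use AE_uniform_sphere[OF d0] in eventually_elim)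
      fix v assume v: "v \<in> Rn d \<and> norm v = 1"
      have "fst (trans t S v) = descent s y v" using True by (simp add: trans_def s_def y_def)
      moreover have "descent s y v \<in> Rn d" using y v by (intro descent_in_Rn) auto
      ultimately have "V (Suc t) (trans t S v) \<le> ennreal (exp (\<psi> (Suc t) (descent s y v)))"
        using exit[of "descent s y v" t] by (auto simp: V_def good_def intro!: one_le_ennreal_exp)
      also have "\<dots> \<le> ennreal (exp (\<kappa> * (s * (s - 1) * (norm (descent s y v - xs))\<^sup>2 + 6 / m * (s - 1) * gap y) + (- (real (Suc t) * e) - l)))"
      proof (intro ennreal_leI iffD2[OF exp_le_cancel_iff])
        have "\<psi> (Suc t) (descent s y v) = \<kappa> * (s * (s - 1)) * (norm (descent s y v - xs))\<^sup>2 + (- (real (Suc t) * e) - l)"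
          unfolding \<kappa>(3) by (simp add: \<psi>_def s_def)
        also have "\<dots> \<le> \<kappa> * (s * (s - 1)) * (norm (descent s y v - xs))\<^sup>2 + \<kappa> * (6 / m * (s - 1) * gap y) + (- (real (Suc t) * e) - l)"
          using mult_nonneg_nonneg[OF \<kappa>(1) gy] by linarith
        finally show "\<psi> (Suc t) (descent s y v) \<le> \<kappa> * (s * (s - 1) * (norm (descent s y v - xs))\<^sup>2 + 6 / m * (s - 1) * gap y) + (- (real (Suc t) * e) - l)"
          by (simp only: distrib_left mult.assoc)
      qed
      also have "\<dots> = ennreal ?c * ennreal (exp (\<kappa> * (s * (s - 1) * (norm (descent s y v - xs))\<^sup>2 + 6 / m * (s - 1) * gap y)))"
        by (subst mult.commute) (rule ennreal_exp_add)
      finally show "V (Suc t) (trans t S v) \<le> ennreal ?c * ennreal (exp (\<kappa> * (s * (s - 1) * (norm (descent s y v - xs))\<^sup>2 + 6 / m * (s - 1) * gap y)))" .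
    qed
    also have "\<dots> = ennreal ?c * (\<integral>\<^sup>+v. ennreal (exp (\<kappa> * (s * (s - 1) * (norm (descent s y v - xs))\<^sup>2 + 6 / m * (s - 1) * gap y))) \<partial>uniform_sphere d)"
      unfolding descent_def est_def by (rule nn_integral_cmult) measurable
    also have "\<dots> \<le> ennreal ?c * ennreal (exp (\<kappa> * ((s - 1) * (s - 2) * (norm (y - xs))\<^sup>2 + 75000 * real d * R\<^sup>2 + 12 / m * (s - 1) * (g * \<nu>))))"
      by (intro mult_left_mono one_step[OF y s(1) \<kappa>(1,2)]) simp
    also have "\<dots> = ennreal (exp (\<kappa> * ((s - 1) * (s - 2) * (norm (y - xs))\<^sup>2 + 75000 * real d * R\<^sup>2 + 12 / m * (s - 1) * (g * \<nu>)) + (- (real (Suc t) * e) - l)))"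
      by (subst mult.commute) (rule ennreal_exp_add[symmetric])
    also have "\<dots> \<le> ennreal (exp (\<psi> t y))"
    proof (intro ennreal_leI iffD2[OF exp_le_cancel_iff])
      have "\<kappa> * ((s - 1) * (s - 2) * (norm (y - xs))\<^sup>2) = ((s - 1) / s) * ((s - 2) * (norm (y - xs))\<^sup>2 / (200 * real d * R\<^sup>2))"
        using s by (simp add: \<kappa>_def mult_ac)
      also have "\<dots> \<le> 1 * ((s - 2) * (norm (y - xs))\<^sup>2 / (200 * real d * R\<^sup>2))"
        using s dR by (intro mult_right_mono) auto
      finally have a: "\<kappa> * ((s - 1) * (s - 2) * (norm (y - xs))\<^sup>2) \<le> (s - 2) * (norm (y - xs))\<^sup>2 / (200 * real d * R\<^sup>2)" by simp
      have "\<kappa> * (75000 * real d * R\<^sup>2) = 375 / s" using s R d0 by (simp add: \<kappa>_def)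
      also have "\<dots> \<le> 375 / t0" using s t0_ge by (intro divide_left_mono) auto
      finally have b: "\<kappa> * (75000 * real d * R\<^sup>2) \<le> 375 / t0" .
      have "\<kappa> * (12 / m * (s - 1) * (g * \<nu>)) = ((s - 1) / s) * (3 * \<nu> / (50 * real d * R))"
        using s R d0 m by (simp add: \<kappa>_def R(2)[symmetric] power2_eq_square field_simps)
      also have "\<dots> \<le> 1 * (3 * \<nu> / (50 * real d * R))" using s \<nu> R d0 by (intro mult_right_mono) auto
      finally have c: "\<kappa> * (12 / m * (s - 1) * (g * \<nu>)) \<le> 3 * \<nu> / (50 * real d * R)" by simp
      have "\<kappa> * ((s - 1) * (s - 2) * (norm (y - xs))\<^sup>2 + 75000 * real d * R\<^sup>2 + 12 / m * (s - 1) * (g * \<nu>))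
          \<le> (s - 2) * (norm (y - xs))\<^sup>2 / (200 * real d * R\<^sup>2) + e"
        using a b c by (simp only: distrib_left e_def)
      moreover have "s - 2 = real t + t0 - 1" by (simp add: s_def)
      ultimately show "\<kappa> * ((s - 1) * (s - 2) * (norm (y - xs))\<^sup>2 + 75000 * real d * R\<^sup>2 + 12 / m * (s - 1) * (g * \<nu>)) + (- (real (Suc t) * e) - l) \<le> \<psi> t y"
        by (simp add: \<psi>_def algebra_simps)
    qed
    also have "\<dots> = V t S" using True by (simp add: V_def y_def)
    finally show ?thesis .
  qed
  let ?E = "{z. \<not> good (fst (states n z T))}"
  have "{z \<in> space (directions d). \<not> good (fst (states n z T))} \<in> sets (directions d)" by measurable
  then have E: "?E \<in> sets (directions d)" by simp
  have "emeasure (directions d) ?E = (\<integral>\<^sup>+z. indicator ?E z \<partial>directions d)"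
    by (rule nn_integral_indicator[OF E, symmetric])
  also have "\<dots> \<le> (\<integral>\<^sup>+z. V T (states n z T) \<partial>directions d)"
    by (intro nn_integral_mono) (auto simp: indicator_def V_def)
  also have "\<dots> \<le> V 0 (x0, 0)"
    by (rule nn_integral_run_le[where F = trans and V = V and S = "borel \<Otimes>\<^sub>M borel" and T = T])
      (auto simp: space_pair_measure intro: measurable_trans step)
  also have "\<dots> = ennreal (exp (- L))" using good_x0 by (simp add: V_def \<psi>_def l_def)
  finally show ?thesis .
qed

definition wsum :: "nat \<Rightarrow> real" where
  "wsum t = (\<Sum>i<t. real (Suc i) + t0 - 1)"

text \<open>A Chernoff bound with fixed \<kappa>, under which the quadratic weights telescope and
  the weighted gaps accumulate in the exponent. The potential is 0 after leaving, since only the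
  event of staying good is estimated here.\<close>

lemma prob_gap:
  "emeasure (directions d) {z. good (fst (states n z T)) \<and>
    snd (states n z T) - 2 * g * \<nu> * wsum T \<ge> m / 6 * (75000 * real T * real d * R\<^sup>2 + t0\<^sup>2 * R\<^sup>2 + 200 * L * real d * R\<^sup>2 * (real T + t0))}
    \<le> ennreal (exp (- L))"
proof -
  define S0 where "S0 = real T + t0"
  have S0: "0 < S0" using t0_ge by (simp add: S0_def)
  \<comment> \<open>Admissible at all times up to \<open>T\<close>. The last term of the threshold
    in the lemma is \<open>L / \<kappa>\<close>; the other two are the noise and the initial
    distance.\<close>
  define \<kappa> where "\<kappa> = 1 / (200 * real d * R\<^sup>2 * S0)"
  have \<kappa>0: "0 < \<kappa>" using S0 R d0 by (simp add: \<kappa>_def)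
  define l where "l = \<kappa> * (t0 * (t0 - 1) * (norm (x0 - xs))\<^sup>2) + L"
  define \<psi> where "\<psi> t S = \<kappa> * ((real t + t0) * (real t + t0 - 1) * (norm (fst S - xs))\<^sup>2 + 6 / m * snd S
      - 12 / m * (g * \<nu>) * wsum t - real t * (75000 * real d * R\<^sup>2)) - l" for t :: nat and S :: "fseq \<times> real"
  define V where "V t S = (if good (fst S) then ennreal (exp (\<psi> t S)) else 0)" for t and S :: "fseq \<times> real"
  have [measurable]: "V t \<in> borel_measurable (borel \<Otimes>\<^sub>M borel)" for t
    unfolding V_def \<psi>_def by measurable
  have step: "(\<integral>\<^sup>+v. V (Suc t) (trans t S v) \<partial>uniform_sphere d) \<le> V t S" if t: "t < T" for t S
  proof (cases "good (fst S)")
    case False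
    then show ?thesis by (simp add: trans_def V_def)
  next
    case True
    define y where "y = fst S"
    define s where "s = real (Suc t) + t0"
    have s: "t0 + 1 \<le> s" "0 < s" "s \<le> S0" using t0_ge t by (auto simp: s_def S0_def)
    have \<kappa>: "\<kappa> * (200 * real d * R\<^sup>2 * s) \<le> 1"
    proof -
      have "\<kappa> * (200 * real d * R\<^sup>2 * s) = s / S0" using R d0 by (simp add: \<kappa>_def)
      also have "\<dots> \<le> 1" using s S0 by simp
      finally show ?thesis .
    qed
    have y: "good y" using True by (simp add: y_def)
    define k where "k = \<kappa> * (6 / m * snd S - 12 / m * (g * \<nu>) * wsum (Suc t) - real (Suc t) * (75000 * real d * R\<^sup>2)) - l"
    have "(\<integral>\<^sup>+v. V (Suc t) (trans t S v) \<partial>uniform_sphere d)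
        \<le> (\<integral>\<^sup>+v. ennreal (exp k) * ennreal (exp (\<kappa> * (s * (s - 1) * (norm (descent s y v - xs))\<^sup>2 + 6 / m * (s - 1) * gap y))) \<partial>uniform_sphere d)"
    proof (rule nn_integral_mono)
      fix v
      have tr: "trans t S v = (descent s y v, snd S + (s - 1) * gap y)" using True by (simp add: trans_def s_def y_def)
      have "V (Suc t) (trans t S v) \<le> ennreal (exp (\<psi> (Suc t) (trans t S v)))" by (simp add: V_def)
      also have "\<psi> (Suc t) (trans t S v) = k + \<kappa> * (s * (s - 1) * (norm (descent s y v - xs))\<^sup>2 + 6 / m * (s - 1) * gap y)"
        unfolding tr \<psi>_def k_def s_def[symmetric] fst_conv snd_conv by (simp add: algebra_simps diff_divide_distrib add_divide_distrib)
      finally show "V (Suc t) (trans t S v) \<le> ennreal (exp k) * ennreal (exp (\<kappa> * (s * (s - 1) * (norm (descent s y v - xs))\<^sup>2 + 6 / m * (s - 1) * gap y)))"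
        by (simp only: ennreal_exp_add)
    qed
    also have "\<dots> = ennreal (exp k) * (\<integral>\<^sup>+v. ennreal (exp (\<kappa> * (s * (s - 1) * (norm (descent s y v - xs))\<^sup>2 + 6 / m * (s - 1) * gap y))) \<partial>uniform_sphere d)"
      unfolding descent_def est_def by (rule nn_integral_cmult) measurable
    also have "\<dots> \<le> ennreal (exp k) * ennreal (exp (\<kappa> * ((s - 1) * (s - 2) * (norm (y - xs))\<^sup>2 + 75000 * real d * R\<^sup>2 + 12 / m * (s - 1) * (g * \<nu>))))"
      by (intro mult_left_mono one_step[OF y s(1) less_imp_le[OF \<kappa>0] \<kappa>]) simp
    also have "\<dots> = ennreal (exp (k + \<kappa> * ((s - 1) * (s - 2) * (norm (y - xs))\<^sup>2 + 75000 * real d * R\<^sup>2 + 12 / m * (s - 1) * (g * \<nu>))))"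
      by (rule ennreal_exp_add[symmetric])
    also have "k + \<kappa> * ((s - 1) * (s - 2) * (norm (y - xs))\<^sup>2 + 75000 * real d * R\<^sup>2 + 12 / m * (s - 1) * (g * \<nu>)) = \<psi> t S"
    proof -
      have w: "wsum (Suc t) = wsum t + (s - 1)" by (simp add: wsum_def s_def)
      have ts: "real t + t0 = s - 1" "real t + t0 - 1 = s - 2" "real (Suc t) = real t + 1" by (simp_all add: s_def)
      show ?thesis
        unfolding k_def \<psi>_def w ts y_def by (simp add: algebra_simps diff_divide_distrib add_divide_distrib)
    qed
    also have "ennreal (exp (\<psi> t S)) = V t S" using True by (simp add: V_def)
    finally show ?thesis .
  qed
  let ?E = "{z. good (fst (states n z T)) \<and>
    snd (states n z T) - 2 * g * \<nu> * wsum T \<ge> m / 6 * (75000 * real T * real d * R\<^sup>2 + t0\<^sup>2 * R\<^sup>2 + 200 * L * real d * R\<^sup>2 * (real T + t0))}"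
  have "{z \<in> space (directions d). good (fst (states n z T)) \<and>
    snd (states n z T) - 2 * g * \<nu> * wsum T \<ge> m / 6 * (75000 * real T * real d * R\<^sup>2 + t0\<^sup>2 * R\<^sup>2 + 200 * L * real d * R\<^sup>2 * (real T + t0))} \<in> sets (directions d)"
    by measurable
  then have E: "?E \<in> sets (directions d)" by simp
  have "emeasure (directions d) ?E = (\<integral>\<^sup>+z. indicator ?E z \<partial>directions d)"
    by (rule nn_integral_indicator[OF E, symmetric])
  also have "\<dots> \<le> (\<integral>\<^sup>+z. V T (states n z T) \<partial>directions d)"
  proof (rule nn_integral_mono)
    fix z
    show "indicator ?E z \<le> V T (states n z T)"
    proof (cases "z \<in> ?E")
      case True
      define S where "S = states n z T"
      have "good (fst S)" and ge: "m / 6 * (75000 * real T * real d * R\<^sup>2 + t0\<^sup>2 * R\<^sup>2 + 200 * L * real d * R\<^sup>2 * S0) \<le> snd S - 2 * g * \<nu> * wsum T"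
        using True by (auto simp: S_def S0_def)
      define Q where "Q = 75000 * real T * real d * R\<^sup>2 + t0\<^sup>2 * R\<^sup>2 + 200 * L * real d * R\<^sup>2 * S0"
      have "Q \<le> 6 / m * (snd S - 2 * g * \<nu> * wsum T)"
        using ge m unfolding Q_def[symmetric] by (simp add: field_simps)
      also have "\<dots> = 6 / m * snd S - 12 / m * (g * \<nu>) * wsum T" by (simp add: right_diff_distrib mult_ac)
      finally have 1: "75000 * real T * real d * R\<^sup>2 + t0\<^sup>2 * R\<^sup>2 + 200 * L * real d * R\<^sup>2 * S0 \<le> 6 / m * snd S - 12 / m * (g * \<nu>) * wsum T"
        unfolding Q_def .
      have "(norm (x0 - xs))\<^sup>2 \<le> R\<^sup>2" using xs R by (intro power_mono) (auto simp: R_def norm_minus_commute)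
      then have "t0 * (t0 - 1) * (norm (x0 - xs))\<^sup>2 \<le> (t0 * t0) * R\<^sup>2" using t0_ge by (intro mult_mono) auto
      then have 2: "t0 * (t0 - 1) * (norm (x0 - xs))\<^sup>2 \<le> t0\<^sup>2 * R\<^sup>2" by (simp add: power2_eq_square)
      have 3: "0 \<le> (real T + t0) * (real T + t0 - 1) * (norm (fst S - xs))\<^sup>2" using t0_ge by simp
      have "t0 * (t0 - 1) * (norm (x0 - xs))\<^sup>2 + 200 * L * real d * R\<^sup>2 * S0
          \<le> (real T + t0) * (real T + t0 - 1) * (norm (fst S - xs))\<^sup>2 + 6 / m * snd S
            - 12 / m * (g * \<nu>) * wsum T - real T * (75000 * real d * R\<^sup>2)"
        using 1 2 3 by (simp add: mult_ac)
      then have "\<kappa> * (t0 * (t0 - 1) * (norm (x0 - xs))\<^sup>2 + 200 * L * real d * R\<^sup>2 * S0)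
          \<le> \<kappa> * ((real T + t0) * (real T + t0 - 1) * (norm (fst S - xs))\<^sup>2 + 6 / m * snd S
            - 12 / m * (g * \<nu>) * wsum T - real T * (75000 * real d * R\<^sup>2))"
        using \<kappa>0 by (intro mult_left_mono) auto
      moreover have "\<kappa> * (200 * L * real d * R\<^sup>2 * S0) = L" using S0 R d0 by (simp add: \<kappa>_def)
      ultimately have "0 \<le> \<psi> T S" unfolding \<psi>_def l_def by (simp only: distrib_left)
      then have "1 \<le> ennreal (exp (\<psi> T S))" by (rule one_le_ennreal_exp)
      then show ?thesis using \<open>good (fst S)\<close> True by (simp add: V_def S_def)
    qed simp
  qed
  also have "\<dots> \<le> V 0 (x0, 0)"
    by (rule nn_integral_run_le[where F = trans and V = V and S = "borel \<Otimes>\<^sub>M borel" and T = T])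
      (auto simp: space_pair_measure intro: measurable_trans step)
  also have "\<dots> = ennreal (exp (- L))" using good_x0 by (simp add: V_def \<psi>_def l_def wsum_def)
  finally show ?thesis .
qed

end

section \<open>From the two tail bounds to the output of an epoch\<close>

context epoch
begin

lemma wsum_eq: "wsum t = real t * (real t + 2 * t0 - 1) / 2"
proof (induction t)
  case (Suc t)
  have "wsum (Suc t) = wsum t + (real (Suc t) + t0 - 1)" by (simp add: wsum_def)
  then show ?case unfolding Suc.IH by (simp add: field_simps)
qed (simp add: wsum_def)

text \<open>A state outside the good region is frozen, so being good at the end means having been
  good throughout.\<close>

lemma good_earlier:
  assumes "good (fst (states n z T'))" "t \<le> T'"
  shows "good (fst (states n z t))"
  using assms(2,1)
proof (induction T' rule: dec_induct)
  case (step T')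
  have "good (fst (states n z T'))"
  proof (rule ccontr)
    assume "\<not> good (fst (states n z T'))"
    then have "states n z (Suc T') = states n z T'" by (simp add: trans_def)
    then show False using step.prems \<open>\<not> good _\<close> by simp
  qed
  then show ?case by (rule step.IH)
qed

lemma states_Suc:
  assumes "good (fst (states n z t))"
  shows "fst (states n z (Suc t)) = descent (real (Suc t) + t0) (fst (states n z t)) (z (n, Suc t))"
    "snd (states n z (Suc t)) = snd (states n z t) + (real (Suc t) + t0 - 1) * gap (fst (states n z t))"
  using assms by (simp_all add: trans_def)

lemma snd_states:
  assumes "good (fst (states n z T'))" "t \<le> T'"
  shows "snd (states n z t) = (\<Sum>i<t. (real (Suc i) + t0 - 1) * gap (fst (states n z i)))"
  using assms(2)
proof (induction t)
  case (Suc t)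
  have "good (fst (states n z t))" by (rule good_earlier[OF assms(1)]) (use Suc.prems in simp)
  from states_Suc(2)[OF this] Suc show ?case by simp
qed simp

lemma grad_est_good:
  assumes y: "good y" and v: "v \<in> Rn d" "norm v = 1"
  shows "grad_est d X f \<nu> y v = Some (est y v)"
proof -
  interpret G: gradient_estimate d x0 rad g \<mu> f y \<nu> by (rule gradient_estimate_good[OF y])
  have "y + \<nu> *\<^sub>R v \<in> B" by (rule G.shifted_in_B0) (use v in auto)
  moreover have "y + \<nu> *\<^sub>R (- v) \<in> B" by (rule G.shifted_in_B0) (use v in auto)
  then have "y - \<nu> *\<^sub>R v \<in> B" by (simp only: scaleR_minus_right add_uminus_conv_diff)
  ultimately have B: "y + \<nu> *\<^sub>R v \<in> B" "y - \<nu> *\<^sub>R v \<in> B" .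
  moreover have "y \<in> B" by (rule good_dist(4)[OF y])
  ultimately have "y \<in> X" "y + \<nu> *\<^sub>R v \<in> X" "y - \<nu> *\<^sub>R v \<in> X" using BX by blast+
  then show ?thesis unfolding grad_est_def est_def F_eq[OF B(1)] F_eq[OF B(2)] by simp
qed

text \<open>On the good event the algorithm makes no query outside the ball, hence it does not fail
  and follows the total process.\<close>

lemma zogd_iter_states:
  assumes z: "\<And>i. z (n, i) \<in> Rn d \<and> norm (z (n, i)) = 1" and good: "good (fst (states n z T'))" and "t \<le> T'"
  shows "zogd_iter d X f m \<nu> t0 x0 (\<lambda>t. z (n, t)) t = Some (fst (states n z t))"
  using assms(3)
proof (induction t)
  case (Suc t)
  have g: "good (fst (states n z t))" by (rule good_earlier[OF good]) (use Suc.prems in simp)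
  have "grad_est d X f \<nu> (fst (states n z t)) (z (n, Suc t)) = Some (est (fst (states n z t)) (z (n, Suc t)))"
    by (rule grad_est_good[OF g]) (use z in auto)
  then show ?case
    using Suc states_Suc(1)[OF g] by (simp add: descent_def)
qed simp

lemma convex_on_gap: "convex_on B gap"
proof (rule convex_onI)
  fix t x y assume t: "0 < t" "t < (1 :: real)" and xy: "x \<in> B" "y \<in> B"
  define Q where "Q = t * (1 - t) * (norm (x - y))\<^sup>2"
  have F: "F ((1 - t) *\<^sub>R x + t *\<^sub>R y) \<le> (1 - t) * F x + t * F y + \<mu> / 2 * (t * (1 - t)) * (norm (x - y))\<^sup>2"
    by (rule F_segment[OF xy]) (use t in auto)
  have "(1 - t) *\<^sub>R x + t *\<^sub>R y - x0 = (1 - t) *\<^sub>R (x - x0) + t *\<^sub>R (y - x0)" by (simp add: algebra_simps)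
  then have n: "(norm ((1 - t) *\<^sub>R x + t *\<^sub>R y - x0))\<^sup>2
      = (1 - t) * (norm (x - x0))\<^sup>2 + t * (norm (y - x0))\<^sup>2 - t * (1 - t) * (norm (x - y))\<^sup>2"
    by (simp only: norm_convex_combination_sq) simp
  have "0 \<le> Q" using t by (simp add: Q_def)
  then have "\<mu> / 2 * Q \<le> m * Q" using \<mu>m m by (intro mult_right_mono) auto
  moreover have "\<mu> / 2 * (t * (1 - t)) * (norm (x - y))\<^sup>2 = \<mu> / 2 * Q" by (simp add: Q_def)
  ultimately have "F ((1 - t) *\<^sub>R x + t *\<^sub>R y) \<le> (1 - t) * F x + t * F y + m * Q" using F by linarith
  then have "F ((1 - t) *\<^sub>R x + t *\<^sub>R y) + m * ((1 - t) * (norm (x - x0))\<^sup>2 + t * (norm (y - x0))\<^sup>2 - Q)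
      \<le> (1 - t) * (F x + m * (norm (x - x0))\<^sup>2) + t * (F y + m * (norm (y - x0))\<^sup>2)"
    by (simp add: distrib_left right_diff_distrib mult.left_commute)
  then show "gap ((1 - t) *\<^sub>R x + t *\<^sub>R y) \<le> (1 - t) * gap x + t * gap y"
    unfolding gap_def n Q_def[symmetric] by (simp add: algebra_simps)
qed (rule convex_B)

lemma AE_directions_unit: "AE z in directions d. \<forall>i. z i \<in> Rn d \<and> norm (z i) = 1"
proof (subst AE_all_countable, rule allI)
  fix i
  show "AE z in directions d. z i \<in> Rn d \<and> norm (z i) = 1"
    unfolding directions_def
    by (rule AE_PiM_component[of UNIV "\<lambda>_. uniform_sphere d" i], rule prob_space_uniform_sphere, simp,
      rule AE_uniform_sphere[OF d0])
qed

text \<open>Jensen's inequality for the convex function \<open>gap\<close> bounds the gap of the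
  average by the weighted sum in the second state component, divided by the total weight
  \<open>wsum T\<close>, which is at least \<open>T\<^sup>2 / 2\<close>.\<close>

lemma zogd_success:
  assumes z: "\<And>i. z (n, i) \<in> Rn d \<and> norm (z (n, i)) = 1" and good: "good (fst (states n z T))" and T: "0 < T"
    and gapsum: "snd (states n z T) - 2 * g * \<nu> * wsum T
      < m / 6 * (75000 * real T * real d * R\<^sup>2 + t0\<^sup>2 * R\<^sup>2 + 200 * L * real d * R\<^sup>2 * (real T + t0))"
    and t0T: "t0 \<le> real T"
    and \<epsilon>: "75000 * real d / real T + (t0 / real T)\<^sup>2 + 400 * L * real d / real T \<le> \<epsilon>"
  shows "\<exists>y. zogd d X f m \<nu> T t0 (\<lambda>t. z (n, t)) x0 = Some y \<and> y \<in> B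
    \<and> f y + m * (norm (y - x0))\<^sup>2 \<le> f xs + m * (norm (xs - x0))\<^sup>2 + 2 * g * \<nu> + g * R / 3 * \<epsilon>"
proof -
  let ?y = "\<lambda>i. fst (states n z i)"
  define w where "w = wsum T"
  define c where "c i = (real (Suc i) + t0 - 1) / w" for i
  define y where "y = (\<Sum>i<T. c i *\<^sub>R ?y i)"
  have T0: "0 < real T" using T by simp
  have w_ge: "(real T)\<^sup>2 / 2 \<le> w"
  proof -
    have "real T * real T \<le> real T * (real T + 2 * t0 - 1)" using t0_ge by (intro mult_left_mono) auto
    then show ?thesis by (simp add: w_def wsum_eq power2_eq_square)
  qed
  have w0: "0 < w" using w_ge T0 by (smt (verit) zero_less_power half_gt_zero)
  have iter: "zogd_iter d X f m \<nu> t0 x0 (\<lambda>t. z (n, t)) t = Some (?y t)" if "t \<le> T" for t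
    by (rule zogd_iter_states[where z = z and n = n, OF z good that])
  have zogd: "zogd d X f m \<nu> T t0 (\<lambda>t. z (n, t)) x0 = Some y"
  proof -
    \<comment> \<open>The output weights \<open>x(t-1)\<close> by \<open>t + t0 - 1\<close>; after
      the shift, iterate \<open>i\<close> has weight \<open>Suc i + t0 - 1\<close>, as in
      \<open>trans\<close>.\<close>
    have "(\<Sum>t=1..T. (real t + t0 - 1) *\<^sub>R the (zogd_iter d X f m \<nu> t0 x0 (\<lambda>t. z (n, t)) (t - 1)))
        = (\<Sum>i<T. (real (Suc i) + t0 - 1) *\<^sub>R the (zogd_iter d X f m \<nu> t0 x0 (\<lambda>t. z (n, t)) i))"
      by (rule sum.reindex_bij_witness[where i = Suc and j = "\<lambda>t. t - 1"]) auto
    also have "\<dots> = (\<Sum>i<T. (real (Suc i) + t0 - 1) *\<^sub>R ?y i)"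
      by (rule sum.cong[OF refl]) (simp add: iter)
    finally have "(2 / (real T * (real T + 2 * t0 - 1))) *\<^sub>R (\<Sum>t=1..T. (real t + t0 - 1) *\<^sub>R the (zogd_iter d X f m \<nu> t0 x0 (\<lambda>t. z (n, t)) (t - 1)))
        = (1 / w) *\<^sub>R (\<Sum>i<T. (real (Suc i) + t0 - 1) *\<^sub>R ?y i)" by (simp add: w_def wsum_eq)
    also have "\<dots> = y" unfolding y_def c_def scaleR_sum_right by (intro sum.cong refl) simp
    finally show ?thesis using iter[of T] by (simp add: zogd_def)
  qed
  have c: "0 \<le> c i" for i using w0 t0_ge by (simp add: c_def)
  have c1: "(\<Sum>i<T. c i) = 1" using w0 by (simp add: c_def sum_divide_distrib[symmetric] w_def wsum_def)
  have yB: "?y i \<in> B" if "i < T" for i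
    by (rule good_dist(4), rule good_earlier[OF good]) (use that in simp)
  have y: "y \<in> B" unfolding y_def
    by (rule convex_sum[OF _ convex_B c1]) (use c yB in \<open>auto simp del: Int_iff\<close>)
  have "gap y \<le> (\<Sum>i<T. c i * gap (?y i))" unfolding y_def
    by (rule convex_on_sum[OF _ _ convex_on_gap c1]) (use c yB T in \<open>auto simp del: Int_iff\<close>)
  also have "\<dots> = snd (states n z T) / w"
    unfolding snd_states[OF good order_refl] sum_divide_distrib c_def by (intro sum.cong refl) simp
  also have "\<dots> \<le> 2 * g * \<nu> + g * R / 3 * \<epsilon>"
  proof -
    define Q where "Q = 75000 * real T * real d * R\<^sup>2 + t0\<^sup>2 * R\<^sup>2 + 200 * L * real d * R\<^sup>2 * (real T + t0)"
    define \<epsilon>' where "\<epsilon>' = 75000 * real d / real T + (t0 / real T)\<^sup>2 + 400 * L * real d / real T"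
    \<comment> \<open>\<open>t0 \<le> T\<close> bounds the factor \<open>T + t0\<close> in the
      deviation by \<open>2 * T\<close>.\<close>
    have "200 * L * real d * R\<^sup>2 * (real T + t0) \<le> 200 * L * real d * R\<^sup>2 * (2 * real T)"
      using t0T L by (intro mult_left_mono) auto
    then have "Q \<le> 75000 * real T * real d * R\<^sup>2 + t0\<^sup>2 * R\<^sup>2 + 400 * L * real d * R\<^sup>2 * real T" by (simp add: Q_def)
    also have "\<dots> = (real T)\<^sup>2 * R\<^sup>2 * \<epsilon>'" using T0 by (simp add: \<epsilon>'_def power_divide power2_eq_square field_simps)
    also have "\<dots> \<le> (real T)\<^sup>2 * R\<^sup>2 * \<epsilon>" using \<epsilon> by (intro mult_left_mono) (auto simp: \<epsilon>'_def)
    finally have Q: "Q \<le> (real T)\<^sup>2 * R\<^sup>2 * \<epsilon>" .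
    have \<epsilon>0: "0 \<le> \<epsilon>" using L T0 by (intro order_trans[OF _ \<epsilon>] add_nonneg_nonneg) auto
    have "(real T)\<^sup>2 * (R\<^sup>2 * \<epsilon>) \<le> 2 * w * (R\<^sup>2 * \<epsilon>)" using w_ge \<epsilon>0 by (intro mult_right_mono) auto
    with Q have "Q \<le> 2 * w * (R\<^sup>2 * \<epsilon>)" by (simp add: mult.assoc)
    then have "m / 6 * Q \<le> m / 6 * (2 * w * (R\<^sup>2 * \<epsilon>))" using m by (intro mult_left_mono) auto
    also have "\<dots> = w * ((m * R) * R / 3 * \<epsilon>)" by (simp add: power2_eq_square)
    also have "\<dots> = w * (g * R / 3 * \<epsilon>)" unfolding R(2) ..
    finally have "snd (states n z T) \<le> w * (2 * g * \<nu>) + w * (g * R / 3 * \<epsilon>)"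
      using gapsum unfolding Q_def[symmetric] w_def[symmetric] by (simp add: mult_ac)
    then show ?thesis using w0 by (simp add: divide_le_eq distrib_left mult.commute)
  qed
  finally have "gap y \<le> 2 * g * \<nu> + g * R / 3 * \<epsilon>" .
  then have "f y + m * (norm (y - x0))\<^sup>2 \<le> f xs + m * (norm (xs - x0))\<^sup>2 + 2 * g * \<nu> + g * R / 3 * \<epsilon>"
    unfolding gap_def F_eq[OF y] F_eq[OF xs_B] by linarith
  then show ?thesis using zogd y by blast
qed

lemma epoch_success:
  assumes T: "0 < T" and t0T: "t0 \<le> real T"
    and \<epsilon>: "75000 * real d / real T + (t0 / real T)\<^sup>2 + 400 * L * real d / real T \<le> \<epsilon>"
  shows "emeasure (directions d) {z. \<not> (\<exists>y. zogd d X f m \<nu> T t0 (\<lambda>t. z (n, t)) x0 = Some y \<and> y \<in> B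
    \<and> f y + m * (norm (y - x0))\<^sup>2 \<le> f xs + m * (norm (xs - x0))\<^sup>2 + 2 * g * \<nu> + g * R / 3 * \<epsilon>)}
    \<le> ennreal (2 * exp (- L))"
    (is "emeasure _ ?E \<le> _")
proof -
  let ?E1 = "{z. \<not> good (fst (states n z T))}"
  let ?E2 = "{z. good (fst (states n z T)) \<and>
    snd (states n z T) - 2 * g * \<nu> * wsum T \<ge> m / 6 * (75000 * real T * real d * R\<^sup>2 + t0\<^sup>2 * R\<^sup>2 + 200 * L * real d * R\<^sup>2 * (real T + t0))}"
  have "{z \<in> space (directions d). \<not> good (fst (states n z T))} \<in> sets (directions d)" by measurable
  then have E1: "?E1 \<in> sets (directions d)" by simp
  have "{z \<in> space (directions d). good (fst (states n z T)) \<and>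
    snd (states n z T) - 2 * g * \<nu> * wsum T \<ge> m / 6 * (75000 * real T * real d * R\<^sup>2 + t0\<^sup>2 * R\<^sup>2 + 200 * L * real d * R\<^sup>2 * (real T + t0))} \<in> sets (directions d)"
    by measurable
  then have E2: "?E2 \<in> sets (directions d)" by simp
  have "emeasure (directions d) ?E \<le> emeasure (directions d) (?E1 \<union> ?E2)"
  proof (rule emeasure_mono_AE)
    show "AE z in directions d. z \<in> ?E \<longrightarrow> z \<in> ?E1 \<union> ?E2"
      using AE_directions_unit
    proof eventually_elim
      fix z :: "nat \<times> nat \<Rightarrow> fseq" assume z: "\<forall>i. z i \<in> Rn d \<and> norm (z i) = 1"
      show "z \<in> ?E \<longrightarrow> z \<in> ?E1 \<union> ?E2"
      proof (rule impI, rule ccontr)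
        assume E: "z \<in> ?E" and not: "z \<notin> ?E1 \<union> ?E2"
        have "good (fst (states n z T))" using not by simp
        moreover have "snd (states n z T) - 2 * g * \<nu> * wsum T
            < m / 6 * (75000 * real T * real d * R\<^sup>2 + t0\<^sup>2 * R\<^sup>2 + 200 * L * real d * R\<^sup>2 * (real T + t0))"
          using not \<open>good _\<close> unfolding Un_iff mem_Collect_eq not_le[symmetric] by blast
        moreover have "z (n, i) \<in> Rn d \<and> norm (z (n, i)) = 1" for i using z by blast
        ultimately show False using E zogd_success[of z n, OF _ _ T _ t0T \<epsilon>] unfolding mem_Collect_eq by blast
      qed
    qed
  qed (use E1 E2 in auto)
  also have "\<dots> \<le> emeasure (directions d) ?E1 + emeasure (directions d) ?E2"
    by (rule emeasure_subadditive[OF E1 E2])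
  also have "\<dots> \<le> ennreal (exp (- L)) + ennreal (exp (- L))"
    by (intro add_mono prob_leave prob_gap)
  also have "\<dots> = ennreal (2 * exp (- L))" by (subst ennreal_plus[symmetric]) auto
  finally show ?thesis .
qed

end

subsection \<open>The lifted problem\<close>

text \<open>The set need not be convex, so local constants cannot be chained. If pairs with quotient
  above \<open>n\<close> existed for all \<open>n\<close>, boundedness of the image would force
  their distances to 0, and near an accumulation point they would violate the local Lipschitz
  bound.\<close>

lemma locally_lipschitz_on_compact:
  fixes h :: "'a::metric_space \<Rightarrow> 'b::metric_space"
  assumes loc: "locally_lipschitz_on S' h" and S: "compact S" "S \<subseteq> S'"
  shows "continuous_on S h" "\<exists>K. K-lipschitz_on S h"
proof -
  have loc': "\<exists>u>0. \<exists>K. K-lipschitz_on (cball x u \<inter> S) h" if "x \<in> S" for x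
    using loc S(2) that unfolding locally_lipschitz_on_def
    by (meson Int_mono in_mono lipschitz_on_subset order_refl)
  show cont: "continuous_on S h"
    unfolding continuous_on_eq_continuous_within
  proof
    fix x assume x: "x \<in> S"
    obtain u K where u: "0 < u" "K-lipschitz_on (cball x u \<inter> S) h" using loc'[OF x] by blast
    have "continuous_on (cball x u \<inter> S) h" using u(2) by (rule lipschitz_on_continuous_on)
    then have "continuous (at x within (cball x u \<inter> S)) h"
      using x u(1) by (auto simp: continuous_on_eq_continuous_within)
    moreover have "at x within (cball x u \<inter> S) = at x within S"
      by (rule at_within_nhd[of _ "ball x u"]) (use u in auto)
    ultimately show "continuous (at x within S) h" by simp
  qed
  show "\<exists>K. K-lipschitz_on S h"
  proof (rule ccontr)
    assume none: "\<not> (\<exists>K. K-lipschitz_on S h)"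
    have "\<exists>x\<in>S. \<exists>y\<in>S. real n * dist x y < dist (h x) (h y)" for n :: nat
    proof (rule ccontr)
      assume "\<not> ?thesis"
      then have "(real n)-lipschitz_on S h" by (intro lipschitz_onI) (auto simp: not_less)
      then show False using none by blast
    qed
    then obtain a b where ab: "\<And>n. a n \<in> S" "\<And>n. b n \<in> S" "\<And>n :: nat. real n * dist (a n) (b n) < dist (h (a n)) (h (b n))"
      by metis
    have "bounded (h ` S)" by (intro compact_imp_bounded compact_continuous_image cont S)
    then obtain C where C: "\<And>x y. x \<in> S \<Longrightarrow> y \<in> S \<Longrightarrow> dist (h x) (h y) \<le> C"
      by (meson bounded_two_points imageI)
    obtain x r where x: "x \<in> S" and r: "strict_mono (r :: nat \<Rightarrow> nat)" "(a \<circ> r) \<longlonglongrightarrow> x"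
      using S(1) ab(1) unfolding compact_def by metis
    obtain u K where u: "0 < u" "K-lipschitz_on (cball x u \<inter> S) h" using loc'[OF x] by blast
    have "\<forall>\<^sub>F n in sequentially. dist (a (r n)) x < u / 2"
      using tendstoD[OF r(2), of "u / 2"] u(1) by (simp add: o_def)
    moreover have "\<forall>\<^sub>F n in sequentially. max (2 * C / u) K < real n"
      using filterlim_real_sequentially unfolding filterlim_at_top_dense by blast
    ultimately have "\<forall>\<^sub>F n in sequentially. False"
    proof eventually_elim
      fix n assume 1: "dist (a (r n)) x < u / 2" and 2: "max (2 * C / u) K < real n"
      have "n \<le> r n" using r(1) by (rule seq_suble)
      then have rn: "max (2 * C / u) K < real (r n)" using 2 by simp
      let ?d = "dist (a (r n)) (b (r n))"
      have lt: "real (r n) * ?d < dist (h (a (r n))) (h (b (r n)))" by (rule ab(3))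
      have "?d < u / 2"
      proof (rule ccontr)
        assume "\<not> ?d < u / 2"
        then have "(2 * C / u) * (u / 2) \<le> real (r n) * ?d"
          using rn u(1) C[OF x x] by (intro mult_mono) auto
        then have "C \<le> real (r n) * ?d" using u(1) by simp
        then show False using lt C[OF ab(1,2)[of "r n"]] by linarith
      qed
      then have "dist x (b (r n)) \<le> u" "dist x (a (r n)) \<le> u"
        using 1 u(1) dist_triangle[of x "b (r n)" "a (r n)"] by (auto simp: dist_commute)
      then have "dist (h (a (r n))) (h (b (r n))) \<le> K * ?d"
        using ab(1,2)[of "r n"] by (intro lipschitz_onD[OF u(2)]) auto
      also have "\<dots> \<le> real (r n) * ?d" using rn by (intro mult_right_mono) auto
      finally show False using lt by simp
    qed
    then show False by simp
  qed
qed

text \<open>The infimum of the Lipschitz constants is itself a Lipschitz constant, since each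
  difference quotient is a lower bound.\<close>

lemma lipschitz_const_lipschitz:
  assumes "K-lipschitz_on S h"
  shows "(lipschitz_const S h)-lipschitz_on S h"
proof (rule lipschitz_onI)
  let ?A = "{K. K-lipschitz_on S h}"
  have ne: "?A \<noteq> {}" using assms by auto
  show "0 \<le> lipschitz_const S h"
    unfolding lipschitz_const_def by (rule cInf_greatest[OF ne]) (auto simp: lipschitz_on_def)
  fix x y assume xy: "x \<in> S" "y \<in> S"
  show "dist (h x) (h y) \<le> lipschitz_const S h * dist x y"
  proof (cases "dist x y = 0")
    case False
    then have d: "0 < dist x y" by simp
    have "dist (h x) (h y) / dist x y \<le> lipschitz_const S h"
      unfolding lipschitz_const_def
    proof (rule cInf_greatest[OF ne])
      fix K assume "K \<in> ?A"
      then have "dist (h x) (h y) \<le> K * dist x y" using xy by (auto dest: lipschitz_onD)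
      then show "dist (h x) (h y) / dist x y \<le> K" using d by (simp add: divide_le_eq)
    qed
    then show ?thesis using d by (simp add: divide_le_eq)
  qed simp
qed

context lifted_problem
begin

lemma X_Rn: "X \<subseteq> Rn d"
  using openin_imp_subset[OF domain_open] by simp

lemma X_borel: "X \<in> sets borel"
proof -
  obtain U where "open U" "X = Rn d \<inter> U" using domain_open by (auto simp: openin_open)
  then show ?thesis by auto
qed

lemma measurable_f: "(\<lambda>x. if x \<in> X then f x else 0) \<in> borel_measurable borel"
proof -
  have "(\<lambda>x. indicator X x *\<^sub>R f x) \<in> borel_measurable borel"
    by (rule borel_measurable_continuous_on_indicator[OF X_borel f_continuous])
  moreover have "(\<lambda>x. indicator X x *\<^sub>R f x) = (\<lambda>x. if x \<in> X then f x else 0)" by (auto simp: fun_eq_iff)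
  ultimately show ?thesis by simp
qed

lemma f_ge_Inf: "x \<in> X \<Longrightarrow> Inf (f ` X) \<le> f x"
  by (rule cInf_lower) (auto intro: f_bdd_below)

lemma f_pos: "x \<in> X \<Longrightarrow> 0 < f x"
  using f_ge_Inf f_Inf_pos by fastforce

lemma lift_exists:
  assumes "x \<in> X" "f x \<le> l"
  obtains \<xi> where "(x, l, \<xi>) \<in> L"
  using lift_epigraph[of x l] assms X_Rn by (auto simp: epigraph_on_def)

lemma lift_in:
  assumes "(x, l, \<xi>) \<in> L"
  shows "x \<in> X" "f x \<le> l"
proof -
  have "x \<in> Rn d" "\<xi> \<in> Rn d\<xi>" using assms L_subset by auto
  then show "x \<in> X" "f x \<le> l" using lift_epigraph[of x l] assms by (auto simp: epigraph_on_def)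
qed

text \<open>A continuous image of the compact lifted set: every point \<open>x\<close> of the
  sublevel set has a lift at height \<open>f x\<close>.\<close>

lemma compact_sublevel:
  assumes "0 < \<Delta>"
  shows "compact (sublevel X f \<Delta>)"
proof -
  have "sublevel X f \<Delta> = fst ` lift_sublevel L \<Delta>"
  proof (intro equalityI subsetI)
    fix x assume "x \<in> sublevel X f \<Delta>"
    then have x: "x \<in> X" "f x \<le> \<Delta>" by (auto simp: sublevel_def)
    obtain \<xi> where "(x, f x, \<xi>) \<in> L" by (rule lift_exists[OF x(1) order_refl])
    then show "x \<in> fst ` lift_sublevel L \<Delta>" using x by (intro image_eqI[of _ _ "(x, f x, \<xi>)"]) (auto simp: lift_sublevel_def)
  next
    fix x assume "x \<in> fst ` lift_sublevel L \<Delta>"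
    then obtain l \<xi> where "(x, l, \<xi>) \<in> L" "l \<le> \<Delta>" by (auto simp: lift_sublevel_def)
    then show "x \<in> sublevel X f \<Delta>" using lift_in[of x l \<xi>] by (auto simp: sublevel_def)
  qed
  then show ?thesis
    using compact_continuous_image[OF continuous_on_fst[OF continuous_on_id] lift_compact[OF assms]] by simp
qed

lemma f_attains_Inf: "\<exists>x\<in>X. f x = Inf (f ` X)"
proof -
  obtain x1 where x1: "x1 \<in> X" using domain_nonempty by blast
  let ?S = "sublevel X f (f x1)"
  have "compact ?S" by (rule compact_sublevel[OF f_pos[OF x1]])
  moreover have "x1 \<in> ?S" using x1 by (simp add: sublevel_def)
  moreover have "continuous_on ?S f" by (rule continuous_on_subset[OF f_continuous]) (auto simp: sublevel_def)
  ultimately obtain x where x: "x \<in> ?S" "\<And>y. y \<in> ?S \<Longrightarrow> f x \<le> f y"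
    using continuous_attains_inf[of ?S f] by blast
  have "f x \<le> f y" if "y \<in> X" for y
    using x(2)[of y] x(1) that by (cases "f y \<le> f x1") (auto simp: sublevel_def)
  then have "f x = Inf (f ` X)" using x(1) by (intro cInf_eq_minimum[symmetric]) (auto simp: sublevel_def)
  then show ?thesis using x(1) by (auto simp: sublevel_def)
qed

text \<open>Minimising over the compact sublevel set of \<open>f x\<close> suffices: outside it
  \<open>f\<close> alone exceeds \<open>f x\<close>, the value attained at
  \<open>y = x\<close>.\<close>

lemma prox_exists:
  assumes x: "x \<in> X" and m: "0 \<le> m"
  shows "\<exists>p\<in>X. \<forall>y\<in>X. f p + m * (norm (p - x))\<^sup>2 \<le> f y + m * (norm (y - x))\<^sup>2"
proof -
  let ?S = "sublevel X f (f x)" and ?h = "\<lambda>y. f y + m * (norm (y - x))\<^sup>2"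
  have "compact ?S" by (rule compact_sublevel[OF f_pos[OF x]])
  moreover have xS: "x \<in> ?S" using x by (simp add: sublevel_def)
  moreover have "continuous_on ?S ?h"
    by (intro continuous_intros continuous_on_subset[OF f_continuous]) (auto simp: sublevel_def)
  ultimately obtain p where p: "p \<in> ?S" "\<And>y. y \<in> ?S \<Longrightarrow> ?h p \<le> ?h y"
    using continuous_attains_inf[of ?S ?h] by blast
  have "?h p \<le> ?h y" if y: "y \<in> X" for y
  proof (cases "f y \<le> f x")
    case True
    then show ?thesis using p(2)[of y] y by (simp add: sublevel_def)
  next
    case False
    have "?h p \<le> f x" using p(2)[OF xS] by simp
    also have "\<dots> \<le> ?h y" using False m by (simp add: add_increasing2)
    finally show ?thesis .
  qed
  then show ?thesis using p(1) by (auto simp: sublevel_def)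
qed

text \<open>\<Phi> preserves the level coordinate. Hence the point on the segment between the lifts
  of \<open>x\<close> and of a minimiser has the averaged level, and mapping it back gives a point
  of the epigraph at that level. Both lifts are taken at the exact function values, and the two
  Lipschitz constants bound the displacement.\<close>

lemma lifted_segment:
  assumes x: "x \<in> X" "f x \<le> \<Delta>" and \<alpha>: "0 \<le> \<alpha>" "\<alpha> \<le> 1"
  defines "K \<equiv> lipschitz_const (cvx_sublevel F \<Delta>) (inv_into L \<Phi>)
    * (lipschitz_const (lift_sublevel L \<Delta>) \<Phi> * diameter (lift_sublevel L \<Delta>))"
  shows "0 \<le> K" "\<exists>y\<in>X. f y \<le> (1 - \<alpha>) * f x + \<alpha> * Inf (f ` X) \<and> norm (y - x) \<le> \<alpha> * K"
proof -
  let ?LS = "lift_sublevel L \<Delta>" and ?FS = "cvx_sublevel F \<Delta>" and ?inv = "inv_into L \<Phi>"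
  define K1 where "K1 = lipschitz_const ?LS \<Phi>"
  define K2 where "K2 = lipschitz_const ?FS ?inv"
  have \<Delta>: "0 < \<Delta>" using f_pos[OF x(1)] x(2) by linarith
  have cLS: "compact ?LS" by (rule lift_compact[OF \<Delta>])
  have LSL: "?LS \<subseteq> L" by (auto simp: lift_sublevel_def)
  note l\<Phi> = locally_lipschitz_on_compact[OF \<Phi>_lipschitz cLS LSL]
  have lev: "fst (\<Phi> p) = fst (snd p)" if "p \<in> L" for p
    using \<Phi>_level[of "fst p" "fst (snd p)" "snd (snd p)"] that by auto
  have \<Phi>F: "\<Phi> p \<in> F" if "p \<in> L" for p using \<Phi>_bij that by (auto simp: bij_betw_def)
  \<comment> \<open>Compactness of the convex sublevel set is inherited through \<Phi>, which
    matches levels.\<close>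
  have FS: "?FS = \<Phi> ` ?LS"
  proof (intro equalityI subsetI)
    fix c assume "c \<in> ?FS"
    then have c: "c \<in> F" "fst c \<le> \<Delta>" by (auto simp: cvx_sublevel_def)
    then obtain p where p: "p \<in> L" "c = \<Phi> p" using \<Phi>_bij by (auto simp: bij_betw_def)
    then have "p \<in> ?LS" using c lev[OF p(1)] by (auto simp: lift_sublevel_def split_beta)
    then show "c \<in> \<Phi> ` ?LS" using p by blast
  next
    fix c assume "c \<in> \<Phi> ` ?LS"
    then obtain p where p: "p \<in> L" "fst (snd p) \<le> \<Delta>" "c = \<Phi> p" by (auto simp: lift_sublevel_def)
    then have "c \<in> F" "fst c \<le> \<Delta>" using lev[OF p(1)] \<Phi>F[OF p(1)] by auto
    then show "c \<in> ?FS" by (cases c) (auto simp: cvx_sublevel_def)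
  qed
  have cFS: "compact ?FS" unfolding FS by (rule compact_continuous_image[OF l\<Phi>(1) cLS])
  have FSF: "?FS \<subseteq> F" by (auto simp: cvx_sublevel_def)
  obtain k1 k2 where k: "k1-lipschitz_on ?LS \<Phi>" "k2-lipschitz_on ?FS ?inv"
    using l\<Phi>(2) locally_lipschitz_on_compact(2)[OF \<Phi>_inv_lipschitz cFS FSF] by blast
  have K1: "K1-lipschitz_on ?LS \<Phi>" and K2: "K2-lipschitz_on ?FS ?inv"
    unfolding K1_def K2_def using k by (auto intro: lipschitz_const_lipschitz)
  have K10: "0 \<le> K1" and K20: "0 \<le> K2" using K1 K2 by (auto simp: lipschitz_on_def)
  have bd: "bounded ?LS" by (rule compact_imp_bounded[OF cLS])
  have K: "K = K2 * (K1 * diameter ?LS)" by (simp add: K_def K1_def K2_def)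
  show "0 \<le> K" unfolding K using K10 K20 diameter_ge_0[OF bd] by simp
  obtain xs where xs: "xs \<in> X" "f xs = Inf (f ` X)" using f_attains_Inf by blast
  have fxs: "f xs \<le> f x" using f_ge_Inf[OF x(1)] xs by simp
  obtain \<xi> \<xi>' where \<xi>: "(x, f x, \<xi>) \<in> L" "(xs, f xs, \<xi>') \<in> L"
    using lift_exists[OF x(1) order_refl] lift_exists[OF xs(1) order_refl] by metis
  define p q where "p = (x, f x, \<xi>)" and "q = (xs, f xs, \<xi>')"
  have pq: "p \<in> ?LS" "q \<in> ?LS" "p \<in> L" "q \<in> L"
    using \<xi> x(2) fxs by (auto simp: p_def q_def lift_sublevel_def)
  define c where "c = (1 - \<alpha>) *\<^sub>R \<Phi> p + \<alpha> *\<^sub>R \<Phi> q"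
  have cF: "c \<in> F" unfolding c_def using convexD_alt[OF F_convex \<Phi>F[OF pq(3)] \<Phi>F[OF pq(4)] \<alpha>] .
  have fc: "fst c = (1 - \<alpha>) * f x + \<alpha> * f xs"
    using lev[OF pq(3)] lev[OF pq(4)] by (simp add: c_def p_def q_def)
  have "(1 - \<alpha>) * f x + \<alpha> * f xs \<le> (1 - \<alpha>) * f x + \<alpha> * f x"
    using fxs \<alpha> by (intro add_left_mono mult_left_mono) auto
  also have "\<dots> = f x" by (simp add: algebra_simps)
  finally have c\<Delta>: "fst c \<le> \<Delta>" using x(2) fc by simp
  have cFS': "c \<in> ?FS" using cF c\<Delta> by (auto simp: cvx_sublevel_def split_beta)
  define r where "r = ?inv c"
  have r: "r \<in> L" "\<Phi> r = c"
    using cF \<Phi>_bij unfolding r_def by (auto simp: bij_betw_def inv_into_into f_inv_into_f)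
  define y where "y = fst r"
  have rL: "(y, fst c, snd (snd r)) \<in> L" using r lev[OF r(1)] by (auto simp: y_def)
  have "norm (y - x) = dist (fst r) (fst p)" by (simp add: y_def p_def dist_norm)
  also have "\<dots> \<le> dist r p" by (rule dist_fst_le)
  also have "p = ?inv (\<Phi> p)" using pq(3) \<Phi>_bij by (simp add: bij_betw_def)
  also have "dist r (?inv (\<Phi> p)) \<le> K2 * dist c (\<Phi> p)"
    unfolding r_def by (rule lipschitz_onD[OF K2 cFS']) (use pq FS in auto)
  also have "dist c (\<Phi> p) = \<alpha> * dist (\<Phi> p) (\<Phi> q)"
  proof -
    have "c - \<Phi> p = \<alpha> *\<^sub>R (\<Phi> q - \<Phi> p)" by (simp add: c_def algebra_simps)
    then show ?thesis using \<alpha> by (simp add: dist_norm norm_minus_commute)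
  qed
  also have "K2 * (\<alpha> * dist (\<Phi> p) (\<Phi> q)) \<le> K2 * (\<alpha> * (K1 * diameter ?LS))"
  proof (intro mult_left_mono)
    have "dist (\<Phi> p) (\<Phi> q) \<le> K1 * dist p q" by (rule lipschitz_onD[OF K1 pq(1,2)])
    also have "\<dots> \<le> K1 * diameter ?LS" using K10 by (intro mult_left_mono diameter_bounded_bound[OF bd pq(1,2)])
    finally show "dist (\<Phi> p) (\<Phi> q) \<le> K1 * diameter ?LS" .
  qed (use K20 \<alpha> in auto)
  finally have "norm (y - x) \<le> \<alpha> * K" by (simp add: K mult_ac)
  moreover have "y \<in> X" "f y \<le> fst c" using lift_in[OF rL] by auto
  ultimately show "\<exists>y\<in>X. f y \<le> (1 - \<alpha>) * f x + \<alpha> * Inf (f ` X) \<and> norm (y - x) \<le> \<alpha> * K"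
    using fc xs by auto
qed

text \<open>The Lipschitz bound holds only inside the sublevel set, so it cannot be applied directly
  at a point of the ball. Along the segment from \<open>x\<close>, the parameters whose points lie
  in the sublevel set form a closed set by compactness and an open one because the Lipschitz bound
  gives strict inequality; connectedness of the interval finishes.\<close>

lemma cball_sublevel:
  assumes x: "x \<in> X" and \<Delta>: "0 < \<Delta>" "f x + G \<Delta> * \<rho> < \<Delta>" and \<rho>: "0 \<le> \<rho>"
  shows "cball x \<rho> \<inter> Rn d \<subseteq> sublevel X f \<Delta>"
proof
  fix y assume y: "y \<in> cball x \<rho> \<inter> Rn d"
  have xR: "x \<in> Rn d" using x X_Rn by auto
  have "0 \<le> G \<Delta> * \<rho>" using G_pos[OF \<Delta>(1)] \<rho> by simp
  then have xS: "x \<in> sublevel X f \<Delta>" using x \<Delta> by (simp add: sublevel_def)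
  define \<gamma> where "\<gamma> t = x + t *\<^sub>R (y - x)" for t :: real
  define A where "A = {t \<in> {0..1}. \<gamma> t \<in> sublevel X f \<Delta>}"
  have \<gamma>cont: "continuous_on S \<gamma>" for S unfolding \<gamma>_def by (intro continuous_intros)
  have \<gamma>R: "\<gamma> t \<in> Rn d" for t unfolding \<gamma>_def using xR y by auto
  have "closedin (top_of_set {0..1}) A"
  proof -
    have "A = {0..1} \<inter> \<gamma> -` sublevel X f \<Delta>" by (auto simp: A_def)
    then show ?thesis
      using continuous_closedin_preimage[OF \<gamma>cont compact_imp_closed[OF compact_sublevel[OF \<Delta>(1)]]] by simp
  qed
  moreover have "openin (top_of_set {0..1}) A"
  proof -
    obtain U where U: "open U" "X = Rn d \<inter> U" using domain_open by (auto simp: openin_open)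
    have pre: "{0..1} \<inter> \<gamma> -` X = {0..1} \<inter> \<gamma> -` U" using \<gamma>R U by auto
    have o1: "openin (top_of_set {0..1}) ({0..1} \<inter> \<gamma> -` X)"
      unfolding pre by (rule continuous_openin_preimage_gen[OF \<gamma>cont U(1)])
    have "continuous_on ({0..1} \<inter> \<gamma> -` X) (f \<circ> \<gamma>)"
      by (rule continuous_on_compose[OF \<gamma>cont], rule continuous_on_subset[OF f_continuous]) auto
    from continuous_openin_preimage_gen[OF this, of "{..<\<Delta>}"]
    have o2: "openin (top_of_set ({0..1} \<inter> \<gamma> -` X)) (({0..1} \<inter> \<gamma> -` X) \<inter> (f \<circ> \<gamma>) -` {..<\<Delta>})" by simp
    have "A = ({0..1} \<inter> \<gamma> -` X) \<inter> (f \<circ> \<gamma>) -` {..<\<Delta>}"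
    proof (intro equalityI subsetI)
      fix t assume t: "t \<in> A"
      then have tS: "\<gamma> t \<in> sublevel X f \<Delta>" "0 \<le> t" "t \<le> 1" by (auto simp: A_def)
      have "f (\<gamma> t) \<le> f x + G \<Delta> * norm (\<gamma> t - x)"
        using f_lipschitz[OF \<Delta>(1) tS(1) xS] by linarith
      moreover have "norm (\<gamma> t - x) \<le> \<rho>"
      proof -
        have "t * norm (y - x) \<le> 1 * \<rho>"
          by (rule mult_mono) (use tS y \<rho> in \<open>auto simp: dist_norm norm_minus_commute\<close>)
        then show ?thesis using tS by (simp add: \<gamma>_def)
      qed
      then have "G \<Delta> * norm (\<gamma> t - x) \<le> G \<Delta> * \<rho>" using G_pos[OF \<Delta>(1)] by (intro mult_left_mono) auto
      ultimately have "f (\<gamma> t) < \<Delta>" using \<Delta>(2) by linarith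
      then show "t \<in> ({0..1} \<inter> \<gamma> -` X) \<inter> (f \<circ> \<gamma>) -` {..<\<Delta>}" using tS by (auto simp: sublevel_def)
    qed (auto simp: A_def sublevel_def)
    then show ?thesis using openin_trans[OF o2 o1] by simp
  qed
  moreover have "0 \<in> A" using xS by (simp add: A_def \<gamma>_def)
  ultimately have "A = {0..1}"
    using connected_Icc[of "0 :: real" 1] unfolding connected_clopen by blast
  then have "1 \<in> A" by simp
  then show "y \<in> sublevel X f \<Delta>" by (simp add: A_def \<gamma>_def)
qed

end

subsection \<open>Choice of the parameters\<close>

lemma sum_inverse_pairs: "(\<Sum>i<n. 1 / (real (Suc i) * (real (Suc i) + 1))) = 1 - 1 / (real n + 1)"
proof (induction n)
  case (Suc n)
  have "1 - 1 / (real n + 1) + 1 / ((real n + 1) * (real n + 2)) = 1 - 1 / (real n + 2)"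
    by (simp add: divide_simps) (simp add: algebra_simps)
  with Suc show ?case by (simp add: add.commute)
qed simp

text \<open>In \<open>t0_eq\<close>, 40300 is \<open>40000 + 300\<close>: the confidence parameter
  of an epoch is at most three times \<open>ln (n / \<delta>)\<close>, which is itself at least 1.
  The constant of \<open>T_ge\<close> is generous.\<close>

locale zoppa_run = lifted_problem d X f d\<xi> L F \<Phi> G \<mu>
  for d X f d\<xi> L F \<Phi> and G \<mu> :: "real \<Rightarrow> real" +
  fixes \<Delta>0 m g D K1 K2 \<delta> C :: real and x0 :: fseq and t0 :: "nat \<Rightarrow> real" and T :: "nat \<Rightarrow> nat" and \<nu> :: "nat \<Rightarrow> real" and N :: nat
  assumes data: "problem_data L F \<Phi> G \<mu> \<Delta>0 m g D K1 K2"
    and x0: "x0 \<in> X" "f x0 \<le> \<Delta>0"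
    and \<delta>: "0 < \<delta>" "\<delta> < 1 / 5"
    and t0_eq: "\<And>n. t0 n = 40300 * (real d * ln (real n / \<delta>))"
    and T_ge: "\<And>n. 1000000 * ((real n)\<^sup>2 * real d * ln (real n / \<delta>)) \<le> real (T n)"
    and \<nu>: "smoothing_ok g m N \<nu>"
    and C: "\<Delta>0 + 4 * m * (K2 * (K1 * D))\<^sup>2 + g\<^sup>2 / m \<le> C" "\<Delta>0 \<le> C" "4 * m * (K2 * (K1 * D))\<^sup>2 + g\<^sup>2 / m \<le> C"
begin

definition R where "R = g / m"

abbreviation fmin where "fmin \<equiv> Inf (f ` X)"

lemma \<Delta>0: "0 < \<Delta>0" using f_pos[OF x0(1)] x0(2) by linarith

lemma m: "0 < m" "\<mu> (24 * \<Delta>0) \<le> m" "g\<^sup>2 / (2 * \<Delta>0) \<le> m"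
proof -
  have eq: "max (\<mu> (24 * \<Delta>0)) (g\<^sup>2 / (2 * \<Delta>0)) = m" using data unfolding problem_data_def by blast
  show "\<mu> (24 * \<Delta>0) \<le> m" "g\<^sup>2 / (2 * \<Delta>0) \<le> m" unfolding eq[symmetric] by (rule max.cobounded1, rule max.cobounded2)
  then show "0 < m" using \<mu>_pos[of "24 * \<Delta>0"] \<Delta>0 by linarith
qed

lemma g_eq: "G (24 * \<Delta>0) = g" using data by (simp add: problem_data_def)

lemma g: "0 < g" using G_pos[of "24 * \<Delta>0"] \<Delta>0 by (simp add: g_eq)

lemma gR: "g * R = g\<^sup>2 / m" "g * R \<le> 2 * \<Delta>0" "0 < R" "m * R = g" "0 < g * R"
proof -
  show "g * R = g\<^sup>2 / m" by (simp add: R_def power2_eq_square)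
  show "0 < R" "m * R = g" "0 < g * R" using g m by (auto simp: R_def)
  have "g\<^sup>2 \<le> m * (2 * \<Delta>0)" using m(3) \<Delta>0 by (simp add: divide_le_eq)
  then show "g * R \<le> 2 * \<Delta>0" using m(1) by (simp add: R_def power2_eq_square divide_le_eq mult.commute)
qed

lemma fmin_bounds: "0 < fmin" "fmin \<le> \<Delta>0"
  using f_Inf_pos f_ge_Inf[OF x0(1)] x0(2) by linarith+

definition KK where "KK = K2 * (K1 * D)"

lemma lifted_step:
  assumes "x \<in> X" "f x \<le> 24 * \<Delta>0" "0 \<le> \<alpha>" "\<alpha> \<le> 1"
  shows "\<exists>y\<in>X. f y \<le> (1 - \<alpha>) * f x + \<alpha> * fmin \<and> norm (y - x) \<le> \<alpha> * KK"
proof -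
  have "KK = lipschitz_const (cvx_sublevel F (24 * \<Delta>0)) (inv_into L \<Phi>) *
      (lipschitz_const (lift_sublevel L (24 * \<Delta>0)) \<Phi> * diameter (lift_sublevel L (24 * \<Delta>0)))"
    using data unfolding problem_data_def KK_def by blast
  then show ?thesis using lifted_segment(2)[OF assms] by (simp only:)
qed

text \<open>Two invariants at once. The first keeps outer iterates below
  \<open>3 * \<Delta>0\<close>, so that the next epoch can be analysed; the second is the rate. Both
  advance by errors of order \<open>1 / (n * (n + 1))\<close>, which telescope.\<close>

definition bound :: "nat \<Rightarrow> real" where
  "bound n = min (\<Delta>0 + g * R * (1 - 1 / (real n + 1))) (fmin + C / (real n + 1))"

lemma epoch_failure:
  assumes x: "x \<in> X" "f x \<le> bound n" and n: "Suc n \<le> N"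
  shows "emeasure (directions d) {w. \<not> (\<exists>y. zogd d X f m (\<nu> (Suc n)) (T (Suc n)) (t0 (Suc n)) (\<lambda>t. w (Suc n, t)) x = Some y
      \<and> y \<in> X \<and> f y \<le> bound (Suc n))} \<le> ennreal (\<delta> * (1 / (real (Suc n) * (real (Suc n) + 1))))"
proof -
  define k where "k = real (Suc n)"
  define \<nu>' where "\<nu>' = \<nu> (Suc n)"
  define l where "l = ln (k / \<delta>)"
  \<comment> \<open>Chosen so that the two tail bounds of an epoch add up to
    \<open>\<delta> / (k * (k + 1))\<close>.\<close>
  define Lg where "Lg = ln (2 * k * (k + 1) / \<delta>)"
  have k: "1 \<le> k" "real n + 1 = k" by (auto simp: k_def)
  have fx: "f x \<le> 3 * \<Delta>0"
  proof -
    have "g * R * (1 - 1 / (real n + 1)) \<le> g * R * 1" using gR by (intro mult_left_mono) auto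
    then show ?thesis using x(2) gR(2) by (simp add: bound_def)
  qed
  have \<nu>': "0 < \<nu>'" "\<nu>' \<le> R / (6 * k * (k + 1))"
    using \<nu> n unfolding smoothing_ok_def \<nu>'_def R_def k_def by (metis atLeastAtMost_iff le_SucI le_add1 plus_1_eq_Suc)+
  have "12 \<le> 6 * k * (k + 1)"
  proof -
    have "12 = 6 * (1 * (1 + 1 :: real))" by simp
    also have "\<dots> \<le> 6 * (k * (k + 1))" using k by (intro mult_left_mono mult_mono) auto
    finally show ?thesis by simp
  qed
  then have "R / (6 * k * (k + 1)) \<le> R / 12" using gR(3) by (intro divide_left_mono) auto
  then have \<nu>12: "\<nu>' \<le> (g / m) / 12" using \<nu>' by (simp add: R_def)
  have k\<delta>: "5 \<le> k / \<delta>"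
  proof -
    have "5 * \<delta> \<le> 1" using \<delta> by simp
    then have "5 * \<delta> \<le> k" using k by linarith
    then show ?thesis using \<delta> by (simp add: le_divide_eq)
  qed
  have ln4: "1 \<le> ln (4 :: real)"
  proof -
    have "exp 1 \<le> (4 :: real)" using exp_le by linarith
    then show ?thesis by (simp add: ln_ge_iff)
  qed
  have l: "ln 4 \<le> l" "1 \<le> l"
  proof -
    show "ln 4 \<le> l" unfolding l_def using k\<delta> by (subst ln_le_cancel_iff) auto
    then show "1 \<le> l" using ln4 by linarith
  qed
  have Lg: "0 \<le> Lg" "Lg \<le> 3 * l" "2 * exp (- Lg) = \<delta> * (1 / (k * (k + 1)))"
  proof -
    have pos: "0 < 2 * k * (k + 1) / \<delta>" using k \<delta> by (intro divide_pos_pos mult_pos_pos) auto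
    have "1 \<le> 2 * k * (k + 1)" using mult_mono[of 1 "2 * k" 1 "k + 1"] k by simp
    then have "1 \<le> 2 * k * (k + 1) / \<delta>" using \<delta> by (simp add: le_divide_eq)
    then show "0 \<le> Lg" unfolding Lg_def by simp
    have "2 * k * (k + 1) / \<delta> \<le> 4 * (k / \<delta>) * (k / \<delta>)"
    proof -
      have "2 * k * (k + 1) \<le> 2 * k * (2 * k)" using k by (intro mult_left_mono) auto
      also have "\<dots> \<le> 4 * k * k * (1 / \<delta>)" using k \<delta> mult_left_mono[of 1 "1 / \<delta>" "4 * k * k"] by simp
      finally have "2 * k * (k + 1) / \<delta> \<le> 4 * k * k * (1 / \<delta>) / \<delta>" using \<delta> by (intro divide_right_mono) auto
      then show ?thesis by simp
    qed
    then have "Lg \<le> ln (4 * (k / \<delta>) * (k / \<delta>))" unfolding Lg_def using pos by (subst ln_le_cancel_iff) auto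
    also have "\<dots> = ln 4 + l + l" 
    proof -
      have "ln (4 * q * q) = ln 4 + ln q + ln q" if "0 < q" for q :: real using that by (simp add: ln_mult)
      moreover have "0 < k / \<delta>" using k\<delta> by linarith
      ultimately show ?thesis unfolding l_def by blast
    qed
    finally show "Lg \<le> 3 * l" using l by linarith
    show "2 * exp (- Lg) = \<delta> * (1 / (k * (k + 1)))"
    proof -
      have "exp Lg = 2 * (k * (k + 1)) / \<delta>" using pos by (simp add: Lg_def mult.assoc)
      then show ?thesis unfolding exp_minus by simp
    qed
  qed
  have d: "3 \<le> d" by (rule dim)
  have dpos: "0 < real d" using d by simp
  have t0': "t0 (Suc n) = 40300 * (real d * l)" by (simp add: t0_eq l_def k_def)
  have T': "1000000 * (k\<^sup>2 * real d * l) \<le> real (T (Suc n))" using T_ge[of "Suc n"] by (simp add: l_def k_def)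
  have xR: "x \<in> Rn d" using x X_Rn by auto
  \<comment> \<open>\<open>3 * \<Delta>0\<close> at the centre plus \<open>10 * g * R\<close>, at
    most \<open>20 * \<Delta>0\<close>, stays below \<open>24 * \<Delta>0\<close>.\<close>
  have sub: "cball x (10 * (g / m)) \<inter> Rn d \<subseteq> sublevel X f (24 * \<Delta>0)"
  proof (rule cball_sublevel[OF x(1)])
    have "G (24 * \<Delta>0) * (10 * (g / m)) = 10 * (g * R)" by (simp add: g_eq R_def)
    then show "f x + G (24 * \<Delta>0) * (10 * (g / m)) < 24 * \<Delta>0" using fx gR(2) \<Delta>0 by linarith
  qed (use \<Delta>0 g m in auto)
  obtain p where p: "p \<in> X" "\<And>y. y \<in> X \<Longrightarrow> f p + m * (norm (p - x))\<^sup>2 \<le> f y + m * (norm (y - x))\<^sup>2"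
    using prox_exists[OF x(1) less_imp_le[OF m(1)]] by blast
  have fp: "f p + m * (norm (p - x))\<^sup>2 \<le> f x" using p(2)[OF x(1)] by simp
  have xS: "x \<in> sublevel X f (24 * \<Delta>0)" using x(1) fx \<Delta>0 by (simp add: sublevel_def)
  have pS: "p \<in> sublevel X f (24 * \<Delta>0)"
  proof -
    have "0 \<le> m * (norm (p - x))\<^sup>2" using m(1) by simp
    then have "f p \<le> 24 * \<Delta>0" using fp fx \<Delta>0 by linarith
    then show ?thesis using p(1) by (simp add: sublevel_def)
  qed
  \<comment> \<open>The decrease of \<open>f\<close> from \<open>x\<close> to \<open>p\<close> is at
    least \<open>m\<close> times the squared distance by minimality and at most \<open>g\<close>
    times the distance.\<close>
  have pR: "norm (p - x) \<le> g / m"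
  proof (cases "norm (p - x) = 0")
    case False
    have "f x - f p \<le> g * norm (p - x)"
      using f_lipschitz[OF _ xS pS] \<Delta>0 by (simp add: g_eq norm_minus_commute)
    then have "m * (norm (p - x))\<^sup>2 \<le> g * norm (p - x)" using fp by linarith
    then have "(m * norm (p - x)) * norm (p - x) \<le> g * norm (p - x)" by (simp add: power2_eq_square)
    then have "m * norm (p - x) \<le> g" using False by (simp add: mult_le_cancel_right)
    then show ?thesis using m(1) by (simp add: le_divide_eq mult.commute)
  qed (use g m in simp)
  have XB: "cball x (10 * (g / m)) \<inter> Rn d \<subseteq> X" using sub by (auto simp: sublevel_def)
  note Req = R_def
  interpret epoch d x "10 * (g / m)" g "\<mu> (24 * \<Delta>0)" f m "g / m" X p \<nu>' "t0 (Suc n)" "T (Suc n)" Lg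
  proof
    show "3 \<le> d" by (rule dim)
    show "x \<in> Rn d" by (rule xR)
    show "0 < 10 * (g / m)" using g m by simp
    show "0 < g" by (rule g)
    show "0 \<le> \<mu> (24 * \<Delta>0)" using \<mu>_pos[of "24 * \<Delta>0"] \<Delta>0 by simp
    show "compact (cball x (10 * (g / m)) \<inter> Rn d)"
    proof -
      have "cball x (10 * (g / m)) \<inter> Rn d = sublevel X f (24 * \<Delta>0) \<inter> (cball x (10 * (g / m)) \<inter> Rn d)" using sub by blast
      then show ?thesis
        using compact_Int_closed[OF compact_sublevel[of "24 * \<Delta>0"] closed_Int[OF closed_cball closed_Rn], of x "10 * (g / m)" d] \<Delta>0
        by simp
    qed
    show "\<bar>f y - f z\<bar> \<le> g * norm (y - z)"
      if "y \<in> cball x (10 * (g / m)) \<inter> Rn d" "z \<in> cball x (10 * (g / m)) \<inter> Rn d" for y z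
      using f_lipschitz[OF _ subsetD[OF sub that(1)] subsetD[OF sub that(2)]] \<Delta>0 by (simp add: g_eq)
    show "convex_on (cball x (10 * (g / m)) \<inter> Rn d) (\<lambda>y. f y + \<mu> (24 * \<Delta>0) / 2 * (norm y)\<^sup>2)"
      by (rule f_weakly_convex[OF _ _ sub]) (use \<Delta>0 in \<open>auto intro!: convex_Int convex_Rn\<close>)
    show "0 < m" "\<mu> (24 * \<Delta>0) \<le> m" by (rule m)+
    show "cball x (10 * (g / m)) \<inter> Rn d \<subseteq> X" by (rule XB)
    show "p \<in> Rn d" using p X_Rn by auto
    show "norm (p - x) \<le> g / m" by (rule pR)
    show "f p + m * (norm (p - x))\<^sup>2 \<le> f y + m * (norm (y - x))\<^sup>2" if "y \<in> cball x (10 * (g / m)) \<inter> Rn d" for y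
      by (rule p(2)[OF subsetD[OF XB that]])
    show "0 < \<nu>'" "\<nu>' \<le> g / m / 12" "0 \<le> Lg" using \<nu>' \<nu>12 Lg by auto
    show "real d * (40000 + 100 * Lg) \<le> t0 (Suc n)"
    proof -
      have "40000 + 100 * Lg \<le> 40300 * l" using Lg(2) l by linarith
      then have "real d * (40000 + 100 * Lg) \<le> real d * (40300 * l)" by (intro mult_left_mono) auto
      then show ?thesis by (simp add: t0' mult.left_commute)
    qed
  qed (rule refl)+
  \<comment> \<open>With this accuracy the optimisation error is one half of
    \<open>g * R / (k * (k + 1))\<close>; the smoothing error is at most one third of it.\<close>
  define \<epsilon> where "\<epsilon> = 3 / (2 * k * (k + 1))"
  define TT where "TT = real (T (Suc n))"
  define q where "q = k\<^sup>2 * real d * l"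
  have q: "0 < q" "1000000 * q \<le> TT" using k l dpos T' by (auto simp: q_def TT_def)
  have TT: "0 < TT" using q by linarith
  have k2: "1 \<le> k\<^sup>2" using k by (simp add: one_le_power)
  have dl: "real d * l \<le> q" unfolding q_def using mult_right_mono[OF k2, of "real d * l"] dpos l by (simp add: mult.assoc)
  have t0T: "t0 (Suc n) \<le> TT" using dl q t0' by linarith
  have \<epsilon>_ge: "3 / (4 * k\<^sup>2) \<le> \<epsilon>"
  proof -
    have "2 * k * (k + 1) \<le> 2 * k * (2 * k)" using k by (intro mult_left_mono) auto
    then show ?thesis unfolding \<epsilon>_def using k by (intro divide_left_mono) (auto simp: power2_eq_square)
  qed
  have e1: "75000 * real d / TT \<le> (75 / 1000) / k\<^sup>2"
  proof -
    have "k\<^sup>2 * real d * 1 \<le> q" unfolding q_def using l dpos by (intro mult_left_mono) auto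
    then have "75000 * (k\<^sup>2 * real d) * 1000 \<le> 75 * TT" using q by linarith
    then show ?thesis using TT k by (simp add: divide_le_eq le_divide_eq field_simps)
  qed
  have e2: "(t0 (Suc n) / TT)\<^sup>2 \<le> (1 / 100) / k\<^sup>2"
  proof -
    have "k\<^sup>2 * (10 * t0 (Suc n)) \<le> TT" using q unfolding t0' q_def by (simp add: mult_ac)
    then have "t0 (Suc n) / TT \<le> (1 / 10) / k\<^sup>2" using TT k by (simp add: divide_le_eq le_divide_eq field_simps)
    moreover have "(1 / 10) / k\<^sup>2 \<le> (1 / 10) / k" using k by (intro divide_left_mono) (auto simp: power2_eq_square)
    ultimately have "t0 (Suc n) / TT \<le> (1 / 10) / k" by linarith
    moreover have "0 \<le> t0 (Suc n) / TT" using TT l by (simp add: t0')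
    ultimately have "(t0 (Suc n) / TT)\<^sup>2 \<le> ((1 / 10) / k)\<^sup>2" by (intro power_mono)
    then show ?thesis by (simp add: power_divide)
  qed
  have e3: "400 * Lg * real d / TT \<le> (12 / 10000) / k\<^sup>2"
  proof -
    have "k\<^sup>2 * (Lg * real d) \<le> k\<^sup>2 * (3 * l * real d)" using Lg by (intro mult_left_mono mult_right_mono) auto
    also have "\<dots> = 3 * q" by (simp add: q_def mult_ac)
    finally have "400 * (k\<^sup>2 * (Lg * real d)) * 10000 \<le> 12 * TT" using q by linarith
    then show ?thesis using TT k by (simp add: divide_le_eq le_divide_eq field_simps)
  qed
  have \<epsilon>: "75000 * real d / TT + (t0 (Suc n) / TT)\<^sup>2 + 400 * Lg * real d / TT \<le> \<epsilon>"
  proof -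
    have "0 < 1 / k\<^sup>2" using k by simp
    then have "(75 / 1000) / k\<^sup>2 + (1 / 100) / k\<^sup>2 + (12 / 10000) / k\<^sup>2 \<le> 3 / (4 * k\<^sup>2)"
      by (simp add: field_simps)
    then show ?thesis using e1 e2 e3 \<epsilon>_ge by linarith
  qed
  define err where "err = 2 * g * \<nu>' + g * (g / m) / 3 * \<epsilon>"
  have err: "err \<le> g * R * (1 / (k * (k + 1)))"
  proof -
    have "2 * g * \<nu>' \<le> 2 * g * (R / (6 * k * (k + 1)))" using g \<nu>' by (intro mult_left_mono) auto
    also have "\<dots> = g * R * (1 / (k * (k + 1))) / 3" by (simp add: mult.assoc)
    finally have a: "2 * g * \<nu>' \<le> g * R * (1 / (k * (k + 1))) / 3" .
    have b: "g * (g / m) / 3 * \<epsilon> = g * R * (1 / (k * (k + 1))) / 2" by (simp add: \<epsilon>_def Req mult.assoc)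
    have "0 \<le> g * R * (1 / (k * (k + 1)))" by (rule mult_nonneg_nonneg[OF less_imp_le[OF gR(5)]]) (use k in simp)
    moreover have "A + B \<le> Z" if "0 \<le> Z" "A \<le> Z / 3" "B = Z / 2" for A B Z :: real using that by linarith
    ultimately show ?thesis unfolding err_def using a b by blast
  qed
  have good: "f y \<le> bound (Suc n)" if y: "f y + m * (norm (y - x))\<^sup>2 \<le> f p + m * (norm (p - x))\<^sup>2 + err" for y
  proof -
    have m0: "0 \<le> m * (norm (y - x))\<^sup>2" using m(1) by simp
    have kk: "1 - 1 / (real (Suc n) + 1) = (1 - 1 / k) + 1 / (k * (k + 1))"
    proof -
      have "1 / k - 1 / (k + 1) = 1 / (k * (k + 1))" using k(1) by (subst diff_frac_eq) auto
      then show ?thesis unfolding k_def[symmetric] by linarith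
    qed
    have 1: "f y \<le> \<Delta>0 + g * R * (1 - 1 / (real (Suc n) + 1))"
    proof -
      have "f x \<le> \<Delta>0 + g * R * (1 - 1 / k)" using x(2) by (simp add: bound_def k(2))
      then have "f y \<le> \<Delta>0 + g * R * (1 - 1 / k) + g * R * (1 / (k * (k + 1)))" using y fp err m0 by linarith
      also have "\<dots> = \<Delta>0 + g * R * ((1 - 1 / k) + 1 / (k * (k + 1)))" by (simp only: distrib_left add.assoc)
      finally show ?thesis unfolding kk .
    qed
    have 2: "f y \<le> fmin + C / (real (Suc n) + 1)"
    proof -
      \<comment> \<open>The choice makes \<open>(1 - \<alpha>) / k + 1 / (k * (k + 1))\<close> equal
        to \<open>1 / (k + 1)\<close>, so the rate reproduces itself. For \<open>k = 1\<close> it is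
        the full step to the minimiser.\<close>
      define \<alpha> where "\<alpha> = 2 / (k + 1)"
      have \<alpha>: "0 \<le> \<alpha>" "\<alpha> \<le> 1" using k by (auto simp: \<alpha>_def)
      obtain y' where y': "y' \<in> X" "f y' \<le> (1 - \<alpha>) * f x + \<alpha> * fmin" "norm (y' - x) \<le> \<alpha> * KK"
        using lifted_step[OF x(1) _ \<alpha>] fx \<Delta>0 by auto
      have "(norm (y' - x))\<^sup>2 \<le> (\<alpha> * KK)\<^sup>2" using y'(3) by (intro power_mono) auto
      then have "m * (norm (y' - x))\<^sup>2 \<le> m * (\<alpha> * KK)\<^sup>2" using m(1) by (intro mult_left_mono) auto
      then have "f y \<le> (1 - \<alpha>) * f x + \<alpha> * fmin + m * (\<alpha> * KK)\<^sup>2 + g * R * (1 / (k * (k + 1)))"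
        using y p(2)[OF y'(1)] y'(2) err m0 by linarith
      moreover have "(1 - \<alpha>) * f x \<le> (1 - \<alpha>) * (fmin + C / k)"
        using x(2) \<alpha> by (intro mult_left_mono) (auto simp: bound_def k(2))
      ultimately have "f y \<le> fmin + (1 - \<alpha>) * (C / k) + m * (\<alpha> * KK)\<^sup>2 + g * R * (1 / (k * (k + 1)))"
        by (simp add: algebra_simps)
      also have "m * (\<alpha> * KK)\<^sup>2 \<le> (4 * m * KK\<^sup>2) * (1 / (k * (k + 1)))"
      proof -
        have "m * (\<alpha> * KK)\<^sup>2 = (4 * m * KK\<^sup>2) * (1 / ((k + 1) * (k + 1)))"
          by (simp add: \<alpha>_def power_mult_distrib power_divide power2_eq_square)
        also have "\<dots> \<le> (4 * m * KK\<^sup>2) * (1 / (k * (k + 1)))"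
          using k m(1) by (intro mult_left_mono divide_left_mono mult_right_mono) auto
        finally show ?thesis .
      qed
      also have "fmin + (1 - \<alpha>) * (C / k) + (4 * m * KK\<^sup>2) * (1 / (k * (k + 1))) + g * R * (1 / (k * (k + 1)))
          = fmin + (1 - \<alpha>) * (C / k) + (4 * m * KK\<^sup>2 + g * R) * (1 / (k * (k + 1)))"
        by (simp only: distrib_right add.assoc)
      also have "\<dots> \<le> fmin + (1 - \<alpha>) * (C / k) + C * (1 / (k * (k + 1)))"
        using C(3) k unfolding KK_def gR(1) by (intro add_left_mono mult_right_mono) auto
      also have "\<dots> = fmin + C / (real (Suc n) + 1)"
      proof -
        have "(1 - \<alpha>) * (C / k) = (k - 1) * C / (k * (k + 1))"
        proof -
          have "1 - \<alpha> = (k - 1) / (k + 1)" using k(1) unfolding \<alpha>_def by (subst diff_divide_eq_iff) auto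
          then show ?thesis by (simp add: mult.commute)
        qed
        then have "(1 - \<alpha>) * (C / k) + C * (1 / (k * (k + 1))) = ((k - 1) * C + C) / (k * (k + 1))"
          by (simp add: add_divide_distrib)
        also have "(k - 1) * C + C = k * C" by (simp add: left_diff_distrib)
        also have "k * C / (k * (k + 1)) = C / (k + 1)" using k(1) by simp
        finally show ?thesis unfolding k_def[symmetric] by linarith
      qed
      finally show ?thesis by simp
    qed
    show ?thesis using 1 2 by (simp add: bound_def)
  qed
  have T0: "0 < T (Suc n)" using TT by (simp add: TT_def)
  \<comment> \<open>\<open>emeasure\<close> is 0 on non-measurable sets, so monotonicity below
    requires the larger event to be measurable.\<close>
  have meas: "{w. \<not> (\<exists>y. zogd d X f m \<nu>' (T (Suc n)) (t0 (Suc n)) (\<lambda>t. w (Suc n, t)) x = Some y \<and> y \<in> cball x (10 * (g / m)) \<inter> Rn d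
      \<and> f y + m * (norm (y - x))\<^sup>2 \<le> f p + m * (norm (p - x))\<^sup>2 + 2 * g * \<nu>' + g * (g / m) / 3 * \<epsilon>)} \<in> sets (directions d)"
    (is "?E \<in> _")
  proof -
    let ?e = "\<lambda>w. enc (zogd d X f m \<nu>' (T (Suc n)) (t0 (Suc n)) (\<lambda>t. w (Suc n, t)) x)"
    have [measurable]: "?e \<in> measurable (directions d) opt_space"
      by (rule measurable_zogd[OF X_borel measurable_f]) (auto intro: measurable_directions_component)
    define f' where "f' = (\<lambda>x. if x \<in> X then f x else 0)"
    have [measurable]: "f' \<in> borel_measurable borel" using measurable_f by (simp add: f'_def)
    have Bm [measurable]: "cball x (10 * (g / m)) \<inter> Rn d \<in> sets borel" by measurable
    have "?E = {w \<in> space (directions d). \<not> (fst (?e w) \<and> snd (?e w) \<in> cball x (10 * (g / m)) \<inter> Rn d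
      \<and> f' (snd (?e w)) + m * (norm (snd (?e w) - x))\<^sup>2 \<le> f p + m * (norm (p - x))\<^sup>2 + 2 * g * \<nu>' + g * (g / m) / 3 * \<epsilon>)}"
    proof (intro set_eqI)
      fix w
      show "w \<in> ?E \<longleftrightarrow> w \<in> {w \<in> space (directions d). \<not> (fst (?e w) \<and> snd (?e w) \<in> cball x (10 * (g / m)) \<inter> Rn d
        \<and> f' (snd (?e w)) + m * (norm (snd (?e w) - x))\<^sup>2 \<le> f p + m * (norm (p - x))\<^sup>2 + 2 * g * \<nu>' + g * (g / m) / 3 * \<epsilon>)}"
        using XB by (cases "zogd d X f m \<nu>' (T (Suc n)) (t0 (Suc n)) (\<lambda>t. w (Suc n, t)) x") (auto simp: f'_def subset_iff)
    qed
    also have "\<dots> \<in> sets (directions d)" by measurable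
    finally show ?thesis .
  qed
  have "emeasure (directions d) {w. \<not> (\<exists>y. zogd d X f m (\<nu> (Suc n)) (T (Suc n)) (t0 (Suc n)) (\<lambda>t. w (Suc n, t)) x = Some y
      \<and> y \<in> X \<and> f y \<le> bound (Suc n))} \<le> emeasure (directions d) ?E"
  proof (rule emeasure_mono[OF _ meas], rule Collect_mono, rule impI, erule contrapos_nn)
    fix w
    assume "\<exists>y. zogd d X f m \<nu>' (T (Suc n)) (t0 (Suc n)) (\<lambda>t. w (Suc n, t)) x = Some y \<and> y \<in> cball x (10 * (g / m)) \<inter> Rn d
      \<and> f y + m * (norm (y - x))\<^sup>2 \<le> f p + m * (norm (p - x))\<^sup>2 + 2 * g * \<nu>' + g * (g / m) / 3 * \<epsilon>"
    then obtain y where y: "zogd d X f m \<nu>' (T (Suc n)) (t0 (Suc n)) (\<lambda>t. w (Suc n, t)) x = Some y"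
      "y \<in> cball x (10 * (g / m)) \<inter> Rn d"
      "f y + m * (norm (y - x))\<^sup>2 \<le> f p + m * (norm (p - x))\<^sup>2 + 2 * g * \<nu>' + g * (g / m) / 3 * \<epsilon>" by blast
    have "y \<in> X" using XB y(2) by blast
    moreover have "f y \<le> bound (Suc n)" by (rule good) (use y(3) in \<open>simp add: err_def\<close>)
    ultimately show "\<exists>y. zogd d X f m (\<nu> (Suc n)) (T (Suc n)) (t0 (Suc n)) (\<lambda>t. w (Suc n, t)) x = Some y \<and> y \<in> X \<and> f y \<le> bound (Suc n)"
      using y(1) unfolding \<nu>'_def by blast
  qed
  also have "\<dots> \<le> ennreal (2 * exp (- Lg))"
    by (rule epoch_success[OF T0]) (use t0T \<epsilon> in \<open>simp_all add: TT_def\<close>)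
  also have "2 * exp (- Lg) = \<delta> * (1 / (real (Suc n) * (real (Suc n) + 1)))" unfolding Lg(3) k_def ..
  finally show ?thesis .
qed

definition reached :: "nat \<Rightarrow> (nat \<times> nat \<Rightarrow> fseq) set" where
  "reached n = {z. \<exists>x. zoppa d X f m \<nu> T t0 x0 z n = Some x \<and> x \<in> X \<and> f x \<le> bound n}"

lemma reached_sets: "reached n \<in> sets (directions d)"
  unfolding reached_def by (rule sets_zoppa_level[OF X_borel measurable_f])

lemma prob_not_reached: "n \<le> N \<Longrightarrow> emeasure (directions d) (- reached n) \<le> ennreal (\<delta> * (\<Sum>i<n. 1 / (real (Suc i) * (real (Suc i) + 1))))"
proof (induction n)
  case 0
  have "f x0 \<le> bound 0" using x0(2) C(2) fmin_bounds by (simp add: bound_def)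
  then have "reached 0 = UNIV" using x0(1) by (auto simp: reached_def)
  then show ?case by simp
next
  case (Suc n)
  have sets: "- reached n \<in> sets (directions d)" "reached n - reached (Suc n) \<in> sets (directions d)"
    using sets.compl_sets[OF reached_sets[of n]] reached_sets by (auto simp: Compl_eq_Diff_UNIV)
  have "emeasure (directions d) (- reached (Suc n)) \<le> emeasure (directions d) (- reached n \<union> (reached n - reached (Suc n)))"
    using sets by (intro emeasure_mono) auto
  also have "\<dots> \<le> emeasure (directions d) (- reached n) + emeasure (directions d) (reached n - reached (Suc n))"
    by (rule emeasure_subadditive[OF sets])
  also have "emeasure (directions d) (reached n - reached (Suc n)) \<le> ennreal (\<delta> * (1 / (real (Suc n) * (real (Suc n) + 1))))"
  proof -
    have "reached n - reached (Suc n) = {z. (\<exists>x. zoppa d X f m \<nu> T t0 x0 z n = Some x \<and> x \<in> X \<and> f x \<le> bound n)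
      \<and> \<not> (\<exists>x. zoppa d X f m \<nu> T t0 x0 z (Suc n) = Some x \<and> x \<in> X \<and> f x \<le> bound (Suc n))}"
      unfolding reached_def by blast
    then show ?thesis
      by (simp only:) (rule emeasure_zoppa_step[OF X_borel measurable_f], rule epoch_failure[OF _ _ Suc.prems])
  qed
  also have "emeasure (directions d) (- reached n) \<le> ennreal (\<delta> * (\<Sum>i<n. 1 / (real (Suc i) * (real (Suc i) + 1))))"
    using Suc by simp
  also have "ennreal (\<delta> * (\<Sum>i<n. 1 / (real (Suc i) * (real (Suc i) + 1)))) + ennreal (\<delta> * (1 / (real (Suc n) * (real (Suc n) + 1))))
      = ennreal (\<delta> * (\<Sum>i<n. 1 / (real (Suc i) * (real (Suc i) + 1))) + \<delta> * (1 / (real (Suc n) * (real (Suc n) + 1))))"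
    using \<delta> by (intro ennreal_plus[symmetric] mult_nonneg_nonneg sum_nonneg) auto
  finally show ?case by (simp add: distrib_left add_mono)
qed

lemma success:
  assumes N: "1 \<le> N" and r: "C / real N \<le> r"
  shows "1 - \<delta> \<le> success_prob d X f m \<nu> T t0 x0 N r"
proof -
  let ?S = "{z \<in> space (directions d). \<exists>x. zoppa d X f m \<nu> T t0 x0 z N = Some x \<and> x \<in> X \<and> f x - fmin \<le> r}"
  have "?S = {z. \<exists>x. zoppa d X f m \<nu> T t0 x0 z N = Some x \<and> x \<in> X \<and> f x \<le> r + fmin}"
    by (auto simp: diff_le_eq)
  then have S: "?S \<in> sets (directions d)" using sets_zoppa_level[OF X_borel measurable_f] by simp
  have C0: "0 \<le> C" using C(2) \<Delta>0 by linarith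
  have sub: "reached N \<subseteq> ?S"
  proof
    fix z assume "z \<in> reached N"
    then obtain x where x: "zoppa d X f m \<nu> T t0 x0 z N = Some x" "x \<in> X" "f x \<le> bound N" by (auto simp: reached_def)
    have "C / (real N + 1) \<le> C / real N" using C0 N by (intro divide_left_mono) auto
    then have "f x - fmin \<le> r" using x(3) r by (simp add: bound_def)
    then show "z \<in> ?S" using x by auto
  qed
  have "emeasure (directions d) (- reached N) \<le> ennreal (\<delta> * (1 - 1 / (real N + 1)))"
    using prob_not_reached[of N] unfolding sum_inverse_pairs by simp
  also have "\<dots> \<le> ennreal \<delta>" using \<delta> by (intro ennreal_leI) (simp add: mult_left_le)
  finally have "measure (directions d) (- reached N) \<le> \<delta>"
    using \<delta> by (simp add: dirs.emeasure_eq_measure)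
  moreover have "measure (directions d) (- reached N) = 1 - measure (directions d) (reached N)"
    using dirs.prob_compl[OF reached_sets[of N]] by (simp add: Compl_eq_Diff_UNIV)
  moreover have "measure (directions d) (reached N) \<le> measure (directions d) ?S"
    by (rule dirs.finite_measure_mono[OF sub S])
  ultimately show ?thesis by (simp add: success_prob_def)
qed

end

text \<open>The smallness of \<epsilon> gives \<open>2 * C \<le> 1 / \<epsilon>\<close>, so
  \<open>n / \<delta>\<close> is at most the square of \<open>1 / (\<epsilon> * \<delta>)\<close>.
  The constant 32 is 2 queries per step, 2 from this square and 8 from the cube of
  \<open>2 * C / \<epsilon>\<close>.\<close>

lemma query_bound:
  fixes \<delta> \<epsilon> C b :: real
  assumes \<delta>: "0 < \<delta>" "\<delta> < 1 / 5" and \<epsilon>: "0 < \<epsilon>" "\<epsilon> < 1 / (2 * C)" and C: "1 \<le> C" and b: "0 < b"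
    and N: "1 \<le> N" "real N \<le> 2 * C / \<epsilon>"
    and T: "\<And>n. n \<in> {1..N} \<Longrightarrow> real (T n) \<le> b * ((real n)\<^sup>2 * real d * ln (real n / \<delta>))"
  shows "real (num_queries T N) \<le> 32 * b * C ^ 3 * (real d / \<epsilon> ^ 3 * ln (1 / (\<epsilon> * \<delta>)))"
proof -
  define l where "l = ln (1 / (\<epsilon> * \<delta>))"
  have "2 * C * \<epsilon> < 1" using \<epsilon>(2) C by (simp add: field_simps)
  then have C\<epsilon>: "2 * C \<le> 1 / \<epsilon>" using \<epsilon> by (simp add: field_simps)
  have "\<epsilon> < 1"
  proof -
    have "1 / (2 * C) \<le> 1" using C by simp
    then show ?thesis using \<epsilon> by linarith
  qed
  then have e\<delta>: "1 / \<epsilon> \<le> 1 / (\<epsilon> * \<delta>)" "1 \<le> 1 / (\<epsilon> * \<delta>)" using \<epsilon> \<delta> mult_mono[of \<epsilon> 1 \<delta> 1] by (auto simp: field_simps)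
  have l0: "0 \<le> l" unfolding l_def using e\<delta>(2) by simp
  have lnN: "ln (real n / \<delta>) \<le> 2 * l" if n: "n \<in> {1..N}" for n
  proof -
    have "real n / \<delta> \<le> (2 * C / \<epsilon>) / \<delta>" using n N \<delta> by (intro divide_right_mono) auto
    also have "\<dots> = 2 * C * (1 / (\<epsilon> * \<delta>))" by simp
    also have "\<dots> \<le> (1 / (\<epsilon> * \<delta>)) * (1 / (\<epsilon> * \<delta>))" using C\<epsilon> e\<delta> by (intro mult_right_mono) linarith+
    finally have "ln (real n / \<delta>) \<le> ln ((1 / (\<epsilon> * \<delta>)) * (1 / (\<epsilon> * \<delta>)))"
      using n \<delta> \<epsilon> by (subst ln_le_cancel_iff) auto
    also have "\<dots> = 2 * l"
    proof -
      have "ln (q * q) = 2 * ln q" if "0 < q" for q :: real using that by (simp add: ln_mult)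
      then show ?thesis unfolding l_def using \<epsilon> \<delta> by (meson divide_pos_pos mult_pos_pos zero_less_one)
    qed
    finally show ?thesis .
  qed
  have "real (num_queries T N) = (\<Sum>n=1..N. 2 * real (T n))" by (simp add: num_queries_def)
  also have "\<dots> \<le> (\<Sum>n=1..N. 2 * (b * ((real N)\<^sup>2 * real d * (2 * l))))"
  proof (rule sum_mono)
    fix n assume n: "n \<in> {1..N}"
    have "(real n)\<^sup>2 * real d * ln (real n / \<delta>) \<le> (real n)\<^sup>2 * real d * (2 * l)"
      by (intro mult_left_mono lnN[OF n]) auto
    also have "\<dots> \<le> (real N)\<^sup>2 * real d * (2 * l)"
      using n l0 by (intro mult_right_mono power_mono) auto
    finally have "b * ((real n)\<^sup>2 * real d * ln (real n / \<delta>)) \<le> b * ((real N)\<^sup>2 * real d * (2 * l))"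
      using b by (intro mult_left_mono) auto
    then show "2 * real (T n) \<le> 2 * (b * ((real N)\<^sup>2 * real d * (2 * l)))" using T[OF n] by linarith
  qed
  also have "\<dots> = 4 * b * real d * l * (real N) ^ 3" by (simp add: power2_eq_square power3_eq_cube)
  also have "\<dots> \<le> 4 * b * real d * l * (2 * C / \<epsilon>) ^ 3"
    using N b l0 by (intro mult_left_mono power_mono) auto
  also have "\<dots> = 32 * b * C ^ 3 * (real d / \<epsilon> ^ 3 * l)" by (simp add: power_divide power_mult_distrib)
  finally show ?thesis by (simp add: l_def)
qed

theorem theorem1:
  fixes \<Delta>0 m g D K1 K2 :: real
  shows "\<exists>a b C K \<epsilon>0 :: real. \<exists>N0 :: nat.
    0 < a \<and> 0 < b \<and> 0 < C \<and> 0 < K \<and> 0 < \<epsilon>0 \<and> 1 \<le> N0 \<and>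
    (\<forall>d X f d\<xi> L F \<Phi> G \<mu> x0 \<delta>.
       lifted_problem d X f d\<xi> L F \<Phi> G \<mu> \<and>
       problem_data L F \<Phi> G \<mu> \<Delta>0 m g D K1 K2 \<and>
       x0 \<in> X \<and> f x0 \<le> \<Delta>0 \<and>
       0 < \<delta> \<and> \<delta> < min (1 / 5) (1 / ln (real d)) \<longrightarrow>
       (\<forall>N\<ge>N0. \<exists>t0 T. schedule a b d \<delta> N t0 T \<and>
          (\<forall>\<nu>. smoothing_ok g m N \<nu> \<longrightarrow>
             success_prob d X f m \<nu> T t0 x0 N (C / real N) \<ge> 1 - \<delta>)) \<and>
       (\<forall>\<epsilon>. 0 < \<epsilon> \<and> \<epsilon> < \<epsilon>0 \<longrightarrow>
          (\<exists>N\<ge>N0. \<exists>t0 T. schedule a b d \<delta> N t0 T \<and>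
             real (num_queries T N) \<le> K * (real d / \<epsilon> ^ 3 * ln (1 / (\<epsilon> * \<delta>))) \<and>
             (\<forall>\<nu>. smoothing_ok g m N \<nu> \<longrightarrow>
                success_prob d X f m \<nu> T t0 x0 N \<epsilon> \<ge> 1 - \<delta>))))"
proof -
  \<comment> \<open>The constants are fixed before any problem instance, when the data are arbitrary
    reals; absolute values keep \<open>C\<close> at least 1. The additional 1 in \<open>b\<close>
    absorbs the rounding of \<open>T\<close>.\<close>
  define a b C where "a = (40300 :: real)" and "b = (1000001 :: real)"
    and "C = 1 + \<bar>\<Delta>0\<bar> + 4 * \<bar>m\<bar> * (K2 * (K1 * D))\<^sup>2 + \<bar>g\<^sup>2 / m\<bar>"
  have nn: "0 \<le> 4 * \<bar>m\<bar> * (K2 * (K1 * D))\<^sup>2" "0 \<le> \<bar>g\<^sup>2 / m\<bar>" "0 \<le> \<bar>\<Delta>0\<bar>" by auto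
  have C1: "1 \<le> C" unfolding C_def using nn by linarith
  have "4 * m * (K2 * (K1 * D))\<^sup>2 \<le> 4 * \<bar>m\<bar> * (K2 * (K1 * D))\<^sup>2" by (intro mult_right_mono) auto
  moreover have "g\<^sup>2 / m \<le> \<bar>g\<^sup>2 / m\<bar>" "\<Delta>0 \<le> \<bar>\<Delta>0\<bar>" by (rule abs_ge_self)+
  ultimately have C: "\<Delta>0 + 4 * m * (K2 * (K1 * D))\<^sup>2 + g\<^sup>2 / m \<le> C" "\<Delta>0 \<le> C"
    "4 * m * (K2 * (K1 * D))\<^sup>2 + g\<^sup>2 / m \<le> C"
    unfolding C_def using nn by linarith+
  have main: "(\<forall>N\<ge>1. \<exists>t0 T. schedule a b d \<delta> N t0 T \<and>
          (\<forall>\<nu>. smoothing_ok g m N \<nu> \<longrightarrow>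
             success_prob d X f m \<nu> T t0 x0 N (C / real N) \<ge> 1 - \<delta>)) \<and>
       (\<forall>\<epsilon>. 0 < \<epsilon> \<and> \<epsilon> < 1 / (2 * C) \<longrightarrow>
          (\<exists>N\<ge>1. \<exists>t0 T. schedule a b d \<delta> N t0 T \<and>
             real (num_queries T N) \<le> 32 * b * C ^ 3 * (real d / \<epsilon> ^ 3 * ln (1 / (\<epsilon> * \<delta>))) \<and>
             (\<forall>\<nu>. smoothing_ok g m N \<nu> \<longrightarrow>
                success_prob d X f m \<nu> T t0 x0 N \<epsilon> \<ge> 1 - \<delta>)))"
    if lp: "lifted_problem d X f d\<xi> L F \<Phi> G \<mu>" and pd: "problem_data L F \<Phi> G \<mu> \<Delta>0 m g D K1 K2"
      and x0: "x0 \<in> X" "f x0 \<le> \<Delta>0" and \<delta>: "0 < \<delta>" "\<delta> < min (1 / 5) (1 / ln (real d))"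
    for d X f d\<xi> L F \<Phi> G \<mu> x0 \<delta>
  proof -
    have \<delta>5: "\<delta> < 1 / 5" using \<delta>(2) by simp
    define t0 where "t0 n = 40300 * (real d * ln (real n / \<delta>))" for n :: nat
    define T where "T n = nat \<lceil>1000000 * ((real n)\<^sup>2 * real d * ln (real n / \<delta>))\<rceil>" for n :: nat
    have d3: "3 \<le> d"
    proof -
      interpret lifted_problem d X f d\<xi> L F \<Phi> G \<mu> by (rule lp)
      show ?thesis by (rule dim)
    qed
    have T_ge: "1000000 * ((real n)\<^sup>2 * real d * ln (real n / \<delta>)) \<le> real (T n)" for n
      unfolding T_def by (rule real_nat_ceiling_ge)
    have big: "1 \<le> (real n)\<^sup>2 * real d * ln (real n / \<delta>)" "0 \<le> real d * ln (real n / \<delta>)" if n: "1 \<le> n" for n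
    proof -
      have "4 * \<delta> \<le> real n" using \<delta>5 n by linarith
      then have "4 \<le> real n / \<delta>" using \<delta> by (simp add: le_divide_eq)
      moreover have "exp 1 \<le> (4 :: real)" using exp_le by linarith
      ultimately have "exp 1 \<le> real n / \<delta>" by linarith
      then have l1: "1 \<le> ln (real n / \<delta>)" using n \<delta> by (simp add: ln_ge_iff)
      have "1 * 1 * 1 \<le> (real n)\<^sup>2 * real d * ln (real n / \<delta>)"
        using n d3 l1 by (intro mult_mono) (auto simp: one_le_power)
      then show "1 \<le> (real n)\<^sup>2 * real d * ln (real n / \<delta>)" by simp
      show "0 \<le> real d * ln (real n / \<delta>)" using l1 by simp
    qed
    have T_le: "real (T n) \<le> b * ((real n)\<^sup>2 * real d * ln (real n / \<delta>))" if n: "1 \<le> n" for n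
    proof -
      define q where "q = (real n)\<^sup>2 * real d * ln (real n / \<delta>)"
      have q: "1 \<le> q" using big(1)[OF n] by (simp add: q_def)
      have "real (T n) = of_int \<lceil>1000000 * q\<rceil>" unfolding T_def q_def[symmetric] using q by simp
      also have "\<dots> \<le> 1000000 * q + 1" by linarith
      finally show ?thesis unfolding q_def[symmetric] b_def using q by linarith
    qed
    have sched: "schedule a b d \<delta> N t0 T" for N
      unfolding schedule_def
    proof (intro ballI conjI)
      fix n assume "n \<in> {1..N}"
      then have n: "1 \<le> n" by simp
      show "a * (real d * ln (real n / \<delta>)) \<le> t0 n" by (simp add: a_def t0_def)
      show "t0 n \<le> b * (real d * ln (real n / \<delta>))"
        unfolding t0_def b_def using big(2)[OF n] by (intro mult_right_mono) auto
      show "real (T n) \<le> b * ((real n)\<^sup>2 * real d * ln (real n / \<delta>))" by (rule T_le[OF n])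
      have "a * ((real n)\<^sup>2 * real d * ln (real n / \<delta>)) \<le> 1000000 * ((real n)\<^sup>2 * real d * ln (real n / \<delta>))"
        using big(1)[OF n] by (intro mult_right_mono) (auto simp: a_def)
      then show "a * ((real n)\<^sup>2 * real d * ln (real n / \<delta>)) \<le> real (T n)" using T_ge[of n] by linarith
    qed
    have succ: "1 - \<delta> \<le> success_prob d X f m \<nu> T t0 x0 N r"
      if N: "1 \<le> N" and r: "C / real N \<le> r" and \<nu>: "smoothing_ok g m N \<nu>" for N \<nu> r
    proof -
      interpret lifted_problem d X f d\<xi> L F \<Phi> G \<mu> by (rule lp)
      interpret zoppa_run d X f d\<xi> L F \<Phi> G \<mu> \<Delta>0 m g D K1 K2 \<delta> C x0 t0 T \<nu> N
        by unfold_locales (rule pd x0 \<delta>(1) \<delta>5 t0_def T_ge \<nu> C)+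
      show ?thesis by (rule success[OF N r])
    qed
    show ?thesis
    proof (intro conjI allI impI)
      fix N :: nat assume "1 \<le> N"
      then show "\<exists>t0 T. schedule a b d \<delta> N t0 T \<and> (\<forall>\<nu>. smoothing_ok g m N \<nu> \<longrightarrow>
             success_prob d X f m \<nu> T t0 x0 N (C / real N) \<ge> 1 - \<delta>)"
        using sched succ by blast
    next
      fix \<epsilon> assume \<epsilon>: "0 < \<epsilon> \<and> \<epsilon> < 1 / (2 * C)"
      \<comment> \<open>The smallest number of epochs for which the rate \<open>C / N\<close>
        reaches \<epsilon>; rounding at most doubles \<open>C / \<epsilon>\<close>, which is at
        least 1.\<close>
      define N where "N = nat \<lceil>C / \<epsilon>\<rceil>"
      have "1 / (2 * C) \<le> 1" using C1 by simp
      then have "\<epsilon> < 1" using \<epsilon> by linarith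
      then have Ce: "1 \<le> C / \<epsilon>" using C1 \<epsilon> by (simp add: le_divide_eq)
      have N_ge: "C / \<epsilon> \<le> real N" unfolding N_def by (rule real_nat_ceiling_ge)
      have N1: "1 \<le> N" using Ce N_ge by linarith
      have "real N = of_int \<lceil>C / \<epsilon>\<rceil>" unfolding N_def using Ce by simp
      also have "\<dots> \<le> C / \<epsilon> + 1" by linarith
      also have "\<dots> \<le> 2 * C / \<epsilon>" using Ce by simp
      finally have N_le: "real N \<le> 2 * C / \<epsilon>" .
      have "C \<le> real N * \<epsilon>" using N_ge \<epsilon> by (simp add: divide_le_eq)
      then have r: "C / real N \<le> \<epsilon>" using N1 by (simp add: divide_le_eq mult.commute)
      have q: "real (num_queries T N) \<le> 32 * b * C ^ 3 * (real d / \<epsilon> ^ 3 * ln (1 / (\<epsilon> * \<delta>)))"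
        by (rule query_bound[OF \<delta>(1) \<delta>5 _ _ C1 _ N1 N_le]) (use \<epsilon> T_le in \<open>auto simp: b_def\<close>)
      show "\<exists>N\<ge>1. \<exists>t0 T. schedule a b d \<delta> N t0 T \<and>
             real (num_queries T N) \<le> 32 * b * C ^ 3 * (real d / \<epsilon> ^ 3 * ln (1 / (\<epsilon> * \<delta>))) \<and>
             (\<forall>\<nu>. smoothing_ok g m N \<nu> \<longrightarrow> success_prob d X f m \<nu> T t0 x0 N \<epsilon> \<ge> 1 - \<delta>)"
        using N1 sched q succ[OF N1 r] by blast
    qed
  qed
  have pos: "0 < a" "0 < b" "0 < C" "0 < 32 * b * C ^ 3" "0 < 1 / (2 * C)" "1 \<le> (1 :: nat)"
    using C1 by (auto simp: a_def b_def)
  show ?thesis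
    by (rule exI[of _ a], rule exI[of _ b], rule exI[of _ C], rule exI[of _ "32 * b * C ^ 3"],
        rule exI[of _ "1 / (2 * C)"], rule exI[of _ 1], intro conjI pos)
      (intro allI impI, elim conjE, rule main, assumption+)
qed

end
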